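(* Let $k\ge1$ be an integer, let $\tilde h\in\mathcal B_k$ and $g=\tilde h|_{\mathbb R\times\{0\}}$, and set $$q:=\frac1{2\pi}\int_{\mathbb R\setminus I}g\wedge g'\,dx\in(0,k).$$ Then: (i) if $q\in(k-1,k)$, then $m_{g,d}$ is achieved for $d=k-1,k$; (ii) if $q\in(k-2,k-1]$, then $m_{g,d}$ is achieved for $d=k-2,k-1,k$; (iii) if $q=\ell\in\{1,\dots,k-2\}$, then $m_{g,d}$ is achieved for $d=\ell-1,\ell,\ell+1,k$; (iv) if $q\in(\ell,\ell+1)$ with $\ell\in\{0,\dots,k-2\}$, then $m_{g,d}$ is achieved for $d=\ell,\ell+1,k$.
   Context: $I=(-1,1)$, $\mathbb S^1=\{z\in\mathbb C:|z|=1\}$, $\mathbb C_+$ is the open upper half-plane. For $v,w\in\mathbb R^2\simeq\mathbb C$, $v\wedge w:=v_1w_2-v_2w_1\in\mathbb R$. $\dot H^{\frac12}(\mathbb R,\mathbb S^1)$ is the set of measurable $u:\mathbb R\to\mathbb C$ (up to a.e. equality) with $|u|=1$ a.e. and $\int_{\mathbb R}\int_{\mathbb R}\frac{|u(x)-u(y)|^2}{|x-y|^2}\,dx\,dy<\infty$, and $E(u)=\frac1{2\pi}\int_{\mathbb R}\int_{\mathbb R}\frac{|u(x)-u(y)|^2}{|x-y|^2}\,dx\,dy$. For $g\in\dot H^{\frac12}(\mathbb R,\mathbb S^1)$ and $d\in\mathbb Z$: $\mathcal E_{g,d}:=\{u\in\dot H^{\frac12}(\mathbb R,\mathbb S^1):u=g\text{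 in }\mathbb R\setminus I,\ \deg(u)=d\}$ and $m_{g,d}:=\inf_{\mathcal E_{g,d}}E$. "$m_{g,d}$ is achieved" means there is $u\in\mathcal E_{g,d}$ with $E(u)=m_{g,d}$. Degree: $\deg(u):=\deg(u\circ\pi)\in\mathbb Z$, where $\pi:\mathbb S^1\setminus\{i\}\to\mathbb R$, $\pi(e^{i\theta})=\frac{\cos\theta}{1-\sin\theta}$, is the stereographic projection from the north pole. The degree on $H^{\frac12}(\mathbb S^1,\mathbb S^1)$ is the unique extension, continuous in the $H^{\frac12}$ norm, of the usual degree $\frac1{2\pi i}\int_{\mathbb S^1}\bar f f'\,d\theta$ of $C^1$ maps (equivalently $\deg f=\sum_{n\in\mathbb Z}n|\hat f(n)|^2$). Blaschke products: for $k>0$, $\mathcal B_k$ is the set of maps $\tilde h:\overline{\mathbb C_+}\to\overline{D^2}$ of the form $\tilde h(z)=e^{i\theta_0}\prod_{j=1}^k\frac{z-\beta_j}{z-\bar\beta_j}$ with $\beta_1,\dots,\beta_k\in\mathbb C_+$ and $\theta_0\in\mathbb R$. *)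

theory Defs
  imports "HOL-Analysis.Analysis"
begin

text \<open>Elements of Sobolev classes are represented by honest functions; conditions on them are
  imposed almost everywhere, so every representative of a class is admitted.\<close>

definition wedge :: "complex \<Rightarrow> complex \<Rightarrow> real" where
  "wedge v w = Re v * Im w - Im v * Re w"


subsection \<open>The homogeneous space of circle-valued maps on the line and its energy\<close>

text \<open>On the diagonal \<open>x = y\<close>, a null set, the integrand is \<open>0 / 0 = 0\<close>.\<close>

definition gagliardo_line :: "(real \<Rightarrow> complex) \<Rightarrow> ennreal" where
  "gagliardo_line u =
     (\<integral>\<^sup>+ x. (\<integral>\<^sup>+ y. ennreal ((cmod (u x - u y))\<^sup>2 / \<bar>x - y\<bar>\<^sup>2) \<partial>lebesgue) \<partial>lebesgue)"

definition H12_line :: "(real \<Rightarrow> complex) set" where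
  "H12_line = {u. u \<in> borel_measurable lebesgue \<and> (AE x in lebesgue. cmod (u x) = 1) \<and>
                  gagliardo_line u < \<infinity>}"

definition energy :: "(real \<Rightarrow> complex) \<Rightarrow> ennreal" where
  "energy u = ennreal (1 / (2 * pi)) * gagliardo_line u"


subsection \<open>The degree\<close>

text \<open>Functions on the circle are functions on \<^typ>\<open>complex\<close> of which only the values
  \<open>f (cis \<theta>)\<close> matter; integration over the circle is with respect to arc length.\<close>

definition H12_circle_norm_sq :: "(complex \<Rightarrow> complex) \<Rightarrow> ennreal" where
  "H12_circle_norm_sq f =
     (\<integral>\<^sup>+ s\<in>{0..2*pi}. ennreal ((cmod (f (cis s)))\<^sup>2) \<partial>lebesgue) +
     (\<integral>\<^sup>+ s\<in>{0..2*pi}. (\<integral>\<^sup>+ t\<in>{0..2*pi}.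
        ennreal ((cmod (f (cis s) - f (cis t)))\<^sup>2 / (cmod (cis s - cis t))\<^sup>2)
        \<partial>lebesgue) \<partial>lebesgue)"

definition H12_circle :: "(complex \<Rightarrow> complex) set" where
  "H12_circle = {f. (\<lambda>\<theta>. f (cis \<theta>)) \<in> borel_measurable lebesgue \<and>
                    (AE \<theta> in lebesgue. cmod (f (cis \<theta>)) = 1) \<and>
                    H12_circle_norm_sq f < \<infinity>}"

definition C1_circle :: "(complex \<Rightarrow> complex) set" where
  "C1_circle = {f. (\<lambda>\<theta>. f (cis \<theta>)) C1_differentiable_on UNIV \<and> (\<forall>\<theta>. cmod (f (cis \<theta>)) = 1)}"

definition C1_degree :: "(complex \<Rightarrow> complex) \<Rightarrow> complex" where
  "C1_degree f = 1 / (2 * of_real pi * \<i>) *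
     integral {0..2*pi}
       (\<lambda>\<theta>. cnj (f (cis \<theta>)) * vector_derivative (\<lambda>\<theta>. f (cis \<theta>)) (at \<theta>))"

text \<open>Extensionality only pins down the irrelevant values outside \<open>H12_circle\<close>, so that the
  extension is unique as a total function.  Since the \<open>H\<^sup>1\<^sup>/\<^sup>2\<close> norm does not see null sets,
  continuity includes invariance under a.e. equality.\<close>

definition is_continuous_degree_extension :: "((complex \<Rightarrow> complex) \<Rightarrow> int) \<Rightarrow> bool" where
  "is_continuous_degree_extension D \<longleftrightarrow>
     D \<in> extensional H12_circle \<and>
     (\<forall>f\<in>C1_circle. of_int (D f) = C1_degree f) \<and>
     (\<forall>F f. (\<forall>n::nat. F n \<in> H12_circle) \<longrightarrow> f \<in> H12_circle \<longrightarrow>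
        (\<lambda>n. H12_circle_norm_sq (\<lambda>z. F n z - f z)) \<longlonglongrightarrow> 0 \<longrightarrow>
        (\<lambda>n. D (F n)) \<longlonglongrightarrow> D f)"

definition degree_circle :: "(complex \<Rightarrow> complex) \<Rightarrow> int" where
  "degree_circle = (THE D. is_continuous_degree_extension D)"

text \<open>For \<open>z = cis \<theta>\<close> this is \<open>cos \<theta> / (1 - sin \<theta>)\<close>; the value at the pole \<open>\<i>\<close> is
  \<open>0 / 0 = 0\<close>, which does not matter because a point is a null set.\<close>

definition stereographic :: "complex \<Rightarrow> real" where
  "stereographic z = Re z / (1 - Im z)"

definition degree_line :: "(real \<Rightarrow> complex) \<Rightarrow> int" where
  "degree_line u = degree_circle (u \<circ> stereographic)"


subsection \<open>The minimisation problem\<close>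

definition admissible :: "(real \<Rightarrow> complex) \<Rightarrow> int \<Rightarrow> (real \<Rightarrow> complex) set" where
  "admissible g d = {u \<in> H12_line. (AE x in lebesgue. x \<notin> {-1<..<1} \<longrightarrow> u x = g x) \<and>
                                   degree_line u = d}"

definition min_energy :: "(real \<Rightarrow> complex) \<Rightarrow> int \<Rightarrow> ennreal" where
  "min_energy g d = (INF u\<in>admissible g d. energy u)"

definition min_energy_achieved :: "(real \<Rightarrow> complex) \<Rightarrow> int \<Rightarrow> bool" where
  "min_energy_achieved g d \<longleftrightarrow> (\<exists>u\<in>admissible g d. energy u = min_energy g d)"


subsection \<open>Blaschke products on the closed upper half-plane\<close>

text \<open>The values of \<open>h\<close> off the closed upper half-plane are left unconstrained.\<close>

definition blaschke :: "nat \<Rightarrow> (complex \<Rightarrow> complex) set" where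
  "blaschke k = {h. \<exists>\<theta>\<^sub>0 \<beta>. (\<forall>j\<in>{1..k}. 0 < Im (\<beta> j)) \<and>
     (\<forall>z. 0 \<le> Im z \<longrightarrow> h z = cis \<theta>\<^sub>0 * (\<Prod>j=1..k. (z - \<beta> j) / (z - cnj (\<beta> j))))}"

end

theory Submission
 imports Defs "HOL-Complex_Analysis.Complex_Analysis"
begin

text \<open>The Cayley transform moves the problem to the circle. There, up to constants, the energy of \<open>f\<close> is
\<open>\<Sum>\<bar>n\<bar> \<bar>f\<^sub>n\<bar>\<^sup>2\<close> and its degree is \<open>\<Sum>n \<bar>f\<^sub>n\<bar>\<^sup>2\<close>, where \<open>f\<^sub>n\<close> are the Fourier coefficients. Hence \<open>\<bar>deg\<bar>\<close> bounds the energy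
from below, with equality for a Blaschke product, which settles \<open>d = k\<close>.

If a minimising sequence of degree \<open>d\<close> converges weakly to a map \<open>f\<close> of degree \<open>d'\<close>, then it loses at least \<open>\<bar>d - d'\<bar>\<close>
energy. Conversely, multiplication by a Moebius bubble concentrated on the free arc changes the degree by one at a cost tending
to 1. Hence \<open>f\<close> is a minimiser for \<open>d'\<close>, and if \<open>d' < d\<close> then no map of degree \<open>d' + 1\<close> has energy less than \<open>E f + 1\<close>. This is
impossible for \<open>d' \<le> d - 1 \<le> q\<close>, as follows.

The energy change caused by a bubble at \<open>e\<close> can be computed exactly up to terms which vanish by
the Euler-Lagrange equation. If no bubble gains, averaging over \<open>e\<close> with weight \<open>\<omega>\<^sup>2\<close> gives
\<open>\<integral>\<integral> \<omega>(z)\<^sup>2 (1 - Re (f(z) cnj (f(w)))) \<le> 4 deg (\<omega> f)\<close>. Points have capacity zero, so \<open>\<omega>\<close> can exhaust the free arc at no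
energy cost, and the right-hand side tends to \<open>4 (d' - q)\<close>. This forces \<open>f\<close> to be constant, hence \<open>q = 0\<close>, a
contradiction; the case \<open>d' > d\<close> follows by conjugation.\<close>

text \<open>The Fourier formulas are all obtained as Abel limits, for \<open>t\<close> tending to 1,
  of double integrals against Poisson-type kernels. For the degree this is decisive: its kernel
  \<open>nk\<close> tends to 0 off the diagonal and is bounded by 4 over the squared distance, so a
  remainder of second order at the diagonal contributes nothing. Hence the degree is additive under
  products and can be localised by squares of cut-offs. The obstacle in the bubble argument is that
  a bubble is not 1 on the fixed arc. Undoing its phase there takes a correction of size
  \<open>1 - t\<close>, the very order of the gain to be detected, so crude estimates decide
  nothing. Two facts help. At a minimiser the correction may be traded, to first order, for the
  imaginary part of the bubble, for which the interaction is known in closed form; and the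
  difference quotient of a bubble tends to 0 in L1, so that the mixed error is
  \<open>o(1 - t)\<close>. Division by \<open>1 - t\<close> then leaves the integral inequality.
  Equality of degree and \<open>q\<close> is allowed because the surviving left-hand side is
  positive unless the map is constant.\<close>

abbreviation tends :: "(nat => 'a::topological_space) => 'a => bool" (infix "\<leadsto>" 60)
 where "f \<leadsto> a \<equiv> LIMSEQ f a"

subsection \<open>Normalised arc length on the circle\<close>

lemmas B_integral_cong = Bochner_Integration.integral_cong
 and B_integrable_bound = Bochner_Integration.integrable_bound
 and B_integral_cnj = Bochner_Integration.integral_cnj
 and B_integrable_diff = Bochner_Integration.integrable_diff
 and B_integral_diff = Bochner_Integration.integral_diff
 and B_integrable_add = Bochner_Integration.integrable_add
 and B_integral_nonneg = Bochner_Integration.integral_nonneg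
 and B_integral_add = Bochner_Integration.integral_add
 and B_integral_zero = Bochner_Integration.integral_zero
 and B_integral_sum = Bochner_Integration.integral_sum
 and B_integrable_sum = Bochner_Integration.integrable_sum
 and B_integral_minus = Bochner_Integration.integral_minus

text \<open>The target sigma-algebra is restricted to the unit circle, so that the circle is the
  whole space and facts about points of modulus 1 hold everywhere on it, not just almost everywhere.
  The total mass is 1.\<close>

definition circ :: "complex measure" where
 "circ = distr (uniform_measure lborel {0..2*pi}) (restrict_space borel (sphere 0 1)) cis"

lemma cis_measurable [measurable]: "cis \<in> borel_measurable borel"
 by (intro borel_measurable_continuous_onI continuous_intros)

lemma cnj_measurable [measurable]: "cnj \<in> borel_measurable borel"
 by (intro borel_measurable_continuous_onI continuous_intros)

lemma cis_measurable_sphere: "cis \<in> measurable borel (restrict_space borel (sphere 0 1))"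
 by (rule measurable_restrict_space2) auto

lemma cis_measurable_uniform:
 "cis \<in> measurable (uniform_measure lborel {0..2*pi}) (restrict_space borel (sphere 0 1))"
 using cis_measurable_sphere by (simp add: measurable_def)

lemma space_circ [simp]: "space circ = sphere 0 1"
 by (simp add: circ_def space_restrict_space)

lemma sets_circ: "sets circ = sets (restrict_space borel (sphere 0 1))"
 by (simp add: circ_def)

lemma circ_borel [measurable (raw)]: "(\<lambda>z. z) \<in> measurable circ borel"
 unfolding measurable_cong_sets[OF sets_circ refl] by (rule measurable_restrict_space1) simp

lemma nn_integral_circ:
 assumes "f \<in> borel_measurable circ"
 shows "(\<integral>\<^sup>+z. f z \<partial>circ) = (\<integral>\<^sup>+\<theta>\<in>{0..2*pi}. f (cis \<theta>) \<partial>lborel) / ennreal (2*pi)"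
proof -
 have [measurable]: "f \<in> borel_measurable (restrict_space borel (sphere 0 1))"
  using assms by (simp add: measurable_cong_sets[OF sets_circ refl])
 have m: "(\<lambda>\<theta>. f (cis \<theta>)) \<in> borel_measurable borel"
  by (rule measurable_compose[OF cis_measurable_sphere]) fact
 have "(\<integral>\<^sup>+z. f z \<partial>circ) = (\<integral>\<^sup>+\<theta>. f (cis \<theta>) \<partial>uniform_measure lborel {0..2*pi})"
  unfolding circ_def by (rule nn_integral_distr[OF cis_measurable_uniform]) simp
 also have "\<dots> = (\<integral>\<^sup>+\<theta>\<in>{0..2*pi}. f (cis \<theta>) \<partial>lborel) / emeasure lborel {0..2*pi}"
  by (rule nn_integral_uniform_measure) (use m in auto)
 finally show ?thesis by simp
qed

lemma integral_circ:
 fixes f :: "complex => 'b::{banach, second_countable_topology}"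
 assumes "f \<in> borel_measurable circ"
 shows "integral\<^sup>L circ f = (1 / (2*pi)) *\<^sub>R (LINT \<theta>:{0..2*pi}|lborel. f (cis \<theta>))"
proof -
 have [measurable]: "f \<in> borel_measurable (restrict_space borel (sphere 0 1))"
  using assms by (simp add: measurable_cong_sets[OF sets_circ refl])
 have m: "(\<lambda>\<theta>. f (cis \<theta>)) \<in> borel_measurable borel"
  by (rule measurable_compose[OF cis_measurable_sphere]) fact
 have "integral\<^sup>L circ f = (\<integral>\<theta>. f (cis \<theta>) \<partial>uniform_measure lborel {0..2*pi})"
  unfolding circ_def by (rule integral_distr[OF cis_measurable_uniform]) simp
 also have "uniform_measure lborel {0..2*pi} = density lborel (\<lambda>\<theta>. ennreal (indicator {0..2*pi} \<theta> / (2*pi)))"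
  unfolding uniform_measure_def by (rule density_cong) (auto simp: indicator_def divide_ennreal[symmetric] ennreal_1[symmetric] simp del: ennreal_1)
 also have "(\<integral>\<theta>. f (cis \<theta>) \<partial>\<dots>) = (\<integral>\<theta>. (indicator {0..2*pi} \<theta> / (2*pi)) *\<^sub>R f (cis \<theta>) \<partial>lborel)"
  using m by (subst integral_density) auto
 also have "\<dots> = (\<integral>\<theta>. (1 / (2*pi)) *\<^sub>R (indicator {0..2*pi} \<theta> *\<^sub>R f (cis \<theta>)) \<partial>lborel)"
  by (rule B_integral_cong) auto
 also have "\<dots> = (1 / (2*pi)) *\<^sub>R (LINT \<theta>:{0..2*pi}|lborel. f (cis \<theta>))"
  unfolding set_lebesgue_integral_def by (rule integral_scaleR_right)
 finally show ?thesis .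
qed

lemma emeasure_circ_space: "emeasure circ (space circ) = 1"
proof -
 have "emeasure circ (space circ) = (\<integral>\<^sup>+z. 1 \<partial>circ)" by simp
 also have "\<dots> = 1"
  by (subst nn_integral_circ) (auto simp: ennreal_divide_self)
 finally show ?thesis .
qed

interpretation circ: finite_measure circ
 by standard (simp only: emeasure_circ_space, simp)

lemma measure_circ_space [simp]: "measure circ (sphere 0 1) = 1"
 using emeasure_circ_space by (simp add: measure_def)

definition circ2 :: "(complex \<times> complex) measure" where
 "circ2 = circ \<Otimes>\<^sub>M circ"

interpretation circ2: pair_sigma_finite circ circ ..

lemma space_circ2 [simp]: "space circ2 = sphere 0 1 \<times> sphere 0 1"
 by (simp add: circ2_def space_pair_measure)

interpretation cc: finite_measure circ2
 unfolding circ2_def by (rule finite_measure_pair_measure) (unfold_locales)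

lemma measure_circ2_space [simp]: "measure circ2 (sphere 0 1 \<times> sphere 0 1) = 1"
proof -
 have "emeasure (circ \<Otimes>\<^sub>M circ) (space circ \<times> space circ) = 1"
  by (subst circ.emeasure_pair_measure_Times) (auto simp: emeasure_circ_space simp del: space_circ)
 thus ?thesis by (simp add: circ2_def measure_def)
qed

lemma fst_circ2 [measurable]: "fst \<in> measurable circ2 circ" "fst \<in> borel_measurable circ2"
 and snd_circ2 [measurable]: "snd \<in> measurable circ2 circ" "snd \<in> borel_measurable circ2"
proof -
 show f: "fst \<in> measurable circ2 circ" and s: "snd \<in> measurable circ2 circ"
  by (simp_all add: circ2_def)
 show "fst \<in> borel_measurable circ2"  "snd \<in> borel_measurable circ2"
  using measurable_compose[OF f circ_borel] measurable_compose[OF s circ_borel] by auto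
qed

lemma circ_integrable_bounded:
 fixes f :: "complex => 'b::{banach, second_countable_topology}"
 assumes "f \<in> borel_measurable circ" "\<And>z. cmod z = 1 ==> norm (f z) \<le> B"
 shows "integrable circ f"
 by (rule circ.integrable_const_bound[where B = B]) (use assms in auto)

lemma circ2_integrable_bounded:
 fixes f :: "complex \<times> complex => 'b::{banach, second_countable_topology}"
 assumes "f \<in> borel_measurable circ2"
  "\<And>z w. cmod z = 1 ==> cmod w = 1 ==> norm (f (z, w)) \<le> B"
 shows "integrable circ2 f"
 by (rule cc.integrable_const_bound[where B = B]) (use assms in auto)

lemma circ2_fubini:
 fixes f :: "complex \<times> complex => 'b::{banach, second_countable_topology}"
 assumes "integrable circ2 f"
 shows "integral\<^sup>L circ2 f = (LINT z|circ. (LINT w|circ. f (z, w)))"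
  "integral\<^sup>L circ2 f = (LINT w|circ. (LINT z|circ. f (z, w)))"
 using assms circ2.integral_fst'[of f] circ2.integral_snd[of "\<lambda>z w. f (z, w)"] unfolding circ2_def
 by (auto simp: case_prod_eta)

lemma circ2_integral_mult:
 fixes f g :: "complex => complex"
 assumes [measurable]: "f \<in> borel_measurable circ" "g \<in> borel_measurable circ"
  and "\<And>z. cmod z = 1 ==> norm (f z) \<le> A" "\<And>z. cmod z = 1 ==> norm (g z) \<le> B"
 shows "(LINT p|circ2. f (fst p) * g (snd p)) = (LINT z|circ. f z) * (LINT z|circ. g z)"
proof -
 have "integrable circ2 (\<lambda>p. f (fst p) * g (snd p))"
  by (rule circ2_integrable_bounded[where B = "A * B"])
    (auto simp: norm_mult intro!: mult_mono assms order_trans[OF norm_ge_zero assms(3)[of 1]])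
 thus ?thesis by (subst circ2_fubini(1)) auto
qed

lemma integral_circ_power:
 assumes "n > 0"
 shows "(LINT z|circ. z ^ n) = 0"
proof -
 let ?L = "\<lambda>\<theta>. cis (real n * \<theta>)"
 let ?I = "\<i> * of_nat n"
 have "((\<lambda>\<theta>. cis (real n * \<theta>) / ?I) has_vector_derivative cis (real n * \<theta>)) (at \<theta> within {0..2*pi})" for \<theta>
 proof -
  have "((\<lambda>z. exp (\<i> * (of_nat n * z)) / ?I) has_field_derivative exp (\<i> * (of_nat n * of_real \<theta>))) (at (of_real \<theta>))"
   using assms by (auto intro!: derivative_eq_intros simp: algebra_simps)
  from has_vector_derivative_real_field[OF this] show ?thesis
   by (simp add: cis_conv_exp)
 qed
 hence "(?L has_integral (cis (real n * (2*pi)) / ?I - cis (real n * 0) / ?I)) {0..2*pi}"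
  by (intro fundamental_theorem_of_calculus) auto
 moreover have "cis (real n * (2*pi)) = 1"
  using cis_multiple_2pi[of "real n"] by (simp add: mult_ac)
 ultimately have "(?L has_integral 0) {0..2*pi}"
  by simp
 moreover have "set_integrable lborel {0..2*pi} ?L"
  unfolding set_integrable_def by (rule borel_integrable_compact) (auto intro!: continuous_intros)
 ultimately have "(LINT \<theta>:{0..2*pi}|lborel. cis (real n * \<theta>)) = 0"
  by (metis integral_unique set_borel_integral_eq_integral(2))
 hence "(LINT \<theta>:{0..2*pi}|lborel. cis \<theta> ^ n) = 0" unfolding Complex.DeMoivre .
 thus ?thesis by (subst integral_circ) auto
qed

subsection \<open>Energy of maps on the circle\<close>

lemma integrable_mult_L2:
 fixes a b :: "'a => real"
 assumes [measurable]: "a \<in> borel_measurable M" "b \<in> borel_measurable M"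
  and "integrable M (\<lambda>x. (a x)^2)" "integrable M (\<lambda>x. (b x)^2)"
 shows "integrable M (\<lambda>x. a x * b x)"
proof (rule B_integrable_bound)
 show "integrable M (\<lambda>x. (a x)^2 + (b x)^2)" using assms by auto
 show "AE x in M. norm (a x * b x) \<le> norm ((a x)^2 + (b x)^2)"
 proof (rule AE_I2)
  fix x
  have "2 * \<bar>a x\<bar> * \<bar>b x\<bar> \<le> \<bar>a x\<bar>^2 + \<bar>b x\<bar>^2" by (rule sum_squares_bound)
  moreover have "0 \<le> \<bar>a x\<bar> * \<bar>b x\<bar>" by simp
  ultimately have "\<bar>a x\<bar> * \<bar>b x\<bar> \<le> \<bar>a x\<bar>^2 + \<bar>b x\<bar>^2" by linarith
  thus "norm (a x * b x) \<le> norm ((a x)^2 + (b x)^2)" by (simp add: abs_mult)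
 qed
qed measurable

lemma integral_Cauchy_Schwarz:
 fixes a b :: "'a => real"
 assumes [measurable]: "a \<in> borel_measurable M" "b \<in> borel_measurable M"
  and a: "integrable M (\<lambda>x. (a x)^2)" and b: "integrable M (\<lambda>x. (b x)^2)"
 shows "(LINT x|M. \<bar>a x * b x\<bar>) \<le> sqrt (LINT x|M. (a x)^2) * sqrt (LINT x|M. (b x)^2)"
proof -
 define A where "A = (LINT x|M. (a x)^2)"
 define B where "B = (LINT x|M. (b x)^2)"
 define C where "C = (LINT x|M. \<bar>a x * b x\<bar>)"
 have ab: "integrable M (\<lambda>x. \<bar>a x * b x\<bar>)"
  using integrable_mult_L2[OF assms] by (rule integrable_abs)
 have "(\<integral>\<^sup>+x. ennreal \<bar>a x\<bar> * ennreal \<bar>b x\<bar> \<partial>M)^2 \<le> (\<integral>\<^sup>+x. (ennreal \<bar>a x\<bar>)^2 \<partial>M) * (\<integral>\<^sup>+x. (ennreal \<bar>b x\<bar>)^2 \<partial>M)"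
  by (rule Cauchy_Schwarz_nn_integral) measurable
 hence "(ennreal C)^2 \<le> ennreal A * ennreal B"
  using a b ab by (simp add: A_def B_def C_def ennreal_power nn_integral_eq_integral flip: ennreal_mult abs_mult)
 hence "C^2 \<le> A * B" by (simp add: ennreal_power A_def B_def C_def flip: ennreal_mult)
 hence "C \<le> sqrt (A * B)" by (rule real_le_rsqrt)
 thus ?thesis by (simp add: real_sqrt_mult A_def B_def C_def)
qed

text \<open>Weak convergence to 0 of an L2-bounded sequence that tends to 0 almost everywhere:
  \<open>|a b|\<close> is at most \<open>min |a b| (K a^2) + b^2 / K\<close>, where the first term
  is dominated by \<open>K a^2\<close> and the second has integral at most \<open>C / K\<close>,
  uniformly in \<open>n\<close>.\<close>

lemma integral_mult_tendsto_0:
 fixes a :: "'a => real" and b :: "nat => 'a => real"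
 assumes [measurable]: "a \<in> borel_measurable M" "\<And>n. b n \<in> borel_measurable M"
  and a: "integrable M (\<lambda>x. (a x)^2)" and b: "\<And>n. integrable M (\<lambda>x. (b n x)^2)"
  and C: "\<And>n. (LINT x|M. (b n x)^2) \<le> C"
  and lim: "AE x in M. (\<lambda>n. b n x) \<leadsto> 0"
 shows "(\<lambda>n. \<integral>x. \<bar>a x * b n x\<bar> \<partial>M) \<leadsto> 0"
proof (rule LIMSEQ_I)
 fix e :: real assume e: "e > 0"
 have C0: "C \<ge> 0" by (rule order_trans[OF _ C[of 0]]) simp
 \<comment> \<open>Makes \<open>C / K\<close> at most \<open>e / 2\<close>; the \<open>+ 1\<close>
   covers \<open>C = 0\<close>.\<close>
 define K where "K = 2 * (C + 1) / e"
 have K: "K > 0" using e C0 by (simp add: K_def)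
 have "(\<lambda>n. \<integral>x. min \<bar>a x * b n x\<bar> (K * (a x)^2) \<partial>M) \<leadsto> (LINT x|M. 0)"
 proof (rule integral_dominated_convergence[where w = "\<lambda>x. K * (a x)^2"])
  show "AE x in M. (\<lambda>n. min \<bar>a x * b n x\<bar> (K * (a x)^2)) \<leadsto> 0"
   using lim
  proof eventually_elim
   case (elim x)
   have "(\<lambda>n. min \<bar>a x * b n x\<bar> (K * (a x)^2)) \<leadsto> min \<bar>a x * 0\<bar> (K * (a x)^2)"
    by (intro tendsto_intros elim)
   thus ?case using K by simp
  qed
 qed (use a K in \<open>auto simp: min_def\<close>)
 hence "(\<lambda>n. \<integral>x. min \<bar>a x * b n x\<bar> (K * (a x)^2) \<partial>M) \<leadsto> 0" by simp
 from LIMSEQ_D[OF this, of "e/2"] e obtain N where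
  N: "\<And>n. n \<ge> N ==> \<bar>\<integral>x. min \<bar>a x * b n x\<bar> (K * (a x)^2) \<partial>M\<bar> < e / 2" by auto
 show "\<exists>N. \<forall>n\<ge>N. norm ((LINT x|M. \<bar>a x * b n x\<bar>) - 0) < e"
 proof (intro exI allI impI)
  fix n assume n: "n \<ge> N"
  have i1: "integrable M (\<lambda>x. \<bar>a x * b n x\<bar>)"
   using integrable_mult_L2[OF _ _ a b] by (intro integrable_abs) auto
  have i2: "integrable M (\<lambda>x. min \<bar>a x * b n x\<bar> (K * (a x)^2))"
   using i1 a by (intro integrable_min) auto
  have "(LINT x|M. \<bar>a x * b n x\<bar>) \<le> (LINT x|M. min \<bar>a x * b n x\<bar> (K * (a x)^2) + (b n x)^2 / K)"
  proof (rule integral_mono)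
   fix x
   show "\<bar>a x * b n x\<bar> \<le> min \<bar>a x * b n x\<bar> (K * (a x)^2) + (b n x)^2 / K"
   proof (cases "\<bar>b n x\<bar> \<le> K * \<bar>a x\<bar>")
    case True
    hence "\<bar>a x\<bar> * \<bar>b n x\<bar> \<le> \<bar>a x\<bar> * (K * \<bar>a x\<bar>)" by (intro mult_left_mono) auto
    thus ?thesis using K by (simp add: abs_mult power2_eq_square mult_ac)
   next
    case False
    hence "(K * \<bar>a x\<bar>) * \<bar>b n x\<bar> \<le> \<bar>b n x\<bar> * \<bar>b n x\<bar>" by (intro mult_right_mono) auto
    hence "\<bar>a x * b n x\<bar> \<le> (b n x)^2 / K" using K by (simp add: abs_mult power2_eq_square field_simps)
    moreover have "0 \<le> min \<bar>a x * b n x\<bar> (K * (a x)^2)" using K by simp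
    ultimately show ?thesis by linarith
   qed
  qed (use i1 i2 b in auto)
  also have "\<dots> = (LINT x|M. min \<bar>a x * b n x\<bar> (K * (a x)^2)) + (LINT x|M. (b n x)^2) / K"
   using i2 b by simp
  also have "(LINT x|M. (b n x)^2) / K \<le> C / K" using C[of n] K by (simp add: divide_right_mono)
  also have "C / K \<le> e / 2" using C0 e by (simp add: K_def field_simps)
  finally show "norm ((LINT x|M. \<bar>a x * b n x\<bar>) - 0) < e" using N[OF n] by auto
 qed
qed

lemma cmod_add_sq: "(cmod (u + v))^2 \<le> 2 * (cmod u)^2 + 2 * (cmod v)^2"
proof -
 have "(cmod (u + v))^2 \<le> (cmod u + cmod v)^2"
  by (intro power_mono norm_triangle_ineq) auto
 also have "\<dots> \<le> 2 * (cmod u)^2 + 2 * (cmod v)^2"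
  using sum_squares_bound[of "cmod u" "cmod v"] by (simp add: power2_sum)
 finally show ?thesis .
qed

text \<open>A Radon-Riesz argument:
  \<open>|b - a|^2 = |b|^2 - |a|^2 + 2 Re (cnj a * (a - b))\<close>. The first two terms have
  integral at most \<open>c n\<close> minus its limit, and the pairing of \<open>b - a\<close> with
  the fixed function \<open>a\<close> tends to 0 by the previous kind of weak convergence.\<close>

lemma L2_tendsto_of_norm_le:
 fixes a :: "'a => complex" and b :: "nat => 'a => complex"
 assumes [measurable]: "a \<in> borel_measurable M" "\<And>n. b n \<in> borel_measurable M"
  and a: "integrable M (\<lambda>x. (cmod (a x))^2)" and b: "\<And>n. integrable M (\<lambda>x. (cmod (b n x))^2)"
  and C: "\<And>n. (LINT x|M. (cmod (b n x))^2) \<le> c n"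
  and c: "c \<leadsto> (LINT x|M. (cmod (a x))^2)"
  and lim: "AE x in M. (\<lambda>n. b n x) \<leadsto> a x"
 shows "(\<lambda>n. \<integral>x. (cmod (b n x - a x))^2 \<partial>M) \<leadsto> 0"
proof -
 define A where "A = (LINT x|M. (cmod (a x))^2)"
 have bd: "(cmod (u - v))^2 \<le> 2 * (cmod u)^2 + 2 * (cmod v)^2" for u v :: complex
  using cmod_add_sq[of u "- v"] by simp
 have d: "integrable M (\<lambda>x. (cmod (b n x - a x))^2)" for n
 proof (rule B_integrable_bound)
  show "integrable M (\<lambda>x. 2 * (cmod (b n x))^2 + 2 * (cmod (a x))^2)" using a b by auto
 qed (use bd in auto)
 from convergent_imp_Bseq[OF convergentI[OF c]] obtain K where K: "\<And>n. \<bar>c n\<bar> \<le> K"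
  by (auto simp: Bseq_def)
 have w: "(\<lambda>n. \<integral>x. \<bar>cmod (a x) * cmod (b n x - a x)\<bar> \<partial>M) \<leadsto> 0"
 proof (rule integral_mult_tendsto_0[where C = "2 * K + 2 * A"])
  fix n
  have "(LINT x|M. (cmod (b n x - a x))^2) \<le> (LINT x|M. 2 * (cmod (b n x))^2 + 2 * (cmod (a x))^2)"
   using bd by (intro integral_mono) (use a b d in auto)
  also have "\<dots> \<le> 2 * K + 2 * A"
   using a b C[of n] K[of n] by (simp add: A_def)
  finally show "(LINT x|M. (cmod (b n x - a x))^2) \<le> 2 * K + 2 * A" .
 next
  show "AE x in M. (\<lambda>n. cmod (b n x - a x)) \<leadsto> 0"
   using lim by eventually_elim (simp add: LIM_zero tendsto_norm_zero)
 qed (use a d in auto)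
 have up: "(LINT x|M. (cmod (b n x - a x))^2) \<le> c n - A + 2 * (LINT x|M. \<bar>cmod (a x) * cmod (b n x - a x)\<bar>)" for n
 proof -
  have i1: "integrable M (\<lambda>x. \<bar>cmod (a x) * cmod (b n x - a x)\<bar>)"
   using integrable_mult_L2[OF _ _ a d] by (intro integrable_abs) auto
  have "(LINT x|M. (cmod (b n x - a x))^2) \<le>
   (LINT x|M. (cmod (b n x))^2 - (cmod (a x))^2 + 2 * \<bar>cmod (a x) * cmod (b n x - a x)\<bar>)"
  proof (rule integral_mono)
   fix x
   have "Re (cnj (a x) * (a x - b n x)) \<le> cmod (cnj (a x) * (a x - b n x))" by (rule complex_Re_le_cmod)
   also have "\<dots> = cmod (a x) * cmod (b n x - a x)" by (simp add: norm_mult norm_minus_commute)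
   finally show "(cmod (b n x - a x))^2 \<le> (cmod (b n x))^2 - (cmod (a x))^2 + 2 * \<bar>cmod (a x) * cmod (b n x - a x)\<bar>"
    unfolding cmod_power2 by (simp add: power2_eq_square algebra_simps)
  qed (use a b d i1 in auto)
  also have "\<dots> \<le> c n - A + 2 * (LINT x|M. \<bar>cmod (a x) * cmod (b n x - a x)\<bar>)"
   using a b i1 C[of n] by (simp add: A_def)
  finally show ?thesis .
 qed
 show ?thesis
 proof (rule tendsto_sandwich[where f = "\<lambda>_. 0", OF always_eventually always_eventually tendsto_const])
  show "\<forall>n. 0 \<le> (LINT x|M. (cmod (b n x - a x))^2)" by simp
  show "\<forall>n. (LINT x|M. (cmod (b n x - a x))^2) \<le> c n - A + 2 * (LINT x|M. \<bar>cmod (a x) * cmod (b n x - a x)\<bar>)"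
   using up by auto
  have "(\<lambda>n. c n - A + 2 * (LINT x|M. \<bar>cmod (a x) * cmod (b n x - a x)\<bar>)) \<leadsto> A - A + 2 * 0"
   using c w unfolding A_def[symmetric] by (intro tendsto_intros)
  thus "(\<lambda>n. c n - A + 2 * (LINT x|M. \<bar>cmod (a x) * cmod (b n x - a x)\<bar>)) \<leadsto> 0" by simp
 qed
qed

section \<open>Difference quotients and the algebra of maps of finite energy\<close>

text \<open>The diagonal, a null set, gets the value 0 by division by zero. The quotient is linear
  in \<open>f\<close> and obeys a Leibniz rule, so the energy is handled as a squared L2
  norm.\<close>

definition dquot :: "(complex => complex) => complex \<times> complex => complex" where
 "dquot f p = (f (fst p) - f (snd p)) / (fst p - snd p)"

text \<open>Boundedness is included because it makes the class closed under products. This bound,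
  and below the condition of modulus 1, hold at every point of the circle; classes up to null sets
  enter only later, through representatives.\<close>

definition fin_energy :: "(complex => complex) => bool" where
 "fin_energy f \<longleftrightarrow> f \<in> borel_measurable circ \<and> (\<exists>B. \<forall>z. cmod z = 1 \<longrightarrow> cmod (f z) \<le> B) \<and>
   integrable circ2 (\<lambda>p. (cmod (dquot f p))^2)"

definition cenergy :: "(complex => complex) => real" where
 "cenergy f = (LINT p|circ2. (cmod (dquot f p))^2)"

definition circ_map :: "(complex => complex) => bool" where
 "circ_map f \<longleftrightarrow> fin_energy f \<and> (\<forall>z. cmod z = 1 \<longrightarrow> cmod (f z) = 1)"

lemma fin_energy_measurable [measurable_dest]: "fin_energy f ==> f \<in> borel_measurable circ"
 by (simp add: fin_energy_def)

lemma circ_map_fin_energy [simp, dest]: "circ_map f ==> fin_energy f"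
 by (simp add: circ_map_def)

lemma circ_map_measurable [measurable_dest]: "circ_map f ==> f \<in> borel_measurable circ"
 by (simp add: fin_energy_measurable)

lemma circ_map_norm: "circ_map f ==> cmod z = 1 ==> cmod (f z) = 1"
 by (simp add: circ_map_def)

lemma fin_energyD: "fin_energy f ==> integrable circ2 (\<lambda>p. (cmod (dquot f p))^2)"
 by (simp add: fin_energy_def)

lemma fin_energy_bound:
 assumes "fin_energy f" obtains B where "B \<ge> 0" "\<And>z. cmod z = 1 ==> cmod (f z) \<le> B"
 using assms unfolding fin_energy_def by (metis norm_ge_zero norm_one order_trans)

lemma fin_energy_square_integrable:
 assumes "fin_energy f" shows "integrable circ (\<lambda>z. (cmod (f z))^2)"
proof -
 obtain B where "\<And>z. cmod z = 1 ==> cmod (f z) \<le> B" by (rule fin_energy_bound[OF assms]) (rule that)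
 thus ?thesis using assms by (intro circ_integrable_bounded[where B = "B^2"]) (auto intro!: power_mono)
qed

lemma measurable_dquot [measurable (raw)]:
 assumes [measurable]: "f \<in> borel_measurable circ"
 shows "dquot f \<in> borel_measurable circ2"
 unfolding dquot_def by measurable

lemma cenergy_nonneg [simp]: "cenergy f \<ge> 0"
 by (simp add: cenergy_def)

lemma fin_energyI:
 assumes [measurable]: "f \<in> borel_measurable circ"
  and B: "\<And>z. cmod z = 1 ==> cmod (f z) \<le> B"
  and g: "integrable circ2 g"
  and le: "\<And>z w. cmod z = 1 ==> cmod w = 1 ==> (cmod (dquot f (z, w)))^2 \<le> g (z, w)"
 shows "fin_energy f" "cenergy f \<le> integral\<^sup>L circ2 g"
proof -
 have i: "integrable circ2 (\<lambda>p. (cmod (dquot f p))^2)"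
  by (rule B_integrable_bound[OF g]) (use le in \<open>force intro!: AE_I2\<close>)+
 with B show "fin_energy f" by (auto simp: fin_energy_def)
 show "cenergy f \<le> integral\<^sup>L circ2 g"
  unfolding cenergy_def by (rule integral_mono[OF i g]) (use le in force)
qed

lemma fin_energy_lipschitz:
 assumes [measurable]: "f \<in> borel_measurable circ"
  and L: "\<And>z w. cmod z = 1 ==> cmod w = 1 ==> cmod (f z - f w) \<le> L * cmod (z - w)" and "L \<ge> 0"
 shows "fin_energy f" "cenergy f \<le> L^2"
proof -
 have B: "cmod (f z) \<le> cmod (f 1) + 2 * L" if "cmod z = 1" for z
 proof -
  have "cmod (f z) \<le> cmod (f 1) + cmod (f z - f 1)" by (metis add.commute diff_add_cancel norm_triangle_ineq)
  also have "cmod (f z - f 1) \<le> L * cmod (z - 1)" using L that by simp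
  also have "\<dots> \<le> L * 2" using norm_triangle_ineq4[of z 1] that \<open>L \<ge> 0\<close> by (intro mult_left_mono) auto
  finally show ?thesis by simp
 qed
 have le: "(cmod (dquot f (z, w)))^2 \<le> (\<lambda>p. L^2) (z, w)" if "cmod z = 1" "cmod w = 1" for z w
  unfolding dquot_def using L[OF that] \<open>L \<ge> 0\<close>
  by (cases "z = w") (auto simp: norm_divide pos_divide_le_eq intro!: power_mono)
 show "fin_energy f" by (rule fin_energyI(1)[OF assms(1) B _ le]) auto
 have "cenergy f \<le> (LINT p|circ2. L^2)" by (rule fin_energyI(2)[OF assms(1) B _ le]) auto
 thus "cenergy f \<le> L^2" by simp
qed

lemma dquot_diff: "dquot (\<lambda>z. f z - g z) p = dquot f p - dquot g p"
 by (simp add: dquot_def diff_divide_distrib)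

lemma dquot_add: "dquot (\<lambda>z. f z + g z) p = dquot f p + dquot g p"
 by (simp only: dquot_def add_divide_distrib[symmetric] add_diff_add)

lemma dquot_mult: "dquot (\<lambda>z. f z * g z) p = dquot f p * g (fst p) + f (snd p) * dquot g p"
proof -
 have "f (fst p) * g (fst p) - f (snd p) * g (snd p) =
  (f (fst p) - f (snd p)) * g (fst p) + f (snd p) * (g (fst p) - g (snd p))"
  by (simp add: algebra_simps)
 thus ?thesis by (simp only: dquot_def add_divide_distrib times_divide_eq_left times_divide_eq_right)
qed

lemma cmod_dquot_cnj [simp]: "cmod (dquot (\<lambda>z. cnj (f z)) p) = cmod (dquot f p)"
 unfolding dquot_def norm_divide complex_cnj_diff[symmetric] complex_mod_cnj ..

lemma fin_energy_add:
 assumes f: "fin_energy f" and g: "fin_energy g"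
 shows "fin_energy (\<lambda>z. f z + g z)" "cenergy (\<lambda>z. f z + g z) \<le> 2 * cenergy f + 2 * cenergy g"
proof -
 let ?L = "\<lambda>z. f z + g z"
 obtain A where "A \<ge> 0" and A: "\<And>z. cmod z = 1 ==> cmod (f z) \<le> A" by (rule fin_energy_bound[OF f]) (rule that)
 obtain B where "B \<ge> 0" and B: "\<And>z. cmod z = 1 ==> cmod (g z) \<le> B" by (rule fin_energy_bound[OF g]) (rule that)
 have m: "?L \<in> borel_measurable circ" using f g by measurable
 have AB: "cmod (f z + g z) \<le> A + B" if "cmod z = 1" for z
  by (intro order_trans[OF norm_triangle_ineq] add_mono A B that)
 have le: "(cmod (dquot ?L (z, w)))^2 \<le> 2 * (cmod (dquot f (z, w)))^2 + 2 * (cmod (dquot g (z, w)))^2" for z w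
  unfolding dquot_add by (rule cmod_add_sq)
 have i: "integrable circ2 (\<lambda>p. 2 * (cmod (dquot f p))^2 + 2 * (cmod (dquot g p))^2)"
  using fin_energyD[OF f] fin_energyD[OF g] by auto
 show "fin_energy ?L" by (rule fin_energyI(1)[OF m AB i le])
 show "cenergy ?L \<le> 2 * cenergy f + 2 * cenergy g"
  using fin_energyI(2)[OF m AB i le] fin_energyD[OF f] fin_energyD[OF g] by (simp add: cenergy_def)
qed

lemma fin_energy_cmult:
 assumes f: "fin_energy f"
 shows "fin_energy (\<lambda>z. c * f z)" "cenergy (\<lambda>z. c * f z) = (cmod c)^2 * cenergy f"
proof -
 let ?L = "\<lambda>z. c * f z"
 obtain A where "A \<ge> 0" and A: "\<And>z. cmod z = 1 ==> cmod (f z) \<le> A" by (rule fin_energy_bound[OF f]) (rule that)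
 have eq: "(cmod (dquot ?L p))^2 = (cmod c)^2 * (cmod (dquot f p))^2" for p
  unfolding dquot_def right_diff_distrib[symmetric] times_divide_eq_right[symmetric] norm_mult power_mult_distrib ..
 have "\<exists>B. \<forall>z. cmod z = 1 \<longrightarrow> cmod (c * f z) \<le> B"
  using A by (intro exI[of _ "cmod c * A"]) (auto simp: norm_mult intro!: mult_left_mono)
 moreover have "?L \<in> borel_measurable circ" using f by measurable
 ultimately show "fin_energy ?L"
  using fin_energyD[OF f] by (simp add: fin_energy_def eq)
 show "cenergy ?L = (cmod c)^2 * cenergy f"
  by (simp add: cenergy_def eq)
qed

lemma fin_energy_diff:
 assumes f: "fin_energy f" and g: "fin_energy g"
 shows "fin_energy (\<lambda>z. f z - g z)" "cenergy (\<lambda>z. f z - g z) \<le> 2 * cenergy f + 2 * cenergy g"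
 using fin_energy_add[OF f fin_energy_cmult(1)[OF g, of "-1"]] fin_energy_cmult(2)[OF g, of "-1"] by auto

lemma fin_energy_cnj:
 "fin_energy f ==> fin_energy (\<lambda>z. cnj (f z))" "cenergy (\<lambda>z. cnj (f z)) = cenergy f"
proof -
 assume f: "fin_energy f"
 have "(\<lambda>z. cnj (f z)) \<in> borel_measurable circ" using f by measurable
 thus "fin_energy (\<lambda>z. cnj (f z))" using f by (auto simp: fin_energy_def)
qed (simp add: cenergy_def)

lemma fin_energy_mult:
 assumes f: "fin_energy f" and g: "fin_energy g"
 shows "fin_energy (\<lambda>z. f z * g z)"
proof -
 obtain A where "A \<ge> 0" and A: "\<And>z. cmod z = 1 ==> cmod (f z) \<le> A" by (rule fin_energy_bound[OF f]) (rule that)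
 obtain B where "B \<ge> 0" and B: "\<And>z. cmod z = 1 ==> cmod (g z) \<le> B" by (rule fin_energy_bound[OF g]) (rule that)
 have m: "(\<lambda>z. f z * g z) \<in> borel_measurable circ" using f g by measurable
 have bd: "cmod (f z * g z) \<le> A * B" if "cmod z = 1" for z
  unfolding norm_mult by (intro mult_mono A B that) (use \<open>A \<ge> 0\<close> in auto)
 have i: "integrable circ2 (\<lambda>p. 2 * (B^2 * (cmod (dquot f p))^2) + 2 * (A^2 * (cmod (dquot g p))^2))"
  using fin_energyD[OF f] fin_energyD[OF g] by auto
 have le: "(cmod (dquot (\<lambda>z. f z * g z) (z, w)))^2 \<le> 2 * (B^2 * (cmod (dquot f (z, w)))^2) + 2 * (A^2 * (cmod (dquot g (z, w)))^2)"
  if "cmod z = 1" "cmod w = 1" for z w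
 proof -
  have "(cmod (g z))^2 \<le> B^2" "(cmod (f w))^2 \<le> A^2" using A B that by (auto intro!: power_mono)
  hence "(cmod (dquot f (z, w)))^2 * (cmod (g z))^2 \<le> (cmod (dquot f (z, w)))^2 * B^2"
   "(cmod (f w))^2 * (cmod (dquot g (z, w)))^2 \<le> A^2 * (cmod (dquot g (z, w)))^2"
   by (auto intro!: mult_left_mono mult_right_mono)
  thus ?thesis
   using cmod_add_sq[of "dquot f (z, w) * g z" "f w * dquot g (z, w)"]
   unfolding dquot_mult fst_conv snd_conv norm_mult power_mult_distrib by (simp add: mult_ac)
 qed
 show ?thesis by (rule fin_energyI(1)[OF m bd i le])
qed

lemma circ_map_mult: "circ_map f ==> circ_map g ==> circ_map (\<lambda>z. f z * g z)"
 by (auto simp: circ_map_def norm_mult intro: fin_energy_mult)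

lemma circ_map_cnj: "circ_map f ==> circ_map (\<lambda>z. cnj (f z))"
 by (auto simp: circ_map_def intro: fin_energy_cnj)

section \<open>The interaction term in the energy of a product\<close>

definition cross :: "(complex => complex) => complex \<times> complex => complex" where
 "cross f p = f (fst p) * cnj (f (snd p))"

definition cdist :: "complex \<times> complex => real" where
 "cdist p = cmod (fst p - snd p)"

lemma measurable_cross [measurable (raw)]:
 assumes [measurable]: "f \<in> borel_measurable circ"
 shows "cross f \<in> borel_measurable circ2"
 unfolding cross_def by measurable

lemma measurable_cdist [measurable]: "cdist \<in> borel_measurable circ2"
 unfolding cdist_def by measurable

lemma cmod_dquot: "cmod (dquot f p) = cmod (f (fst p) - f (snd p)) / cdist p"
 by (simp add: dquot_def cdist_def norm_divide)

lemma cmod_one_minus_cross: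
 assumes "cmod (f z) = 1" "cmod (f w) = 1"
 shows "cmod (1 - cross f (z, w)) = cmod (f z - f w)"
proof -
 have "f w * cnj (f w) = 1" using assms(2) complex_norm_square[of "f w"] by simp
 hence "1 - cross f (z, w) = - ((f z - f w) * cnj (f w))" by (simp add: cross_def algebra_simps)
 thus ?thesis using assms by (simp only: norm_minus_cancel norm_mult complex_mod_cnj mult_1_right)
qed

text \<open>With \<open>U\<close>, \<open>V\<close> the two cross terms, \<open>1 - Re (U V) = (1 -
  Re U) + (1 - Re V) - Re ((1 - U) (1 - V))\<close>, and \<open>2 - 2 Re U\<close> is a squared
  difference of values. The last term, over the squared distance, is thus the failure of the energy
  to be additive under products.\<close>

definition interact :: "(complex => complex) => (complex => complex) => complex \<times> complex => real" where
 "interact f g p = Re ((1 - cross f p) * (1 - cross g p)) / (cdist p)^2"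

lemma measurable_interact [measurable (raw)]:
 assumes [measurable]: "f \<in> borel_measurable circ" "g \<in> borel_measurable circ"
 shows "interact f g \<in> borel_measurable circ2"
 unfolding interact_def by measurable

lemma interact_le:
 assumes "circ_map f" "circ_map g" "cmod z = 1" "cmod w = 1"
 shows "\<bar>interact f g (z, w)\<bar> \<le> cmod (dquot f (z, w)) * cmod (dquot g (z, w))"
proof -
 have "\<bar>Re ((1 - cross f (z, w)) * (1 - cross g (z, w)))\<bar> \<le> cmod (f z - f w) * cmod (g z - g w)"
  using abs_Re_le_cmod[of "(1 - cross f (z, w)) * (1 - cross g (z, w))"]
   cmod_one_minus_cross[of f z w] cmod_one_minus_cross[of g z w] assms
  by (simp add: norm_mult circ_map_norm)
 thus ?thesis
  by (simp add: interact_def cmod_dquot power2_eq_square divide_right_mono)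
qed

lemma integrable_dquot_mult:
 assumes "fin_energy f" "fin_energy g"
 shows "integrable circ2 (\<lambda>p. cmod (dquot f p) * cmod (dquot g p))"
proof -
 have [measurable]: "f \<in> borel_measurable circ" "g \<in> borel_measurable circ"
  using assms by (auto simp: fin_energy_measurable)
 show ?thesis by (intro integrable_mult_L2 fin_energyD assms) measurable
qed

lemma integrable_interact:
 assumes "circ_map f" "circ_map g"
 shows "integrable circ2 (interact f g)"
 by (rule B_integrable_bound[OF integrable_dquot_mult[of f g]])
   (use assms interact_le in \<open>auto simp: circ_map_measurable\<close>)

lemma cenergy_mult:
 assumes f: "circ_map f" and g: "circ_map g"
 shows "cenergy (\<lambda>z. f z * g z) = cenergy f + cenergy g - 2 * integral\<^sup>L circ2 (interact f g)"
proof -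
 let ?L = "\<lambda>z. f z * g z"
 have eq: "(cmod (dquot ?L (z, w)))^2 =
   (cmod (dquot f (z, w)))^2 + (cmod (dquot g (z, w)))^2 - 2 * interact f g (z, w)"
  if "cmod z = 1" "cmod w = 1" for z w
 proof -
  have *: "(cmod (h z - h w))^2 = 2 - 2 * Re (cross h (z, w))" if "cmod (h z) = 1" "cmod (h w) = 1" for h
   using that unfolding cross_def cmod_power2 fst_conv snd_conv
   by (auto simp: cmod_def power2_eq_square algebra_simps)
  have c: "cross ?L (z, w) = cross f (z, w) * cross g (z, w)"
   by (simp add: cross_def)
  show ?thesis
   using *[of "\<lambda>z. f z * g z"] *[of f] *[of g] f g that
   unfolding c cmod_dquot interact_def
   by (simp add: circ_map_norm norm_mult power_divide diff_divide_distrib[symmetric] add_divide_distrib[symmetric] algebra_simps)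
 qed
 have "cenergy ?L = (LINT p|circ2. (cmod (dquot f p))^2 + (cmod (dquot g p))^2 - 2 * interact f g p)"
  unfolding cenergy_def by (rule B_integral_cong) (use eq in auto)
 thus ?thesis
  using f g by (simp add: cenergy_def fin_energyD integrable_interact)
qed

lemma integral_interact_le:
 assumes "circ_map f" "circ_map g"
 shows "\<bar>integral\<^sup>L circ2 (interact f g)\<bar> \<le> sqrt (cenergy f) * sqrt (cenergy g)"
proof -
 have "\<bar>integral\<^sup>L circ2 (interact f g)\<bar> \<le> (LINT p|circ2. \<bar>interact f g p\<bar>)"
  by (rule integral_abs_bound)
 also have "\<dots> \<le> (LINT p|circ2. \<bar>cmod (dquot f p) * cmod (dquot g p)\<bar>)"
  by (rule integral_mono) (use assms interact_le in \<open>auto intro!: integrable_abs integrable_interact integrable_dquot_mult\<close>)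
 also have "\<dots> \<le> sqrt (cenergy f) * sqrt (cenergy g)"
  unfolding cenergy_def by (rule integral_Cauchy_Schwarz) (use assms in \<open>auto simp: fin_energyD circ_map_measurable\<close>)
 finally show ?thesis .
qed

text \<open>The interaction is dominated by the product of the two difference quotients, and the
  second of these tends weakly to 0. This is the decoupling used for weak limits and for
  concentrating bubbles.\<close>

lemma integral_interact_tendsto_0:
 assumes f: "circ_map f" and g: "\<And>n. circ_map (g n)" and C: "\<And>n. cenergy (g n) \<le> C"
  and lim: "AE p in circ2. (\<lambda>n. g n (fst p) - g n (snd p)) \<leadsto> 0"
 shows "(\<lambda>n. integral\<^sup>L circ2 (interact f (g n))) \<leadsto> 0"
proof (rule tendsto_rabs_zero_cancel, rule tendsto_sandwich[where f = "\<lambda>_. 0", OF always_eventually always_eventually tendsto_const])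
 show "\<forall>n. 0 \<le> \<bar>integral\<^sup>L circ2 (interact f (g n))\<bar>" by simp
 show "\<forall>n. \<bar>integral\<^sup>L circ2 (interact f (g n))\<bar> \<le> (LINT p|circ2. \<bar>cmod (dquot f p) * cmod (dquot (g n) p)\<bar>)"
 proof
  fix n
  have "\<bar>integral\<^sup>L circ2 (interact f (g n))\<bar> \<le> (LINT p|circ2. \<bar>interact f (g n) p\<bar>)"
   by (rule integral_abs_bound)
  also have "\<dots> \<le> (LINT p|circ2. \<bar>cmod (dquot f p) * cmod (dquot (g n) p)\<bar>)"
   by (rule integral_mono) (use f g interact_le in \<open>auto intro!: integrable_abs integrable_interact integrable_dquot_mult\<close>)
  finally show "\<bar>integral\<^sup>L circ2 (interact f (g n))\<bar> \<le> (LINT p|circ2. \<bar>cmod (dquot f p) * cmod (dquot (g n) p)\<bar>)" .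
 qed
 show "(\<lambda>n. \<integral>p. \<bar>cmod (dquot f p) * cmod (dquot (g n) p)\<bar> \<partial>circ2) \<leadsto> 0"
 proof (rule integral_mult_tendsto_0[where C = C])
  show "AE p in circ2. (\<lambda>n. cmod (dquot (g n) p)) \<leadsto> 0"
   using lim
  proof eventually_elim
   case (elim p)
   hence "(\<lambda>n. cmod (g n (fst p) - g n (snd p)) / cdist p) \<leadsto> 0"
    by (intro tendsto_divide_zero tendsto_norm_zero)
   thus ?case by (simp add: cmod_dquot)
  qed
 qed (use f g C in \<open>auto simp: fin_energyD circ_map_measurable cenergy_def\<close>)
qed

subsection \<open>Poisson kernel and Fourier coefficients\<close>

lemma one_minus_ge:
 assumes "cmod x \<le> 1" "0 \<le> t" "t < 1" shows "1 - t \<le> cmod (1 - of_real t * x)"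
 using norm_triangle_ineq2[of 1 "of_real t * x"] mult_left_mono[OF assms(1,2)] assms(2) by (simp add: norm_mult)

lemma geometric_sums_integral:
 fixes h F :: "'a => complex"
 assumes "finite_measure M" and [measurable]: "h \<in> borel_measurable M" "F \<in> borel_measurable M"
  and h: "\<And>x. x \<in> space M ==> cmod (h x) \<le> 1" and F: "\<And>x. x \<in> space M ==> cmod (F x) \<le> B"
  and t: "0 \<le> t" "t < 1"
 shows "(\<lambda>n. of_real t ^ n * (LINT x|M. h x ^ n * F x)) sums (LINT x|M. F x / (1 - of_real t * h x))"
  "integrable M (\<lambda>x. F x / (1 - of_real t * h x))"
proof -
 let ?O = "\<lambda>n x. of_real t ^ n * (h x ^ n * F x)"
 let ?F = "\<lambda>x. 1 - of_real t * h x"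
 let ?S = "\<lambda>x. \<Sum>n. of_real t ^ n * (h x ^ n * F x)"
 interpret finite_measure M by fact
 have "cmod (F x / (?F x)) \<le> B / (1 - t)" if "x \<in> space M" for x
  using one_minus_ge[OF h[OF that] t] order_trans[OF norm_ge_zero F[OF that]] F[OF that] t
  unfolding norm_divide by (intro frac_le) auto
 thus "integrable M (\<lambda>x. F x / (?F x))"
  by (intro integrable_const_bound[where B = "B / (1 - t)"]) (auto intro!: AE_I2)
 have bd: "cmod (?O n x) \<le> t ^ n * B" if "x \<in> space M" for n x
  using power_le_one[of "cmod (h x)" n] h[OF that] F[OF that] t order_trans[OF norm_ge_zero F[OF that]]
  by (auto simp: norm_mult norm_power intro!: mult_left_mono mult_le_one
    order_trans[OF mult_right_mono[of "cmod (h x) ^ n" 1 "cmod (F x)"]])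
 have i: "integrable M (\<lambda>x. of_real t ^ n * (h x ^ n * F x))" for n
  by (rule integrable_const_bound[where B = "t ^ n * B"]) (use bd in \<open>auto intro!: AE_I2\<close>)
 have B: "B \<ge> 0 \<or> space M = {}" using F by (meson equals0I norm_ge_zero order_trans)
 have sg: "summable (\<lambda>n. t ^ n * B)" using t by (intro summable_mult2 summable_geometric) auto
 have "(\<lambda>n. \<integral>x. of_real t ^ n * (h x ^ n * F x) \<partial>M) sums (LINT x|M. (?S x))"
 proof (rule sums_integral[OF i])
  show "AE x in M. summable (\<lambda>n. norm (?O n x))"
   by (intro AE_I2 summable_comparison_test[OF _ sg]) (use bd in auto)
  show "summable (\<lambda>n. \<integral>x. norm (?O n x) \<partial>M)"
  proof (rule summable_comparison_test)
   show "summable (\<lambda>n. (t ^ n * B) * measure M (space M))" using sg by (rule summable_mult2)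
   have "(LINT x|M. norm (?O n x)) \<le> (LINT x|M. t ^ n * B)" for n
    by (rule integral_mono) (use i bd in auto)
   thus "\<exists>N. \<forall>n\<ge>N. norm (LINT x|M. norm (?O n x)) \<le> (t ^ n * B) * measure M (space M)"
    by (auto simp: mult_ac)
  qed
 qed
 also have "(LINT x|M. (?S x)) = (LINT x|M. F x / (?F x))"
 proof (rule B_integral_cong[OF refl])
  fix x assume "x \<in> space M"
  hence "cmod (of_real t * h x) < 1" using h[of x] t
   by (auto simp: norm_mult intro: le_less_trans[OF mult_left_le])
  hence "(\<lambda>n. (of_real t * h x) ^ n * F x) sums (1 / (?F x) * F x)"
   by (intro sums_mult2 geometric_sums)
  thus "(?S x) = F x / (?F x)"
   by (simp add: sums_iff power_mult_distrib mult_ac)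
 qed
 finally show "(\<lambda>n. of_real t ^ n * (LINT x|M. h x ^ n * F x)) sums (LINT x|M. F x / (?F x))"
  by simp
qed

definition zeta :: "complex \<times> complex => complex" where
 "zeta p = fst p * cnj (snd p)"

text \<open>The Poisson kernel. On the circle its denominator is \<open>|1 - t zeta|^2\<close>; it
  is written through the chord because the estimates below compare it with powers of the
  chord.\<close>

definition pk :: "real => complex \<times> complex => real" where
 "pk t p = (1 - t^2) / ((1 - t)^2 + t * (cdist p)^2)"

definition qk :: "real => complex \<times> complex => real" where
 "qk t p = 2 * t * Im (zeta p) / ((1 - t)^2 + t * (cdist p)^2)"

text \<open>The limit of the conjugate Poisson kernel \<open>qk\<close> at \<open>t = 1\<close>: the
  cotangent of half the angle between the two points, that is, the kernel of the Hilbert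
  transform.\<close>

definition ck :: "complex \<times> complex => real" where
 "ck p = 2 * Im (zeta p) / (cdist p)^2"

lemma measurable_zeta [measurable]: "zeta \<in> borel_measurable circ2"
 unfolding zeta_def by measurable

lemma measurable_pk_section [measurable]: "(\<lambda>w. pk t (z, w)) \<in> borel_measurable circ" "(\<lambda>w. pk t (w, z)) \<in> borel_measurable circ"
 unfolding pk_def cdist_def fst_conv snd_conv by measurable

lemma measurable_kernels [measurable]:
 "pk t \<in> borel_measurable circ2" "qk t \<in> borel_measurable circ2" "ck \<in> borel_measurable circ2"
 unfolding pk_def qk_def ck_def by measurable

lemma cmod_zeta: "cmod z = 1 ==> cmod w = 1 ==> cmod (zeta (z, w)) = 1"
 by (simp add: zeta_def norm_mult)

lemma cmod_zeta_minus_1: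
 assumes "cmod w = 1" shows "cmod (zeta (z, w) - 1) = cdist (z, w)"
proof -
 have "w * cnj w = 1" using complex_norm_square[of w] assms by simp
 hence "zeta (z, w) - 1 = (z - w) * cnj w" by (simp add: zeta_def algebra_simps)
 thus ?thesis using assms by (simp add: norm_mult cdist_def)
qed

lemma cdist_le_2: "cmod z = 1 ==> cmod w = 1 ==> cdist (z, w) \<le> 2"
 using norm_triangle_ineq4[of z w] by (simp add: cdist_def)

lemma Im_zeta_le: "cmod w = 1 ==> \<bar>Im (zeta (z, w))\<bar> \<le> cdist (z, w)"
 using abs_Im_le_cmod[of "zeta (z, w) - 1"] cmod_zeta_minus_1[of w z] by simp

lemma cdist_nonneg [simp]: "cdist p \<ge> 0" by (simp add: cdist_def)

lemma poisson_denom: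
 assumes "cmod z = 1" "cmod w = 1"
 shows "(cmod (1 - of_real t * zeta (z, w)))^2 = (1 - t)^2 + t * (cdist (z, w))^2"
proof -
 have "(Re (zeta (z, w)))^2 + (Im (zeta (z, w)))^2 = 1"
  using cmod_zeta[OF assms] by (metis cmod_power2 one_power2)
 moreover have "(cdist (z, w))^2 = (Re (zeta (z, w)) - 1)^2 + (Im (zeta (z, w)))^2"
  unfolding cmod_zeta_minus_1[OF assms(2), symmetric] cmod_power2 by simp
 ultimately show ?thesis unfolding cmod_power2
  by (simp add: power2_eq_square) algebra
qed

lemma poisson_denom_pos: "0 \<le> t ==> t < 1 ==> (1 - t)^2 + t * (cdist p)^2 > 0"
 by (intro add_pos_nonneg) auto

lemma herglotz_kernel:
 assumes "cmod z = 1" "cmod w = 1" "0 \<le> t" "t < 1"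
 shows "2 / (1 - of_real t * zeta (z, w)) - 1 = Complex (pk t (z, w)) (qk t (z, w))"
proof -
 let ?u = "1 - of_real t * zeta (z, w)"
 have n: "(cmod ?u)^2 = (1 - t)^2 + t * (cdist (z, w))^2" by (rule poisson_denom[OF assms(1,2)])
 have "?u \<noteq> 0" using poisson_denom_pos[OF assms(3,4), of "(z, w)"] n by auto
 have r: "(Re (zeta (z, w)))^2 + (Im (zeta (z, w)))^2 = 1"
  using cmod_zeta[OF assms(1,2)] by (metis cmod_power2 one_power2)
 have "2 / u - 1 = (2 - u) * cnj u / of_real ((cmod u)^2)" if "u \<noteq> 0" for u :: complex
 proof -
  have "2 / u - 1 = (2 - u) / u" using that by (simp add: diff_divide_distrib)
  also have "\<dots> = (2 - u) * cnj u / (u * cnj u)"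
   by (rule mult_divide_mult_cancel_right[symmetric]) (use that in simp)
  finally show ?thesis unfolding complex_norm_square .
 qed
 from this[OF \<open>?u \<noteq> 0\<close>] have "2 / ?u - 1 = (2 - ?u) * cnj ?u / of_real ((cmod ?u)^2)" .
 moreover have "(2 - ?u) * cnj ?u = Complex (1 - t^2) (2 * t * Im (zeta (z, w)))"
  using r by (simp add: complex_eq_iff power2_eq_square) algebra
 ultimately show ?thesis unfolding n pk_def qk_def by (simp add: complex_eq_iff)
qed

lemma pk_nonneg: "0 \<le> t ==> t < 1 ==> pk t p \<ge> 0"
 unfolding pk_def by (intro divide_nonneg_nonneg add_nonneg_nonneg) (auto simp: power_le_one abs_square_le_1)

lemma pk_le:
 assumes "0 \<le> t" "t < 1" shows "pk t p \<le> (1 + t) / (1 - t)"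
proof -
 have "pk t p \<le> (1 - t^2) / (1 - t)^2"
  unfolding pk_def using assms by (intro divide_left_mono) (auto simp: power_le_one abs_square_le_1 poisson_denom_pos intro!: mult_pos_pos)
 also have "1 - t^2 = (1 + t) * (1 - t)" by (simp add: power2_eq_square algebra_simps)
 also have "\<dots> / (1 - t)^2 = (1 + t) / (1 - t)" using assms by (simp add: power2_eq_square)
 finally show ?thesis .
qed

lemma pk_ge:
 assumes "0 \<le> t" "t < 1" "cdist p \<le> 2" shows "pk t p \<ge> (1 - t) / (1 + t)"
proof -
 have "(cdist p)^2 \<le> 2^2" using assms by (intro power_mono) auto
 hence "t * (cdist p)^2 \<le> t * 4" using assms by (intro mult_left_mono) auto
 hence "(1 - t)^2 + t * (cdist p)^2 \<le> (1 + t)^2" by (simp add: power2_eq_square algebra_simps)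
 hence "(1 - t^2) / (1 + t)^2 \<le> pk t p"
  unfolding pk_def using assms by (intro divide_left_mono) (auto simp: power_le_one abs_square_le_1 poisson_denom_pos intro!: mult_pos_pos)
 moreover have "1 - t^2 = (1 - t) * (1 + t)" by (simp add: power2_eq_square algebra_simps)
 hence "(1 - t^2) / (1 + t)^2 = (1 - t) / (1 + t)" using assms by (simp add: power2_eq_square)
 ultimately show ?thesis by simp
qed

lemma pk_cdist2:
 assumes "0 < t" "t < 1" shows "pk t p * (cdist p)^2 \<le> (1 - t^2) / t"
proof -
 have "t * (cdist p)^2 * (1 - t^2) \<le> ((1 - t)^2 + t * (cdist p)^2) * (1 - t^2)"
  using assms by (intro mult_right_mono) (auto simp: power_le_one abs_square_le_1)
 thus ?thesis unfolding pk_def using assms poisson_denom_pos[of t p]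
  by (simp add: field_simps)
qed

text \<open>By the inequality of the means,
  \<open>2 (1 - t) sqrt t * d \<le> (1 - t)^2 + t d^2\<close>. The hypothesis
  \<open>1/4 \<le> t\<close>, which recurs from here on, says that \<open>sqrt t\<close> is at least
  1/2.\<close>

lemma pk_cdist:
 assumes "1/4 \<le> t" "t < 1" shows "pk t p * cdist p \<le> 2"
proof -
 let ?S = "sqrt t * cdist p"
 have s: "sqrt t \<ge> 1/2" using assms by (intro real_le_rsqrt) (simp add: power2_eq_square)
 have s2: "(sqrt t)^2 = t" using assms by simp
 have "2 * (1 - t) * ?S \<le> (1 - t)^2 + ?S^2" by (rule sum_squares_bound)
 hence *: "2 * (1 - t) * ?S \<le> (1 - t)^2 + t * (cdist p)^2" by (simp add: power_mult_distrib s2)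
 have "(1 - t) * cdist p * (1/2) \<le> (1 - t) * cdist p * sqrt t"
  using s assms by (intro mult_left_mono) auto
 with * have **: "(1 - t) * cdist p \<le> (1 - t)^2 + t * (cdist p)^2" by (simp add: mult_ac)
 have "(1 - t^2) * cdist p = (1 + t) * ((1 - t) * cdist p)" by (simp add: power2_eq_square algebra_simps)
 also have "\<dots> \<le> 2 * ((1 - t)^2 + t * (cdist p)^2)" using ** assms by (intro mult_mono) auto
 finally show ?thesis unfolding pk_def using assms poisson_denom_pos[of t p] by (simp add: field_simps)
qed

lemma ck_cdist: "cmod w = 1 ==> \<bar>ck (z, w)\<bar> \<le> 2 / cdist (z, w)"
 using Im_zeta_le[of w z] unfolding ck_def
 by (cases "cdist (z, w) = 0") (auto simp: abs_mult field_simps power2_eq_square)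

text \<open>Both sides are \<open>ck\<close> times \<open>(1 - t)^2\<close> over the Poisson
  denominator. This turns a product of kernels, as produced by bubbles, into a difference whose
  Fourier sums are known.\<close>

lemma pk_ck:
 assumes "0 \<le> t" "t < 1" "cmod w = 1"
 shows "(1 - t) / (1 + t) * (pk t (z, w) * ck (z, w)) = ck (z, w) - qk t (z, w)"
proof (cases "cdist (z, w) = 0")
 case True
 hence "Im (zeta (z, w)) = 0" using Im_zeta_le[of w z] assms by simp
 thus ?thesis by (simp add: ck_def qk_def)
next
 case False
 show ?thesis using poisson_denom_pos[OF assms(1,2), of "(z, w)"] assms False unfolding pk_def ck_def qk_def
  by (simp add: divide_simps power2_eq_square) (simp add: algebra_simps)
qed

lemma qk_le_ck:
 assumes "0 \<le> t" "t < 1" "cmod w = 1"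
 shows "\<bar>qk t (z, w)\<bar> \<le> \<bar>ck (z, w)\<bar>"
proof (cases "cdist (z, w) = 0")
 case True
 hence "Im (zeta (z, w)) = 0" using Im_zeta_le[of w z] assms by simp
 thus ?thesis by (simp add: ck_def qk_def)
next
 case False
 have d: "t * (cdist (z, w))^2 \<le> (1 - t)^2 + t * (cdist (z, w))^2" by simp
 have "\<bar>Im (zeta (z, w))\<bar> * (t * (cdist (z, w))^2) \<le> \<bar>Im (zeta (z, w))\<bar> * ((1 - t)^2 + t * (cdist (z, w))^2)"
  by (intro mult_left_mono d) auto
 thus ?thesis using poisson_denom_pos[OF assms(1,2), of "(z, w)"] assms False unfolding ck_def qk_def
  by (simp add: abs_mult abs_divide field_simps)
qed

lemma kernel_limits:
 assumes "t \<leadsto> 1" "cdist p \<noteq> 0"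
 shows "(\<lambda>n. pk (t n) p) \<leadsto> 0" "(\<lambda>n. qk (t n) p) \<leadsto> ck p"
  "(\<lambda>n. (1 + t n) * (cdist p)^2 / ((1 - t n)^2 + t n * (cdist p)^2)) \<leadsto> 2"
proof -
 let ?L = "\<lambda>n. (1 + t n) * (cdist p)^2 / ((1 - t n)^2 + t n * (cdist p)^2)"
 let ?C = "(1 - 1)^2 + 1 * (cdist p)^2"
 have "(\<lambda>n. pk (t n) p) \<leadsto> (1 - 1^2) / ?C"
  unfolding pk_def by (intro tendsto_intros assms) (use assms in auto)
 thus "(\<lambda>n. pk (t n) p) \<leadsto> 0" by simp
 have "(\<lambda>n. qk (t n) p) \<leadsto> 2 * 1 * Im (zeta p) / ?C"
  unfolding qk_def by (intro tendsto_intros assms) (use assms in auto)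
 thus "(\<lambda>n. qk (t n) p) \<leadsto> ck p" by (simp add: ck_def)
 have "?L \<leadsto> (1 + 1) * (cdist p)^2 / ?C"
  by (intro tendsto_intros assms) (use assms in auto)
 thus "?L \<leadsto> 2" using assms by simp
qed

lemma pk_commute: "pk t (w, z) = pk t (z, w)"
 by (simp add: pk_def cdist_def norm_minus_commute)

lemma pk_geometric:
 assumes "cmod z = 1" "cmod w = 1" "0 \<le> t" "t < 1"
 shows "of_real (pk t (z, w)) = 1 / (1 - of_real t * (z * cnj w)) + 1 / (1 - of_real t * cnj (z * cnj w)) - 1"
proof -
 let ?u = "1 / (1 - of_real t * zeta (z, w))"
 have "complex_of_real (2 * Re ?u - 1) = of_real (pk t (z, w))"
  using arg_cong[OF herglotz_kernel[OF assms], of Re] by (simp add: Re_divide Im_divide)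
 moreover have "?u + cnj ?u - 1 = complex_of_real (2 * Re ?u - 1)" unfolding complex_add_cnj by simp
 ultimately show ?thesis by (simp add: zeta_def)
qed

lemma qk_geometric:
 assumes "cmod z = 1" "cmod w = 1" "0 \<le> t" "t < 1"
 shows "\<i> * of_real (qk t (z, w)) = 1 / (1 - of_real t * (z * cnj w)) - 1 / (1 - of_real t * cnj (z * cnj w))"
proof -
 let ?u = "1 / (1 - of_real t * zeta (z, w))"
 have "complex_of_real (2 * Im ?u) = of_real (qk t (z, w))"
  using arg_cong[OF herglotz_kernel[OF assms], of Im] by (simp add: Re_divide Im_divide)
 moreover have "?u - cnj ?u = of_real (2 * Im ?u) * \<i>" by (rule complex_diff_cnj)
 ultimately show ?thesis by (simp add: zeta_def mult.commute)
qed

section \<open>Fourier coefficients and Abel sums\<close>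

lemma circ_monomials:
 "(LINT z|circ. z ^ m * cnj z ^ n) = (if m = n then 1 else 0)"
 "(LINT z|circ. cnj z ^ m * cnj z ^ n) = (if m + n = 0 then 1 else 0)"
 "(LINT z|circ. z ^ m * z ^ n) = (if m + n = 0 then 1 else 0)"
proof -
 show 0: "(LINT z|circ. z ^ m * z ^ n) = (if m + n = 0 then 1 else 0)" for m n
  unfolding power_add[symmetric] using integral_circ_power[of "m + n"] by auto
 show "(LINT z|circ. cnj z ^ m * cnj z ^ n) = (if m + n = 0 then 1 else 0)"
  using arg_cong[OF 0[of m n], of cnj] by (simp flip: B_integral_cnj)
 have 1: "(LINT z|circ. z ^ m * cnj z ^ n) = (if m = n then 1 else 0)" if "n \<le> m" for m n
 proof -
  have "(LINT z|circ. z ^ m * cnj z ^ n) = (LINT z|circ. z ^ 0 * z ^ (m - n))"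
  proof (rule B_integral_cong[OF refl])
   fix z assume "z \<in> space circ"
   hence "z ^ n * cnj z ^ n = 1" using complex_norm_square[of z] by (simp flip: power_mult_distrib)
   moreover have "z ^ m = z ^ (m - n) * z ^ n" using that by (simp flip: power_add)
   ultimately show "z ^ m * cnj z ^ n = z ^ 0 * z ^ (m - n)" by (simp add: mult.assoc)
  qed
  thus ?thesis unfolding 0 using that by simp
 qed
 show "(LINT z|circ. z ^ m * cnj z ^ n) = (if m = n then 1 else 0)"
  using 1[of n m] arg_cong[OF 1[of m n], of cnj] by (cases "n \<le> m") (auto simp: mult.commute simp flip: B_integral_cnj)
qed

text \<open>The Fourier coefficient at \<open>-n\<close>; \<open>fp\<close> is the one at
  \<open>n\<close>. Splitting by sign keeps the index a natural number, at the price that frequency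
  0 is listed twice.\<close>

definition fm :: "(complex => complex) => nat => complex" where
 "fm f n = (LINT z|circ. f z * z ^ n)"

definition fp :: "(complex => complex) => nat => complex" where
 "fp f n = (LINT z|circ. f z * cnj z ^ n)"

lemma fm_cnj: "fm (\<lambda>z. cnj (f z)) n = cnj (fp f n)"
proof -
 have "fm (\<lambda>z. cnj (f z)) n = (LINT z|circ. cnj (f z * cnj z ^ n))" by (simp add: fm_def)
 also have "\<dots> = cnj (fp f n)" unfolding fp_def by (rule B_integral_cnj)
 finally show ?thesis .
qed

lemma fp_0: "fp f 0 = fm f 0" by (simp add: fp_def fm_def)

definition pint :: "real => (complex => complex) => complex => complex" where
 "pint t f e = (LINT w|circ. of_real (pk t (e, w)) * f w)"

text \<open>The kernel is a sum of two geometric series, in \<open>e * cnj w\<close> and in its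
  conjugate. The constant term belongs to both, whence the extra \<open>fm f 0\<close>.\<close>

lemma poisson_expansion:
 assumes [measurable]: "f \<in> borel_measurable circ" and B: "\<And>z. cmod z = 1 ==> cmod (f z) \<le> B"
  and e: "cmod e = 1" and t: "0 \<le> t" "t < 1"
 shows "(\<lambda>n. of_real t ^ n * (fp f n * e ^ n + fm f n * cnj e ^ n)) sums (pint t f e + fm f 0)"
proof -
 let ?L = "LINT w|circ. f w / (1 - of_real t * cnj (e * cnj w))"
 let ?I = "LINT w|circ. f w / (1 - of_real t * (e * cnj w))"
 have [measurable]: "(\<lambda>w. e * cnj w) \<in> borel_measurable circ" by measurable
 have i3: "integrable circ f" by (rule circ_integrable_bounded[OF _ B]) auto
 have s: "(\<lambda>n. of_real t ^ n * (LINT w|circ. h w ^ n * f w)) sums (LINT w|circ. f w / (1 - of_real t * h w))"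
  "integrable circ (\<lambda>w. f w / (1 - of_real t * h w))" if "h = (\<lambda>w. e * cnj w) \<or> h = (\<lambda>w. cnj (e * cnj w))" for h
  by (rule geometric_sums_integral[OF circ.finite_measure_axioms, where B = B]; use that e B t in \<open>auto simp: norm_mult\<close>)+
 have "pint t f e = (LINT w|circ. f w / (1 - of_real t * (e * cnj w)) + f w / (1 - of_real t * cnj (e * cnj w)) - f w)"
  unfolding pint_def by (rule B_integral_cong) (use e t in \<open>auto simp: pk_geometric algebra_simps\<close>)
 also have "\<dots> = ?I + ?L - fm f 0"
  by (subst B_integral_diff[OF B_integrable_add i3], (rule s, simp)+, subst B_integral_add, (rule s, simp)+) (simp add: fm_def)
 finally have "pint t f e + fm f 0 = ?I + ?L"
  by simp
 moreover have "(LINT w|circ. (e * cnj w) ^ n * f w) = fp f n * e ^ n" "(LINT w|circ. cnj (e * cnj w) ^ n * f w) = fm f n * cnj e ^ n" for n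
  unfolding fp_def fm_def integral_mult_left_zero[symmetric] by (auto simp: power_mult_distrib mult_ac)
 ultimately show ?thesis using sums_add[OF s(1)[OF disjI1[OF refl]] s(1)[OF disjI2[OF refl]]] by (simp only: distrib_left)
qed

lemma pint_power:
 assumes e: "cmod e = 1" and t: "0 \<le> t" "t < 1"
 shows "pint t (\<lambda>w. w ^ n) e = (of_real t * e) ^ n"
proof -
 let ?L = "\<lambda>w. w ^ n"
 let ?S = "\<lambda>m. of_real t ^ m * (fp ?L m * e ^ m + fm ?L m * cnj e ^ m)"
 have c: "fp ?L m = (if m = n then 1 else 0)" "fm ?L m = (if m + n = 0 then 1 else 0)" for m
  unfolding fp_def fm_def circ_monomials by auto
 have "?S sums (pint t ?L e + fm ?L 0)"
  by (rule poisson_expansion[where B = 1]) (use assms in \<open>auto simp: norm_power\<close>)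
 moreover have "?S sums (\<Sum>m\<in>{n}. ?S m)" by (rule sums_finite) (auto simp: c)
 ultimately have "pint t ?L e + fm ?L 0 = (\<Sum>m\<in>{n}. ?S m)" by (rule sums_unique2)
 thus ?thesis by (auto simp: c power_mult_distrib split: if_splits)
qed

lemma integral_pk:
 assumes "cmod z = 1" "0 \<le> t" "t < 1"
 shows "(LINT w|circ. pk t (z, w)) = 1" "(LINT w|circ. pk t (w, z)) = 1"
 using pint_power[OF assms, of 0] unfolding pint_def pk_commute[of t _ z]
 by (simp_all only: power_0 mult_1_right integral_complex_of_real of_real_eq_1_iff)

lemma abs_pk_le: "0 \<le> t ==> t < 1 ==> \<bar>pk t p\<bar> \<le> (1 + t) / (1 - t)"
 using pk_le pk_nonneg by simp

lemma integrable_pk: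
 assumes "0 \<le> t" "t < 1" shows "integrable circ (\<lambda>w. pk t (z, w))" "integrable circ (\<lambda>w. pk t (w, z))"
 by (rule circ_integrable_bounded[where B = "(1 + t) / (1 - t)"]; use abs_pk_le[OF assms] in simp)+

lemma integrable_kernel_scaleR:
 fixes \<phi> :: "complex \<times> complex => 'a::{banach, second_countable_topology}"
 assumes [measurable]: "\<phi> \<in> borel_measurable circ2" and t: "0 \<le> t" "t < 1"
  and B: "\<And>z w. cmod z = 1 ==> cmod w = 1 ==> norm (\<phi> (z, w)) \<le> B"
 shows "integrable circ2 (\<lambda>p. pk t p *\<^sub>R \<phi> p)" "integrable circ2 (\<lambda>p. qk t p *\<^sub>R \<phi> p)"
proof -
 have "\<bar>qk t (z, w)\<bar> \<le> 2 / (1 - t)^2" if zw: "cmod z = 1" "cmod w = 1" for z w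
 proof -
  have "\<bar>2 * t * Im (zeta (z, w))\<bar> \<le> 2 * 1 * 1"
   unfolding abs_mult using t abs_Im_le_cmod[of "zeta (z, w)"] cmod_zeta[OF zw] by (intro mult_mono) auto
  hence "\<bar>2 * t * Im (zeta (z, w))\<bar> / ((1 - t)^2 + t * (cdist (z, w))^2) \<le> 2 / (1 - t)^2"
   using t by (intro frac_le) auto
  thus ?thesis unfolding qk_def abs_divide using poisson_denom_pos[OF t, of "(z, w)"] by simp
 qed
 thus "integrable circ2 (\<lambda>p. qk t p *\<^sub>R \<phi> p)"
  using B t by (intro circ2_integrable_bounded[where B = "2 / (1 - t)^2 * B"]) (auto simp del: times_divide_eq_left intro!: mult_mono)
 show "integrable circ2 (\<lambda>p. pk t p *\<^sub>R \<phi> p)"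
  using B t by (intro circ2_integrable_bounded[where B = "(1 + t) / (1 - t) * B"]) (auto simp del: times_divide_eq_left intro!: mult_mono abs_pk_le)
qed

text \<open>Each term of the geometric series separates the variables, so the double integral
  becomes a sum of products of coefficients. The Poisson kernel weights both signs of the frequency
  equally, its conjugate oppositely; only in the first is the constant term counted twice.\<close>

lemma kernel_sums:
 assumes [measurable]: "f \<in> borel_measurable circ" "g \<in> borel_measurable circ"
  and f: "\<And>z. cmod z = 1 ==> cmod (f z) \<le> A" and g: "\<And>z. cmod z = 1 ==> cmod (g z) \<le> B"
  and t: "0 \<le> t" "t < 1"
 shows "(\<lambda>n. of_real t ^ n * (fp f n * cnj (fp g n) + fm f n * cnj (fm g n))) sums
   ((LINT p|circ2. of_real (pk t p) * (f (fst p) * cnj (g (snd p)))) + fm f 0 * cnj (fm g 0))" (is ?P)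
  "(\<lambda>n. of_real t ^ n * (fp f n * cnj (fp g n) - fm f n * cnj (fm g n))) sums
   (- \<i> * (LINT p|circ2. of_real (qk t p) * (f (fst p) * cnj (g (snd p)))))" (is ?Q)
proof -
 let ?O = "\<lambda>p. 1 - of_real t * zeta p"
 have AB: "A \<ge> 0" "B \<ge> 0" using f[of 1] g[of 1] by (auto intro: order_trans[OF norm_ge_zero])
 let ?F = "\<lambda>p. f (fst p) * cnj (g (snd p))" let ?G = "\<lambda>h. LINT p|circ2. ?F p / (1 - of_real t * h p)"
 have F: "cmod (?F (z, w)) \<le> A * B" if "cmod z = 1" "cmod w = 1" for z w
  using that f g AB by (auto simp: norm_mult intro!: mult_mono)
 have coeff: "(LINT p|circ2. (e (fst p) * cnj (e (snd p))) ^ n * ?F p) = (LINT z|circ. f z * e z ^ n) * cnj (LINT z|circ. g z * e z ^ n)"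
  if e: "e = (\<lambda>z. z) \<or> e = cnj" for e n
 proof -
  have [measurable]: "e \<in> borel_measurable circ" using e by auto
  have "(LINT p|circ2. (e (fst p) * cnj (e (snd p))) ^ n * ?F p) = (LINT p|circ2. (f (fst p) * e (fst p) ^ n) * (cnj (g (snd p) * e (snd p) ^ n)))"
   by (rule B_integral_cong) (auto simp: power_mult_distrib)
  also have "\<dots> = (LINT z|circ. f z * e z ^ n) * (LINT z|circ. cnj (g z * e z ^ n))"
   by (rule circ2_integral_mult[where A = A and B = B]) (use f g e in \<open>auto simp: norm_mult norm_power\<close>)
  finally show ?thesis by (simp only: B_integral_cnj)
 qed
 have s: "(\<lambda>n. of_real t ^ n * (LINT p|circ2. h p ^ n * ?F p)) sums ?G h"
  "integrable circ2 (\<lambda>p. ?F p / (1 - of_real t * h p))" if h: "h = zeta \<or> h = (\<lambda>p. cnj (zeta p))" for h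
 proof -
  have [measurable]: "h \<in> borel_measurable circ2" using h by auto
  show "(\<lambda>n. of_real t ^ n * (LINT p|circ2. h p ^ n * ?F p)) sums ?G h" "integrable circ2 (\<lambda>p. ?F p / (1 - of_real t * h p))"
   by (rule geometric_sums_integral[where B = "A * B"]; use F t h cmod_zeta in \<open>auto intro: cc.finite_measure_axioms\<close>)+
 qed
 let ?c = "\<lambda>p. cnj (zeta p)"
 have m: "(\<lambda>n. of_real t ^ n * (fm f n * cnj (fm g n))) sums ?G zeta"
  using s(1)[of zeta] coeff[of "\<lambda>z. z"] by (simp add: zeta_def fm_def)
 have p: "(\<lambda>n. of_real t ^ n * (fp f n * cnj (fp g n))) sums ?G ?c"
  using s(1)[of ?c] coeff[of cnj] by (simp add: zeta_def fp_def)
 note i = s(2)[of zeta, simplified] s(2)[of ?c, simplified]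
 have iF: "integrable circ2 ?F" using F by (intro circ2_integrable_bounded[where B = "A * B"]) auto
 have "(LINT p|circ2. of_real (pk t p) * ?F p) = (LINT p|circ2. ?F p / (1 - of_real t * ?c p) + ?F p / (?O p) - ?F p)"
  by (rule B_integral_cong) (use t in \<open>auto simp: pk_geometric zeta_def algebra_simps\<close>)
 also have "\<dots> = ?G ?c + ?G zeta - (LINT p|circ2. ?F p)" by (simp only: B_integral_diff[OF B_integrable_add iF] B_integral_add i)
 also have "(LINT p|circ2. ?F p) = fm f 0 * cnj (fm g 0)" using coeff[of "\<lambda>z. z" 0] by (simp add: fm_def)
 finally have "?G ?c + ?G zeta = (LINT p|circ2. of_real (pk t p) * ?F p) + fm f 0 * cnj (fm g 0)" by simp
 thus ?P using sums_add[OF p m] by (simp only: distrib_left)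
 have "- \<i> * (of_real (qk t p) * ?F p) = ?F p / (1 - of_real t * ?c p) - ?F p / (?O p)" if "p \<in> space circ2" for p
 proof -
  have "\<i> * of_real (qk t p) = 1 / (?O p) - 1 / (1 - of_real t * ?c p)"
   using that t qk_geometric[of "fst p" "snd p" t] by (auto simp: zeta_def)
  from arg_cong[OF this, of "\<lambda>x. - x * ?F p"] show ?thesis by (simp add: algebra_simps diff_divide_distrib)
 qed
 hence "- \<i> * (LINT p|circ2. of_real (qk t p) * ?F p) = (LINT p|circ2. ?F p / (1 - of_real t * ?c p) - ?F p / (?O p))"
  unfolding integral_mult_right_zero[symmetric] by (intro B_integral_cong) auto
 also have "\<dots> = ?G ?c - ?G zeta" by (simp only: B_integral_diff i)
 finally show ?Q using sums_diff[OF p m] by (simp only: right_diff_distrib)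
qed

lemma integral_pk_marginal:
 fixes \<phi> :: "complex => 'a::{banach, second_countable_topology}"
 assumes [measurable]: "\<phi> \<in> borel_measurable circ"
  and B: "\<And>z. cmod z = 1 ==> norm (\<phi> z) \<le> B" and t: "0 \<le> t" "t < 1"
 shows "integrable circ2 (\<lambda>p. pk t p *\<^sub>R \<phi> (fst p))" "(LINT p|circ2. pk t p *\<^sub>R \<phi> (fst p)) = (LINT z|circ. \<phi> z)"
  "integrable circ2 (\<lambda>p. pk t p *\<^sub>R \<phi> (snd p))" "(LINT p|circ2. pk t p *\<^sub>R \<phi> (snd p)) = (LINT z|circ. \<phi> z)"
proof -
 show i: "integrable circ2 (\<lambda>p. pk t p *\<^sub>R \<phi> (fst p))" "integrable circ2 (\<lambda>p. pk t p *\<^sub>R \<phi> (snd p))"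
  by (rule integrable_kernel_scaleR[where B = B]; use B t in simp)+
 show "(LINT p|circ2. pk t p *\<^sub>R \<phi> (fst p)) = (LINT z|circ. \<phi> z)"
  by (subst circ2_fubini(1)[OF i(1)], rule B_integral_cong) (use t in \<open>auto simp: integral_pk integrable_pk\<close>)
 show "(LINT p|circ2. pk t p *\<^sub>R \<phi> (snd p)) = (LINT z|circ. \<phi> z)"
  by (subst circ2_fubini(2)[OF i(2)], rule B_integral_cong) (use t in \<open>auto simp: integral_pk integrable_pk\<close>)
qed

definition ac :: "(complex => complex) => nat => real" where
 "ac f n = (if n = 0 then (cmod (fm f 0))^2 else (cmod (fp f n))^2 + (cmod (fm f n))^2)"

definition dc :: "(complex => complex) => nat => real" where
 "dc f n = (cmod (fp f n))^2 - (cmod (fm f n))^2"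

definition cdeg :: "(complex => complex) => real" where
 "cdeg f = (\<Sum>n. real n * dc f n)"

lemma ac_nonneg [simp]: "ac f n \<ge> 0" by (simp add: ac_def)

lemma dc_le_ac: "\<bar>dc f n\<bar> \<le> ac f n"
 by (cases "n = 0") (auto simp: dc_def ac_def fp_0 abs_le_iff)

lemma tendsto_suminf_dominated:
 fixes a :: "nat => nat => real"
 assumes "\<And>n. (\<lambda>k. a n k) \<leadsto> b n" "\<And>n k. \<bar>a n k\<bar> \<le> M n" "summable M"
 shows "(\<lambda>k. \<Sum>n. a n k) \<leadsto> (\<Sum>n. b n)"
 using tannerys_theorem[where a = a and b = b and F = sequentially and M = M] assms by (auto intro: always_eventually)

lemma cross_bound:
 assumes "\<And>z. cmod z = 1 ==> cmod (f z) \<le> A" "cmod z = 1" "cmod w = 1"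
 shows "cmod (cross f (z, w)) \<le> A^2"
 using assms(1)[OF assms(2)] assms(1)[OF assms(3)] order_trans[OF norm_ge_zero assms(1)[OF assms(2)]]
 by (auto simp: cross_def norm_mult power2_eq_square intro!: mult_mono)

lemma Re_cross_bound:
 assumes "\<And>z. cmod z = 1 ==> cmod (f z) \<le> A" "cmod z = 1" "cmod w = 1"
 shows "\<bar>Re (cross f (z, w))\<bar> \<le> A^2" "\<bar>Im (cross f (z, w))\<bar> \<le> A^2"
 using cross_bound[where f = f and A = A, OF assms] abs_Re_le_cmod[of "cross f (z, w)"] abs_Im_le_cmod[of "cross f (z, w)"] by auto

lemma integrable_kernel_cross:
 assumes [measurable]: "f \<in> borel_measurable circ"
  and f: "\<And>z. cmod z = 1 ==> cmod (f z) \<le> A" and t: "0 \<le> t" "t < 1"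
 shows "integrable circ2 (\<lambda>p. pk t p * Re (cross f p))" "integrable circ2 (\<lambda>p. qk t p * Im (cross f p))"
 using integrable_kernel_scaleR(1)[of "\<lambda>p. Re (cross f p)" t "A^2"] integrable_kernel_scaleR(2)[of "\<lambda>p. Im (cross f p)" t "A^2"]
  Re_cross_bound[where f=f and A=A] f t by auto

lemma poisson_sums:
 assumes [measurable]: "f \<in> borel_measurable circ"
  and f: "\<And>z. cmod z = 1 ==> cmod (f z) \<le> A" and t: "0 \<le> t" "t < 1"
 shows "(\<lambda>n. t ^ n * ac f n) sums (LINT p|circ2. pk t p * Re (cross f p))"
  "(\<lambda>n. t ^ n * dc f n) sums (LINT p|circ2. qk t p * Im (cross f p))"
proof -
 let ?L = "LINT p|circ2. pk t p * Re (cross f p)"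
 have i: "integrable circ2 (\<lambda>p. of_real (pk t p) * cross f p)" "integrable circ2 (\<lambda>p. of_real (qk t p) * cross f p)"
  using integrable_kernel_scaleR[of "cross f" t "A^2"] cross_bound[where f=f and A=A] f t by (auto simp: scaleR_conv_of_real)
 have re: "Re (of_real t ^ n * (x * cnj x + y * cnj y)) = t ^ n * ((cmod x)^2 + (cmod y)^2)"
  "Re (of_real t ^ n * (x * cnj x - y * cnj y)) = t ^ n * ((cmod x)^2 - (cmod y)^2)" for n x y
  by (simp_all only: complex_norm_square[symmetric] of_real_power[symmetric] of_real_add[symmetric] of_real_diff[symmetric]
    of_real_mult[symmetric] Re_complex_of_real)
 note k = kernel_sums[OF assms(1,1) f f t, folded cross_def]
 have "(\<lambda>n. t ^ n * ((cmod (fp f n))^2 + (cmod (fm f n))^2)) sums (?L + (cmod (fm f 0))^2)"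
  using sums_Re[OF k(1)] unfolding re by (simp add: integral_Re[OF i(1), symmetric] complex_norm_square[symmetric] del: of_real_power)
 moreover have "t ^ n * ((cmod (fp f n))^2 + (cmod (fm f n))^2) - (if n = 0 then (cmod (fm f 0))^2 else 0) = t ^ n * ac f n" for n
  by (auto simp: ac_def fp_0)
 ultimately show "(\<lambda>n. t ^ n * ac f n) sums ?L"
  using sums_diff[OF _ sums_single[of 0 "\<lambda>n. (cmod (fm f 0))^2"]] by fastforce
 show "(\<lambda>n. t ^ n * dc f n) sums (LINT p|circ2. qk t p * Im (cross f p))"
  using sums_Re[OF k(2)] unfolding re dc_def by (simp add: integral_Im[OF i(2), symmetric])
qed

lemma cdist_dquot: "cdist p * cmod (dquot f p) = cmod (f (fst p) - f (snd p))"
 by (simp add: cmod_dquot cdist_def)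

lemma cdist2_dquot2: "(cdist p)^2 * (cmod (dquot f p))^2 = (cmod (f (fst p) - f (snd p)))^2"
 unfolding power_mult_distrib[symmetric] cdist_dquot ..

section \<open>Parseval's identity and the Fourier formula for the energy\<close>

text \<open>The Abel means fall short of the full L2 norm by half of a smoothed energy integral. The
  last bound, from \<open>pk d^2 \<le> (1 - t^2) / t\<close>, makes this defect vanish as
  \<open>t\<close> tends to 1, so that finite energy by itself yields Parseval.\<close>

lemma poisson_parseval:
 assumes f: "fin_energy f" and t: "0 < t" "t < 1"
 shows "integrable circ2 (\<lambda>p. pk t p * (cmod (f (fst p) - f (snd p)))^2)"
  "(LINT p|circ2. pk t p * (cmod (f (fst p) - f (snd p)))^2) = 2 * (LINT z|circ. (cmod (f z))^2) - 2 * (\<Sum>n. t ^ n * ac f n)"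
  "(LINT p|circ2. pk t p * (cmod (f (fst p) - f (snd p)))^2) \<le> (1 - t^2) / t * cenergy f"
proof -
 let ?L = "LINT p|circ2. pk t p * (cmod (f (fst p) - f (snd p)))^2"
 let ?I = "LINT p|circ2. pk t p * Re (cross f p)"
 let ?C = "\<lambda>p. cmod (f (fst p) - f (snd p))"
 note [measurable] = fin_energy_measurable[OF f]
 have t0: "0 \<le> t" using t by simp
 obtain A where A: "A \<ge> 0" "\<And>z. cmod z = 1 ==> cmod (f z) \<le> A" by (rule fin_energy_bound[OF f]) (rule that)
 have A2: "\<bar>(cmod (f z))^2\<bar> \<le> A^2" if "cmod z = 1" for z
  using A that by (auto intro!: power_mono)
 note m = integral_pk_marginal[of "\<lambda>z. (cmod (f z))^2", OF _ _ t0 t(2), unfolded real_norm_def, OF _ A2, unfolded real_scaleR_def]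
 have eq: "pk t p * (?C p)^2 = pk t p * (cmod (f (fst p)))^2 + pk t p * (cmod (f (snd p)))^2 - 2 * (pk t p * Re (cross f p))" for p
  unfolding cmod_power2 cross_def by (simp add: power2_eq_square algebra_simps)
 have i: "integrable circ2 (\<lambda>p. pk t p * Re (cross f p))" by (rule integrable_kernel_cross[OF _ A(2) t0 t(2)]) measurable
 show I: "integrable circ2 (\<lambda>p. pk t p * (?C p)^2)"
  unfolding eq by (intro B_integrable_diff B_integrable_add m integrable_mult_right i) measurable
 have "?L = 2 * (LINT z|circ. (cmod (f z))^2) - 2 * ?I"
  unfolding eq using m i by simp
 also have "?I = (\<Sum>n. t ^ n * ac f n)"
  by (rule sums_unique, rule poisson_sums(1)[OF _ A(2) t0 t(2)]) measurable
 finally show "?L = 2 * (LINT z|circ. (cmod (f z))^2) - 2 * (\<Sum>n. t ^ n * ac f n)" .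
 have "?L \<le> (LINT p|circ2. (1 - t^2) / t * (cmod (dquot f p))^2)"
 proof (rule integral_mono[OF I])
  show "integrable circ2 (\<lambda>p. (1 - t^2) / t * (cmod (dquot f p))^2)" using fin_energyD[OF f] by simp
  fix p
  show "pk t p * (?C p)^2 \<le> (1 - t^2) / t * (cmod (dquot f p))^2"
   unfolding cdist2_dquot2[symmetric] mult.assoc[symmetric]
   by (intro mult_right_mono pk_cdist2 t) auto
 qed
 thus "?L \<le> (1 - t^2) / t * cenergy f"
  by (simp add: cenergy_def)
qed

text \<open>The sequence starts at 1/2, so that bounds requiring \<open>1/4 \<le> t\<close> apply to
  all of its terms and also to their squares.\<close>

definition tseq :: "nat => real" where "tseq k = 1 - 1 / (real k + 2)"

lemma tseq: "1/2 \<le> tseq k" "0 < tseq k" "tseq k < 1"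
 by (auto simp: tseq_def field_simps)

lemma tseq_lim: "tseq \<leadsto> 1"
proof -
 have "(\<lambda>k. 1 - 1 / real (k + 2)) \<leadsto> 1 - 0"
  by (intro tendsto_diff tendsto_const LIMSEQ_ignore_initial_segment[OF lim_1_over_n])
 thus ?thesis by (simp add: tseq_def[abs_def] add.commute)
qed

text \<open>For nonnegative terms, every partial sum is a limit of partial sums of the regularised
  series and so stays below \<open>L\<close>, while each regularised sum lies below the full
  one.\<close>

lemma sums_of_nonneg_abel:
 fixes a :: "nat => real" and c :: "nat => nat => real"
 assumes a: "\<And>n. a n \<ge> 0" and c: "\<And>k n. 0 \<le> c k n" "\<And>k n. c k n \<le> C n" "\<And>n. (\<lambda>k. c k n) \<leadsto> C n"
  and s: "\<And>k. (\<lambda>n. c k n * a n) sums S k" and S: "S \<leadsto> L"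
 shows "(\<lambda>n. C n * a n) sums L"
proof -
 let ?S = "\<Sum>n. C n * a n"
 have nn: "0 \<le> C n * a n" for n using a[of n] c(1)[of 0 n] c(2)[of 0 n] by simp
 have part: "(\<Sum>n<N. C n * a n) \<le> L" for N
 proof (rule LIMSEQ_le[OF _ S])
  show "(\<lambda>k. \<Sum>n<N. c k n * a n) \<leadsto> (\<Sum>n<N. C n * a n)"
   by (intro tendsto_sum tendsto_mult c tendsto_const)
  show "\<exists>N'. \<forall>k\<ge>N'. (\<Sum>n<N. c k n * a n) \<le> S k"
  proof (intro exI[of _ 0] allI impI)
   fix k
   have "(\<Sum>n<N. c k n * a n) \<le> (\<Sum>n. c k n * a n)"
    by (rule sum_le_suminf) (use s a c(1) in \<open>auto simp: sums_iff\<close>)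
   thus "(\<Sum>n<N. c k n * a n) \<le> S k" using s[of k] by (simp add: sums_iff)
  qed
 qed
 have sm: "summable (\<lambda>n. C n * a n)"
  by (rule bounded_imp_summable[OF nn, where B = L]) (metis lessThan_Suc_atMost part)
 have le: "?S \<le> L"
  by (rule suminf_le_const[OF sm part])
 have "S k \<le> ?S" for k
  using sums_le[OF _ s[of k] summable_sums[OF sm]] c(2) a by (auto intro!: mult_right_mono)
 hence "L \<le> ?S" by (intro LIMSEQ_le_const2[OF S]) auto
 with le have "?S = L" by simp
 with sm show ?thesis by (simp add: sums_iff)
qed

lemma parseval:
 assumes f: "fin_energy f"
 shows "ac f sums (LINT z|circ. (cmod (f z))^2)"
proof -
 let ?L = "LINT z|circ. (cmod (f z))^2"
 note [measurable] = fin_energy_measurable[OF f]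
 obtain A where A: "A \<ge> 0" "\<And>z. cmod z = 1 ==> cmod (f z) \<le> A" by (rule fin_energy_bound[OF f]) (rule that)
 define S where "S k = (\<Sum>n. tseq k ^ n * ac f n)" for k
 have s: "(\<lambda>n. tseq k ^ n * ac f n) sums S k" for k
 proof -
  have "(\<lambda>n. tseq k ^ n * ac f n) sums (LINT p|circ2. pk (tseq k) p * Re (cross f p))"
   by (rule poisson_sums(1)[OF _ A(2)]) (use tseq[of k] in auto)
  thus ?thesis by (simp add: S_def sums_iff)
 qed
 have S: "S \<leadsto> ?L"
 proof -
  define D where "D k = (LINT p|circ2. pk (tseq k) p * (cmod (f (fst p) - f (snd p)))^2)" for k
  have D0: "0 \<le> D k" for k unfolding D_def by (rule B_integral_nonneg) (use pk_nonneg[of "tseq k"] tseq[of k] in auto)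
  have D1: "D k \<le> (1 - (tseq k)^2) / tseq k * cenergy f" for k
   unfolding D_def using poisson_parseval(3)[OF f] tseq[of k] by simp
  have "(\<lambda>k. (1 - (tseq k)^2) / tseq k * cenergy f) \<leadsto> (1 - 1^2) / 1 * cenergy f"
   by (intro tendsto_intros tseq_lim) simp
  hence "D \<leadsto> 0" using D0 D1
   by (intro tendsto_sandwich[of "\<lambda>_. 0" D sequentially "\<lambda>k. (1 - (tseq k)^2) / tseq k * cenergy f"]) auto
  hence "(\<lambda>k. ?L - D k / 2) \<leadsto> ?L - 0 / 2"
   by (intro tendsto_intros) auto
  moreover have "?L - D k / 2 = S k" for k
   using poisson_parseval(2)[OF f tseq(2,3)[of k]] unfolding D_def[symmetric] S_def[symmetric] by linarith
  ultimately show ?thesis by simp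
 qed
 have "(\<lambda>n. 1 * ac f n) sums ?L"
 proof (rule sums_of_nonneg_abel[OF _ _ _ _ s S])
  show "(\<lambda>k. tseq k ^ n) \<leadsto> 1" for n
   using tendsto_power[OF tseq_lim, of n] by simp
 qed (use tseq in \<open>auto simp: power_le_one less_imp_le\<close>)
 thus ?thesis by simp
qed

lemma geometric_quotient: "t < 1 ==> (1 - t ^ n) / (1 - t) = (\<Sum>j<n. t ^ j)" for t :: real
 using sum_gp_strict[of t n] by simp

text \<open>Divides the Abel defect of Parseval by \<open>2 (1 - t)\<close>. On the Fourier side
  \<open>(1 - t^n) / (1 - t)\<close> tends to \<open>n\<close> from below; on the other side the
  kernel becomes \<open>(1 + t) / 2\<close> over the Poisson denominator and tends to the inverse
  squared distance.\<close>

lemma energy_sums: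
 assumes f: "fin_energy f"
 shows "(\<lambda>n. real n * ac f n) sums cenergy f"
proof -
 let ?C = "\<lambda>p. cmod (dquot f p)"
 let ?L = "LINT z|circ. (cmod (f z))^2"
 let ?S = "\<lambda>k. \<Sum>n. tseq k ^ n * ac f n"
 note [measurable] = fin_energy_measurable[OF f]
 define D where "D k = (LINT p|circ2. pk (tseq k) p * (cmod (f (fst p) - f (snd p)))^2)" for k
 have s: "(\<lambda>n. (\<Sum>j<n. tseq k ^ j) * ac f n) sums (D k / (2 * (1 - tseq k)))" for k
 proof -
  obtain A where A: "A \<ge> 0" "\<And>z. cmod z = 1 ==> cmod (f z) \<le> A" by (rule fin_energy_bound[OF f]) (rule that)
  have "summable (\<lambda>n. tseq k ^ n * ac f n)"
   by (rule sums_summable[OF poisson_sums(1)[OF _ A(2)]]) (use tseq[of k] in auto)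
  from sums_divide[OF sums_diff[OF parseval[OF f] summable_sums[OF this]], of "1 - tseq k"]
  have 1: "(\<lambda>n. (ac f n - tseq k ^ n * ac f n) / (1 - tseq k)) sums
    ((?L - (?S k)) / (1 - tseq k))" .
  have 2: "(?L - (?S k)) / (1 - tseq k) = D k / (2 * (1 - tseq k))"
  proof -
   have "D k / (2 * (1 - tseq k)) = D k / 2 / (1 - tseq k)" by simp
   also have "D k / 2 = ?L - (?S k)"
    using poisson_parseval(2)[OF f tseq(2,3)[of k]] unfolding D_def[symmetric] by linarith
   finally show ?thesis by simp
  qed
  have 3: "(ac f n - tseq k ^ n * ac f n) / (1 - tseq k) = (1 - tseq k ^ n) / (1 - tseq k) * ac f n" for n
   by (simp add: left_diff_distrib diff_divide_distrib)
  have "(\<lambda>n. (1 - tseq k ^ n) / (1 - tseq k) * ac f n) sums (D k / (2 * (1 - tseq k)))"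
   using 1 unfolding 2 3 .
  thus ?thesis using tseq(3)[of k] by (simp add: geometric_quotient)
 qed
 have S: "(\<lambda>k. D k / (2 * (1 - tseq k))) \<leadsto> cenergy f"
 proof -
  \<comment> \<open>The smoothed integrand divided by \<open>2 (1 - t)\<close> and rewritten through
    \<open>dquot\<close>: the fraction is at most 4 because \<open>1/2 \<le> t\<close>, which
    provides the dominating function.\<close>
  let ?g = "\<lambda>k p. ((1 + tseq k) * (cdist p)^2 / ((1 - tseq k)^2 + tseq k * (cdist p)^2)) * (?C p)^2 / 2"
  have bd: "(1 + t) * c / ((1 - t)^2 + t * c) \<le> 4" if "1/2 \<le> t" "t < 1" "c \<ge> 0" for t c :: real
  proof -
   have "(1 + t) * c \<le> 4 * (t * c)" using mult_right_mono[of "1 + t" "4 * t" c] that by simp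
   also have "\<dots> \<le> 4 * ((1 - t)^2 + t * c)" by simp
   finally have "(1 + t) * c \<le> 4 * ((1 - t)^2 + t * c)" .
   moreover have "(1 - t)^2 + t * c > 0" using that by (intro add_pos_nonneg) auto
   ultimately show ?thesis by (simp add: pos_divide_le_eq)
  qed
  have "(\<lambda>k. integral\<^sup>L circ2 (?g k)) \<leadsto> (LINT p|circ2. (?C p)^2)"
  proof (rule integral_dominated_convergence[where w = "\<lambda>p. 2 * (?C p)^2"])
   show "AE p in circ2. (\<lambda>k. ?g k p) \<leadsto> (?C p)^2"
   proof (rule AE_I2)
    fix p
    show "(\<lambda>k. ?g k p) \<leadsto> (?C p)^2"
    proof (cases "cdist p = 0")
     case False
     have "(\<lambda>k. ?g k p) \<leadsto> 2 * (?C p)^2 / 2"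
      by (intro tendsto_intros kernel_limits(3) tseq_lim False) auto
     thus ?thesis by simp
    qed (simp add: cmod_dquot)
   qed
   show "AE p in circ2. norm (?g k p) \<le> 2 * (?C p)^2" for k
   proof (rule AE_I2)
    fix p
    have "0 \<le> (1 + tseq k) * (cdist p)^2 / ((1 - tseq k)^2 + tseq k * (cdist p)^2)"
     using tseq[of k] by (intro divide_nonneg_nonneg) auto
    moreover have "(1 + tseq k) * (cdist p)^2 / ((1 - tseq k)^2 + tseq k * (cdist p)^2) \<le> 4"
     using tseq[of k] by (intro bd) auto
    moreover have "norm (x * y / 2) \<le> 2 * y" if "0 \<le> x" "x \<le> 4" "0 \<le> y" for x y :: real
     using that mult_right_mono[of x 4 y] by (simp add: abs_mult)
    moreover have "0 \<le> (?C p)^2" by simp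
    ultimately show "norm (?g k p) \<le> 2 * (?C p)^2" by blast
   qed
  qed (use fin_energyD[OF f] in auto)
  moreover have "integral\<^sup>L circ2 (?g k) = D k / (2 * (1 - tseq k))" for k
  proof -
   have t: "1 - tseq k \<noteq> 0" using tseq(3)[of k] by simp
   have "?g k p = pk (tseq k) p * (cmod (f (fst p) - f (snd p)))^2 / (2 * (1 - tseq k))" for p
   proof -
    have "1 - (tseq k)^2 = (1 - tseq k) * (1 + tseq k)" by (simp add: power2_eq_square algebra_simps)
    moreover have "a * c / E * d / 2 = b * a / E * (c * d) / (2 * b)" if "b \<noteq> 0" for a b c d E :: real
     using that by simp
    ultimately show ?thesis unfolding cdist2_dquot2[symmetric] pk_def using t by metis
   qed
   thus ?thesis by (simp add: D_def)
  qed
  ultimately show ?thesis by (simp add: cenergy_def)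
 qed
 show ?thesis
 proof (rule sums_of_nonneg_abel[OF _ _ _ _ s S])
  show "(\<lambda>k. \<Sum>j<n. tseq k ^ j) \<leadsto> real n" for n
   using tendsto_sum[of "{..<n}" "\<lambda>j k. tseq k ^ j" "\<lambda>_. 1" sequentially] tendsto_power[OF tseq_lim] by simp
  show "(\<Sum>j<n. tseq k ^ j) \<le> real n" for n k
   using sum_mono[of "{..<n}" "\<lambda>j. tseq k ^ j" "\<lambda>_. 1"] tseq[of k] by (simp add: power_le_one)
 qed (use tseq in \<open>auto intro!: sum_nonneg simp: less_imp_le\<close>)
qed

lemma cdeg_summable: "fin_energy f ==> summable (\<lambda>n. real n * dc f n)"
 by (rule summable_comparison_test[OF _ sums_summable[OF energy_sums]])
   (auto simp: abs_mult intro!: mult_left_mono dc_le_ac exI[of _ 0])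

lemma abs_cdeg_le:
 assumes "fin_energy f" shows "\<bar>cdeg f\<bar> \<le> cenergy f"
proof -
 have s: "summable (\<lambda>n. \<bar>real n * dc f n\<bar>)"
  by (rule summable_comparison_test[OF _ sums_summable[OF energy_sums[OF assms]]])
   (auto simp: abs_mult intro!: mult_left_mono dc_le_ac exI[of _ 0])
 have "\<bar>cdeg f\<bar> \<le> (\<Sum>n. \<bar>real n * dc f n\<bar>)" unfolding cdeg_def by (rule summable_rabs[OF s])
 also have "\<dots> \<le> cenergy f"
  by (rule sums_le[OF _ summable_sums[OF s] energy_sums[OF assms]])
    (auto simp: abs_mult intro!: mult_left_mono dc_le_ac)
 finally show ?thesis .
qed

lemma cdeg_cnj:
 assumes "fin_energy f" shows "cdeg (\<lambda>z. cnj (f z)) = - cdeg f"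
proof -
 have "dc (\<lambda>z. cnj (f z)) n = - dc f n" for n
  using fm_cnj[of f n] fm_cnj[of "\<lambda>z. cnj (f z)" n] by (simp add: dc_def)
 thus ?thesis unfolding cdeg_def using suminf_minus[OF cdeg_summable[OF assms]] by simp
qed

section \<open>The degree as a limit of double integrals\<close>

text \<open>By \<open>pk_ck\<close> this is \<open>(ck - qk) / (1 - t)\<close>, so against
  \<open>Im (cross f p)\<close> it produces the degree sum with \<open>n\<close> replaced by
  \<open>(1 - t^n) / (1 - t)\<close>. The product form shows what the difference hides: the kernel
  tends to 0 off the diagonal.\<close>

definition nk :: "real => complex \<times> complex => real" where
 "nk t p = pk t p * ck p / (1 + t)"

lemma measurable_nk [measurable]: "nk t \<in> borel_measurable circ2"
 unfolding nk_def by measurable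

lemma Im_cross_le:
 assumes "\<And>z. cmod z = 1 ==> cmod (f z) \<le> A" "cmod z = 1" "cmod w = 1"
 shows "\<bar>Im (cross f (z, w))\<bar> \<le> A * cmod (f z - f w)"
proof -
 have "Im (cross f (z, w)) = Im ((f z - f w) * cnj (f w))" by (simp add: cross_def algebra_simps)
 also have "\<bar>\<dots>\<bar> \<le> cmod (f z - f w) * cmod (f w)"
  using abs_Im_le_cmod[of "(f z - f w) * cnj (f w)"] by (simp only: norm_mult complex_mod_cnj)
 also have "\<dots> \<le> cmod (f z - f w) * A" by (intro mult_left_mono assms) auto
 finally show ?thesis by (simp add: mult_ac)
qed

lemma ck_Im_cross_le:
 assumes "\<And>z. cmod z = 1 ==> cmod (f z) \<le> A" "cmod z = 1" "cmod w = 1"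
 shows "\<bar>ck (z, w) * Im (cross f (z, w))\<bar> \<le> 2 * A * cmod (dquot f (z, w))"
proof -
 have "A \<ge> 0" using assms(1)[OF assms(2)] norm_ge_zero order_trans by blast
 have "\<bar>ck (z, w) * Im (cross f (z, w))\<bar> \<le> 2 / cdist (z, w) * (A * cmod (f z - f w))"
  unfolding abs_mult by (intro mult_mono ck_cdist Im_cross_le assms) auto
 thus ?thesis by (simp add: cmod_dquot)
qed

lemma integrable_dquot:
 assumes "fin_energy f" shows "integrable circ2 (\<lambda>p. cmod (dquot f p))"
proof -
 have [measurable]: "f \<in> borel_measurable circ" using assms by (simp add: fin_energy_measurable)
 have "integrable circ2 (\<lambda>p. 1 * cmod (dquot f p))"
  by (rule integrable_mult_L2) (use fin_energyD[OF assms] in auto)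
 thus ?thesis by simp
qed

lemma integrable_ck_cross:
 assumes f: "fin_energy f"
 shows "integrable circ2 (\<lambda>p. ck p * Im (cross f p))"
proof -
 note [measurable] = fin_energy_measurable[OF f]
 obtain A where A: "A \<ge> 0" "\<And>z. cmod z = 1 ==> cmod (f z) \<le> A" by (rule fin_energy_bound[OF f]) (rule that)
 show ?thesis
 proof (rule B_integrable_bound)
  show "integrable circ2 (\<lambda>p. 2 * A * cmod (dquot f p))" using integrable_dquot[OF f] by simp
  show "AE p in circ2. norm (ck p * Im (cross f p)) \<le> norm (2 * A * cmod (dquot f p))"
   using ck_Im_cross_le[OF A(2)] A(1) by (intro AE_I2) auto
 qed measurable
qed

text \<open>The two kernels in \<open>ck - qk\<close> are evaluated separately. The conjugate
  Poisson kernel gives the factors \<open>t^n\<close>; its limit \<open>ck\<close>, integrable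
  against \<open>Im (cross f p)\<close> because the latter is bounded by a difference of values of
  \<open>f\<close>, gives the factor 1.\<close>

lemma nk_integral_sums:
 assumes f: "fin_energy f" and t: "0 < t" "t < 1"
 shows "(LINT p|circ2. nk t p * Im (cross f p)) = (\<Sum>n. (\<Sum>j<n. t ^ j) * dc f n)"
proof -
 let ?S = "(\<Sum>n. dc f n) - (\<Sum>n. t ^ n * dc f n)"
 let ?U = "\<Sum>n. dc f n"
 note [measurable] = fin_energy_measurable[OF f]
 obtain A where A: "A \<ge> 0" "\<And>z. cmod z = 1 ==> cmod (f z) \<le> A" by (rule fin_energy_bound[OF f]) (rule that)
 have sq: "(\<lambda>n. s ^ n * dc f n) sums (LINT p|circ2. qk s p * Im (cross f p))" if "0 < s" "s < 1" for s
  by (rule poisson_sums(2)[OF _ A(2)]) (use that in auto)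
 have sm: "summable (\<lambda>n. \<bar>dc f n\<bar>)"
  by (rule summable_comparison_test[OF _ sums_summable[OF parseval[OF f]]]) (auto intro!: exI[of _ 0] dc_le_ac)
 have c1: "(LINT p|circ2. ck p * Im (cross f p)) = ?U"
 proof (rule LIMSEQ_unique)
  show "(\<lambda>k. \<integral>p. qk (tseq k) p * Im (cross f p) \<partial>circ2) \<leadsto> (LINT p|circ2. ck p * Im (cross f p))"
  proof (rule integral_dominated_convergence[where w = "\<lambda>p. \<bar>ck p * Im (cross f p)\<bar>"])
   show "AE p in circ2. (\<lambda>k. qk (tseq k) p * Im (cross f p)) \<leadsto> ck p * Im (cross f p)"
   proof (rule AE_I2)
    fix p assume p: "p \<in> space circ2"
    show "(\<lambda>k. qk (tseq k) p * Im (cross f p)) \<leadsto> ck p * Im (cross f p)"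
    proof (cases "cdist p = 0")
     case True
     hence "Im (cross f p) = 0" by (cases p) (simp add: cdist_def cross_def)
     thus ?thesis by simp
    qed (intro tendsto_intros kernel_limits tseq_lim)
   qed
   show "AE p in circ2. norm (qk (tseq k) p * Im (cross f p)) \<le> \<bar>ck p * Im (cross f p)\<bar>" for k
    using qk_le_ck[of "tseq k"] tseq[of k] by (intro AE_I2) (auto simp: abs_mult intro!: mult_right_mono)
  qed (use integrable_ck_cross[OF f] in auto)
  have "(\<lambda>k. \<Sum>n. tseq k ^ n * dc f n) \<leadsto> ?U"
  proof (rule tendsto_suminf_dominated[OF _ _ sm])
   show "\<bar>tseq k ^ n * dc f n\<bar> \<le> \<bar>dc f n\<bar>" for n k
    using tseq[of k] by (auto simp: abs_mult power_le_one less_imp_le intro!: mult_left_le_one_le)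
   show "(\<lambda>k. tseq k ^ n * dc f n) \<leadsto> dc f n" for n
    using tendsto_mult[OF tendsto_power[OF tseq_lim, of n] tendsto_const[of "dc f n"]] by simp
  qed
  thus "(\<lambda>k. \<integral>p. qk (tseq k) p * Im (cross f p) \<partial>circ2) \<leadsto> ?U"
   using sq[OF tseq(2,3)] by (simp add: sums_iff)
 qed
 have iq: "integrable circ2 (\<lambda>p. qk t p * Im (cross f p))" by (rule integrable_kernel_cross[OF _ A(2)]) (use t in auto)
 have "(LINT p|circ2. nk t p * Im (cross f p)) = (LINT p|circ2. (ck p * Im (cross f p) - qk t p * Im (cross f p)) / (1 - t))"
 proof (rule B_integral_cong[OF refl])
  fix p assume "p \<in> space circ2"
  then obtain z w where p: "p = (z, w)" "cmod w = 1" by auto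
  have "nk t p = (ck p - qk t p) / (1 - t)"
   using pk_ck[of t w z] t p by (simp add: nk_def field_simps)
  thus "nk t p * Im (cross f p) = (ck p * Im (cross f p) - qk t p * Im (cross f p)) / (1 - t)"
   by (simp add: left_diff_distrib)
 qed
 also have "\<dots> = ?S / (1 - t)"
  using integrable_ck_cross[OF f] iq c1 sums_unique[OF sq[OF t]] by simp
 also have "\<dots> = (\<Sum>n. (\<Sum>j<n. t ^ j) * dc f n)"
 proof (rule sums_unique)
  have "(\<lambda>n. (dc f n - t ^ n * dc f n) / (1 - t)) sums (?S / (1 - t))"
   by (intro sums_divide sums_diff summable_sums) (use summable_rabs_cancel[OF sm] sums_summable[OF sq[OF t]] in auto)
  moreover have "(dc f n - t ^ n * dc f n) / (1 - t) = (\<Sum>j<n. t ^ j) * dc f n" for n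
  proof -
   have "(dc f n - t ^ n * dc f n) / (1 - t) = (1 - t ^ n) / (1 - t) * dc f n"
    by (simp add: left_diff_distrib diff_divide_distrib)
   thus ?thesis using geometric_quotient[of t n] t by simp
  qed
  ultimately show "(\<lambda>n. (\<Sum>j<n. t ^ j) * dc f n) sums (?S / (1 - t))" by simp
 qed
 finally show ?thesis .
qed

lemma nk_tendsto_cdeg:
 assumes f: "fin_energy f" and t: "\<And>k. 0 < t k" "\<And>k. t k < 1" "t \<leadsto> 1"
 shows "(\<lambda>k. \<integral>p. nk (t k) p * Im (cross f p) \<partial>circ2) \<leadsto> cdeg f"
proof -
 let ?S = "\<lambda>n k. \<Sum>j<n. t k ^ j"
 have "(\<lambda>k. \<Sum>n. (?S n k) * dc f n) \<leadsto> (\<Sum>n. real n * dc f n)"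
 proof (rule tendsto_suminf_dominated[OF _ _ sums_summable[OF energy_sums[OF f]]])
  fix n
  have "(\<lambda>k. (?S n k) * dc f n) \<leadsto> (\<Sum>j<n. 1 ^ j) * dc f n"
   by (intro tendsto_intros t)
  thus "(\<lambda>k. (?S n k) * dc f n) \<leadsto> real n * dc f n" by simp
  fix k
  have "(?S n k) \<le> real n" "0 \<le> (?S n k)"
   using sum_mono[of "{..<n}" "\<lambda>j. t k ^ j" "\<lambda>_. 1"] t(1,2)[of k] by (auto simp: power_le_one intro!: sum_nonneg)
  thus "\<bar>(?S n k) * dc f n\<bar> \<le> real n * ac f n"
   by (auto simp: abs_mult intro!: mult_mono dc_le_ac)
 qed
 thus ?thesis using nk_integral_sums[OF f] t by (simp add: cdeg_def)
qed

subsection \<open>Continuity and additivity of the degree\<close>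

text \<open>One factor of the distance is absorbed by \<open>pk\<close>, the other by
  \<open>ck\<close>.\<close>

lemma nk_cdist2:
 assumes "1/4 \<le> t" "t < 1" "cmod w = 1"
 shows "\<bar>nk t (z, w)\<bar> * (cdist (z, w))^2 \<le> 4"
proof (cases "cdist (z, w) = 0")
 case False
 have p: "0 \<le> pk t (z, w)" using assms by (intro pk_nonneg) auto
 have "\<bar>ck (z, w)\<bar> * cdist (z, w) \<le> 2"
  using ck_cdist[OF assms(3), of z] False order_le_less[of 0 "cdist (z, w)"] by (simp add: pos_le_divide_eq)
 hence "pk t (z, w) * cdist (z, w) * (\<bar>ck (z, w)\<bar> * cdist (z, w)) \<le> 2 * 2"
  using pk_cdist[OF assms(1,2), of "(z, w)"] p by (intro mult_mono) auto
 hence "pk t (z, w) * \<bar>ck (z, w)\<bar> * (cdist (z, w))^2 \<le> 4"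
  by (simp add: power2_eq_square mult_ac)
 moreover have "0 \<le> pk t (z, w) * \<bar>ck (z, w)\<bar> * (cdist (z, w))^2" using p by simp
 ultimately have "pk t (z, w) * \<bar>ck (z, w)\<bar> * (cdist (z, w))^2 / (1 + t) \<le> 4 / 1"
  using assms by (intro frac_le) auto
 thus ?thesis using p assms by (simp add: nk_def abs_mult)
qed simp

lemma integrable_nk_cross:
 assumes f: "fin_energy f" and t: "1/4 \<le> t" "t < 1"
 shows "integrable circ2 (\<lambda>p. nk t p * Im (cross f p))"
proof -
 note [measurable] = fin_energy_measurable[OF f]
 define K where "K = (1 + t) / (1 - t)"
 show ?thesis
 proof (rule B_integrable_bound)
  show "integrable circ2 (\<lambda>p. K * (ck p * Im (cross f p)))" using integrable_ck_cross[OF f] by simp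
  have "norm (nk t p * Im (cross f p)) \<le> norm (K * (ck p * Im (cross f p)))" for p
  proof -
   have "\<bar>pk t p / (1 + t)\<bar> \<le> K / 1"
    unfolding abs_divide using pk_le[of t p] pk_nonneg[of t p] t by (intro frac_le) (auto simp: K_def)
   hence "\<bar>pk t p / (1 + t)\<bar> * \<bar>ck p * Im (cross f p)\<bar> \<le> \<bar>K\<bar> * \<bar>ck p * Im (cross f p)\<bar>"
    by (intro mult_right_mono) auto
   thus ?thesis by (simp add: nk_def abs_mult)
  qed
  thus "AE p in circ2. norm (nk t p * Im (cross f p)) \<le> norm (K * (ck p * Im (cross f p)))" by simp
 qed measurable
qed

lemma nk_tendsto_0:
 assumes "t \<leadsto> 1" "cdist p \<noteq> 0"
 shows "(\<lambda>k. nk (t k) p) \<leadsto> 0"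
proof -
 have "(\<lambda>k. nk (t k) p) \<leadsto> 0 * ck p / (1 + 1)"
  unfolding nk_def by (intro tendsto_intros kernel_limits(1) assms) auto
 thus ?thesis by simp
qed

text \<open>With \<open>U\<close>, \<open>V\<close> the cross terms,
  \<open>Im (U V) - Im U - Im V = Im ((1 - U) (1 - V))\<close> is bounded by a product of two
  differences. Over the squared distance this is integrable, while \<open>nk\<close> tends to 0 off
  the diagonal, so the defect vanishes by dominated convergence.\<close>

lemma cdeg_mult:
 assumes f: "circ_map f" and g: "circ_map g"
 shows "cdeg (\<lambda>z. f z * g z) = cdeg f + cdeg g"
proof -
 let ?L = "\<lambda>z. f z * g z"
 let ?C = "\<lambda>z w. cmod (dquot f (z, w)) * cmod (dquot g (z, w))"
 note [measurable] = circ_map_measurable[OF f] circ_map_measurable[OF g]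
 note fg = circ_map_mult[OF f g]
 let ?R = "\<lambda>p. Im (cross f p * cross g p) - Im (cross f p) - Im (cross g p)"
 have R: "\<bar>?R (z, w)\<bar> \<le> 2 * (cmod (f z - f w) * cmod (g z - g w))" if "cmod z = 1" "cmod w = 1" for z w
 proof -
  have *: "Im (x * y) - Im x - Im y = Im ((1 - x) * (1 - y))" for x y by (simp add: algebra_simps)
  have "\<bar>?R (z, w)\<bar> \<le> cmod ((1 - cross f (z, w)) * (1 - cross g (z, w)))"
   unfolding * by (rule abs_Im_le_cmod)
  also have "\<dots> = cmod (f z - f w) * cmod (g z - g w)"
   using cmod_one_minus_cross[of f z w] cmod_one_minus_cross[of g z w] f g that by (simp add: norm_mult circ_map_norm)
  finally show ?thesis by (simp add: order_trans)
 qed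
 have N: "\<bar>nk t (z, w) * ?R (z, w)\<bar> \<le> 8 * (?C z w)"
  if "cmod z = 1" "cmod w = 1" "1/4 \<le> t" "t < 1" for z w t
 proof -
  have "\<bar>nk t (z, w) * ?R (z, w)\<bar> \<le> \<bar>nk t (z, w)\<bar> * (2 * (cmod (f z - f w) * cmod (g z - g w)))"
   unfolding abs_mult by (intro mult_left_mono R that) auto
  also have "\<dots> = (\<bar>nk t (z, w)\<bar> * (cdist (z, w))^2) * (2 * (?C z w))"
  proof -
   have ab: "cmod (f z - f w) = cdist (z, w) * cmod (dquot f (z, w))" "cmod (g z - g w) = cdist (z, w) * cmod (dquot g (z, w))"
    using cdist_dquot[of "(z, w)" f] cdist_dquot[of "(z, w)" g] by auto
   show ?thesis unfolding ab by (simp add: power2_eq_square mult_ac)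
  qed
  also have "\<dots> \<le> 4 * (2 * (?C z w))"
   by (intro mult_right_mono nk_cdist2 that) auto
  finally show ?thesis by simp
 qed
 have "(\<lambda>k. \<integral>p. nk (tseq k) p * ?R p \<partial>circ2) \<leadsto> (LINT p|circ2. 0)"
 proof (rule integral_dominated_convergence[where w = "\<lambda>p. 8 * (cmod (dquot f p) * cmod (dquot g p))"])
  show "AE p in circ2. (\<lambda>k. nk (tseq k) p * ?R p) \<leadsto> 0"
  proof (rule AE_I2)
   fix p assume "p \<in> space circ2"
   then obtain z w where p: "p = (z, w)" "cmod z = 1" "cmod w = 1" by auto
   show "(\<lambda>k. nk (tseq k) p * ?R p) \<leadsto> 0"
   proof (cases "cdist p = 0")
    case True
    hence "z = w" using p by (simp add: cdist_def)
    hence "?R p = 0" using R[of z w] p by simp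
    thus ?thesis by simp
   next
    case False
    from tendsto_mult_left_zero[OF nk_tendsto_0[OF tseq_lim this], of "?R p"] show ?thesis by simp
   qed
  qed
  show "AE p in circ2. norm (nk (tseq k) p * ?R p) \<le> 8 * (cmod (dquot f p) * cmod (dquot g p))" for k
   using N tseq[of k] by (intro AE_I2) auto
 qed (use integrable_dquot_mult[of f g] f g in auto)
 hence 1: "(\<lambda>k. \<integral>p. nk (tseq k) p * ?R p \<partial>circ2) \<leadsto> 0" by simp
 have 2: "(LINT p|circ2. nk (tseq k) p * ?R p) = (LINT p|circ2. nk (tseq k) p * Im (cross ?L p))
   - (LINT p|circ2. nk (tseq k) p * Im (cross f p)) - (LINT p|circ2. nk (tseq k) p * Im (cross g p))" for k
 proof -
  have c: "cross ?L p = cross f p * cross g p" for p by (simp add: cross_def)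
  have t: "1/4 \<le> tseq k" using tseq(1)[of k] by simp
  note i = integrable_nk_cross[OF _ t tseq(3)]
  have "(LINT p|circ2. nk (tseq k) p * ?R p) = (LINT p|circ2. nk (tseq k) p * Im (cross ?L p)
   - nk (tseq k) p * Im (cross f p) - nk (tseq k) p * Im (cross g p))"
   unfolding c by (simp only: right_diff_distrib)
  also have "\<dots> = (LINT p|circ2. nk (tseq k) p * Im (cross ?L p))
   - (LINT p|circ2. nk (tseq k) p * Im (cross f p)) - (LINT p|circ2. nk (tseq k) p * Im (cross g p))"
   by (simp only: B_integral_diff B_integrable_diff i circ_map_fin_energy f g fg)
  finally show ?thesis .
 qed
 have "(\<lambda>k. \<integral>p. nk (tseq k) p * ?R p \<partial>circ2) \<leadsto> cdeg ?L - cdeg f - cdeg g"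
  unfolding 2 by (intro tendsto_diff nk_tendsto_cdeg tseq_lim tseq circ_map_fin_energy f g fg)
 from LIMSEQ_unique[OF 1 this] show ?thesis by simp
qed

lemma fp_diff:
 assumes "fin_energy f" "fin_energy g"
 shows "fp (\<lambda>z. f z - g z) n = fp f n - fp g n" "fm (\<lambda>z. f z - g z) n = fm f n - fm g n"
proof -
 have i: "integrable circ (\<lambda>z. h z * e z ^ n)" if h: "fin_energy h" and e: "e = cnj \<or> e = (\<lambda>z. z)" for h e
 proof -
  note [measurable] = fin_energy_measurable[OF h]
  obtain A where A: "A \<ge> 0" "\<And>z. cmod z = 1 ==> cmod (h z) \<le> A" by (rule fin_energy_bound[OF h]) (rule that)
  show ?thesis by (rule circ_integrable_bounded[where B = A]) (use e A in \<open>auto simp: norm_mult norm_power\<close>)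
 qed
 show "fp (\<lambda>z. f z - g z) n = fp f n - fp g n" "fm (\<lambda>z. f z - g z) n = fm f n - fm g n"
  unfolding fp_def fm_def left_diff_distrib
  using i[OF assms(1), of cnj] i[OF assms(2), of cnj] i[OF assms(1), of "\<lambda>z. z"] i[OF assms(2), of "\<lambda>z. z"]
  by (auto intro!: B_integral_diff)
qed

lemma cmod_add_sq_eps:
 fixes u v :: complex
 assumes "e > 0"
 shows "(cmod u)^2 \<le> (1 + e) * (cmod v)^2 + (1 + 1/e) * (cmod (u - v))^2"
proof -
 have "cmod u \<le> cmod v + cmod (u - v)" using norm_triangle_ineq[of v "u - v"] by simp
 hence "(cmod u)^2 \<le> (cmod v + cmod (u - v))^2" by (intro power_mono) auto
 also have "\<dots> = (cmod v)^2 + (cmod (u - v))^2 + 2 * cmod v * cmod (u - v)"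
  by (simp add: power2_sum)
 also have "2 * cmod v * cmod (u - v) \<le> e * (cmod v)^2 + (1 / e) * (cmod (u - v))^2"
  using sum_squares_bound[of "sqrt e * cmod v" "sqrt (1/e) * cmod (u - v)"] assms
  by (simp add: power_mult_distrib real_sqrt_divide power_divide mult.assoc)
 finally show ?thesis by (simp add: algebra_simps)
qed

text \<open>Young's inequality with a parameter, applied to \<open>fp\<close> in one direction and
  to \<open>fm\<close> in the other, as they enter the degree with opposite signs. For bounded
  energies the first term is made small by the choice of \<open>e\<close>, and then the second by
  convergence.\<close>

lemma cdeg_diff_le:
 assumes f: "fin_energy f" and g: "fin_energy g" and e: "e > 0"
 shows "cdeg f - cdeg g \<le> e * (cenergy f + cenergy g) + (1 + 1/e) * cenergy (\<lambda>z. f z - g z)"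
proof -
 let ?L = "\<lambda>z. f z - g z"
 note fg = fin_energy_diff(1)[OF f g]
 have *: "dc f n - dc g n \<le> e * (ac f n + ac g n) + (1 + 1/e) * ac ?L n" if "n > 0" for n
 proof -
  have 1: "(cmod (fp f n))^2 \<le> (1 + e) * (cmod (fp g n))^2 + (1 + 1/e) * (cmod (fp ?L n))^2"
   unfolding fp_diff[OF f g] by (rule cmod_add_sq_eps[OF e])
  have 2: "(cmod (fm g n))^2 \<le> (1 + e) * (cmod (fm f n))^2 + (1 + 1/e) * (cmod (fm ?L n))^2"
   unfolding fp_diff[OF f g] norm_minus_commute[of "fm f n"] by (rule cmod_add_sq_eps[OF e])
  have "0 \<le> e * (cmod (fp f n))^2" "0 \<le> e * (cmod (fm g n))^2" using e by auto
  with 1 2 show ?thesis using that by (simp add: dc_def ac_def algebra_simps)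
 qed
 show ?thesis
 proof (rule sums_le)
  show "(\<lambda>n. real n * dc f n - real n * dc g n) sums (cdeg f - cdeg g)"
   unfolding cdeg_def by (intro sums_diff summable_sums cdeg_summable f g)
  show "(\<lambda>n. e * (real n * ac f n + real n * ac g n) + (1 + 1/e) * (real n * ac ?L n)) sums
    (e * (cenergy f + cenergy g) + (1 + 1/e) * cenergy ?L)"
   by (intro sums_add sums_mult energy_sums f g fg)
  fix n
  show "real n * dc f n - real n * dc g n \<le> e * (real n * ac f n + real n * ac g n) + (1 + 1/e) * (real n * ac ?L n)"
  proof (cases "n = 0")
   case False
   have "real n * (dc f n - dc g n) \<le> real n * (e * (ac f n + ac g n) + (1 + 1/e) * ac ?L n)"
    using False by (intro mult_left_mono *) auto
   thus ?thesis by (simp add: algebra_simps)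
  qed simp
 qed
qed

lemma cenergy_diff_commute: "cenergy (\<lambda>z. f z - g z) = cenergy (\<lambda>z. g z - f z)"
 unfolding cenergy_def dquot_diff by (simp add: norm_minus_commute)

lemma cdeg_tendsto:
 assumes f: "\<And>n. fin_energy (f n)" and g: "fin_energy g"
  and lim: "(\<lambda>n. cenergy (\<lambda>z. f n z - g z)) \<leadsto> 0"
 shows "(\<lambda>n. cdeg (f n)) \<leadsto> cdeg g"
proof (rule LIMSEQ_I)
 fix e :: real assume e: "e > 0"
 \<comment> \<open>\<open>C - 1\<close> bounds the sum of the two energies once the difference has
   energy below 1; the final \<open>+ 1\<close> leaves room for a strict inequality.\<close>
 define C where "C = 3 * cenergy g + 2 + 1"
 have C: "C > 0" unfolding C_def using cenergy_nonneg[of g] by linarith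
 define d where "d = e / (2 * C)"
 have d: "d > 0" using e C by (simp add: d_def)
 have "eventually (\<lambda>n. cenergy (\<lambda>z. f n z - g z) < min 1 (e / (2 * (1 + 1/d)))) sequentially"
  using d e by (intro order_tendstoD[OF lim]) (auto simp: add_pos_pos)
 then obtain N where N: "\<And>n. n \<ge> N ==> cenergy (\<lambda>z. f n z - g z) < min 1 (e / (2 * (1 + 1/d)))"
  by (auto simp: eventually_sequentially)
 show "\<exists>N. \<forall>n\<ge>N. norm (cdeg (f n) - cdeg g) < e"
 proof (intro exI allI impI)
  fix n assume n: "n \<ge> N"
  let ?D = "cenergy (\<lambda>z. f n z - g z)"
  have D: "?D < 1" "?D < e / (2 * (1 + 1/d))" using N[OF n] by auto
  have "cenergy (f n) \<le> 2 * ?D + 2 * cenergy g"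
   using fin_energy_add(2)[OF fin_energy_diff(1)[OF f g] g, of n] by simp
  hence "cenergy (f n) + cenergy g \<le> C - 1" using D by (simp add: C_def)
  hence "d * (cenergy (f n) + cenergy g) \<le> d * (C - 1)" using d by (intro mult_left_mono) auto
  also have "\<dots> < d * C" using d by simp
  also have "d * C = e / 2" using C by (simp add: d_def)
  finally have 1: "d * (cenergy (f n) + cenergy g) < e / 2" .
  have "1 + 1/d > 0" using d by (simp add: add_pos_pos)
  hence 2: "(1 + 1/d) * ?D < e / 2" using D(2) by (simp add: field_simps)
  have "cdeg (f n) - cdeg g < e"
   using cdeg_diff_le[OF f g d, of n] 1 2 by linarith
  moreover have "cdeg g - cdeg (f n) < e"
   using cdeg_diff_le[OF g f d, of n] 1 2
   unfolding cenergy_diff_commute[of g] add.commute[of "cenergy g"] by linarith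
  ultimately show "norm (cdeg (f n) - cdeg g) < e" by simp
 qed
qed

section \<open>Continuously differentiable maps and the integral formula for their degree\<close>

text \<open>\<open>F'\<close> is the derivative with respect to the angle, but as a function of the
  point, so that its periodicity is built in.\<close>

definition circ_C1 :: "(complex => complex) => (complex => complex) => bool" where
 "circ_C1 F F' \<longleftrightarrow> (\<forall>\<theta>. ((\<lambda>\<theta>. F (cis \<theta>)) has_vector_derivative F' (cis \<theta>)) (at \<theta>)) \<and>
   continuous_on UNIV (\<lambda>\<theta>. F' (cis \<theta>))"

lemma cis_Im_Ln: "cmod z = 1 ==> cis (Im (Ln z)) = z"
 using exp_Ln[of z] by (cases "z = 0") (auto simp: exp_eq_polar Re_Ln)

lemma circ_measurable_of_cis:
 assumes "continuous_on UNIV (\<lambda>\<theta>. F (cis \<theta>))"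
 shows "F \<in> borel_measurable circ"
proof -
 let ?L = "\<lambda>z. F (cis (Im (Ln z)))"
 have [measurable]: "(\<lambda>\<theta>. F (cis \<theta>)) \<in> borel_measurable borel"
  using assms by (rule borel_measurable_continuous_onI)
 have "(\<lambda>z. Im (Ln z)) \<in> borel_measurable borel" by measurable
 from measurable_compose[OF measurable_compose[OF circ_borel this], of "\<lambda>\<theta>. F (cis \<theta>)"]
 have "?L \<in> borel_measurable circ" by simp
 moreover have "?L \<in> borel_measurable circ \<longleftrightarrow> F \<in> borel_measurable circ"
 proof (rule measurable_cong)
  fix z assume "z \<in> space circ"
  hence "cmod z = 1" by simp
  thus "F (cis (Im (Ln z))) = F z" by (simp only: cis_Im_Ln)
 qed
 ultimately show ?thesis by (rule iffD1[rotated])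
qed

lemma circ_bounded_of_cis:
 assumes "continuous_on UNIV (\<lambda>\<theta>. F (cis \<theta>))"
 obtains B where "B \<ge> 0" "\<And>z. cmod z = 1 ==> cmod (F z) \<le> B"
proof -
 let ?L = "\<lambda>\<theta>. F (cis \<theta>)"
 have "compact (?L ` {-pi..pi})"
  using assms by (intro compact_continuous_image continuous_on_subset[OF assms]) auto
 from compact_imp_bounded[OF this] obtain B where "\<forall>x\<in>?L ` {-pi..pi}. cmod x \<le> B"
  unfolding bounded_iff by (elim exE)
 hence B: "\<And>\<theta>. \<theta> \<in> {-pi..pi} ==> cmod (F (cis \<theta>)) \<le> B" by auto
 show ?thesis
 proof (rule that[of "max B 0"])
  fix z :: complex assume z: "cmod z = 1"
  hence "Im (Ln z) \<in> {-pi..pi}" using Im_Ln_le_pi[of z] mpi_less_Im_Ln[of z] by (cases "z = 0") auto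
  from B[OF this] show "cmod (F z) \<le> max B 0" using cis_Im_Ln[OF z] by simp
 qed simp
qed

lemma sin_ge_half:
 assumes "0 \<le> x" "x \<le> pi / 2" shows "sin x \<ge> x / 2"
proof (cases "x \<le> pi / 3")
 case True
 have "(\<lambda>x. sin x - x / 2) 0 \<le> (\<lambda>x. sin x - x / 2) x"
 proof (rule DERIV_nonneg_imp_nondecreasing[OF assms(1)])
  fix y assume "0 \<le> y" "y \<le> x"
  hence "cos y \<ge> cos (pi / 3)" using True by (intro cos_monotone_0_pi_le) auto
  hence "cos y - 1/2 \<ge> 0" by (simp add: cos_60)
  moreover have "((\<lambda>x. sin x - x / 2) has_real_derivative cos y - 1/2) (at y)"
   by (auto intro!: derivative_eq_intros)
  ultimately show "\<exists>z. ((\<lambda>x. sin x - x / 2) has_real_derivative z) (at y) \<and> 0 \<le> z" by blast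
 qed
 thus ?thesis by simp
next
 case False
 hence "sin (pi / 3) \<le> sin x" using assms by (intro sin_monotone_2pi_le) auto
 moreover have "sqrt 3 \<ge> 8/5" by (rule real_le_rsqrt) (simp add: power2_eq_square)
 ultimately have "sin x \<ge> 4/5" by (simp add: sin_60)
 moreover have "x / 2 \<le> 4/5" using assms pi_less_4 pi_approx by simp
 ultimately show ?thesis by simp
qed

lemma cmod_cis_minus_1: "\<bar>r\<bar> \<le> pi ==> \<bar>r\<bar> \<le> 2 * cmod (cis r - 1)"
proof -
 let ?B = "\<bar>r\<bar> / 2"
 let ?C = "cmod (cis r - 1)"
 assume r: "\<bar>r\<bar> \<le> pi"
 have "?C^2 = (2 * sin ?B)^2"
 proof -
  have "cos \<bar>r\<bar> = 1 - 2 * (sin ?B)^2" using cos_double_sin[of "\<bar>r\<bar> / 2"] by simp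
  moreover have "?C^2 = 2 - 2 * cos r"
  proof -
   have "?C^2 = (cos r - 1)^2 + (sin r)^2" by (simp add: cmod_power2)
   thus ?thesis using sin_cos_squared_add[of r] by (simp add: power2_diff)
  qed
  ultimately show ?thesis by (simp add: power_mult_distrib)
 qed
 note sq = this
 have s: "sin ?B \<ge> \<bar>r\<bar> / 2 / 2" using r by (intro sin_ge_half) auto
 have "0 \<le> 2 * sin ?B" using s abs_ge_zero[of r] by linarith
 with sq have "cmod (cis r - 1) = 2 * sin ?B" by (rule power2_eq_imp_eq[OF _ norm_ge_zero])
 thus ?thesis using s by linarith
qed

text \<open>A bounded derivative gives a Lipschitz bound in the angle; the angle between two points,
  chosen in \<open>[-pi, pi]\<close>, is at most twice the chord.\<close>

lemma circ_C1_lipschitz: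
 assumes "circ_C1 F F'"
 obtains L where "L \<ge> 0" "\<And>z w. cmod z = 1 ==> cmod w = 1 ==> cmod (F z - F w) \<le> L * cmod (z - w)"
proof -
 let ?L = "\<lambda>\<theta>. F (cis \<theta>)"
 have d: "(?L has_vector_derivative F' (cis \<theta>)) (at \<theta>)" for \<theta>
  using assms by (simp add: circ_C1_def)
 have c: "continuous_on UNIV (\<lambda>\<theta>. F' (cis \<theta>))" using assms by (simp add: circ_C1_def)
 obtain B where B: "B \<ge> 0" "\<And>z. cmod z = 1 ==> cmod (F' z) \<le> B" by (rule circ_bounded_of_cis[OF c]) (rule that)
 have lip: "cmod (F (cis s) - F (cis t)) \<le> B * \<bar>s - t\<bar>" for s t
 proof -
  have "norm (?L s - ?L t) \<le> B * norm (s - t)"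
  proof (rule differentiable_bound[where S = UNIV and f' = "\<lambda>\<theta> h. h *\<^sub>R F' (cis \<theta>)"])
   show "(?L has_derivative (\<lambda>h. h *\<^sub>R F' (cis x))) (at x within UNIV)" for x
    using d[of x] by (simp add: has_vector_derivative_def)
   show "onorm (\<lambda>h. h *\<^sub>R F' (cis x)) \<le> B" for x
   proof (rule onorm_le)
    fix h :: real
    have "\<bar>h\<bar> * cmod (F' (cis x)) \<le> \<bar>h\<bar> * B" using B by (intro mult_left_mono) auto
    thus "norm (h *\<^sub>R F' (cis x)) \<le> B * norm h" by (simp add: mult.commute)
   qed
  qed auto
  thus ?thesis by simp
 qed
 show ?thesis
 proof (rule that[of "2 * B"])
  fix z w :: complex assume z: "cmod z = 1" "cmod w = 1"
  define r where "r = Im (Ln (w / z))"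
  define a where "a = Im (Ln z)"
  have nz: "cmod (w / z) = 1" using z by (simp add: norm_divide)
  hence r: "\<bar>r\<bar> \<le> pi" using Im_Ln_le_pi[of "w / z"] mpi_less_Im_Ln[of "w / z"] unfolding r_def
   by (cases "w / z = 0") auto
  have cr: "cis r = w / z" "cis a = z" using cis_Im_Ln[OF nz] cis_Im_Ln[OF z(1)] by (auto simp: r_def a_def)
  hence w: "cis (a + r) = w" using z by (auto simp: cis_mult[symmetric])
  have "cmod (F z - F w) \<le> B * \<bar>a - (a + r)\<bar>" using lip[of a "a + r"] w cr by simp
  also have "\<dots> \<le> B * (2 * cmod (cis r - 1))" using cmod_cis_minus_1[OF r] B by (intro mult_left_mono) auto
  also have "cmod (cis r - 1) = cmod (z - w)"
  proof -
   have "cis r - 1 = (w - z) / z" using z cr by (auto simp: field_simps)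
   thus ?thesis using z by (simp add: norm_divide norm_minus_commute)
  qed
  finally show "cmod (F z - F w) \<le> 2 * B * cmod (z - w)" by simp
 qed (use B in auto)
qed

lemma circ_C1_continuous:
 assumes "circ_C1 F F'"
 shows "continuous_on UNIV (\<lambda>\<theta>. F (cis \<theta>))" "continuous_on UNIV (\<lambda>\<theta>. F' (cis \<theta>))"
 using assms by (auto simp: circ_C1_def continuous_on_eq_continuous_at intro: has_vector_derivative_continuous)

lemma circ_C1_fin_energy: "circ_C1 F F' ==> fin_energy F"
 by (metis circ_C1_lipschitz circ_C1_continuous(1) circ_measurable_of_cis fin_energy_lipschitz(1))

lemma integral_circ_continuous:
 fixes F :: "complex => complex"
 assumes "continuous_on UNIV (\<lambda>\<theta>. F (cis \<theta>))"
 shows "integral\<^sup>L circ F = integral {0..2*pi} (\<lambda>\<theta>. F (cis \<theta>)) / (2 * pi)"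
proof -
 have "set_integrable lborel {0..2*pi} (\<lambda>\<theta>. F (cis \<theta>))"
  unfolding set_integrable_def by (rule borel_integrable_compact) (auto intro: continuous_on_subset[OF assms])
 from set_borel_integral_eq_integral(2)[OF this] show ?thesis
  by (subst integral_circ[OF circ_measurable_of_cis[OF assms]]) (simp add: scaleR_conv_of_real)
qed

lemma integral_circ_derivative:
 assumes "circ_C1 F F'"
 shows "integral\<^sup>L circ F' = 0"
proof -
 let ?L = "\<lambda>\<theta>. F' (cis \<theta>)"
 have "(?L has_integral (F (cis (2*pi)) - F (cis 0))) {0..2*pi}"
  using assms by (intro fundamental_theorem_of_calculus) (auto simp: circ_C1_def intro: has_vector_derivative_at_within)
 hence "integral {0..2*pi} ?L = 0" by (auto dest: integral_unique)
 thus ?thesis by (simp add: integral_circ_continuous[OF circ_C1_continuous(2)[OF assms]])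
qed

lemma circ_C1_mult:
 assumes "circ_C1 F F'" "circ_C1 G G'"
 shows "circ_C1 (\<lambda>z. F z * G z) (\<lambda>z. F z * G' z + F' z * G z)"
proof -
 have "((\<lambda>\<theta>. F (cis \<theta>) * G (cis \<theta>)) has_vector_derivative F (cis \<theta>) * G' (cis \<theta>) + F' (cis \<theta>) * G (cis \<theta>)) (at \<theta>)" for \<theta>
  using assms by (intro has_vector_derivative_mult) (auto simp: circ_C1_def)
 moreover have "continuous_on UNIV (\<lambda>\<theta>. F (cis \<theta>) * G' (cis \<theta>) + F' (cis \<theta>) * G (cis \<theta>))"
  using circ_C1_continuous[OF assms(1)] circ_C1_continuous[OF assms(2)] by (intro continuous_intros)
 ultimately show ?thesis by (simp add: circ_C1_def)
qed

lemma circ_C1_add: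
 assumes "circ_C1 F F'" "circ_C1 G G'"
 shows "circ_C1 (\<lambda>z. F z + G z) (\<lambda>z. F' z + G' z)"
 using assms by (auto simp: circ_C1_def intro!: has_vector_derivative_add continuous_intros)

lemma circ_C1_cnj:
 assumes "circ_C1 F F'"
 shows "circ_C1 (\<lambda>z. cnj (F z)) (\<lambda>z. cnj (F' z))"
 using assms by (auto simp: circ_C1_def intro!: has_vector_derivative_cnj continuous_intros)

lemma circ_C1_const: "circ_C1 (\<lambda>z. c) (\<lambda>z. 0)"
 by (auto simp: circ_C1_def intro!: has_vector_derivative_const)

lemma circ_C1_id: "circ_C1 (\<lambda>z. z) (\<lambda>z. \<i> * z)"
proof -
 have "(cis has_vector_derivative \<i> * cis \<theta>) (at \<theta>)" for \<theta>
  using has_derivative_cis[OF has_derivative_ident, of \<theta> UNIV] by (simp add: has_vector_derivative_def)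
 thus ?thesis by (auto simp: circ_C1_def intro!: continuous_intros)
qed

lemma circ_C1_power: "circ_C1 (\<lambda>z. z ^ n) (\<lambda>z. \<i> * of_nat n * z ^ n)"
proof (induction n)
 case 0
 show ?case using circ_C1_const[of 1] by simp
next
 case (Suc n)
 from circ_C1_mult[OF circ_C1_id Suc] show ?case by (simp add: algebra_simps)
qed

lemma circ_C1_fourier:
 assumes "circ_C1 F F'"
 shows "fm F' n = - \<i> * of_nat n * fm F n" "fp F' n = \<i> * of_nat n * fp F n"
proof -
 let ?L = "LINT z|circ. F z * cnj (\<i> * of_nat n * z ^ n) + F' z * cnj (z ^ n)"
 let ?I = "LINT z|circ. F z * (\<i> * of_nat n * z ^ n) + F' z * z ^ n"
 have i: "integrable circ (\<lambda>z. G z)" if c: "continuous_on UNIV (\<lambda>\<theta>. G (cis \<theta>))" for G :: "complex => complex"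
  by (rule circ_bounded_of_cis[OF c], rule circ_integrable_bounded[OF circ_measurable_of_cis[OF c]])
 note c = circ_C1_continuous[OF assms]
 have "?I = 0"
  by (rule integral_circ_derivative[OF circ_C1_mult[OF assms circ_C1_power]])
 moreover have "?I = \<i> * of_nat n * fm F n + fm F' n"
 proof -
  have "?I = (LINT z|circ. \<i> * of_nat n * (F z * z ^ n) + F' z * z ^ n)"
   by (simp add: mult_ac)
  also have "\<dots> = \<i> * of_nat n * fm F n + fm F' n"
   unfolding fm_def by (subst B_integral_add) (auto intro!: i continuous_intros c simp del: mult_eq_0_iff)
  finally show ?thesis .
 qed
 ultimately show "fm F' n = - \<i> * of_nat n * fm F n" by (simp add: eq_neg_iff_add_eq_0 add.commute)
 have "?L = 0"
  by (rule integral_circ_derivative[OF circ_C1_mult[OF assms circ_C1_cnj[OF circ_C1_power]]])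
 moreover have "?L = - \<i> * of_nat n * fp F n + fp F' n"
 proof -
  have "?L = (LINT z|circ. - \<i> * of_nat n * (F z * cnj z ^ n) + F' z * cnj z ^ n)"
   by (simp add: mult_ac)
  also have "\<dots> = - \<i> * of_nat n * fp F n + fp F' n"
   unfolding fp_def by (subst B_integral_add) (auto intro!: i continuous_intros c simp del: mult_eq_0_iff)
  finally show ?thesis .
 qed
 ultimately show "fp F' n = \<i> * of_nat n * fp F n" by (simp add: add_eq_0_iff)
qed

subsection \<open>Smooth maps and Moebius bubbles\<close>

lemma circ_C1_bounded:
 assumes "circ_C1 F F'"
 obtains B where "B \<ge> 0" "\<And>z. cmod z = 1 ==> cmod (F z) \<le> B" "\<And>z. cmod z = 1 ==> cmod (F' z) \<le> B"
proof -
 note c = circ_C1_continuous[OF assms]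
 obtain A where A: "A \<ge> 0" "\<And>z. cmod z = 1 ==> cmod (F z) \<le> A" by (rule circ_bounded_of_cis[OF c(1)]) (rule that)
 obtain B where B: "B \<ge> 0" "\<And>z. cmod z = 1 ==> cmod (F' z) \<le> B" by (rule circ_bounded_of_cis[OF c(2)]) (rule that)
 show ?thesis by (rule that[of "max A B"]) (use A B in \<open>auto simp: le_max_iff_disj\<close>)
qed

lemma circ_C1_poisson:
 assumes F: "circ_C1 F F'" and t: "0 \<le> t" "t < 1"
 shows "(\<lambda>n. of_real t ^ n * (\<i> * of_real (real n * dc F n))) sums
  (LINT p|circ2. of_real (pk t p) * (F' (fst p) * cnj (F (snd p))))"
proof -
 note c = circ_C1_continuous[OF F]
 note [measurable] = circ_measurable_of_cis[OF c(1)] circ_measurable_of_cis[OF c(2)]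
 obtain B where B: "B \<ge> 0" "\<And>z. cmod z = 1 ==> cmod (F z) \<le> B" "\<And>z. cmod z = 1 ==> cmod (F' z) \<le> B"
  by (rule circ_C1_bounded[OF F]) (rule that)
 have "fp F' n * cnj (fp F n) + fm F' n * cnj (fm F n) = \<i> * of_real (real n * dc F n)" for n
  unfolding circ_C1_fourier[OF F] dc_def of_real_mult of_real_diff complex_norm_square by (simp add: algebra_simps)
 thus ?thesis using kernel_sums(1)[of F' F B B t] B t circ_C1_fourier(1)[OF F, of 0] by simp
qed

text \<open>Both sides are limits of the Poisson means of \<open>F' z * cnj (F w)\<close>. The
  Fourier coefficients give the degree; and replacing \<open>F w\<close> by \<open>F z\<close> is
  controlled by \<open>2 * B * cmod (dquot F p)\<close>, since \<open>pk\<close> times the distance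
  is at most 2, so the difference disappears by dominated convergence.\<close>

lemma circ_C1_cdeg:
 assumes F: "circ_C1 F F'"
 shows "(LINT z|circ. F' z * cnj (F z)) = \<i> * of_real (cdeg F)"
proof -
 let ?F = "\<lambda>p. F' (fst p) * (cnj (F (snd p)) - cnj (F (fst p)))"
 let ?L = "LINT z|circ. F' z * cnj (F z)"
 let ?R = "\<lambda>n. real n * dc F n"
 let ?A = "\<lambda>p. \<lambda>k. of_real (pk (tseq k) p) * (?F p)"
 let ?S = "\<lambda>p. F' (fst p) * cnj (F (snd p))"
 note c = circ_C1_continuous[OF F]
 note [measurable] = circ_measurable_of_cis[OF c(1)] circ_measurable_of_cis[OF c(2)]
 note fe = circ_C1_fin_energy[OF F]
 obtain B where B: "B \<ge> 0" "\<And>z. cmod z = 1 ==> cmod (F z) \<le> B" "\<And>z. cmod z = 1 ==> cmod (F' z) \<le> B"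
  by (rule circ_C1_bounded[OF F]) (rule that)
 define J where "J k = (LINT p|circ2. of_real (pk (tseq k) p) * (?S p))" for k
 have t: "0 \<le> tseq k" "tseq k < 1" "1/4 \<le> tseq k" for k using tseq[of k] by auto
 have 1: "J \<leadsto> \<i> * of_real (cdeg F)"
 proof -
  have le: "\<bar>tseq k ^ n * (?R n)\<bar> \<le> real n * ac F n" for n k
   unfolding abs_mult using t[of k] order_trans[OF mult_left_le_one_le mult_left_mono[OF dc_le_ac]] by (simp add: power_le_one)
  note sm = sums_summable[OF energy_sums[OF fe]]
  have "(\<lambda>k. \<Sum>n. tseq k ^ n * (?R n)) \<leadsto> cdeg F"
   unfolding cdeg_def
  proof (rule tendsto_suminf_dominated[OF _ le sm])
   show "(\<lambda>k. tseq k ^ n * (?R n)) \<leadsto> real n * dc F n" for n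
    using tendsto_mult[OF tendsto_power[OF tseq_lim, of n] tendsto_const[of "real n * dc F n"]] by simp
  qed
  moreover have "J k = \<i> * of_real (\<Sum>n. tseq k ^ n * (?R n))" for k
  proof -
   have "summable (\<lambda>n. tseq k ^ n * (?R n))"
    by (rule summable_comparison_test[OF _ sm]) (use le in auto)
   hence "(\<lambda>n. \<i> * of_real (tseq k ^ n * (?R n))) sums (\<i> * of_real (\<Sum>n. tseq k ^ n * (?R n)))"
    by (intro sums_mult sums_of_real summable_sums)
   moreover have "(\<lambda>n. \<i> * of_real (tseq k ^ n * (?R n))) sums J k"
    using circ_C1_poisson[OF F t(1,2)[of k]] by (simp add: J_def mult_ac)
   ultimately show ?thesis by (rule sums_unique2[symmetric])
  qed
  ultimately have "J = (\<lambda>k. \<i> * of_real (\<Sum>n. tseq k ^ n * (?R n)))"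
   "(\<lambda>k. \<Sum>n. tseq k ^ n * (?R n)) \<leadsto> cdeg F" by auto
  thus ?thesis by (simp only:) (intro tendsto_intros)
 qed
 have "(\<lambda>k. J k - ?L) \<leadsto> 0"
 proof -
  have bd: "cmod (of_real (pk (tseq k) (z, w)) * (F' z * (cnj (F w) - cnj (F z)))) \<le> 2 * B * cmod (dquot F (z, w))"
   if "cmod z = 1" "cmod w = 1" for k z w
  proof -
   have "cmod (of_real (pk (tseq k) (z, w)) * (F' z * (cnj (F w) - cnj (F z)))) = pk (tseq k) (z, w) * (cmod (F' z) * cmod (F z - F w))"
    using pk_nonneg[OF t(1,2)[of k], of "(z, w)"]
    unfolding norm_mult complex_cnj_diff[symmetric] complex_mod_cnj by (simp add: norm_minus_commute)
   also have "cmod (F z - F w) = cdist (z, w) * cmod (dquot F (z, w))" by (simp add: cdist_dquot)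
   also have "pk (tseq k) (z, w) * (cmod (F' z) * (cdist (z, w) * cmod (dquot F (z, w)))) =
    (pk (tseq k) (z, w) * cdist (z, w)) * (cmod (F' z) * cmod (dquot F (z, w)))" by simp
   also have "\<dots> \<le> 2 * (B * cmod (dquot F (z, w)))"
    using pk_cdist[OF t(3,2)[of k], of "(z, w)"] B that by (intro mult_mono) auto
   finally show ?thesis by simp
  qed
  have "(\<lambda>k. \<integral>p. of_real (pk (tseq k) p) * (?F p) \<partial>circ2) \<leadsto> (LINT p|circ2. 0)"
  proof (rule integral_dominated_convergence[where w = "\<lambda>p. 2 * B * cmod (dquot F p)"])
   show "AE p in circ2. (?A p) \<leadsto> 0"
   proof (rule AE_I2)
    fix p :: "complex \<times> complex"
    show "(?A p) \<leadsto> 0"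
    proof (cases "cdist p = 0")
     case False
     have "(?A p) \<leadsto> of_real 0 * (?F p)"
      by (intro tendsto_intros kernel_limits(1) tseq_lim False)
     thus ?thesis by simp
    qed (simp add: cdist_def)
   qed
  qed (use bd integrable_dquot[OF fe] in auto)
  moreover have "(LINT p|circ2. of_real (pk (tseq k) p) * (?F p)) = J k - ?L" for k
  proof -
   have b2: "cmod (F' z * cnj (F z)) \<le> B * B" if "cmod z = 1" for z
    using B that by (auto simp: norm_mult intro!: mult_mono)
   have m: "(\<lambda>z. F' z * cnj (F z)) \<in> borel_measurable circ" by measurable
   have mm: "integrable circ2 (\<lambda>p. of_real (pk (tseq k) p) * (F' (fst p) * cnj (F (fst p))))"
    "(LINT p|circ2. of_real (pk (tseq k) p) * (F' (fst p) * cnj (F (fst p)))) = ?L"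
    using integral_pk_marginal(1,2)[OF m b2 t(1,2)[of k]] by (simp_all add: scaleR_conv_of_real)
   have "integrable circ2 (\<lambda>p. pk (tseq k) p *\<^sub>R (?S p))"
    by (rule integrable_kernel_scaleR[where B = "B * B"]) (use t B in \<open>auto simp: norm_mult intro!: mult_mono\<close>)
   hence i: "integrable circ2 (\<lambda>p. of_real (pk (tseq k) p) * (?S p))"
    by (simp only: scaleR_conv_of_real)
   show ?thesis unfolding right_diff_distrib J_def using mm(2) by (subst B_integral_diff[OF i mm(1)]) simp
  qed
  ultimately show ?thesis by simp
 qed
 hence 2: "J \<leadsto> ?L" by (rule LIM_zero_cancel)
 show ?thesis by (rule LIMSEQ_unique[OF 2 1])
qed

text \<open>For modulus 1 the product of \<open>F\<close> with the exponential of minus the integral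
  of \<open>F' * cnj F\<close> has derivative 0. Over one full turn that integral is therefore a
  multiple of \<open>2 pi \<i>\<close>.\<close>

lemma circ_C1_cdeg_int:
 assumes F: "circ_C1 F F'" and u: "\<And>z. cmod z = 1 ==> cmod (F z) = 1"
 shows "\<exists>m::int. cdeg F = of_int m"
proof -
 note c = circ_C1_continuous[OF F]
 define h where "h \<theta> = F' (cis \<theta>) * cnj (F (cis \<theta>))" for \<theta>
 have ch: "continuous_on UNIV h" unfolding h_def by (intro continuous_intros c)
 define J where "J \<theta> = integral {0..\<theta>} h" for \<theta>
 have hd: "((\<lambda>\<theta>. F (cis \<theta>) * exp (- J \<theta>)) has_vector_derivative 0) (at \<theta> within {0..2*pi})" if "\<theta> \<in> {0..2*pi}" for \<theta>
 proof -
  have 1: "(J has_vector_derivative h \<theta>) (at \<theta> within {0..2*pi})"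
   unfolding J_def by (rule integral_has_vector_derivative[OF continuous_on_subset[OF ch] that]) auto
  hence 2: "((\<lambda>\<theta>. - J \<theta>) has_vector_derivative - h \<theta>) (at \<theta> within {0..2*pi})" by (rule has_vector_derivative_minus)
  have 3: "(exp \<circ> (\<lambda>\<theta>. - J \<theta>) has_vector_derivative (- h \<theta> * exp (- J \<theta>))) (at \<theta> within {0..2*pi})"
   by (rule field_vector_diff_chain_within[OF 2]) (auto intro!: derivative_eq_intros)
  have 4: "((\<lambda>\<theta>. F (cis \<theta>)) has_vector_derivative F' (cis \<theta>)) (at \<theta> within {0..2*pi})"
   using F by (auto simp: circ_C1_def intro: has_vector_derivative_at_within)
  have "((\<lambda>\<theta>. F (cis \<theta>) * exp (- J \<theta>)) has_vector_derivative (F (cis \<theta>) * (- h \<theta> * exp (- J \<theta>)) + F' (cis \<theta>) * exp (- J \<theta>))) (at \<theta> within {0..2*pi})"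
   using has_vector_derivative_mult[OF 4 3] by (simp add: o_def)
  moreover have "F (cis \<theta>) * cnj (F (cis \<theta>)) = 1" using u[of "cis \<theta>"] complex_norm_square[of "F (cis \<theta>)"] by simp
  hence "F (cis \<theta>) * (- h \<theta> * exp (- J \<theta>)) + F' (cis \<theta>) * exp (- J \<theta>) = 0"
   unfolding h_def by (simp add: algebra_simps) (simp only: mult.assoc[symmetric], simp add: mult_ac)?
  ultimately show ?thesis by simp
 qed
 obtain C where C: "\<And>\<theta>. \<theta> \<in> {0..2*pi} ==> F (cis \<theta>) * exp (- J \<theta>) = C"
  by (rule has_vector_derivative_zero_constant[OF convex_real_interval(5) hd]) auto
 have "F 1 * exp (- J (2 * pi)) = F 1 * exp (- J 0)" using C[of 0] C[of "2*pi"] by simp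
 moreover have "J 0 = 0" by (simp add: J_def)
 moreover have "F 1 \<noteq> 0" using u[of 1] by auto
 ultimately have "exp (- J (2 * pi)) = 1" by simp
 then obtain m :: int where m: "Im (- J (2 * pi)) = of_int (2 * m) * pi" by (auto simp: exp_eq_1)
 have "J (2 * pi) = 2 * pi * (LINT z|circ. F' z * cnj (F z))"
  unfolding J_def h_def by (subst integral_circ_continuous) (auto intro!: continuous_intros c)
 also have "\<dots> = 2 * pi * (\<i> * of_real (cdeg F))" by (simp add: circ_C1_cdeg[OF F])
 finally have "Im (J (2 * pi)) = 2 * pi * cdeg F" by simp
 with m have "pi * cdeg F = pi * of_int (- m)" by simp
 hence "cdeg F = of_int (- m)" unfolding mult_cancel_left by simp
 thus ?thesis by blast
qed

section \<open>Moebius bubbles\<close>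

text \<open>The disc automorphism with zero \<open>t e\<close>, with the constant chosen such that
  it tends to 1 away from \<open>e\<close> as \<open>t\<close> tends to 1. The derivative of its
  argument along the circle is the Poisson kernel \<open>pk t (e, z)\<close>.\<close>

definition bub :: "real => complex => complex => complex" where
 "bub t e z = (of_real t * e - z) / (e - of_real t * z)"

lemma bub_denom:
 assumes "cmod e = 1" "cmod z = 1"
 shows "(cmod (e - of_real t * z))^2 = (1 - t)^2 + t * (cdist (e, z))^2"
proof -
 have "e * cnj e = 1" using complex_norm_square[of e] assms by simp
 hence "e - of_real t * z = e * (1 - of_real t * zeta (z, e))"
  by (simp add: zeta_def algebra_simps)
 hence "cmod (e - of_real t * z) = cmod (1 - of_real t * zeta (z, e))" using assms by (simp add: norm_mult)
 thus ?thesis using poisson_denom[OF assms(2,1)] by (simp add: cdist_def norm_minus_commute)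
qed

lemma bub_denom_nz:
 assumes "cmod e = 1" "cmod z = 1" "0 \<le> t" "t < 1"
 shows "e - of_real t * z \<noteq> 0"
 using bub_denom[OF assms(1,2), of t] poisson_denom_pos[OF assms(3,4), of "(e, z)"] by auto

lemma pk_bub_denom:
 assumes "cmod e = 1" "cmod z = 1"
 shows "pk t (e, z) = (1 - t^2) / (cmod (e - of_real t * z))^2"
 using bub_denom[OF assms] by (simp add: pk_def)

lemma bub_numer:
 assumes "cmod e = 1" "cmod z = 1"
 shows "of_real t * e - z = - (e * z) * cnj (e - of_real t * z)"
proof -
 have "z * cnj z = 1" "e * cnj e = 1" using complex_norm_square[of z] complex_norm_square[of e] assms by auto
 moreover have "- (e * z) * cnj (e - of_real t * z) = - z * (e * cnj e) + of_real t * e * (z * cnj z)"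
  by (simp add: algebra_simps)
 ultimately show ?thesis by simp
qed

lemma cmod_bub:
 assumes "cmod e = 1" "cmod z = 1" "0 \<le> t" "t < 1"
 shows "cmod (bub t e z) = 1"
proof -
 have "cmod (of_real t * e - z) = cmod (e - of_real t * z)"
  using assms unfolding bub_numer[OF assms(1,2)] by (simp only: norm_mult norm_minus_cancel complex_mod_cnj mult_1)
 thus ?thesis using bub_denom_nz[OF assms] by (simp add: bub_def norm_divide)
qed

lemma bub_diff:
 assumes "cmod e = 1" "cmod z = 1" "cmod w = 1" "0 \<le> t" "t < 1"
 shows "bub t e z - bub t e w = - (1 - of_real t ^ 2) * e * (z - w) / ((e - of_real t * z) * (e - of_real t * w))"
 using bub_denom_nz[OF assms(1,2,4,5)] bub_denom_nz[OF assms(1,3,4,5)] unfolding bub_def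
 by (simp add: diff_frac_eq power2_eq_square algebra_simps)

text \<open>Conformal invariance: chords are stretched by the geometric mean of the boundary
  derivatives at their end points. Hence the energy density of a bubble is a product of two Poisson
  kernels, each of mass 1.\<close>

lemma cmod_bub_diff:
 assumes "cmod e = 1" "cmod z = 1" "cmod w = 1" "0 \<le> t" "t < 1"
 shows "(cmod (bub t e z - bub t e w))^2 = pk t (e, z) * pk t (e, w) * (cdist (z, w))^2"
proof -
 have "1 - t^2 \<ge> 0" using assms by (simp add: power_le_one abs_square_le_1)
 hence n: "cmod (1 - of_real t ^ 2) = 1 - t^2"
  by (metis norm_of_real abs_of_nonneg of_real_1 of_real_diff of_real_power)
 show ?thesis
  unfolding bub_diff[OF assms] norm_mult norm_divide norm_minus_cancel n pk_bub_denom[OF assms(1,2)] pk_bub_denom[OF assms(1,3)]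
  using assms by (simp add: cdist_def power2_eq_square mult_ac)
qed

lemma bub_C1:
 assumes "cmod e = 1" "0 \<le> t" "t < 1"
 shows "circ_C1 (bub t e) (\<lambda>z. \<i> * of_real (pk t (e, z)) * bub t e z)"
proof -
 let ?L = "\<lambda>\<theta>. bub t e (cis \<theta>)"
 have "(?L has_vector_derivative \<i> * of_real (pk t (e, cis \<theta>)) * bub t e (cis \<theta>)) (at \<theta>)" for \<theta>
 proof -
  let ?z = "cis \<theta>"
  note nz = bub_denom_nz[OF assms(1) norm_cis[of \<theta>] assms(2,3)]
  have 1: "(cis has_vector_derivative \<i> * cis \<theta>) (at \<theta>)"
   using has_derivative_cis[OF has_derivative_ident, of \<theta> UNIV] by (simp add: has_vector_derivative_def)
  have 2: "(bub t e has_field_derivative (- 1 * (e - of_real t * ?z) - (of_real t * e - ?z) * (- of_real t)) / ((e - of_real t * ?z) * (e - of_real t * ?z))) (at ?z)"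
   unfolding bub_def by (rule DERIV_divide) (use nz in \<open>auto intro!: derivative_eq_intros\<close>)
  have 3: "(?L has_vector_derivative (\<i> * ?z * ((- 1 * (e - of_real t * ?z) - (of_real t * e - ?z) * (- of_real t)) / ((e - of_real t * ?z) * (e - of_real t * ?z))))) (at \<theta>)"
   using field_vector_diff_chain_at[OF 1 2] by (simp add: o_def)
  note b = bub_numer[OF assms(1) norm_cis[of \<theta>], of t]
  have gen: "\<i> * (k / (u * v)) * (m * v / u) = \<i> * k * m / (u * u)" if "v \<noteq> 0" for k u v m :: complex
   using that by (simp add: field_simps)
  have "\<i> * of_real (pk t (e, ?z)) * bub t e ?z = \<i> * (1 - of_real t ^ 2) * (- (e * ?z)) / ((e - of_real t * ?z) * (e - of_real t * ?z))"
  proof -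
   have pk: "of_real (pk t (e, ?z)) = (1 - of_real t ^ 2) / ((e - of_real t * ?z) * cnj (e - of_real t * ?z))"
    unfolding pk_bub_denom[OF assms(1) norm_cis] complex_norm_square[symmetric] by simp
   have "cnj (e - of_real t * ?z) \<noteq> 0" using nz complex_cnj_zero_iff by blast
   from gen[OF this] show ?thesis unfolding bub_def b pk .
  qed
  also have "\<dots> = \<i> * ?z * ((- 1 * (e - of_real t * ?z) - (of_real t * e - ?z) * (- of_real t)) / ((e - of_real t * ?z) * (e - of_real t * ?z)))"
   by (simp add: algebra_simps power2_eq_square)
  finally show ?thesis using 3 by simp
 qed
 moreover have "continuous_on UNIV (\<lambda>\<theta>. \<i> * of_real (pk t (e, cis \<theta>)) * bub t e (cis \<theta>))"
  unfolding bub_def pk_def cdist_def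
  using poisson_denom_pos[OF assms(2,3)] bub_denom_nz[OF assms(1) norm_cis assms(2,3)]
  by (intro continuous_intros) (auto simp: cdist_def less_le)
 ultimately show ?thesis by (simp add: circ_C1_def)
qed

lemma circ_C1_circ_map: "circ_C1 F F' ==> (\<And>z. cmod z = 1 ==> cmod (F z) = 1) ==> circ_map F"
 by (simp add: circ_map_def circ_C1_fin_energy)

lemma circ_map_bub: "cmod e = 1 ==> 0 \<le> t ==> t < 1 ==> circ_map (bub t e)"
 by (rule circ_C1_circ_map[OF bub_C1]) (auto simp: cmod_bub)

lemma cdeg_bub:
 assumes "cmod e = 1" "0 \<le> t" "t < 1"
 shows "cdeg (bub t e) = 1"
proof -
 have "\<i> * of_real (cdeg (bub t e)) = (LINT z|circ. \<i> * of_real (pk t (e, z)) * bub t e z * cnj (bub t e z))"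
  by (rule circ_C1_cdeg[OF bub_C1[OF assms], symmetric])
 also have "\<dots> = (LINT z|circ. \<i> * of_real (pk t (e, z)))"
 proof (rule B_integral_cong[OF refl])
  fix z assume "z \<in> space circ"
  hence "bub t e z * cnj (bub t e z) = 1"
   using cmod_bub[OF assms(1) _ assms(2,3), of z] complex_norm_square[of "bub t e z"] by simp
  thus "\<i> * of_real (pk t (e, z)) * bub t e z * cnj (bub t e z) = \<i> * of_real (pk t (e, z))"
   by (simp add: mult.assoc)
 qed
 also have "\<dots> = \<i>" using integral_pk(1)[OF assms] by simp
 finally show ?thesis by simp
qed

lemma cenergy_bub_le:
 assumes "cmod e = 1" "0 \<le> t" "t < 1"
 shows "cenergy (bub t e) \<le> 1"
proof -
 have i2: "integrable circ2 (\<lambda>p. pk t (e, fst p) * pk t (e, snd p))"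
 proof (rule circ2_integrable_bounded[where B = "(1 + t) / (1 - t) * ((1 + t) / (1 - t))"])
  show "norm (pk t (e, fst (z, w)) * pk t (e, snd (z, w))) \<le> (1 + t) / (1 - t) * ((1 + t) / (1 - t))" for z w
   unfolding norm_mult using pk_le[OF assms(2,3)] pk_nonneg[OF assms(2,3)] assms by (intro mult_mono) auto
 qed (unfold pk_def cdist_def fst_conv snd_conv, measurable)
 have "cenergy (bub t e) \<le> (LINT p|circ2. pk t (e, fst p) * pk t (e, snd p))"
  unfolding cenergy_def
 proof (rule integral_mono[OF fin_energyD[OF circ_map_fin_energy[OF circ_map_bub[OF assms]]] i2])
  fix p assume "p \<in> space circ2"
  then obtain z w where p: "p = (z, w)" "cmod z = 1" "cmod w = 1" by auto
  have nn: "0 \<le> pk t (e, z)" "0 \<le> pk t (e, w)" using pk_nonneg[OF assms(2,3)] by auto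
  show "(cmod (dquot (bub t e) p))^2 \<le> pk t (e, fst p) * pk t (e, snd p)"
   using cmod_bub_diff[OF assms(1) p(2,3) assms(2,3)] nn unfolding p cmod_dquot power_divide fst_conv snd_conv
   by (cases "cdist (z, w) = 0") auto
 qed
 also have "\<dots> = (LINT z|circ. (LINT w|circ. pk t (e, z) * pk t (e, w)))"
  by (subst circ2_fubini(1)[OF i2]) simp
 also have "\<dots> = 1" using integral_pk(1)[OF assms] by simp
 finally show ?thesis .
qed

lemma one_minus_bub:
 assumes "cmod e = 1" "cmod z = 1" "0 \<le> t" "t < 1"
 shows "(cmod (1 - bub t e z))^2 \<le> 4 * (1 - t) * pk t (e, z)"
proof -
 let ?E = "e - of_real t * z"
 note nz = bub_denom_nz[OF assms]
 have "1 - bub t e z = (1 - of_real t) * (e + z) / ?E"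
  using nz by (simp add: bub_def field_simps)
 hence "(cmod (1 - bub t e z))^2 = (1 - t)^2 * (cmod (e + z))^2 / (cmod ?E)^2"
 proof -
  assume *: "1 - bub t e z = (1 - of_real t) * (e + z) / ?E"
  have "cmod (1 - of_real t) = 1 - t"
   using assms by (metis abs_of_nonneg diff_ge_0_iff_ge less_imp_le norm_of_real of_real_1 of_real_diff)
  thus ?thesis unfolding * norm_mult norm_divide power_mult_distrib power_divide by simp
 qed
 also have "(1 - t)^2 * (cmod (e + z))^2 \<le> (1 - t)^2 * 2^2"
  using norm_triangle_ineq[of e z] assms by (intro mult_left_mono power_mono) auto
 also have "\<dots> \<le> 4 * (1 - t) * (1 - t^2)"
 proof -
  have "(1 - t) * (1 - t) \<le> (1 - t) * (1 - t^2)"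
   using assms by (intro mult_left_mono) (auto simp: power2_eq_square mult_left_le)
  thus ?thesis by (simp add: power2_eq_square algebra_simps)
 qed
 finally have "(cmod (1 - bub t e z))^2 \<le> 4 * (1 - t) * (1 - t^2) / (cmod ?E)^2"
  by (simp add: divide_right_mono)
 thus ?thesis by (simp add: pk_bub_denom[OF assms(1,2)])
qed

definition bk :: "real => complex => complex \<times> complex => real" where
 "bk t e p = pk t (e, fst p) * pk t (e, snd p)"

lemma measurable_bk [measurable]: "bk t e \<in> borel_measurable circ2"
 unfolding bk_def pk_def cdist_def fst_conv snd_conv by measurable

lemma bk_nonneg: "0 \<le> t ==> t < 1 ==> 0 \<le> bk t e p"
 by (simp add: bk_def pk_nonneg)

lemma bk_le:
 assumes "0 \<le> t" "t < 1" shows "bk t e p \<le> ((1 + t) / (1 - t))^2"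
 unfolding bk_def power2_eq_square using pk_le[OF assms] pk_nonneg[OF assms] assms by (intro mult_mono) auto

lemma integrable_bk_bounded:
 fixes \<phi> :: "complex \<times> complex => real"
 assumes [measurable]: "\<phi> \<in> borel_measurable circ2" and t: "0 \<le> t" "t < 1"
  and B: "\<And>z w. cmod z = 1 ==> cmod w = 1 ==> \<bar>\<phi> (z, w)\<bar> \<le> B"
 shows "integrable circ2 (\<lambda>p. bk t e p * \<phi> p)"
 by (rule circ2_integrable_bounded[where B = "((1 + t) / (1 - t))^2 * B"])
   (use bk_le[OF t] bk_nonneg[OF t] B in \<open>auto simp: abs_mult intro!: mult_mono\<close>)

lemma integral_bk:
 assumes "cmod e = 1" "0 \<le> t" "t < 1"
 shows "integrable circ2 (bk t e)" "(LINT p|circ2. bk t e p) = 1"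
proof -
 show i2: "integrable circ2 (bk t e)"
  using integrable_bk_bounded[of "\<lambda>_. 1" t 1 e] assms by simp
 show "(LINT p|circ2. bk t e p) = 1"
  by (subst circ2_fubini(1)[OF i2]) (use integral_pk(1)[OF assms] in \<open>simp add: bk_def\<close>)
qed

text \<open>The left-hand side is the squared distance of two values of the bubble. The first bound
  is the squared diameter of the circle; the second expresses that both values are close to 1, and
  makes the integral \<open>O(1 - t)\<close>.\<close>

lemma bk_cdist_le:
 assumes "cmod e = 1" "cmod z = 1" "cmod w = 1" "0 \<le> t" "t < 1"
 shows "bk t e (z, w) * (cdist (z, w))^2 \<le> 4"
  "bk t e (z, w) * (cdist (z, w))^2 \<le> 8 * (1 - t) * (pk t (e, z) + pk t (e, w))"
proof -
 let ?B = "bub t e z - bub t e w"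
 have eq: "bk t e (z, w) * (cdist (z, w))^2 = (cmod ?B)^2"
  using cmod_bub_diff[OF assms] by (simp add: bk_def)
 have "cmod ?B \<le> 2"
  using norm_triangle_ineq4[of "bub t e z" "bub t e w"] cmod_bub[OF assms(1,2,4,5)] cmod_bub[OF assms(1,3,4,5)] by simp
 hence "(cmod ?B)^2 \<le> 2^2" by (rule power_mono) simp
 thus "bk t e (z, w) * (cdist (z, w))^2 \<le> 4" unfolding eq by simp
 have "(cmod ?B)^2 = (cmod ((1 - bub t e w) + (- (1 - bub t e z))))^2" by simp
 also have "\<dots> \<le> 2 * (cmod (1 - bub t e w))^2 + 2 * (cmod (1 - bub t e z))^2"
  using cmod_add_sq[of "1 - bub t e w" "- (1 - bub t e z)"] by (simp only: norm_minus_cancel)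
 also have "\<dots> \<le> 8 * (1 - t) * (pk t (e, z) + pk t (e, w))"
  using one_minus_bub[OF assms(1,2,4,5)] one_minus_bub[OF assms(1,3,4,5)] by (simp add: algebra_simps)
 finally show "bk t e (z, w) * (cdist (z, w))^2 \<le> 8 * (1 - t) * (pk t (e, z) + pk t (e, w))" unfolding eq .
qed

lemma integral_bk_cdist_le:
 assumes "cmod e = 1" "0 \<le> t" "t < 1"
 shows "integrable circ2 (\<lambda>p. bk t e p * (cdist p)^2)" "(LINT p|circ2. bk t e p * (cdist p)^2) \<le> 16 * (1 - t)"
proof -
 let ?L = "LINT p|circ2. bk t e p * (cdist p)^2"
 have "\<bar>(cdist (z, w))^2\<bar> \<le> 4" if "cmod z = 1" "cmod w = 1" for z w
  using power_mono[OF cdist_le_2[OF that] cdist_nonneg, of 2] by simp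
 thus i: "integrable circ2 (\<lambda>p. bk t e p * (cdist p)^2)" by (intro integrable_bk_bounded assms) auto
 have m: "(\<lambda>p. pk t (e, fst p)) \<in> borel_measurable circ2" "(\<lambda>p. pk t (e, snd p)) \<in> borel_measurable circ2"
  unfolding pk_def cdist_def fst_conv snd_conv by measurable
 have i1: "integrable circ2 (\<lambda>p. pk t (e, fst p))"
  by (rule circ2_integrable_bounded[where B = "(1 + t) / (1 - t)"]) (use abs_pk_le[OF assms(2,3)] m in auto)
 have i2: "integrable circ2 (\<lambda>p. pk t (e, snd p))"
  by (rule circ2_integrable_bounded[where B = "(1 + t) / (1 - t)"]) (use abs_pk_le[OF assms(2,3)] m in auto)
 have e1: "(LINT p|circ2. pk t (e, fst p)) = 1"
  by (subst circ2_fubini(1)[OF i1]) (use integral_pk(1)[OF assms] in simp)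
 have e2: "(LINT p|circ2. pk t (e, snd p)) = 1"
  by (subst circ2_fubini(1)[OF i2]) (use integral_pk(1)[OF assms] in simp)
 have "?L \<le> (LINT p|circ2. 8 * (1 - t) * (pk t (e, fst p) + pk t (e, snd p)))"
  by (rule integral_mono[OF i]) (use i1 i2 bk_cdist_le(2)[OF assms(1) _ _ assms(2,3)] in auto)
 also have "\<dots> = 16 * (1 - t)" using i1 i2 e1 e2 by simp
 finally show "?L \<le> 16 * (1 - t)" .
qed

section \<open>The Poisson extension near the circle and its partial sums\<close>

text \<open>For any probability density, the squared modulus of a mean of unit vectors falls short
  of 1 by half of the mean squared difference.\<close>

lemma cmod_pint:
 assumes f: "circ_map f" and e: "cmod e = 1" and t: "0 \<le> t" "t < 1"
 shows "(cmod (pint t f e))^2 = 1 - (LINT p|circ2. bk t e p * (cmod (f (fst p) - f (snd p)))^2) / 2"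
proof -
 let ?C = "\<lambda>p. cmod (f (fst p) - f (snd p))"
 let ?L = "LINT p|circ2. of_real (bk t e p) * cross f p"
 note [measurable] = circ_map_measurable[OF f]
 have "of_real ((cmod (pint t f e))^2) = pint t f e * cnj (pint t f e)" by (rule complex_norm_square)
 also have "\<dots> = (LINT w|circ. of_real (pk t (e, w)) * f w) * (LINT w|circ. of_real (pk t (e, w)) * cnj (f w))"
  by (simp add: pint_def flip: B_integral_cnj)
 also have "\<dots> = (LINT p|circ2. (of_real (pk t (e, fst p)) * f (fst p)) * (of_real (pk t (e, snd p)) * cnj (f (snd p))))"
  by (rule circ2_integral_mult[symmetric, where A = "(1 + t) / (1 - t)" and B = "(1 + t) / (1 - t)"])
    (use abs_pk_le[OF t] f in \<open>auto simp: norm_mult circ_map_norm\<close>)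
 also have "\<dots> = ?L"
  by (rule B_integral_cong) (auto simp: bk_def cross_def)
 finally have "Re (of_real ((cmod (pint t f e))^2)) = Re ?L" by simp
 also have "\<dots> = (LINT p|circ2. Re (of_real (bk t e p) * cross f p))"
 proof (rule integral_Re[symmetric], rule circ2_integrable_bounded[where B = "((1 + t) / (1 - t))^2 * 1"])
  fix z w :: complex assume "cmod z = 1" "cmod w = 1"
  thus "cmod (complex_of_real (bk t e (z, w)) * cross f (z, w)) \<le> ((1 + t) / (1 - t))^2 * 1"
   unfolding norm_mult norm_of_real using bk_le[OF t] bk_nonneg[OF t] f
   by (intro mult_mono) (auto simp: cross_def norm_mult circ_map_norm)
 qed measurable
 also have "\<dots> = (LINT p|circ2. bk t e p - bk t e p * (?C p)^2 / 2)"
 proof (rule B_integral_cong[OF refl])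
  fix p assume "p \<in> space circ2"
  hence "cmod (f (fst p)) = 1" "cmod (f (snd p)) = 1" using f by (auto simp: circ_map_norm)
  hence eq: "(?C p)^2 = 2 - 2 * Re (cross f p)"
   unfolding cross_def cmod_power2 by (auto simp: cmod_def power2_eq_square algebra_simps)
  show "Re (of_real (bk t e p) * cross f p) = bk t e p - bk t e p * (?C p)^2 / 2"
   unfolding eq by (simp add: field_simps)
 qed
 also have "\<dots> = 1 - (LINT p|circ2. bk t e p * (?C p)^2) / 2"
 proof -
  have bd: "(cmod (f z - f w))^2 \<le> 2^2" if "cmod z = 1" "cmod w = 1" for z w
   using norm_triangle_ineq4[of "f z" "f w"] f that by (intro power_mono) (auto simp: circ_map_norm)
  have "integrable circ2 (\<lambda>p. bk t e p * (?C p)^2)"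
   by (rule integrable_bk_bounded[OF _ t]) (use bd in auto)
  thus ?thesis using integral_bk[OF e t] by simp
 qed
 finally show ?thesis by simp
qed

text \<open>Finite energy implies vanishing mean oscillation, uniformly in the centre. The part of
  \<open>(cmod (dquot f p))^2\<close> below \<open>n\<close> contributes
  \<open>O(n (1 - t))\<close>; the part above \<open>n\<close> has small integral and is multiplied
  by at most 4.\<close>

lemma pint_lower:
 assumes f: "circ_map f" and \<epsilon>: "\<epsilon> > 0"
 obtains t0 where "t0 < 1" "\<And>t e. t0 \<le> t ==> 0 \<le> t ==> t < 1 ==> cmod e = 1 ==> (cmod (pint t f e))^2 \<ge> 1 - \<epsilon>"
proof -
 let ?C = "\<lambda>p. cmod (f (fst p) - f (snd p))"
 note [measurable] = circ_map_measurable[OF f]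
 let ?y = "\<lambda>p. (cmod (dquot f p))^2"
 have iy: "integrable circ2 ?y" using f by (simp add: fin_energyD)
 have "(\<lambda>n. \<integral>p. ?y p - min (?y p) (real n) \<partial>circ2) \<leadsto> (LINT p|circ2. 0)"
 proof (rule integral_dominated_convergence[where w = ?y])
  show "AE p in circ2. (\<lambda>n. ?y p - min (?y p) (real n)) \<leadsto> 0"
  proof (rule AE_I2, rule tendsto_eventually)
   fix p
   obtain N where "?y p \<le> real N" using real_arch_simple by blast
   thus "eventually (\<lambda>n. ?y p - min (?y p) (real n) = 0) sequentially"
    unfolding eventually_sequentially by (intro exI[of _ N]) (auto simp: min_def)
  qed
 qed (use iy in auto)
 hence "(\<lambda>n. \<integral>p. ?y p - min (?y p) (real n) \<partial>circ2) \<leadsto> 0" by simp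
 from LIMSEQ_D[OF this, of "\<epsilon> / 4"] \<epsilon> obtain n where
  n: "\<bar>\<integral>p. ?y p - min (?y p) (real n) \<partial>circ2\<bar> < \<epsilon> / 4" by auto
 \<comment> \<open>With the constant 16 of \<open>integral_bk_cdist_le\<close> the truncated part
   contributes at most \<open>\<epsilon>\<close>; the tail contributes at most
   \<open>4 (\<epsilon> / 4)\<close>, and the formula of \<open>cmod_pint\<close> halves the
   sum.\<close>
 define t0 where "t0 = 1 - \<epsilon> / (16 * (real n + 1))"
 show ?thesis
 proof (rule that[of t0])
  show "t0 < 1" using \<epsilon> by (simp add: t0_def)
  fix t and e :: complex assume t: "t0 \<le> t" "0 \<le> t" "t < 1" and e: "cmod e = 1"
  note ic = integral_bk_cdist_le[OF e t(2,3)]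
  have imin: "integrable circ2 (\<lambda>p. min (?y p) (real n))" by (intro integrable_min iy cc.integrable_const)
  have "(LINT p|circ2. bk t e p * (?C p)^2) \<le>
   (LINT p|circ2. real n * (bk t e p * (cdist p)^2) + 4 * (?y p - min (?y p) (real n)))"
  proof (rule integral_mono)
   show "integrable circ2 (\<lambda>p. bk t e p * (?C p)^2)"
   proof (rule integrable_bk_bounded[OF _ t(2,3), where B = "2^2"])
    fix z w :: complex assume "cmod z = 1" "cmod w = 1"
    hence "cmod (f z - f w) \<le> 2" using norm_triangle_ineq4[of "f z" "f w"] f by (simp add: circ_map_norm)
    from power_mono[OF this, of 2] show "\<bar>(cmod (f (fst (z, w)) - f (snd (z, w))))^2\<bar> \<le> 2^2" by simp
   qed measurable
   show "integrable circ2 (\<lambda>p. real n * (bk t e p * (cdist p)^2) + 4 * (?y p - min (?y p) (real n)))"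
    using ic iy imin by auto
   fix p assume "p \<in> space circ2"
   then obtain z w where p: "p = (z, w)" "cmod z = 1" "cmod w = 1" by auto
   let ?X = "bk t e p * (cdist p)^2"
   have X: "0 \<le> ?X" "?X \<le> 4" using bk_cdist_le(1)[OF e p(2,3) t(2,3)] bk_nonneg[OF t(2,3)] p by auto
   have "bk t e p * (?C p)^2 = ?X * ?y p"
    unfolding cdist2_dquot2[symmetric] by simp
   also have "\<dots> = ?X * min (?y p) (real n) + ?X * (?y p - min (?y p) (real n))" by (simp add: algebra_simps)
   also have "\<dots> \<le> ?X * real n + 4 * (?y p - min (?y p) (real n))"
    using X by (intro add_mono mult_left_mono mult_right_mono) auto
   finally show "bk t e p * (?C p)^2 \<le> real n * ?X + 4 * (?y p - min (?y p) (real n))"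
    by (simp add: mult.commute)
  qed
  also have "\<dots> = real n * (LINT p|circ2. bk t e p * (cdist p)^2) + 4 * (LINT p|circ2. ?y p - min (?y p) (real n))"
   using ic(1) iy imin by simp
  also have "\<dots> \<le> real n * (16 * (1 - t)) + \<epsilon>"
   using ic(2) n by (intro add_mono mult_left_mono) auto
  also have "real n * (16 * (1 - t)) \<le> (real n + 1) * 16 * (1 - t0)"
   using t mult_mono[of "real n * 16" "(real n + 1) * 16" "1 - t" "1 - t0"] by (simp only: mult.assoc) simp
  also have "\<dots> = \<epsilon>"
  proof -
   have "x * 16 * (1 - (1 - \<epsilon> / (16 * x))) = \<epsilon>" if "x \<noteq> 0" for x using that by simp
   from this[of "real n + 1"] show ?thesis unfolding t0_def by linarith
  qed
  finally show "(cmod (pint t f e))^2 \<ge> 1 - \<epsilon>" unfolding cmod_pint[OF f e t(2,3)] by simp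
 qed
qed

text \<open>A partial sum of the Poisson extension, restricted to the circle of radius
  \<open>t\<close>: a trigonometric polynomial whose coefficients are explicit multiples of those of
  \<open>f\<close>.\<close>

definition tpoly :: "real => nat => (complex => complex) => complex => complex" where
 "tpoly t N f z = fp f 0 + (\<Sum>n<N. of_real t ^ Suc n * (fp f (Suc n) * z ^ Suc n + fm f (Suc n) * cnj z ^ Suc n))"

lemma circ_map_coeff_le:
 assumes f: "circ_map f" shows "cmod (fm f n) \<le> 1" "cmod (fp f n) \<le> 1"
proof -
 note [measurable] = circ_map_measurable[OF f]
 have "cmod (LINT z|circ. f z * e z ^ n) \<le> 1" if "e = cnj \<or> e = (\<lambda>z. z)" for e
 proof -
  have i: "integrable circ (\<lambda>z. f z * e z ^ n)"
   by (rule circ_integrable_bounded[where B = 1]) (use f that in \<open>auto simp: norm_mult norm_power circ_map_norm\<close>)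
  have "cmod (LINT z|circ. f z * e z ^ n) \<le> (LINT z|circ. cmod (f z * e z ^ n))" by (rule integral_norm_bound)
  also have "\<dots> = (LINT z|circ. 1)"
   by (rule B_integral_cong) (use f that in \<open>auto simp: norm_mult norm_power circ_map_norm\<close>)
  finally show ?thesis by simp
 qed
 from this[of "\<lambda>z. z"] this[of cnj] show "cmod (fm f n) \<le> 1" "cmod (fp f n) \<le> 1"
  by (auto simp: fm_def fp_def)
qed

lemma tpoly_pint:
 assumes f: "circ_map f" and e: "cmod e = 1" and t: "0 \<le> t" "t < 1"
 shows "cmod (tpoly t N f e - pint t f e) \<le> 2 * t ^ Suc N / (1 - t)"
proof -
 let ?F = "\<lambda>n. fp f n * e ^ n + fm f n * cnj e ^ n"
 note [measurable] = circ_map_measurable[OF f]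
 define a where "a n = of_real t ^ n * (?F n)" for n
 have sa: "a sums (pint t f e + fm f 0)"
  unfolding a_def by (rule poisson_expansion[where B = 1]) (use f e t in \<open>auto simp: circ_map_norm\<close>)
 have an: "cmod (a n) \<le> 2 * t ^ n" for n
 proof -
  have "cmod (?F n) \<le> 1 + 1"
   using circ_map_coeff_le[OF f, of n] e by (intro order_trans[OF norm_triangle_ineq] add_mono) (auto simp: norm_mult norm_power)
  hence "t ^ n * cmod (?F n) \<le> t ^ n * 2" using t by (intro mult_left_mono) auto
  thus ?thesis unfolding a_def norm_mult norm_power using t by simp
 qed
 have sg: "(\<lambda>n. 2 * t ^ (n + Suc N)) sums (2 * t ^ Suc N / (1 - t))"
  using sums_mult[OF geometric_sums[of t], of "2 * t ^ Suc N"] t by (simp add: power_add mult_ac)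
 have "(\<Sum>n<Suc N. a n) = tpoly t N f e + fm f 0"
  unfolding sum.lessThan_Suc_shift by (simp add: tpoly_def a_def fp_0)
 hence "(\<lambda>n. a (n + Suc N)) sums - (tpoly t N f e - pint t f e)"
  using sums_split_initial_segment[OF sa, of "Suc N"] by (simp add: algebra_simps)
 hence "cmod (tpoly t N f e - pint t f e) = cmod (\<Sum>n. a (n + Suc N))"
  by (metis sums_unique norm_minus_cancel)
 also have "\<dots> \<le> (\<Sum>n. 2 * t ^ (n + Suc N))"
  by (intro norm_suminf_le an sums_summable[OF sg])
 also have "\<dots> = 2 * t ^ Suc N / (1 - t)" using sg by (simp add: sums_iff)
 finally show ?thesis .
qed

subsection \<open>Density of smooth maps and integrality of the degree\<close>

lemma sphere_sets_circ [simp, measurable]: "sphere 0 1 \<in> sets circ"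
 using sets.top[of circ] by simp

lemma cis_measurable_circ [measurable]: "cis \<in> measurable borel circ"
 using cis_measurable_sphere by (simp add: measurable_cong_sets[OF refl sets_circ])

lemma AE_circ_cis:
 assumes "{z \<in> space circ. P z} \<in> sets circ" "AE \<theta> in lborel. \<theta> \<in> {0..2*pi} \<longrightarrow> P (cis \<theta>)"
 shows "AE z in circ. P z"
proof -
 have "AE \<theta> in uniform_measure lborel {0..2*pi}. P (cis \<theta>)"
  by (rule AE_uniform_measureI) (use assms(2) in auto)
 moreover have "{z \<in> space (restrict_space borel (sphere 0 1)). P z} \<in> sets (restrict_space borel (sphere 0 1))"
  using assms(1) by (simp add: sets_circ space_restrict_space)
 ultimately show ?thesis unfolding circ_def by (subst AE_distr_iff[OF cis_measurable_uniform]) simp_all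
qed

lemma AE_circ_neq:
 assumes "cmod w = 1" shows "AE z in circ. z \<noteq> w"
proof (rule AE_circ_cis)
 obtain a where a: "w = exp (\<i> * of_real a)" using assms complex_norm_eq_1_exp by metis
 have "AE \<theta> in lborel. \<theta> \<notin> range (\<lambda>n::int. a + 2 * of_int n * pi)"
  by (intro AE_not_in countable_imp_null_set_lborel) simp
 thus "AE \<theta> in lborel. \<theta> \<in> {0..2*pi} \<longrightarrow> cis \<theta> \<noteq> w"
  by (rule eventually_mono) (auto simp: a cis_conv_exp exp_eq dest!: arg_cong[where f = Im])
qed measurable

lemma AE_circ2:
 assumes "AE z in circ. P z"
 shows "AE p in circ2. P (fst p) \<and> P (snd p)"
proof -
 from assms obtain N where N: "{z \<in> space circ. \<not> P z} \<subseteq> N" "emeasure circ N = 0" "N \<in> sets circ"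
  by (rule AE_E)
 have n1: "AE p in circ2. fst p \<notin> N"
 proof (rule AE_I)
  show "{p \<in> space circ2. \<not> fst p \<notin> N} \<subseteq> N \<times> space circ" by auto
  show "emeasure circ2 (N \<times> space circ) = 0"
   unfolding circ2_def using N by (subst circ.emeasure_pair_measure_Times) auto
  show "N \<times> space circ \<in> sets circ2" unfolding circ2_def using N by auto
 qed
 have n2: "AE p in circ2. snd p \<notin> N"
 proof (rule AE_I)
  show "{p \<in> space circ2. \<not> snd p \<notin> N} \<subseteq> space circ \<times> N" by auto
  show "emeasure circ2 (space circ \<times> N) = 0"
   unfolding circ2_def using N by (subst circ.emeasure_pair_measure_Times) auto
  show "space circ \<times> N \<in> sets circ2" unfolding circ2_def using N by auto
 qed
 show ?thesis using n1 n2 AE_space by eventually_elim (use N(1) in auto)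
qed

lemma fp_add:
 assumes "fin_energy f" "fin_energy g"
 shows "fp (\<lambda>z. f z + g z) n = fp f n + fp g n" "fm (\<lambda>z. f z + g z) n = fm f n + fm g n"
proof -
 have "fp (\<lambda>z. f z - (-1) * g z) n = fp f n - fp (\<lambda>z. (-1) * g z) n"
  "fm (\<lambda>z. f z - (-1) * g z) n = fm f n - fm (\<lambda>z. (-1) * g z) n"
  by (intro fp_diff assms fin_energy_cmult)+
 thus "fp (\<lambda>z. f z + g z) n = fp f n + fp g n" "fm (\<lambda>z. f z + g z) n = fm f n + fm g n"
  by (auto simp: fp_def fm_def)
qed

lemma fp_cmult: "fp (\<lambda>z. c * f z) n = c * fp f n" "fm (\<lambda>z. c * f z) n = c * fm f n"
 by (simp_all add: fp_def fm_def mult.assoc)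

lemma circ_C1_cmult: "circ_C1 F F' ==> circ_C1 (\<lambda>z. c * F z) (\<lambda>z. c * F' z)"
 using circ_C1_mult[OF circ_C1_const[of c], of F F'] by simp

lemma circ_C1_monomials:
 "circ_C1 (\<lambda>z. a * z ^ n + b * cnj z ^ n) (\<lambda>z. a * (\<i> * of_nat n * z ^ n) + b * cnj (\<i> * of_nat n * z ^ n))"
 using circ_C1_add[OF circ_C1_cmult[OF circ_C1_power] circ_C1_cmult[OF circ_C1_cnj[OF circ_C1_power]], of a n b n] by simp

lemma tpoly_C1: "\<exists>F'. circ_C1 (tpoly t N f) F'"
proof (induction N)
 case 0
 show ?case using circ_C1_const[of "fp f 0"] by (auto simp: tpoly_def[abs_def])
next
 case (Suc N)
 then obtain F' where "circ_C1 (tpoly t N f) F'" by blast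
 from circ_C1_add[OF this circ_C1_cmult[OF circ_C1_monomials, of "of_real t ^ Suc N" "fp f (Suc N)" "Suc N" "fm f (Suc N)"]]
 show ?case by (auto simp: tpoly_def[abs_def] add.assoc)
qed

lemma tpoly_fin_energy: "fin_energy (tpoly t N f)"
 using tpoly_C1[of t N f] circ_C1_fin_energy by blast

lemma tpoly_coeff:
 "fp (tpoly t N f) n = (if n \<le> N then of_real t ^ n * fp f n else 0)"
 "fm (tpoly t N f) n = (if n \<le> N then of_real t ^ n * fm f n else 0)"
proof -
 have "fp (tpoly t N f) n = (if n \<le> N then of_real t ^ n * fp f n else 0) \<and>
  fm (tpoly t N f) n = (if n \<le> N then of_real t ^ n * fm f n else 0)"
 proof (induction N)
  case 0
  show ?case using circ_monomials(1)[of 0 n] circ_monomials(1)[of n 0]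
   by (auto simp: tpoly_def[abs_def] fp_0 fp_def[of "\<lambda>z. fm f 0"] fm_def[of "\<lambda>z. fm f 0"])
 next
  case (Suc N)
  let ?m = "\<lambda>z. of_real t ^ Suc N * (fp f (Suc N) * z ^ Suc N + fm f (Suc N) * cnj z ^ Suc N)"
  have eq: "tpoly t (Suc N) f = (\<lambda>z. tpoly t N f z + ?m z)" by (simp add: tpoly_def fun_eq_iff)
  note p1 = circ_C1_fin_energy[OF circ_C1_cmult[OF circ_C1_power]]
  note p2 = circ_C1_fin_energy[OF circ_C1_cmult[OF circ_C1_cnj[OF circ_C1_power]]]
  have fe2: "fin_energy ?m"
   by (rule circ_C1_fin_energy[OF circ_C1_cmult[OF circ_C1_monomials]])
  have "fp (\<lambda>z. z ^ Suc N) n = (if Suc N = n then 1 else 0)" "fp (\<lambda>z. cnj z ^ Suc N) n = 0"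
   "fm (\<lambda>z. z ^ Suc N) n = 0"
   unfolding fp_def fm_def circ_monomials by auto
  moreover have "fm (\<lambda>z. cnj z ^ Suc N) n = (if Suc N = n then 1 else 0)"
   using circ_monomials(1)[of n "Suc N"] by (auto simp: fm_def mult.commute simp del: power_Suc)
  ultimately have "fp ?m n = of_real t ^ Suc N * (if Suc N = n then fp f (Suc N) else 0)"
   "fm ?m n = of_real t ^ Suc N * (if Suc N = n then fm f (Suc N) else 0)"
   using fp_add[OF p1 p2, of "fp f (Suc N)" "Suc N" "fm f (Suc N)" "Suc N" n] by (simp_all only: fp_cmult) auto
  thus ?case unfolding eq fp_add[OF tpoly_fin_energy fe2] using Suc by (auto simp: le_Suc_eq)
 qed
 thus "fp (tpoly t N f) n = (if n \<le> N then of_real t ^ n * fp f n else 0)"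
  "fm (tpoly t N f) n = (if n \<le> N then of_real t ^ n * fm f n else 0)" by auto
qed

lemma tpoly_energy:
 assumes f: "fin_energy f" and t: "0 \<le> t" "t \<le> 1"
 shows "cenergy (tpoly t N f) \<le> cenergy f"
proof (rule sums_le[OF _ energy_sums[OF tpoly_fin_energy] energy_sums[OF f]])
 fix n
 have "(cmod (of_real t ^ n * c))^2 \<le> (cmod c)^2" for c
  using t by (intro power_mono) (auto simp: norm_mult norm_power power_le_one mult_left_le_one_le)
 hence "ac (tpoly t N f) n \<le> ac f n" by (auto simp: ac_def tpoly_coeff intro!: add_mono)
 thus "real n * ac (tpoly t N f) n \<le> real n * ac f n" by (intro mult_left_mono) auto
qed

text \<open>The fraction lost at frequency \<open>n\<close> is
  \<open>1 - t^n \<le> n (1 - t)\<close> up to \<open>N\<close>, and 1 beyond, where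
  \<open>n \<ge> N + 1\<close>. Either loss is paid for by the weight \<open>n\<close> of the
  energy.\<close>

lemma tpoly_L2:
 assumes f: "fin_energy f" and t: "0 \<le> t" "t \<le> 1"
 shows "(LINT z|circ. (cmod (tpoly t N f z - f z))^2) \<le> (1 - t + 1 / (real N + 1)) * cenergy f"
proof (rule sums_le[OF _ parseval[OF fin_energy_diff(1)[OF tpoly_fin_energy f]] sums_mult[OF energy_sums[OF f]]])
 let ?T = "1 - t + 1 / (real N + 1)"
 let ?L = "\<lambda>z. tpoly t N f z - f z"
 fix n
 define C where "C = (if n \<le> N then 1 - t ^ n else 1 :: real)"
 have "\<bar>1 - t\<bar> * (\<Sum>i<n. t ^ i) \<le> (1 - t) * real n"
  using t sum_bounded_above[of "{..<n}" "\<lambda>i. t ^ i" 1] by (auto intro!: mult_left_mono simp: power_le_one)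
 hence "1 - t ^ n \<le> (1 - t) * real n" using t by (simp add: one_diff_power_eq)
 moreover have "real n * ?T = (1 - t) * real n + real n / (real N + 1)" by (simp add: algebra_simps)
 moreover have "1 \<le> real n / (real N + 1)" if "\<not> n \<le> N" using that by (simp add: pos_le_divide_eq)
 moreover have "0 \<le> (1 - t) * real n" "0 \<le> real n / (real N + 1)" using t by auto
 ultimately have C3: "C \<le> real n * ?T" unfolding C_def by (smt (verit))
 have C: "0 \<le> C" "C \<le> 1" using t by (auto simp: C_def power_le_one)
 have cm: "cmod (of_real t ^ n * x - x) = (1 - t ^ n) * cmod x" for x
 proof -
  have "of_real t ^ n * x - x = - (of_real (1 - t ^ n) * x)" by (simp add: left_diff_distrib)
  thus ?thesis using t by (simp only: norm_minus_cancel norm_mult norm_of_real) (simp add: power_le_one)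
 qed
 have "ac ?L n = C^2 * ac f n"
  unfolding ac_def fp_diff[OF tpoly_fin_energy f] tpoly_coeff
  by (cases "n = 0") (simp_all add: C_def cm power_mult_distrib distrib_left)
 also have "\<dots> \<le> C * ac f n" using C by (intro mult_right_mono) (auto simp: power2_eq_square mult_left_le)
 also have "\<dots> \<le> (real n * ?T) * ac f n" using C3 by (intro mult_right_mono) auto
 finally show "ac ?L n \<le> ?T * (real n * ac f n)" by (simp add: mult_ac)
qed

text \<open>The squared distance of the two radial projections, times \<open>|z| |w|\<close>, equals
  \<open>2 |z| |w| - 2 Re (z * cnj w)\<close>, which the inequality of the means bounds by the
  squared distance of \<open>z\<close> and \<open>w\<close>.\<close>

lemma cmod_normalize_diff:
 fixes z w :: complex
 assumes "m > 0" "cmod z \<ge> m" "cmod w \<ge> m"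
 shows "cmod (z / of_real (cmod z) - w / of_real (cmod w)) \<le> cmod (z - w) / m"
proof (rule power2_le_imp_le)
 let ?a = "cmod z" let ?b = "cmod w" let ?r = "Re (z * cnj w)"
 have ab: "?a > 0" "?b > 0" using assms by auto
 have e: "(cmod (x - y))^2 = (cmod x)^2 + (cmod y)^2 - 2 * Re (x * cnj y)" for x y
  unfolding cmod_power2 by (simp add: power2_eq_square algebra_simps)
 define D where "D = (cmod (z / of_real ?a - w / of_real ?b))^2"
 have D: "D = 2 - 2 * (?r / (?a * ?b))"
  unfolding D_def e using ab by (simp add: norm_divide power_divide)
 have "m^2 * D \<le> ?a * ?b * D"
  using assms by (intro mult_right_mono) (auto simp: power2_eq_square D_def intro!: mult_mono)
 also have "\<dots> = 2 * ?a * ?b - 2 * ?r"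
  unfolding D using ab by (simp add: field_simps)
 also have "\<dots> \<le> (cmod (z - w))^2"
  unfolding e using sum_squares_bound[of ?a ?b] by simp
 finally have "m^2 * D \<le> (cmod (z - w))^2" .
 hence "D \<le> (cmod (z - w) / m)^2"
  using assms by (simp add: power_divide field_simps)
 thus "(cmod (z / of_real ?a - w / of_real ?b))^2 \<le> (cmod (z - w) / m)^2" by (simp only: D_def)
qed (use assms in auto)

lemma circ_C1_normalize:
 assumes F: "circ_C1 F F'" and nz: "\<And>z. cmod z = 1 ==> F z \<noteq> 0"
 shows "\<exists>G'. circ_C1 (\<lambda>z. F z / of_real (cmod (F z))) G'"
proof -
 let ?L = "\<lambda>\<theta>. Re (F (cis \<theta>) * cnj (F (cis \<theta>)))"
 define s where "s \<theta> = (cmod (F (cis \<theta>)))^2" for \<theta>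
 define s' where "s' \<theta> = 2 * Re (cnj (F (cis \<theta>)) * F' (cis \<theta>))" for \<theta>
 have s0: "s \<theta> > 0" for \<theta> using nz[of "cis \<theta>"] by (simp add: s_def)
 note c = circ_C1_continuous[OF F]
 have d: "((\<lambda>\<theta>. F (cis \<theta>)) has_vector_derivative F' (cis \<theta>)) (at \<theta>)" for \<theta> using F by (simp add: circ_C1_def)
 have ds: "(s has_real_derivative s' \<theta>) (at \<theta>)" for \<theta>
 proof -
  have "((\<lambda>\<theta>. F (cis \<theta>) * cnj (F (cis \<theta>))) has_vector_derivative (F (cis \<theta>) * cnj (F' (cis \<theta>)) + F' (cis \<theta>) * cnj (F (cis \<theta>)))) (at \<theta>)"
   by (intro has_vector_derivative_mult has_vector_derivative_cnj d)
  hence "(?L has_vector_derivative Re (F (cis \<theta>) * cnj (F' (cis \<theta>)) + F' (cis \<theta>) * cnj (F (cis \<theta>)))) (at \<theta>)"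
   by (rule bounded_linear.has_vector_derivative[OF bounded_linear_Re])
  moreover have "?L = s"
   by (intro ext) (simp only: s_def complex_norm_square[symmetric] Re_complex_of_real)
  moreover have "Re (F (cis \<theta>) * cnj (F' (cis \<theta>)) + F' (cis \<theta>) * cnj (F (cis \<theta>))) = s' \<theta>"
   by (simp add: s'_def algebra_simps)
  ultimately show ?thesis by (simp add: has_real_derivative_iff_has_vector_derivative)
 qed
 define r where "r \<theta> = 1 / sqrt (s \<theta>)" for \<theta>
 define r' where "r' \<theta> = - (s' \<theta> / (2 * sqrt (s \<theta>))) / s \<theta>" for \<theta>
 have dr: "(r has_real_derivative r' \<theta>) (at \<theta>)" for \<theta>
  unfolding r_def[abs_def] r'_def using s0[of \<theta>]
  by (auto intro!: derivative_eq_intros ds simp: field_simps)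
 have dr2: "((\<lambda>\<theta>. complex_of_real (r \<theta>)) has_vector_derivative of_real (r' \<theta>)) (at \<theta>)" for \<theta>
  by (rule bounded_linear.has_vector_derivative[OF bounded_linear_of_real dr[unfolded has_real_derivative_iff_has_vector_derivative]])
 have dG: "((\<lambda>\<theta>. F (cis \<theta>) / of_real (cmod (F (cis \<theta>)))) has_vector_derivative (F (cis \<theta>) * of_real (r' \<theta>) + F' (cis \<theta>) * of_real (r \<theta>))) (at \<theta>)" for \<theta>
  using has_vector_derivative_mult[OF d dr2[of \<theta>]] by (simp add: r_def s_def)
 have cs: "continuous_on UNIV s" unfolding s_def[abs_def] by (intro continuous_intros c)
 have cs': "continuous_on UNIV s'" unfolding s'_def[abs_def] by (intro continuous_intros c)
 have cr: "continuous_on UNIV (\<lambda>\<theta>. F (cis \<theta>) * of_real (r' \<theta>) + F' (cis \<theta>) * of_real (r \<theta>))"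
  unfolding r_def r'_def using s0 by (intro continuous_intros c cs cs') (auto simp: less_le)
 define G' where "G' z = (let \<theta> = Im (Ln z) in F (cis \<theta>) * of_real (r' \<theta>) + F' (cis \<theta>) * of_real (r \<theta>))" for z
 have per: "G' (cis \<theta>) = F (cis \<theta>) * of_real (r' \<theta>) + F' (cis \<theta>) * of_real (r \<theta>)" for \<theta>
 proof -
  have "cis (Im (Ln (cis \<theta>))) = cis \<theta>" by (rule cis_Im_Ln) simp
  thus ?thesis by (simp add: G'_def Let_def r_def r'_def s_def s'_def)
 qed
 show ?thesis unfolding circ_C1_def by (intro exI[of _ G']) (use dG cr in \<open>auto simp: per\<close>)
qed

text \<open>Close to the circle the Poisson extension has modulus near 1 by
  \<open>pint_lower\<close>, so a long partial sum of it can be divided by its modulus. This costs a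
  factor \<open>1 / (1 - 2 ep)^2\<close> in energy; hence in the limit the energies do not exceed
  that of \<open>f\<close>, and \<open>L2_tendsto_of_norm_le\<close> turns almost everywhere
  convergence into convergence in energy.\<close>

lemma circ_map_dense:
 assumes f: "circ_map f"
 obtains \<phi> where "\<And>j::nat. \<exists>\<phi>'. circ_C1 (\<phi> j) \<phi>'" "\<And>j. circ_map (\<phi> j)"
  "(\<lambda>j. \<integral>z. (cmod (\<phi> j z - f z))^2 \<partial>circ) \<leadsto> 0" "(\<lambda>j. cenergy (\<lambda>z. \<phi> j z - f z)) \<leadsto> 0"
proof -
 note [measurable] = circ_map_measurable[OF f]
 \<comment> \<open>At most 1/4, so that the lower bound \<open>1 - 2 ep\<close> for the modulus of
   the partial sums stays positive.\<close>
 define ep where "ep j = 1 / (real j + 4)" for j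
 have ep: "0 < ep j" "ep j \<le> 1/4" for j by (auto simp: ep_def field_simps)
 have ep0: "ep \<leadsto> 0"
 proof -
  have "(\<lambda>k. 1 / real (k + 4)) \<leadsto> 0" by (intro LIMSEQ_ignore_initial_segment[OF lim_1_over_n])
  thus ?thesis by (simp add: ep_def[abs_def])
 qed
 have "\<exists>t N. tseq j \<le> t \<and> t < 1 \<and> N \<ge> j \<and> (\<forall>e. cmod e = 1 \<longrightarrow> cmod (pint t f e) \<ge> 1 - ep j) \<and>
   (\<forall>e. cmod e = 1 \<longrightarrow> cmod (tpoly t N f e - pint t f e) \<le> ep j)" for j
 proof -
  obtain t0 where t0: "t0 < 1" "\<And>t e. t0 \<le> t ==> 0 \<le> t ==> t < 1 ==> cmod e = 1 ==> (cmod (pint t f e))^2 \<ge> 1 - ep j"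
   by (rule pint_lower[OF f ep(1)[of j]]) (rule that)
  define t where "t = max t0 (tseq j)"
  have t: "t0 \<le> t" "tseq j \<le> t" "0 \<le> t" "t < 1" "0 < t" using t0(1) tseq[of j] by (auto simp: t_def max_def)
  have "(\<lambda>N. 2 * t ^ N / (1 - t)) \<leadsto> 2 * 0 / (1 - t)"
   by (intro tendsto_intros LIMSEQ_realpow_zero) (use t in auto)
  from order_tendstoD(2)[OF this, of "ep j"] obtain M where "\<And>n. n \<ge> M ==> 2 * t ^ n / (1 - t) < ep j"
   using ep(1)[of j] by (auto simp: eventually_sequentially)
  then obtain N where N: "2 * t ^ Suc N / (1 - t) < ep j" "N \<ge> j" using that[of "max M j"] by (meson le_SucI max.bounded_iff order_refl)
  have "cmod (pint t f e) \<ge> 1 - ep j" if "cmod e = 1" for e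
  proof (rule power2_le_imp_le)
   have "(1 - ep j)^2 \<le> 1 - ep j" using ep[of j] by (simp add: power2_eq_square mult_left_le)
   also have "\<dots> \<le> (cmod (pint t f e))^2" using t0(2) t that by blast
   finally show "(1 - ep j)^2 \<le> (cmod (pint t f e))^2" .
  qed simp
  moreover have "cmod (tpoly t N f e - pint t f e) \<le> ep j" if "cmod e = 1" for e
   using tpoly_pint[OF f that t(3,4), of N] N by simp
  ultimately show ?thesis using t N(2) by blast
 qed
 then obtain t N where tN: "\<And>j. tseq j \<le> t j" "\<And>j. t j < 1" "\<And>j e. cmod e = 1 ==> cmod (pint (t j) f e) \<ge> 1 - ep j"
  "\<And>j e. cmod e = 1 ==> cmod (tpoly (t j) (N j) f e - pint (t j) f e) \<le> ep j" "\<And>j. N j \<ge> j" by metis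
 have t: "0 < t j" "1/2 \<le> t j" for j using tN(1)[of j] tseq[of j] by auto
 define T where "T j = tpoly (t j) (N j) f" for j
 define \<phi> where "\<phi> j z = T j z / of_real (cmod (T j z))" for j z
 have Tlow: "cmod (T j e) \<ge> 1 - 2 * ep j" if "cmod e = 1" for j e
  using norm_triangle_ineq2[of "pint (t j) f e" "pint (t j) f e - T j e"] tN(3)[OF that, of j] tN(4)[OF that, of j]
  by (simp add: T_def norm_minus_commute)
 have Tpos: "1 - 2 * ep j > 0" for j using ep[of j] by simp
 have Tnz: "T j e \<noteq> 0" if "cmod e = 1" for j e using Tlow[OF that, of j] Tpos[of j] by auto
 have TC: "\<exists>T'. circ_C1 (T j) T'" for j unfolding T_def by (rule tpoly_C1)
 have C: "\<exists>\<phi>'. circ_C1 (\<phi> j) \<phi>'" for j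
  using TC[of j] circ_C1_normalize[of "T j"] Tnz unfolding \<phi>_def by blast
 have u: "cmod (\<phi> j z) = 1" if "cmod z = 1" for j z
  using Tnz[OF that, of j] by (simp add: \<phi>_def norm_divide)
 have cm: "circ_map (\<phi> j)" for j using C[of j] u circ_C1_circ_map by blast
 note [measurable] = circ_map_measurable[OF cm]
 have pl: "cmod (pint (t j) f e) \<le> 1" if "cmod e = 1" for j e
 proof -
  have "0 \<le> (LINT p|circ2. bk (t j) e p * (cmod (f (fst p) - f (snd p)))^2)"
   by (rule B_integral_nonneg) (use bk_nonneg[of "t j"] t[of j] tN(2)[of j] in auto)
  hence "(cmod (pint (t j) f e))^2 \<le> 1^2" using cmod_pint[OF f that, of "t j"] t(1)[of j] tN(2)[of j] by simp
  thus ?thesis by (rule power2_le_imp_le) simp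
 qed
 have dp: "cmod (\<phi> j e - T j e) \<le> 2 * ep j" if e: "cmod e = 1" for j e
 proof -
  have "\<phi> j e - T j e = T j e / of_real (cmod (T j e)) * of_real (1 - cmod (T j e))"
   using Tnz[OF e, of j] by (simp add: \<phi>_def field_simps)
  hence "cmod (\<phi> j e - T j e) = \<bar>1 - cmod (T j e)\<bar>"
   using Tnz[OF e, of j] by (simp only: norm_mult norm_divide norm_of_real) simp
  thus ?thesis
   using Tlow[OF e, of j] pl[OF e, of j] tN(4)[OF e, of j] ep(1)[of j]
    norm_triangle_ineq2[of "T j e" "pint (t j) f e"] by (simp add: T_def abs_le_iff)
 qed
 define c where "c j = cenergy f / (1 - 2 * ep j)^2" for j
 have en: "cenergy (\<phi> j) \<le> c j" for j
 proof -
  have "cenergy (\<phi> j) \<le> (LINT p|circ2. (cmod (dquot (T j) p))^2 / (1 - 2 * ep j)^2)"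
   unfolding cenergy_def
  proof (rule integral_mono)
   show "integrable circ2 (\<lambda>p. (cmod (dquot (\<phi> j) p))^2)" using cm by (simp add: fin_energyD)
   show "integrable circ2 (\<lambda>p. (cmod (dquot (T j) p))^2 / (1 - 2 * ep j)^2)" using fin_energyD[OF tpoly_fin_energy] by (simp add: T_def)
   fix p assume "p \<in> space circ2"
   then obtain z w where p: "p = (z, w)" "cmod z = 1" "cmod w = 1" by auto
   have "cmod (\<phi> j z - \<phi> j w) \<le> cmod (T j z - T j w) / (1 - 2 * ep j)"
    unfolding \<phi>_def by (rule cmod_normalize_diff[OF Tpos Tlow Tlow]) (use p in auto)
   from divide_right_mono[OF this cdist_nonneg[of "(z, w)"]]
   have "cmod (dquot (\<phi> j) p) \<le> cmod (dquot (T j) p) / (1 - 2 * ep j)"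
    by (simp add: p cmod_dquot divide_divide_eq_left mult.commute)
   from power_mono[OF this, of 2] show "(cmod (dquot (\<phi> j) p))^2 \<le> (cmod (dquot (T j) p))^2 / (1 - 2 * ep j)^2"
    by (simp add: power_divide)
  qed
  also have "\<dots> = cenergy (T j) / (1 - 2 * ep j)^2" by (simp add: cenergy_def)
  also have "\<dots> \<le> c j" unfolding c_def T_def using t[of j] tN(2)[of j]
   by (intro divide_right_mono tpoly_energy) (auto simp: f)
  finally show ?thesis .
 qed
 have clim: "c \<leadsto> cenergy f"
 proof -
  have "c \<leadsto> cenergy f / (1 - 2 * 0)^2" unfolding c_def[abs_def] by (intro tendsto_intros ep0) auto
  thus ?thesis by simp
 qed
 have i\<phi>f: "integrable circ (\<lambda>z. (cmod (\<phi> j z - f z))^2)" for j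
  by (rule fin_energy_square_integrable[OF fin_energy_diff(1)]) (use cm f in auto)
 have iT: "integrable circ (\<lambda>z. (cmod (T j z - f z))^2)" for j
  unfolding T_def by (rule fin_energy_square_integrable[OF fin_energy_diff(1)[OF tpoly_fin_energy]]) (use f in auto)
 let ?b = "\<lambda>j. 2 * (2 * ep j)^2 + 2 * ((1 - t j + 1 / (real j + 1)) * cenergy f)"
 have L2: "(\<lambda>j. \<integral>z. (cmod (\<phi> j z - f z))^2 \<partial>circ) \<leadsto> 0"
 proof (rule tendsto_sandwich[where f = "\<lambda>_. 0", OF always_eventually always_eventually tendsto_const])
  show "\<forall>j. (LINT z|circ. (cmod (\<phi> j z - f z))^2) \<le> ?b j"
  proof
   fix j
   have "(LINT z|circ. (cmod (\<phi> j z - f z))^2) \<le> (LINT z|circ. 2 * (2 * ep j)^2 + 2 * (cmod (T j z - f z))^2)"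
   proof (rule integral_mono[OF i\<phi>f])
    fix z assume "z \<in> space circ"
    hence "(cmod (\<phi> j z - T j z))^2 \<le> (2 * ep j)^2" by (intro power_mono dp) auto
    thus "(cmod (\<phi> j z - f z))^2 \<le> 2 * (2 * ep j)^2 + 2 * (cmod (T j z - f z))^2"
     using cmod_add_sq[of "\<phi> j z - T j z" "T j z - f z"] by simp
   qed (use iT in simp)
   also have "\<dots> = 2 * (2 * ep j)^2 + 2 * (LINT z|circ. (cmod (T j z - f z))^2)" using iT by simp
   also have "(LINT z|circ. (cmod (T j z - f z))^2) \<le> (1 - t j + 1 / (real (N j) + 1)) * cenergy f"
    unfolding T_def using t[of j] tN(2)[of j] f by (intro tpoly_L2) auto
   also have "\<dots> \<le> (1 - t j + 1 / (real j + 1)) * cenergy f"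
    using tN(5)[of j] by (intro mult_right_mono add_mono frac_le) auto
   finally show "(LINT z|circ. (cmod (\<phi> j z - f z))^2) \<le> ?b j" by simp
  qed
  have "t \<leadsto> 1"
   by (rule tendsto_sandwich[OF _ _ tseq_lim tendsto_const]) (use tN(1,2) in \<open>auto intro!: always_eventually simp: less_imp_le\<close>)
  moreover have "(\<lambda>j. 1 / (real j + 1)) \<leadsto> 0"
   using LIMSEQ_ignore_initial_segment[OF lim_1_over_n[where 'a=real], of 1] by (simp add: add.commute)
  ultimately have "?b \<leadsto> 2 * (2 * 0)^2 + 2 * ((1 - 1 + 0) * cenergy f)"
   by (intro tendsto_intros ep0)
  thus "?b \<leadsto> 0" by simp
 qed auto
 \<comment> \<open>The pointwise convergence needed for the difference quotients follows from the L2
   convergence only along a subsequence.\<close>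
 obtain r where r: "strict_mono r" "AE z in circ. (\<lambda>j. (cmod (\<phi> (r j) z - f z))^2) \<leadsto> 0"
  using tendsto_L1_AE_subseq[of circ "\<lambda>j z. (cmod (\<phi> j z - f z))^2"] i\<phi>f L2 by auto
 have AE: "AE p in circ2. (\<lambda>j. dquot (\<phi> (r j)) p) \<leadsto> dquot f p"
  using AE_circ2[OF r(2)]
 proof eventually_elim
  case (elim p)
  have *: "(\<lambda>j. \<phi> (r j) z) \<leadsto> f z" if "(\<lambda>j. (cmod (\<phi> (r j) z - f z))^2) \<leadsto> 0" for z
  proof -
   have "(\<lambda>j. cmod (\<phi> (r j) z - f z)) \<leadsto> 0"
    using tendsto_real_sqrt[OF that] by simp
   thus ?thesis by (rule LIM_zero_cancel[OF tendsto_norm_zero_cancel])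
  qed
  have "(\<lambda>j. (\<phi> (r j) (fst p) - \<phi> (r j) (snd p)) * inverse (fst p - snd p)) \<leadsto> (f (fst p) - f (snd p)) * inverse (fst p - snd p)"
   using elim by (intro tendsto_intros *) auto
  thus ?case by (simp add: dquot_def divide_inverse)
 qed
 have "(\<lambda>j. \<integral>p. (cmod (dquot (\<phi> (r j)) p - dquot f p))^2 \<partial>circ2) \<leadsto> 0"
 proof (rule L2_tendsto_of_norm_le[OF _ _ _ _ _ _ AE])
  show "(LINT p|circ2. (cmod (dquot (\<phi> (r j)) p))^2) \<le> (c \<circ> r) j" for j using en[of "r j"] by (simp add: cenergy_def)
  show "(c \<circ> r) \<leadsto> (LINT p|circ2. (cmod (dquot f p))^2)"
   using LIMSEQ_subseq_LIMSEQ[OF clim r(1)] by (simp add: cenergy_def)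
 qed (use f cm in \<open>auto simp: fin_energyD\<close>)
 hence E: "(\<lambda>j. cenergy (\<lambda>z. \<phi> (r j) z - f z)) \<leadsto> 0" by (simp add: cenergy_def dquot_diff)
 show ?thesis
  by (rule that[of "\<lambda>j. \<phi> (r j)"]) (use C cm E LIMSEQ_subseq_LIMSEQ[OF L2 r(1)] in \<open>auto simp: o_def\<close>)
qed

text \<open>The degree is continuous in energy and integral on a dense set, and the integers are
  closed.\<close>

lemma cdeg_int:
 assumes f: "circ_map f" shows "\<exists>m::int. cdeg f = of_int m"
proof -
 obtain \<phi> where \<phi>: "\<And>j::nat. \<exists>\<phi>'. circ_C1 (\<phi> j) \<phi>'" "\<And>j. circ_map (\<phi> j)"
  "(\<lambda>j. cenergy (\<lambda>z. \<phi> j z - f z)) \<leadsto> 0" by (rule circ_map_dense[OF f]) (rule that)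
 have "(\<lambda>j. cdeg (\<phi> j)) \<leadsto> cdeg f"
  by (rule cdeg_tendsto) (use \<phi> f in auto)
 hence "cdeg f \<in> \<int>"
 proof (rule closed_sequentially[OF closed_Ints, rotated])
  fix j
  obtain \<phi>' where "circ_C1 (\<phi> j) \<phi>'" using \<phi>(1)[of j] by blast
  from circ_C1_cdeg_int[OF this] \<phi>(2)[of j] obtain m :: int where "cdeg (\<phi> j) = of_int m"
   by (auto simp: circ_map_norm)
  thus "cdeg (\<phi> j) \<in> \<int>" by simp
 qed
 thus ?thesis by (auto simp: Ints_def)
qed

subsection \<open>Compactness and concentration\<close>

lemma cenergy_cong_AE:
 assumes "AE z in circ. f z = g z" "f \<in> borel_measurable circ" "g \<in> borel_measurable circ"
 shows "cenergy f = cenergy g"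
 unfolding cenergy_def
proof (rule integral_cong_AE)
 show "AE p in circ2. (cmod (dquot f p))^2 = (cmod (dquot g p))^2"
  using AE_circ2[OF assms(1)] by eventually_elim (simp add: dquot_def)
qed (use assms in auto)

lemma cdeg_cong_AE:
 assumes "AE z in circ. f z = g z" "f \<in> borel_measurable circ" "g \<in> borel_measurable circ"
 shows "cdeg f = cdeg g"
proof -
 note [measurable] = assms(2,3)
 have "fm f n = fm g n" "fp f n = fp g n" for n
  unfolding fm_def fp_def using assms(1) by (auto intro!: integral_cong_AE elim!: eventually_mono)
 thus ?thesis by (simp add: cdeg_def dc_def)
qed

lemma integral_square_le_tail:
 assumes d: "fin_energy d" and J: "J > 0"
 shows "(LINT z|circ. (cmod (d z))^2) \<le> (\<Sum>j<J. ac d j) + cenergy d / real J"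
proof (rule sums_le[OF _ parseval[OF d]])
 show "(\<lambda>j. (if j \<in> {..<J} then ac d j else 0) + real j * ac d j / real J) sums ((\<Sum>j<J. ac d j) + cenergy d / real J)"
  by (intro sums_add sums_divide energy_sums d sums_If_finite_set) simp
 fix j
 show "ac d j \<le> (if j \<in> {..<J} then ac d j else 0) + real j * ac d j / real J"
 proof (cases "j < J")
  case False
  hence "real J * ac d j \<le> real j * ac d j" by (intro mult_right_mono) auto
  thus ?thesis using False J by (simp add: field_simps)
 qed simp
qed

text \<open>A diagonal subsequence makes all Fourier coefficients converge. As the energy controls
  the high frequencies, this subsequence is Cauchy in L2 and hence in mean, so a further one
  converges almost everywhere; Fatou's lemma bounds the energy of the limit.\<close>

lemma circ_map_compact:
 fixes f :: "nat => complex => complex"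
 assumes f: "\<And>n. circ_map (f n)" and C: "\<And>n. cenergy (f n) \<le> C"
 obtains r g where "strict_mono r" "circ_map g" "AE z in circ. (\<lambda>n. f (r n) z) \<leadsto> g z"
proof -
 note [measurable] = circ_map_measurable[OF f]
 have C0: "C \<ge> 0" using order_trans[OF cenergy_nonneg C[of 0]] .
 define co where "co n = (\<lambda>(b, j). if b then fp (f n) j else fm (f n) j)" for n
 have "cmod (co n x) \<le> 1" for n x using circ_map_coeff_le[OF f, of n] by (cases x) (auto simp: co_def)
 from function_convergent_subsequence[of "UNIV :: (bool \<times> nat) set" co 1, OF _ this] obtain k where
  k: "strict_mono k" "\<And>x. \<exists>l. (\<lambda>n. co (k n) x) \<leadsto> l" by auto
 then obtain l where l: "\<And>x. (\<lambda>n. co (k n) x) \<leadsto> l x" by metis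
 have i: "integrable circ (f n)" for n
  by (rule circ_integrable_bounded[where B = 1]) (use f in \<open>auto simp: circ_map_norm\<close>)
 have small: "\<exists>N. \<forall>i\<ge>N. \<forall>j\<ge>N. (LINT z|circ. cmod (f (k i) z - f (k j) z)) < e" if e: "e > 0" for e
 proof -
  \<comment> \<open>\<open>4 C\<close> bounds the energy of the difference of two members, so the
    frequencies from \<open>J\<close> on use half of the budget \<open>e^2\<close>. The low ones use
    the other half, through \<open>h\<close>.\<close>
  obtain J :: nat where J: "J > 0" "4 * C / real J < e^2 / 2"
  proof -
   obtain J :: nat where "8 * C / e^2 < real J" using reals_Archimedean2 by blast
   hence "8 * C < real J * e^2" using e by (simp add: field_simps)
   also have "\<dots> \<le> real (Suc J) * e^2" by (intro mult_right_mono) auto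
   finally have "4 * C / real (Suc J) < e^2 / 2" by (simp add: divide_less_eq del: of_nat_Suc) (simp add: mult_ac)?
   thus ?thesis using that[of "Suc J"] by simp
  qed
  define h where "h n = (\<Sum>j<J. (cmod (co (k n) (True, j) - l (True, j)))^2 + (cmod (co (k n) (False, j) - l (False, j)))^2)" for n
  have "h \<leadsto> (\<Sum>j<J. (cmod (l (True, j) - l (True, j)))^2 + (cmod (l (False, j) - l (False, j)))^2)"
   unfolding h_def[abs_def] by (intro tendsto_intros l)
  hence "h \<leadsto> 0" by simp
  from order_tendstoD(2)[OF this, of "e^2 / 8"] e obtain N where N: "\<And>n. n \<ge> N ==> h n < e^2 / 8"
   by (auto simp: eventually_sequentially)
  have "(LINT z|circ. cmod (f (k m) z - f (k n) z)) < e" if "m \<ge> N" "n \<ge> N" for m n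
  proof -
   define d where "d z = f (k m) z - f (k n) z" for z
   have d: "fin_energy d" unfolding d_def by (intro fin_energy_diff) (use f in auto)
   have dE: "cenergy d \<le> 4 * C" using fin_energy_diff(2)[of "f (k m)" "f (k n)"] f C[of "k m"] C[of "k n"]
    by (simp add: d_def[abs_def])
   note [measurable] = fin_energy_measurable[OF d]
   have "ac d j \<le> 2 * ((cmod (co (k m) (True, j) - l (True, j)))^2 + (cmod (co (k m) (False, j) - l (False, j)))^2)
     + 2 * ((cmod (co (k n) (True, j) - l (True, j)))^2 + (cmod (co (k n) (False, j) - l (False, j)))^2)" for j
   proof -
    have "ac d j \<le> (cmod (fp d j))^2 + (cmod (fm d j))^2" by (simp add: ac_def)
    moreover have "(cmod (u - v))^2 \<le> 2 * (cmod (u - w))^2 + 2 * (cmod (v - w))^2" for u v w :: complex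
     using cmod_add_sq[of "u - w" "w - v"] by (simp add: norm_minus_commute)
    from this[of "fp (f (k m)) j" "fp (f (k n)) j" "l (True, j)"] this[of "fm (f (k m)) j" "fm (f (k n)) j" "l (False, j)"]
    have "(cmod (fp d j))^2 + (cmod (fm d j))^2 \<le> 2 * ((cmod (co (k m) (True, j) - l (True, j)))^2 + (cmod (co (k m) (False, j) - l (False, j)))^2)
     + 2 * ((cmod (co (k n) (True, j) - l (True, j)))^2 + (cmod (co (k n) (False, j) - l (False, j)))^2)"
     unfolding d_def[abs_def] by (simp add: fp_diff f co_def)
    ultimately show ?thesis by (rule order_trans)
   qed
   hence "(\<Sum>j<J. ac d j) \<le> (\<Sum>j<J. 2 * ((cmod (co (k m) (True, j) - l (True, j)))^2 + (cmod (co (k m) (False, j) - l (False, j)))^2)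
     + 2 * ((cmod (co (k n) (True, j) - l (True, j)))^2 + (cmod (co (k n) (False, j) - l (False, j)))^2))"
    by (rule sum_mono)
   also have "\<dots> = 2 * h m + 2 * h n" by (simp only: h_def sum.distrib sum_distrib_left[symmetric])
   also have "\<dots> < e^2 / 2" using N[OF that(1)] N[OF that(2)] by simp
   finally have "(LINT z|circ. (cmod (d z))^2) < e^2"
    using integral_square_le_tail[OF d J(1)] J(2) divide_right_mono[OF dE, of "real J"] by simp
   hence s: "sqrt (LINT z|circ. (cmod (d z))^2) < e" using e by (intro real_less_lsqrt) auto
   have "(LINT z|circ. \<bar>cmod (d z) * 1\<bar>) \<le> sqrt (LINT z|circ. (cmod (d z))^2) * sqrt (LINT z|circ. 1^2)"
   proof (rule integral_Cauchy_Schwarz)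
    show "integrable circ (\<lambda>z. (cmod (d z))^2)" by (rule fin_energy_square_integrable[OF d])
   qed auto
   thus ?thesis using s by (simp add: d_def)
  qed
  thus ?thesis by blast
 qed
 obtain r where r: "strict_mono r" "AE z in circ. Cauchy (\<lambda>n. f (k (r n)) z)"
  by (rule cauchy_L1_AE_cauchy_subseq[OF i, of k]) (rule small)
 \<comment> \<open>The default value 1 gives the limit modulus 1 at every point, also where the
   sequence does not converge.\<close>
 define g where "g z = (if cmod (lim (\<lambda>n. f (k (r n)) z)) = 1 then lim (\<lambda>n. f (k (r n)) z) else 1)" for z
 have gm [measurable]: "g \<in> borel_measurable circ"
  unfolding g_def[abs_def] by measurable
 have gu: "cmod (g z) = 1" for z by (simp add: g_def)
 have AE: "AE z in circ. (\<lambda>n. f (k (r n)) z) \<leadsto> g z"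
  using r(2) AE_space
 proof eventually_elim
  case (elim z)
  hence z: "cmod z = 1" by simp
  from Cauchy_convergent[OF elim(1)] have "(\<lambda>n. f (k (r n)) z) \<leadsto> lim (\<lambda>n. f (k (r n)) z)"
   by (simp add: convergent_LIMSEQ_iff)
  moreover from tendsto_norm[OF this] have "cmod (lim (\<lambda>n. f (k (r n)) z)) = 1"
   using circ_map_norm[OF f z] by (simp add: LIMSEQ_const_iff)
  ultimately show ?case by (simp add: g_def)
 qed
 have "circ_map g"
 proof -
  have "(\<integral>\<^sup>+p. ennreal ((cmod (dquot g p))^2) \<partial>circ2) \<le> (\<integral>\<^sup>+p. liminf (\<lambda>n. ennreal ((cmod (dquot (f (k (r n))) p))^2)) \<partial>circ2)"
  proof (rule nn_integral_mono_AE)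
   show "AE p in circ2. ennreal ((cmod (dquot g p))^2) \<le> liminf (\<lambda>n. ennreal ((cmod (dquot (f (k (r n))) p))^2))"
    using AE_circ2[OF AE]
   proof eventually_elim
    case (elim p)
    have "(\<lambda>n. (cmod ((f (k (r n)) (fst p) - f (k (r n)) (snd p)) * inverse (fst p - snd p)))^2) \<leadsto> (cmod ((g (fst p) - g (snd p)) * inverse (fst p - snd p)))^2"
     using elim by (intro tendsto_intros) auto
    hence "(\<lambda>n. ennreal ((cmod (dquot (f (k (r n))) p))^2)) \<leadsto> ennreal ((cmod (dquot g p))^2)"
     by (simp add: dquot_def divide_inverse tendsto_ennrealI)
    from lim_imp_Liminf[OF _ this] show ?case by simp
   qed
  qed
  also have "\<dots> \<le> liminf (\<lambda>n. \<integral>\<^sup>+p. ennreal ((cmod (dquot (f (k (r n))) p))^2) \<partial>circ2)"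
   by (rule nn_integral_liminf) measurable
  also have "\<dots> \<le> ennreal C"
  proof -
   have "(\<integral>\<^sup>+p. ennreal ((cmod (dquot (f n) p))^2) \<partial>circ2) \<le> ennreal C" for n
    using C[of n] f[of n] by (subst nn_integral_eq_integral) (auto simp: fin_energyD cenergy_def intro!: ennreal_leI)
   thus ?thesis by (intro Liminf_le) (auto simp: eventually_sequentially)
  qed
  finally have "(\<integral>\<^sup>+p. ennreal ((cmod (dquot g p))^2) \<partial>circ2) < \<infinity>"
   using ennreal_less_top le_less_trans by (simp add: le_less_trans)
  hence "integrable circ2 (\<lambda>p. (cmod (dquot g p))^2)"
   by (intro integrableI_bounded) auto
  thus ?thesis using gu unfolding circ_map_def fin_energy_def by (auto intro!: exI[of _ 1])
 qed
 thus ?thesis using that[of "k \<circ> r" g] AE strict_mono_o[OF k(1) r(1)] by (simp add: o_def)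
qed

lemma cenergy_mult_le:
 assumes f: "circ_map f" and g: "circ_map g"
 shows "cenergy (\<lambda>z. f z * g z) \<le> cenergy f + cenergy g + 2 * (sqrt (cenergy f) * sqrt (cenergy g))"
 using cenergy_mult[OF f g] integral_interact_le[OF f g] by simp

lemma cdeg_quotient:
 assumes f: "circ_map f" and g: "circ_map g"
 shows "cdeg (\<lambda>z. f z * cnj (g z)) = cdeg f - cdeg g"
 using cdeg_mult[OF f circ_map_cnj[OF g]] cdeg_cnj[OF circ_map_fin_energy[OF g]] by simp

text \<open>Write \<open>f n = g * b n\<close> with \<open>b n = f n * cnj g\<close>, which tends to
  1 almost everywhere. The interaction of \<open>g\<close> with \<open>b n\<close> then vanishes in
  the limit, so the energies add up, and that of \<open>b n\<close> is at least the absolute value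
  of its degree \<open>d - cdeg g\<close>.\<close>

lemma energy_concentration:
 assumes f: "\<And>n. circ_map (f n)" and d: "\<And>n. cdeg (f n) = d" and m: "(\<lambda>n. cenergy (f n)) \<leadsto> m"
  and g: "circ_map g" and AE: "AE z in circ. (\<lambda>n. f n z) \<leadsto> g z"
 shows "cenergy g + \<bar>d - cdeg g\<bar> \<le> m"
proof -
 define b where "b n z = f n z * cnj (g z)" for n z
 have b: "circ_map (b n)" for n unfolding b_def by (intro circ_map_mult circ_map_cnj f g)
 note [measurable] = circ_map_measurable[OF f] circ_map_measurable[OF g] circ_map_measurable[OF b]
 have gg: "g z * cnj (g z) = 1" if "cmod z = 1" for z
  using circ_map_norm[OF g that] complex_norm_square[of "g z"] by simp
 from convergent_imp_Bseq[OF convergentI[OF m]] obtain K where K: "\<And>n. \<bar>cenergy (f n)\<bar> \<le> K"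
  by (auto simp: Bseq_def)
 have C: "cenergy (b n) \<le> K + cenergy g + 2 * (sqrt K * sqrt (cenergy g))" for n
 proof -
  have fK: "cenergy (f n) \<le> K" using K[of n] by simp
  have "cenergy (b n) \<le> cenergy (f n) + cenergy g + 2 * (sqrt (cenergy (f n)) * sqrt (cenergy g))"
   using cenergy_mult_le[OF f circ_map_cnj[OF g], of n] by (simp add: b_def[abs_def] fin_energy_cnj(2))
  also have "\<dots> \<le> K + cenergy g + 2 * (sqrt K * sqrt (cenergy g))"
   using fK by (intro add_mono mult_left_mono mult_right_mono) auto
  finally show ?thesis .
 qed
 have "(\<lambda>n. integral\<^sup>L circ2 (interact g (b n))) \<leadsto> 0"
 proof (rule integral_interact_tendsto_0[OF g b C])
  show "AE p in circ2. (\<lambda>n. b n (fst p) - b n (snd p)) \<leadsto> 0"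
   using AE_circ2[OF AE] AE_space
  proof eventually_elim
   case (elim p)
   have "(\<lambda>n. b n (fst p) - b n (snd p)) \<leadsto> g (fst p) * cnj (g (fst p)) - g (snd p) * cnj (g (snd p))"
    unfolding b_def using elim by (intro tendsto_intros) auto
   thus ?case using elim gg by auto
  qed
 qed
 hence lim: "(\<lambda>n. cenergy (f n) + 2 * integral\<^sup>L circ2 (interact g (b n))) \<leadsto> m + 2 * 0"
  by (intro tendsto_intros m)
 have "cenergy g + \<bar>d - cdeg g\<bar> \<le> cenergy (f n) + 2 * integral\<^sup>L circ2 (interact g (b n))" for n
 proof -
  have "cenergy (f n) = cenergy (\<lambda>z. g z * b n z)"
  proof (rule cenergy_cong_AE)
   show "AE z in circ. f n z = g z * b n z"
   proof (rule AE_I2)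
    fix z assume "z \<in> space circ"
    hence "g z * cnj (g z) = 1" using gg by simp
    thus "f n z = g z * b n z" by (simp add: b_def mult_ac)
   qed
  qed measurable
  also have "\<dots> = cenergy g + cenergy (b n) - 2 * integral\<^sup>L circ2 (interact g (b n))"
   by (rule cenergy_mult[OF g b])
  finally have 1: "cenergy (f n) + 2 * integral\<^sup>L circ2 (interact g (b n)) = cenergy g + cenergy (b n)" by simp
  have "cdeg (b n) = d - cdeg g" using cdeg_quotient[OF f g, of n] d by (simp add: b_def[abs_def])
  hence "\<bar>d - cdeg g\<bar> \<le> cenergy (b n)" using abs_cdeg_le[of "b n"] b[of n] by simp
  thus ?thesis using 1 by simp
 qed
 from LIMSEQ_le_const[OF lim] this show ?thesis by auto
qed

subsection \<open>Inserting a bubble\<close>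

lemma bub_ReIm:
 assumes "cmod e = 1" "cmod z = 1" "0 \<le> t" "t < 1"
 defines "x \<equiv> z * cnj e"
 defines "A \<equiv> 1 - 2 * t * Re x + t^2"
 shows "A > 0" "Re (bub t e z) = (2 * t - (1 + t^2) * Re x) / A" "Im (bub t e z) = - (1 - t^2) * Im x / A"
  "pk t (e, z) = (1 - t^2) / A"
proof -
 let ?O = "1 - of_real t * x"
 have x1: "cmod x = 1" using assms(1,2) by (simp add: x_def norm_mult)
 hence r: "(Re x)^2 + (Im x)^2 = 1" by (metis cmod_power2 one_power2)
 have ee: "e * cnj e = 1" "cnj e * e = 1" using complex_norm_square[of e] assms(1) by (auto simp: mult.commute)
 hence z: "z = e * x" by (simp add: x_def)
 have Aeq: "A = (cmod ?O)^2"
  unfolding cmod_power2 A_def using r by (simp add: power2_eq_square) algebra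
 have den: "e - of_real t * z = e * ?O" by (simp add: z algebra_simps)
 have nz: "1 - of_real t * x \<noteq> 0" using bub_denom_nz[OF assms(1-4)] den by auto
 show A: "A > 0" unfolding Aeq using nz by simp
 have "e \<noteq> 0" using assms(1) by auto
 have "bub t e z = (e * (of_real t - x)) / (e * ?O)"
  unfolding bub_def den by (simp add: z algebra_simps)
 also have "\<dots> = (of_real t - x) / ?O" using \<open>e \<noteq> 0\<close> by simp
 also have "\<dots> = (of_real t - x) * cnj ?O / (?O * cnj ?O)"
  by (rule mult_divide_mult_cancel_right[symmetric]) (use nz complex_cnj_zero_iff in blast)
 also have "?O * cnj ?O = of_real A" unfolding Aeq complex_norm_square ..
 also have "(of_real t - x) * cnj ?O = Complex (2 * t - (1 + t^2) * Re x) (- (1 - t^2) * Im x)"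
  using r by (simp add: complex_eq_iff power2_eq_square) algebra
 finally show "Re (bub t e z) = (2 * t - (1 + t^2) * Re x) / A" "Im (bub t e z) = - (1 - t^2) * Im x / A"
  by (simp_all add: Re_divide_of_real Im_divide_of_real)
 show "pk t (e, z) = (1 - t^2) / A"
  unfolding pk_bub_denom[OF assms(1,2)] Aeq den using assms(1) by (simp add: norm_mult)
qed

text \<open>After rotation to \<open>e = 1\<close> this is an identity of rational functions. Its
  purpose: apart from a multiple of the kernel \<open>bk\<close>, the sine of the phase difference
  of a bubble becomes a difference of values of the single function \<open>Im (bub t e)\<close>, a
  form which the Euler-Lagrange equation can treat.\<close>

lemma bub_identity:
 assumes "cmod e = 1" "cmod z = 1" "cmod w = 1" "0 \<le> t" "t < 1"
 shows "(1 + t^2) * Im (cross (bub t e) (z, w)) =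
  2 * t * (Im (bub t e z) - Im (bub t e w)) + (1 - t^2) * bk t e (z, w) * Im (zeta (z, w))"
proof -
 let ?x = "z * cnj e" let ?y = "w * cnj e"
 define x1 x2 y1 y2 where xy: "x1 = Re ?x" "x2 = Im ?x" "y1 = Re ?y" "y2 = Im ?y"
 define A C where AC: "A = 1 - 2 * t * x1 + t^2" "C = 1 - 2 * t * y1 + t^2"
 note bx = bub_ReIm[OF assms(1,2,4,5), folded xy, folded AC]
 note by' = bub_ReIm[OF assms(1,3,4,5), folded xy, folded AC]
 have "cnj e * e = 1" using complex_norm_square[of e] assms(1) by (simp add: mult.commute)
 hence "?x * cnj ?y = z * cnj w" by (simp add: mult_ac)
 hence zeta: "Im (zeta (z, w)) = x2 * y1 - x1 * y2"
 proof -
  have "Im (a * cnj b) = Im a * Re b - Re a * Im b" for a b by simp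
  from this[of ?x ?y] show ?thesis
   unfolding zeta_def fst_conv snd_conv \<open>?x * cnj ?y = z * cnj w\<close> xy .
 qed
 have nz: "A \<noteq> 0" "C \<noteq> 0" using bx(1) by'(1) by auto
 have cr: "Im (cross (bub t e) (z, w)) = Im (bub t e z) * Re (bub t e w) - Re (bub t e z) * Im (bub t e w)"
  by (simp add: cross_def)
 have "(1 + t^2) * Im (cross (bub t e) (z, w)) * (A * C) = (2 * t * (Im (bub t e z) - Im (bub t e w)) + (1 - t^2) * bk t e (z, w) * Im (zeta (z, w))) * (A * C)"
 proof -
  define b1 b2 c1 c2 P Q where bc: "b1 = Re (bub t e z)" "b2 = Im (bub t e z)" "c1 = Re (bub t e w)" "c2 = Im (bub t e w)"
   "P = pk t (e, z)" "Q = pk t (e, w)"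
  have "b1 * A = 2 * t - (1 + t^2) * x1" "b2 * A = - (1 - t^2) * x2" "P * A = 1 - t^2"
   "c1 * C = 2 * t - (1 + t^2) * y1" "c2 * C = - (1 - t^2) * y2" "Q * C = 1 - t^2"
   using bx by' nz by (simp_all add: bc)
  hence "(1 + t^2) * (b2 * c1 - b1 * c2) * (A * C) = (2 * t * (b2 - c2) + (1 - t^2) * (P * Q) * (x2 * y1 - x1 * y2)) * (A * C)"
   using AC by algebra
  thus ?thesis unfolding cr zeta by (simp add: bc bk_def)
 qed
 thus ?thesis using nz by simp
qed

text \<open>The previous identity is inserted into the interaction. The differences of
  \<open>Im (bub t e)\<close> are kept on the left, where they form a first variation of the energy
  of \<open>f\<close>; on the right the bubble is present only through the nonnegative kernel
  \<open>bk\<close>.\<close>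

lemma bub_interact_identity:
 assumes f: "circ_map f" and "cmod e = 1" "cmod z = 1" "cmod w = 1" "0 \<le> t" "t < 1"
 shows "interact f (bub t e) (z, w) + 2 * t / (1 + t^2) * (Im (cross f (z, w)) * (Im (bub t e z) - Im (bub t e w)) / (cdist (z, w))^2)
  = bk t e (z, w) * (1 - Re (cross f (z, w))) / 2 - (1 - t^2) / (1 + t^2) * (bk t e (z, w) * (ck (z, w) * Im (cross f (z, w)))) / 2"
proof (cases "z = w")
 case True
 have "cross f (w, w) = 1"
  using complex_norm_square[of "f w"] circ_map_norm[OF f assms(4)] by (simp add: cross_def)
 thus ?thesis using True by (simp add: interact_def cdist_def)
next
 case False
 define D where "D = (cdist (z, w))^2"
 have D: "D > 0" using False by (simp add: D_def cdist_def)
 define u v where uv: "u = Re (cross f (z, w))" "v = Im (cross f (z, w))"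
 let ?B = "cross (bub t e) (z, w)"
 have B1: "1 - Re ?B = bk t e (z, w) * D / 2"
 proof -
  have "(cmod (bub t e z - bub t e w))^2 = 2 - 2 * Re ?B"
   using cmod_bub[OF assms(2,3,5,6)] cmod_bub[OF assms(2,4,5,6)]
   unfolding cross_def cmod_power2 by (auto simp: cmod_def power2_eq_square algebra_simps)
  thus ?thesis using cmod_bub_diff[OF assms(2-6)] by (simp add: bk_def D_def)
 qed
 have t2: "1 + t^2 > 0" by (simp add: add_pos_nonneg)
 have B2: "Im ?B - 2 * t / (1 + t^2) * (Im (bub t e z) - Im (bub t e w)) = (1 - t^2) / (1 + t^2) * (bk t e (z, w) * Im (zeta (z, w)))"
  using bub_identity[OF assms(2-6)] t2 by (simp add: field_simps)
 have B3: "Im (zeta (z, w)) = ck (z, w) * D / 2" using D by (simp add: ck_def D_def)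
 have "interact f (bub t e) (z, w) = ((1 - u) * (1 - Re ?B) - v * Im ?B) / D"
  by (simp add: interact_def uv D_def)
 hence "interact f (bub t e) (z, w) + 2 * t / (1 + t^2) * (v * (Im (bub t e z) - Im (bub t e w)) / D)
  = ((1 - u) * (1 - Re ?B) - v * (Im ?B - 2 * t / (1 + t^2) * (Im (bub t e z) - Im (bub t e w)))) / D"
 proof -
  have gen: "(a - v * y) / D + k * (v * d / D) = (a - v * (y - k * d)) / D" for a y k d
   by (simp add: diff_divide_distrib right_diff_distrib mult.left_commute)
  assume "interact f (bub t e) (z, w) = ((1 - u) * (1 - Re ?B) - v * Im ?B) / D"
  thus ?thesis by (simp only: gen)
 qed
 also have "\<dots> = bk t e (z, w) * (1 - u) / 2 - (1 - t^2) / (1 + t^2) * (bk t e (z, w) * (ck (z, w) * v)) / 2"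
 proof -
  have gen: "((1 - u) * (b * D / 2) - v * (k * (b * (c * D / 2)))) / D = b * (1 - u) / 2 - k * (b * (c * v)) / 2" for b c k
   using D by (simp add: field_simps)
  show ?thesis unfolding B1 B2 B3 by (rule gen)
 qed
 finally show ?thesis by (simp add: uv D_def)
qed

text \<open>Multiplication by \<open>cnj (lift \<eta>)\<close> turns the phase by \<open>- \<eta>\<close> to first order without changing the degree.\<close>

definition lift :: "(complex => real) => complex => complex" where
 "lift \<eta> z = Complex (sqrt (1 - (\<eta> z)^2)) (\<eta> z)"

text \<open>The lift inherits Lipschitz constant \<open>2 s\<close> from \<open>\<eta>\<close>. For
  \<open>s \<le> 1/3\<close> its energy is at most 4/9, and since the degree is an integer bounded
  by the energy, it must be 0.\<close>

lemma lift_props: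
 fixes \<eta> :: "complex => real"
 assumes [measurable]: "\<eta> \<in> borel_measurable circ" and s: "0 \<le> s" "s \<le> 1/3"
  and b: "\<And>z. cmod z = 1 ==> \<bar>\<eta> z\<bar> \<le> s"
  and l: "\<And>z w. cmod z = 1 ==> cmod w = 1 ==> \<bar>\<eta> z - \<eta> w\<bar> \<le> s * cmod (z - w)"
 shows "circ_map (lift \<eta>)" "cenergy (lift \<eta>) \<le> 4 * s^2" "cdeg (lift \<eta>) = 0"
  "\<And>z w. cmod z = 1 ==> cmod w = 1 ==> \<bar>Im (cross (lift \<eta>) (z, w)) - (\<eta> z - \<eta> w)\<bar> \<le> 2 * s^2 * cmod (z - w)"
  "\<And>z w. cmod z = 1 ==> cmod w = 1 ==> cmod (lift \<eta> z - lift \<eta> w) \<le> 2 * s * cmod (z - w)"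
proof -
 define R where "R z = sqrt (1 - (\<eta> z)^2)" for z
 have e2: "(\<eta> z)^2 \<le> s^2" "s^2 \<le> 1/9" if "cmod z = 1" for z
  using power_mono[OF b[OF that], of 2] power_mono[OF s(2,1), of 2] by (auto simp: power2_eq_square)
 have R: "1/2 \<le> R z" "1 - R z \<le> s^2" "R z \<le> 1" "(R z)^2 = 1 - (\<eta> z)^2" if "cmod z = 1" for z
 proof -
  show "1/2 \<le> R z" unfolding R_def using e2[OF that] by (intro real_le_rsqrt) (auto simp: power2_eq_square)
  show "R z \<le> 1" unfolding R_def by (intro real_le_lsqrt) auto
  show "(R z)^2 = 1 - (\<eta> z)^2" unfolding R_def using e2[OF that] by simp
  hence "1 - s^2 \<le> (R z)^2" using e2[OF that] by simp
  also have "\<dots> \<le> R z" using \<open>R z \<le> 1\<close> \<open>1/2 \<le> R z\<close> by (simp add: power2_eq_square mult_left_le)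
  finally show "1 - R z \<le> s^2" by simp
 qed
 have RL: "\<bar>R z - R w\<bar> \<le> \<bar>\<eta> z - \<eta> w\<bar>" if "cmod z = 1" "cmod w = 1" for z w
 proof -
  have "(R z - R w) * (R z + R w) = - ((\<eta> z - \<eta> w) * (\<eta> z + \<eta> w))"
   using R(4)[OF that(1)] R(4)[OF that(2)] by (simp add: power2_eq_square algebra_simps)
  hence "\<bar>R z - R w\<bar> * \<bar>R z + R w\<bar> = \<bar>\<eta> z - \<eta> w\<bar> * \<bar>\<eta> z + \<eta> w\<bar>"
   by (metis abs_minus_cancel abs_mult)
  also have "\<dots> \<le> \<bar>\<eta> z - \<eta> w\<bar> * 1"
   using b[OF that(1)] b[OF that(2)] s by (intro mult_left_mono) auto
  finally have 1: "\<bar>R z - R w\<bar> * \<bar>R z + R w\<bar> \<le> \<bar>\<eta> z - \<eta> w\<bar>" by simp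
  have "\<bar>R z - R w\<bar> * 1 \<le> \<bar>R z - R w\<bar> * \<bar>R z + R w\<bar>"
   using R(1)[OF that(1)] R(1)[OF that(2)] by (intro mult_left_mono) auto
  with 1 show ?thesis by simp
 qed
 have lip: "cmod (lift \<eta> z - lift \<eta> w) \<le> 2 * s * cmod (z - w)" if "cmod z = 1" "cmod w = 1" for z w
 proof -
  have "cmod (lift \<eta> z - lift \<eta> w) \<le> \<bar>R z - R w\<bar> + \<bar>\<eta> z - \<eta> w\<bar>"
   using cmod_le[of "lift \<eta> z - lift \<eta> w"] by (simp add: lift_def R_def)
  thus ?thesis using RL[OF that] l[OF that] by simp
 qed
 thus "\<And>z w. cmod z = 1 ==> cmod w = 1 ==> cmod (lift \<eta> z - lift \<eta> w) \<le> 2 * s * cmod (z - w)" .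
 have m: "lift \<eta> \<in> borel_measurable circ" unfolding lift_def[abs_def] Complex_eq by measurable
 have fe: "fin_energy (lift \<eta>)" "cenergy (lift \<eta>) \<le> (2 * s)^2"
  by (rule fin_energy_lipschitz[OF m, where L = "2 * s"]; use lip s in simp)+
 show cm: "circ_map (lift \<eta>)" unfolding circ_map_def
 proof (intro conjI allI impI fe(1))
  fix z :: complex assume z: "cmod z = 1"
  have "(cmod (lift \<eta> z))^2 = 1" using R(4)[OF z] unfolding cmod_power2 by (simp add: lift_def R_def)
  thus "cmod (lift \<eta> z) = 1" unfolding power2_eq_1_iff using norm_ge_zero[of "lift \<eta> z"] by linarith
 qed
 show "cenergy (lift \<eta>) \<le> 4 * s^2" using fe(2) by (simp add: power_mult_distrib)
 show "cdeg (lift \<eta>) = 0"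
 proof -
  obtain n :: int where n: "cdeg (lift \<eta>) = of_int n" using cdeg_int[OF cm] by blast
  have "\<bar>cdeg (lift \<eta>)\<bar> < 1" using abs_cdeg_le[OF fe(1)] fe(2) e2(2)[of 1] by (simp add: power_mult_distrib)
  hence "\<bar>n\<bar> < 1" unfolding n by linarith
  thus ?thesis using n by simp
 qed
 fix z w :: complex assume zw: "cmod z = 1" "cmod w = 1"
 have "Im (cross (lift \<eta>) (z, w)) = \<eta> z * R w - R z * \<eta> w" by (simp add: cross_def lift_def R_def)
 hence "Im (cross (lift \<eta>) (z, w)) - (\<eta> z - \<eta> w) = (\<eta> z - \<eta> w) * (R w - 1) + \<eta> w * (R w - R z)"
  by (simp add: algebra_simps)
 also have "\<bar>\<dots>\<bar> \<le> \<bar>\<eta> z - \<eta> w\<bar> * s^2 + s * \<bar>\<eta> z - \<eta> w\<bar>"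
  using R(2,3)[OF zw(2)] b[OF zw(2)] RL[OF zw(2,1)] s
  by (intro order_trans[OF abs_triangle_ineq] add_mono) (auto simp: abs_mult abs_minus_commute[of "\<eta> w"] intro!: mult_mono)
 also have "\<dots> \<le> 2 * s * \<bar>\<eta> z - \<eta> w\<bar>"
 proof -
  have "s^2 \<le> s" using s by (simp add: power2_eq_square mult_left_le)
  from mult_left_mono[OF this, of "\<bar>\<eta> z - \<eta> w\<bar>"] show ?thesis by (simp add: algebra_simps)
 qed
 also have "\<dots> \<le> 2 * s * (s * cmod (z - w))" using l[OF zw] s by (intro mult_left_mono) auto
 finally show "\<bar>Im (cross (lift \<eta>) (z, w)) - (\<eta> z - \<eta> w)\<bar> \<le> 2 * s^2 * cmod (z - w)"
  by (simp add: power2_eq_square mult_ac)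
qed

lemma integral_abs_dquot_le_1:
 assumes "fin_energy f" "cenergy f \<le> 1"
 shows "(LINT p|circ2. cmod (dquot f p)) \<le> 1"
proof -
 have "(LINT p|circ2. cmod (dquot f p)) \<le> (LINT p|circ2. (1 + (cmod (dquot f p))^2) / 2)"
 proof (rule integral_mono[OF integrable_dquot[OF assms(1)]])
  show "integrable circ2 (\<lambda>p. (1 + (cmod (dquot f p))^2) / 2)" using fin_energyD[OF assms(1)] by simp
  show "cmod (dquot f p) \<le> (1 + (cmod (dquot f p))^2) / 2" for p
   using sum_squares_bound[of 1 "cmod (dquot f p)"] by simp
 qed
 also have "\<dots> = (1 + cenergy f) / 2" using fin_energyD[OF assms(1)] by (simp add: cenergy_def)
 finally show ?thesis using assms(2) by simp
qed

lemma Im_cross_cdist: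
 assumes f: "circ_map f" and "cmod z = 1" "cmod w = 1"
 shows "\<bar>Im (cross f (z, w))\<bar> / cdist (z, w) \<le> cmod (dquot f (z, w))"
proof -
 have "\<bar>Im (cross f (z, w))\<bar> \<le> 1 * cmod (f z - f w)"
  by (rule Im_cross_le) (use assms in \<open>auto simp: circ_map_norm\<close>)
 thus ?thesis by (simp add: cmod_dquot divide_right_mono)
qed

text \<open>Up to a constant factor, the integral is the first variation of the energy of
  \<open>f\<close> when its phase is moved by \<open>\<psi>\<close>. It converges because the
  numerator is bounded by \<open>cmod (f z - f w)\<close> times a multiple of the distance.\<close>

lemma integrable_Im_cross_lip:
 fixes \<psi> :: "complex => real"
 assumes f: "circ_map f" and [measurable]: "\<psi> \<in> borel_measurable circ"
  and l: "\<And>z w. cmod z = 1 ==> cmod w = 1 ==> \<bar>\<psi> z - \<psi> w\<bar> \<le> s * cmod (z - w)"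
 shows "integrable circ2 (\<lambda>p. Im (cross f p) * (\<psi> (fst p) - \<psi> (snd p)) / (cdist p)^2)"
  "\<bar>\<integral>p. Im (cross f p) * (\<psi> (fst p) - \<psi> (snd p)) / (cdist p)^2 \<partial>circ2\<bar> \<le> s * (LINT p|circ2. cmod (dquot f p))"
proof -
 note [measurable] = circ_map_measurable[OF f]
 let ?F = "\<lambda>p. Im (cross f p) * (\<psi> (fst p) - \<psi> (snd p)) / (cdist p)^2"
 have b: "\<bar>?F (z, w)\<bar> \<le> s * cmod (dquot f (z, w))" if zw: "cmod z = 1" "cmod w = 1" for z w
 proof (cases "cdist (z, w) = 0")
  case False
  hence c: "cdist (z, w) > 0" using cdist_nonneg[of "(z, w)"] by linarith
  have "\<bar>?F (z, w)\<bar> = (\<bar>Im (cross f (z, w))\<bar> / cdist (z, w)) * (\<bar>\<psi> z - \<psi> w\<bar> / cdist (z, w))"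
   by (simp add: abs_mult power2_eq_square)
  also have "\<dots> \<le> cmod (dquot f (z, w)) * s"
   using c l[OF zw] by (intro mult_mono Im_cross_cdist[OF f zw]) (auto simp: field_simps cdist_def)
  finally show ?thesis by (simp add: mult.commute)
 qed (simp add: cmod_dquot)
 have i: "integrable circ2 (\<lambda>p. s * cmod (dquot f p))" using integrable_dquot[of f] f by simp
 show I: "integrable circ2 ?F"
  by (rule B_integrable_bound[OF i]) (use b in \<open>force intro!: AE_I2\<close>)+
 have "\<bar>integral\<^sup>L circ2 ?F\<bar> \<le> (LINT p|circ2. \<bar>?F p\<bar>)" by (rule integral_abs_bound)
 also have "\<dots> \<le> (LINT p|circ2. s * cmod (dquot f p))"
  by (rule integral_mono[OF integrable_abs[OF I] i]) (use b in force)
 finally show "\<bar>integral\<^sup>L circ2 ?F\<bar> \<le> s * (LINT p|circ2. cmod (dquot f p))" by simp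
qed

text \<open>The last integral is the first-order effect of the correction. The terms with
  \<open>s^2\<close> are quadratic errors; the mixed error carries only one factor \<open>s\<close>,
  but also the L1 norm of \<open>dquot b\<close>, which tends to 0 for a concentrating
  bubble.\<close>

lemma circ_map_mult_lift:
 fixes \<eta> :: "complex => real"
 assumes f: "circ_map f" and bm: "circ_map b"
  and [measurable]: "\<eta> \<in> borel_measurable circ" and s: "0 \<le> s" "s \<le> 1/3"
  and bd: "\<And>z. cmod z = 1 ==> \<bar>\<eta> z\<bar> \<le> s"
  and l: "\<And>z w. cmod z = 1 ==> cmod w = 1 ==> \<bar>\<eta> z - \<eta> w\<bar> \<le> s * cmod (z - w)"
 defines "v \<equiv> \<lambda>z. f z * b z * cnj (lift \<eta> z)"
 shows "circ_map v" "cdeg v = cdeg f + cdeg b"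
  "cenergy v \<le> cenergy f + cenergy b + 4 * s^2 + 4 * s^2 * (LINT p|circ2. cmod (dquot f p)) + 4 * s * (LINT p|circ2. cmod (dquot b p))
   - 2 * (LINT p|circ2. interact f b p) - 2 * (LINT p|circ2. Im (cross f p) * (\<eta> (fst p) - \<eta> (snd p)) / (cdist p)^2)"
proof -
 let ?E = "\<lambda>z w. \<eta> z - \<eta> w"
 let ?L = "\<lambda>z. cnj (lift \<eta> z)"
 let ?A = "\<lambda>z. f z * b z"
 let ?N = "LINT p|circ2. cmod (dquot f p)"
 let ?T = "LINT p|circ2. cmod (dquot b p)"
 note L = lift_props[OF assms(3) s bd l]
 have H: "circ_map (lift \<eta>)" "cenergy (lift \<eta>) \<le> 4 * s^2" "cdeg (lift \<eta>) = 0"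
  by (rule L; assumption)+
 note fb = circ_map_mult[OF f bm]
 note cH = circ_map_cnj[OF H(1)]
 note [measurable] = circ_map_measurable[OF f] circ_map_measurable[OF bm] circ_map_measurable[OF H(1)]
 show "circ_map v" unfolding v_def by (rule circ_map_mult[OF fb cH])
 show "cdeg v = cdeg f + cdeg b"
  unfolding v_def using cdeg_quotient[OF fb H(1)] cdeg_mult[OF f bm] H(3) by simp
 let ?D = "\<lambda>p. Im (cross f p) * (\<eta> (fst p) - \<eta> (snd p)) / (cdist p)^2"
 let ?I = "interact ?A ?L"
 have iD: "integrable circ2 ?D" by (rule integrable_Im_cross_lip(1)[OF f, where s = s]) (use l in auto)
 note iI = integrable_interact[OF fb cH]
 note if' = integrable_dquot[OF circ_map_fin_energy[OF f]]
 note ib = integrable_dquot[OF circ_map_fin_energy[OF bm]]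
 have pt: "?D (z, w) - 2 * s^2 * cmod (dquot f (z, w)) - 2 * s * cmod (dquot b (z, w)) \<le> ?I (z, w)"
  if zw: "cmod z = 1" "cmod w = 1" for z w
 proof (cases "cdist (z, w) = 0")
  case True
  thus ?thesis by (simp add: interact_def cmod_dquot)
 next
  case False
  hence c: "cdist (z, w) > 0" using cdist_nonneg[of "(z, w)"] by linarith
  let ?c = "cdist (z, w)"
  define U B J where UBJ: "U = cross f (z, w)" "B = cross b (z, w)" "J = cross (lift \<eta>) (z, w)"
  have cr: "cross ?A (z, w) = U * B" "cross ?L (z, w) = cnj J"
   by (simp_all add: UBJ cross_def)
  have nU: "cmod U = 1" "cmod B = 1" "cmod J = 1"
   using zw f bm H(1) by (auto simp: UBJ cross_def norm_mult circ_map_norm)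
  have r: "Re (U * B) \<le> 1" "Re J \<le> 1"
   using complex_Re_le_cmod[of "U * B"] complex_Re_le_cmod[of J] nU by (auto simp: norm_mult)
  have gen: "Re ((1 - X) * (1 - cnj Y)) = (1 - Re X) * (1 - Re Y) + Im X * Im Y" for X Y
   by (simp add: algebra_simps)
  \<comment> \<open>This product of real parts lowers the energy and is dropped; only the product of
    imaginary parts remains to be estimated.\<close>
  have "0 \<le> (1 - Re (U * B)) * (1 - Re J)" using r by (intro mult_nonneg_nonneg) auto
  hence 1: "Im (U * B) * Im J \<le> Re ((1 - U * B) * (1 - cnj J))" unfolding gen by linarith
  have a1: "\<bar>Im U\<bar> \<le> cmod (f z - f w)"
   using Im_cross_le[of f 1 z w] zw f by (simp add: UBJ circ_map_norm)
  have a2: "\<bar>Im J - (?E z w)\<bar> \<le> 2 * s^2 * ?c"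
   unfolding UBJ cdist_def fst_conv snd_conv by (rule L(4); (assumption | rule zw))
  have "cmod (lift \<eta> z - lift \<eta> w) \<le> 2 * s * cmod (z - w)" by (rule L(5); (assumption | rule zw))
  hence a3: "\<bar>Im J\<bar> \<le> 2 * s * ?c"
   using Im_cross_le[of "lift \<eta>" 1 z w] zw H(1) by (simp add: UBJ circ_map_norm cdist_def)
  have "Im (U * B) - Im U = Im (U * (B - 1))" by (simp add: algebra_simps)
  also have "\<bar>\<dots>\<bar> \<le> cmod (U * (B - 1))" by (rule abs_Im_le_cmod)
  also have "\<dots> = cmod (b z - b w)"
   using cmod_one_minus_cross[of b z w] zw bm nU by (simp add: norm_mult UBJ circ_map_norm norm_minus_commute)
  finally have a4: "\<bar>Im (U * B) - Im U\<bar> \<le> cmod (b z - b w)" .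
  have "Im U * (?E z w) - cmod (f z - f w) * (2 * s^2 * ?c) - cmod (b z - b w) * (2 * s * ?c) \<le> Im (U * B) * Im J"
  proof -
   have "\<bar>Im U\<bar> * \<bar>Im J - (?E z w)\<bar> \<le> cmod (f z - f w) * (2 * s^2 * ?c)"
    by (intro mult_mono a1 a2) auto
   hence b1: "\<bar>Im U * (Im J - (?E z w))\<bar> \<le> cmod (f z - f w) * (2 * s^2 * ?c)" by (simp only: abs_mult)
   have "\<bar>Im (U * B) - Im U\<bar> * \<bar>Im J\<bar> \<le> cmod (b z - b w) * (2 * s * ?c)"
    by (intro mult_mono a3 a4) auto
   hence b2: "\<bar>(Im (U * B) - Im U) * Im J\<bar> \<le> cmod (b z - b w) * (2 * s * ?c)" by (simp only: abs_mult)
   have "Im (U * B) * Im J = Im U * (?E z w) + Im U * (Im J - (?E z w)) + (Im (U * B) - Im U) * Im J"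
    by (simp only: left_diff_distrib right_diff_distrib)
   thus ?thesis using b1 b2 by linarith
  qed
  with 1 have 2: "Im U * (?E z w) - cmod (f z - f w) * (2 * s^2 * ?c) - cmod (b z - b w) * (2 * s * ?c) \<le> Re ((1 - U * B) * (1 - cnj J))"
   by linarith
  have "(Im U * (?E z w) - cmod (f z - f w) * (2 * s^2 * ?c) - cmod (b z - b w) * (2 * s * ?c)) / ?c^2 \<le> Re ((1 - U * B) * (1 - cnj J)) / ?c^2"
   by (rule divide_right_mono[OF 2]) simp
  moreover have "(a - x * (k * c) - y * (m * c)) / c^2 = a / c^2 - k * (x / c) - m * (y / c)" if "c \<noteq> 0" for a x k y m c :: real
   using that by (simp add: field_simps power2_eq_square)
  from this[OF False] have "(Im U * (?E z w) - cmod (f z - f w) * (2 * s^2 * ?c) - cmod (b z - b w) * (2 * s * ?c)) / ?c^2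
   = Im U * (?E z w) / ?c^2 - 2 * s^2 * (cmod (f z - f w) / ?c) - 2 * s * (cmod (b z - b w) / ?c)" .
  ultimately show ?thesis unfolding interact_def cr cmod_dquot UBJ(1) fst_conv snd_conv by simp
 qed
 have "integral\<^sup>L circ2 ?D - 2 * s^2 * ?N - 2 * s * ?T
  = (LINT p|circ2. ?D p - 2 * s^2 * cmod (dquot f p) - 2 * s * cmod (dquot b p))"
  using iD if' ib by simp
 also have "\<dots> \<le> integral\<^sup>L circ2 ?I"
  by (rule integral_mono[OF _ iI]) (use iD if' ib pt in force)+
 finally have I: "integral\<^sup>L circ2 ?D - 2 * s^2 * ?N - 2 * s * ?T \<le> integral\<^sup>L circ2 ?I" .
 have "cenergy v = cenergy ?A + cenergy ?L - 2 * integral\<^sup>L circ2 ?I"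
  unfolding v_def by (rule cenergy_mult[OF fb cH])
 also have "cenergy ?A = cenergy f + cenergy b - 2 * integral\<^sup>L circ2 (interact f b)"
  by (rule cenergy_mult[OF f bm])
 also have "cenergy ?L = cenergy (lift \<eta>)" by (rule fin_energy_cnj(2))
 finally show "cenergy v \<le> cenergy f + cenergy b + 4 * s^2 + 4 * s^2 * ?N + 4 * s * ?T
   - 2 * integral\<^sup>L circ2 (interact f b) - 2 * integral\<^sup>L circ2 ?D"
  using I H(2) by linarith
qed

section \<open>Bubbles that leave the fixed arc untouched\<close>

definition chi :: "real => complex => real" where
 "chi \<delta> z = max 0 (min 1 (1 + 2 * Im z / \<delta>))"

lemma measurable_chi [measurable]: "chi \<delta> \<in> borel_measurable borel"
 unfolding chi_def[abs_def] by measurable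

lemma chi_props:
 assumes "\<delta> > 0"
 shows "0 \<le> chi \<delta> z" "chi \<delta> z \<le> 1" "Im z \<ge> 0 ==> chi \<delta> z = 1" "Im z \<le> -\<delta>/2 ==> chi \<delta> z = 0"
  "\<bar>chi \<delta> z - chi \<delta> w\<bar> \<le> 2 / \<delta> * cmod (z - w)"
proof -
 show "0 \<le> chi \<delta> z" "chi \<delta> z \<le> 1" by (auto simp: chi_def)
 show "Im z \<ge> 0 ==> chi \<delta> z = 1" "Im z \<le> -\<delta>/2 ==> chi \<delta> z = 0" using assms by (auto simp: chi_def field_simps)
 have "\<bar>chi \<delta> z - chi \<delta> w\<bar> \<le> \<bar>(1 + 2 * Im z / \<delta>) - (1 + 2 * Im w / \<delta>)\<bar>" unfolding chi_def by linarith
 also have "(1 + 2 * Im z / \<delta>) - (1 + 2 * Im w / \<delta>) = 2 / \<delta> * Im (z - w)" using assms by (simp add: field_simps)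
 also have "\<bar>\<dots>\<bar> = 2 / \<delta> * \<bar>Im (z - w)\<bar>" using assms by (simp only: abs_mult) simp
 also have "\<dots> \<le> 2 / \<delta> * cmod (z - w)" using assms by (intro mult_left_mono abs_Im_le_cmod) auto
 finally show "\<bar>chi \<delta> z - chi \<delta> w\<bar> \<le> 2 / \<delta> * cmod (z - w)" .
qed

text \<open>Such points are at distance at least \<open>\<delta> / 2\<close> from the centre, so the
  Poisson denominator is at least \<open>\<delta>^2 / 16\<close> when \<open>1/4 \<le> t\<close>.
  The 12 rounds up the square root of 128.\<close>

lemma bub_far:
 assumes "cmod e = 1" "Im e \<le> -\<delta>" "0 < \<delta>" "\<delta> \<le> 1" "1/4 \<le> t" "t < 1" "cmod z = 1" "Im z \<ge> -\<delta>/2"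
 shows "pk t (e, z) \<le> 32 * (1 - t) / \<delta>^2" "cmod (1 - bub t e z) \<le> 12 * (1 - t) / \<delta>"
proof -
 have "\<delta> / 2 \<le> Im (z - e)" using assms by simp
 also have "\<dots> \<le> cmod (e - z)" using abs_Im_le_cmod[of "z - e"] by (simp add: norm_minus_commute)
 finally have "(\<delta> / 2)^2 \<le> (cdist (e, z))^2" unfolding cdist_def using assms by (intro power_mono) auto
 hence "1/4 * (\<delta> / 2)^2 \<le> t * (cdist (e, z))^2" using assms by (intro mult_mono) auto
 also have "\<dots> \<le> (1 - t)^2 + t * (cdist (e, z))^2" by simp
 finally have den: "\<delta>^2 / 16 \<le> (1 - t)^2 + t * (cdist (e, z))^2" by (simp add: power2_eq_square)
 have "1 - t^2 = (1 + t) * (1 - t)" by (simp add: power2_eq_square algebra_simps)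
 also have "\<dots> \<le> 2 * (1 - t)" using assms by (intro mult_right_mono) auto
 finally have num: "1 - t^2 \<le> 2 * (1 - t)" .
 have "0 \<le> 1 - t^2" using assms by (simp add: power_le_one abs_square_le_1)
 hence "pk t (e, z) \<le> (2 * (1 - t)) / (\<delta>^2 / 16)" unfolding pk_def using den num assms by (intro frac_le) auto
 also have "\<dots> = 32 * (1 - t) / \<delta>^2" by simp
 finally show p: "pk t (e, z) \<le> 32 * (1 - t) / \<delta>^2" .
 have "(cmod (1 - bub t e z))^2 \<le> 4 * (1 - t) * pk t (e, z)" using assms by (intro one_minus_bub) auto
 also have "\<dots> \<le> 4 * (1 - t) * (32 * (1 - t) / \<delta>^2)" using p assms by (intro mult_left_mono) auto
 also have "\<dots> = 128 * (1 - t)^2 / \<delta>^2" by (simp add: power2_eq_square algebra_simps)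
 also have "\<dots> \<le> 144 * (1 - t)^2 / \<delta>^2" by (intro divide_right_mono mult_right_mono) auto
 also have "\<dots> = (12 * (1 - t) / \<delta>)^2" by (simp only: power_divide power_mult_distrib) simp
 finally have "(cmod (1 - bub t e z))^2 \<le> (12 * (1 - t) / \<delta>)^2" .
 moreover have "0 \<le> 12 * (1 - t) / \<delta>" using assms by simp
 ultimately show "cmod (1 - bub t e z) \<le> 12 * (1 - t) / \<delta>" by (rule power2_le_imp_le)
qed

text \<open>On the upper arc the cut-off is 1, so there \<open>lift\<close> rebuilds the bubble from
  its imaginary part, provided that the real part is nonnegative. Dividing by the lift then removes
  the bubble exactly on the fixed arc.\<close>

definition etab :: "real => real => complex => complex => real" where
 "etab \<delta> t e z = chi \<delta> z * Im (bub t e z)"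

text \<open>The constant 56 is 32, from the bubble away from its centre, plus 24, from the slope
  \<open>2 / \<delta>\<close> of the cut-off times the bound \<open>12 (1 - t) / \<delta>\<close> on
  \<open>Im (bub t e)\<close>.\<close>

lemma etab_props:
 assumes "cmod e = 1" "Im e \<le> -\<delta>" "0 < \<delta>" "\<delta> \<le> 1" "1/4 \<le> t" "t < 1"
 defines "s \<equiv> 56 / \<delta>^2 * (1 - t)"
 shows "etab \<delta> t e \<in> borel_measurable circ"
  "\<And>z. cmod z = 1 ==> \<bar>etab \<delta> t e z\<bar> \<le> s"
  "\<And>z w. cmod z = 1 ==> cmod w = 1 ==> \<bar>etab \<delta> t e z - etab \<delta> t e w\<bar> \<le> s * cmod (z - w)"
  "s \<le> 1/3 ==> cmod z = 1 ==> Im z \<ge> 0 ==> lift (etab \<delta> t e) z = bub t e z"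
proof -
 let ?T = "12 * (1 - t) / \<delta>"
 let ?D = "\<lambda>z w. 32 * (1 - t) / \<delta>^2 * cmod (z - w)"
 have t0: "0 \<le> t" using assms by simp
 note far = bub_far[OF assms(1-6)]
 note chi = chi_props[OF assms(3)]
 have [measurable]: "bub t e \<in> borel_measurable circ" using circ_map_bub[OF assms(1) t0 assms(6)] by (rule circ_map_measurable)
 have [measurable]: "chi \<delta> \<in> borel_measurable circ" using measurable_compose[OF circ_borel measurable_chi] by simp
 show "etab \<delta> t e \<in> borel_measurable circ" unfolding etab_def[abs_def] by measurable
 have d2: "\<delta>^2 \<le> \<delta>" "\<delta>^2 > 0" using assms by (auto simp: power2_eq_square mult_left_le)
 have s12: "12 * (1 - t) / \<delta> \<le> s"
 proof -
  have "12 * (1 - t) / \<delta> \<le> 56 * (1 - t) / \<delta>^2" using assms d2 by (intro frac_le) auto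
  thus ?thesis by (simp add: s_def)
 qed
 have Imb: "\<bar>Im (bub t e z)\<bar> \<le> 12 * (1 - t) / \<delta>" if "cmod z = 1" "Im z \<ge> -\<delta>/2" for z
  using abs_Im_le_cmod[of "1 - bub t e z"] far(2)[OF that] by simp
 have s0: "0 \<le> s" using assms by (simp add: s_def)
 show bd: "\<bar>etab \<delta> t e z\<bar> \<le> s" if "cmod z = 1" for z
 proof (cases "Im z \<ge> -\<delta>/2")
  case True
  have "\<bar>chi \<delta> z\<bar> * \<bar>Im (bub t e z)\<bar> \<le> 1 * ?T"
   using chi(1,2)[of z] Imb[OF that True] by (intro mult_mono) auto
  thus ?thesis using s12 by (simp add: etab_def abs_mult)
 next
  case False
  thus ?thesis using chi(4)[of z] s0 by (simp add: etab_def)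
 qed
 have half: "\<bar>etab \<delta> t e z - etab \<delta> t e w\<bar> \<le> s * cmod (z - w)" if zw: "cmod z = 1" "cmod w = 1" and z: "Im z \<ge> -\<delta>/2" for z w
 proof (cases "Im w \<ge> -\<delta>/2")
  case True
  have "(cmod (bub t e z - bub t e w))^2 = pk t (e, z) * pk t (e, w) * (cdist (z, w))^2"
   by (rule cmod_bub_diff[OF assms(1) zw t0 assms(6)])
  also have "\<dots> \<le> (32 * (1 - t) / \<delta>^2) * (32 * (1 - t) / \<delta>^2) * (cdist (z, w))^2"
   using far(1)[OF zw(1) z] far(1)[OF zw(2) True] pk_nonneg[OF t0 assms(6)] assms by (intro mult_right_mono mult_mono) auto
  also have "\<dots> = (?D z w)^2" by (simp add: power2_eq_square cdist_def)
  finally have "(cmod (bub t e z - bub t e w))^2 \<le> (?D z w)^2" .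
  moreover have "0 \<le> 32 * (1 - t) / \<delta>^2 * cmod (z - w)"
   using assms by (intro mult_nonneg_nonneg divide_nonneg_nonneg) auto
  ultimately have "cmod (bub t e z - bub t e w) \<le> 32 * (1 - t) / \<delta>^2 * cmod (z - w)"
   by (rule power2_le_imp_le)
  hence bL: "\<bar>Im (bub t e z) - Im (bub t e w)\<bar> \<le> 32 * (1 - t) / \<delta>^2 * cmod (z - w)"
   using abs_Im_le_cmod[of "bub t e z - bub t e w"] by simp
  have "etab \<delta> t e z - etab \<delta> t e w = (chi \<delta> z - chi \<delta> w) * Im (bub t e z) + chi \<delta> w * (Im (bub t e z) - Im (bub t e w))"
   by (simp add: etab_def algebra_simps)
  also have "\<bar>\<dots>\<bar> \<le> \<bar>chi \<delta> z - chi \<delta> w\<bar> * \<bar>Im (bub t e z)\<bar> + \<bar>chi \<delta> w\<bar> * \<bar>Im (bub t e z) - Im (bub t e w)\<bar>"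
   using abs_triangle_ineq[of "(chi \<delta> z - chi \<delta> w) * Im (bub t e z)" "chi \<delta> w * (Im (bub t e z) - Im (bub t e w))"]
   by (simp only: abs_mult)
  also have "\<dots> \<le> (2 / \<delta> * cmod (z - w)) * ?T + 1 * (?D z w)"
   using chi(1,2)[of w] assms(3) by (intro add_mono mult_mono chi(5) Imb zw z bL) auto
  also have "\<dots> = s * cmod (z - w)" using assms(3) by (simp add: s_def power2_eq_square field_simps)
  finally show ?thesis .
 next
  case False
  hence "etab \<delta> t e w = 0" "chi \<delta> w = 0" using chi(4)[of w] by (auto simp: etab_def)
  hence "\<bar>etab \<delta> t e z - etab \<delta> t e w\<bar> = \<bar>chi \<delta> z - chi \<delta> w\<bar> * \<bar>Im (bub t e z)\<bar>" by (simp add: etab_def abs_mult)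
  also have "\<dots> \<le> (2 / \<delta> * cmod (z - w)) * ?T"
   using assms(3) by (intro mult_mono chi(5) Imb zw z) auto
  also have "\<dots> \<le> s * cmod (z - w)"
  proof -
   have "2 / \<delta> * ?T \<le> s" using assms by (simp add: s_def power2_eq_square divide_right_mono)
   from mult_right_mono[OF this, of "cmod (z - w)"]
   have "2 / \<delta> * ?T * cmod (z - w) \<le> s * cmod (z - w)" by simp
   thus ?thesis by (simp only: mult.assoc mult.commute[of "cmod (z - w)"])
  qed
  finally show ?thesis .
 qed
 show "\<bar>etab \<delta> t e z - etab \<delta> t e w\<bar> \<le> s * cmod (z - w)" if zw: "cmod z = 1" "cmod w = 1" for z w
 proof -
  consider "Im z \<ge> -\<delta>/2" | "Im w \<ge> -\<delta>/2" | "Im z < -\<delta>/2" "Im w < -\<delta>/2" by linarith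
  thus ?thesis
  proof cases
   case 2
   from half[OF zw(2,1) this] show ?thesis by (simp add: abs_minus_commute norm_minus_commute)
  next
   case 3
   hence "etab \<delta> t e z = 0" "etab \<delta> t e w = 0" using chi(4) by (auto simp: etab_def)
   thus ?thesis using s0 by simp
  qed (use half zw in auto)
 qed
 show "lift (etab \<delta> t e) z = bub t e z" if "s \<le> 1/3" "cmod z = 1" "Im z \<ge> 0"
 proof -
  have "Im z \<ge> -\<delta>/2" using that assms by simp
  from far(2)[OF that(2) this] s12 that(1) have "cmod (1 - bub t e z) \<le> 1/3" by simp
  hence "1 - Re (bub t e z) \<le> 1/3" using complex_Re_le_cmod[of "1 - bub t e z"] by simp
  hence R: "Re (bub t e z) \<ge> 0" by simp
  have "(Re (bub t e z))^2 + (Im (bub t e z))^2 = 1"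
   using cmod_bub[OF assms(1) that(2) t0 assms(6)] by (metis cmod_power2 one_power2)
  hence "1 - (Im (bub t e z))^2 = (Re (bub t e z))^2" by linarith
  hence "sqrt (1 - (Im (bub t e z))^2) = sqrt ((Re (bub t e z))^2)" by (rule arg_cong)
  also have "\<dots> = Re (bub t e z)" using R by simp
  finally show ?thesis using chi(3)[OF that(3)] by (simp add: lift_def etab_def complex_eq_iff)
 qed
qed

text \<open>The closed upper arc without the point \<open>\<i>\<close> is the image of the
  complement of the interval under the Cayley transform.\<close>

definition adm :: "(complex => complex) => int => (complex => complex) => bool" where
 "adm g d f \<longleftrightarrow> circ_map f \<and> cdeg f = of_int d \<and> (AE z in circ. Im z \<ge> 0 \<longrightarrow> f z = g z)"

lemma adm_cnj: "adm (\<lambda>z. cnj (g z)) (- d) (\<lambda>z. cnj (f z)) \<longleftrightarrow> adm g d f"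
proof -
 have "adm (\<lambda>z. cnj (g z)) (- d) (\<lambda>z. cnj (f z))" if "adm g d f" for g d f
  using that cdeg_cnj[of f] unfolding adm_def by (auto intro: circ_map_cnj elim!: eventually_mono)
 from this[of g d f] this[of "\<lambda>z. cnj (g z)" "- d" "\<lambda>z. cnj (f z)"] show ?thesis by auto
qed

lemma bubble_adm:
 assumes f: "adm g d f" and "cmod e = 1" "Im e \<le> -\<delta>" "0 < \<delta>" "\<delta> \<le> 1" "1/4 \<le> t" "t < 1"
  and s: "56 / \<delta>^2 * (1 - t) \<le> 1/3"
 defines "s \<equiv> 56 / \<delta>^2 * (1 - t)"
 obtains v where "adm g (d + 1) v"
  "cenergy v \<le> cenergy f + 1 + 4 * s^2 + 4 * s^2 * (LINT p|circ2. cmod (dquot f p)) + 4 * s * (LINT p|circ2. cmod (dquot (bub t e) p))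
   - 2 * (LINT p|circ2. interact f (bub t e) p) - 2 * (LINT p|circ2. Im (cross f p) * (etab \<delta> t e (fst p) - etab \<delta> t e (snd p)) / (cdist p)^2)"
proof -
 have cf: "circ_map f" using f by (simp add: adm_def)
 have t: "0 \<le> t" "t < 1" using assms by auto
 have s0: "0 \<le> s" using assms by (simp add: s_def)
 have s1: "s \<le> 1/3" using s by (simp add: s_def)
 note ep = etab_props[OF assms(2-7), folded s_def]
 define v where "v z = f z * bub t e z * cnj (lift (etab \<delta> t e) z)" for z
 note bm = circ_map_bub[OF assms(2) t]
 note be = circ_map_mult_lift[OF cf bm ep(1) s0 s1 ep(2,3), folded v_def]
 have "circ_map v" "cdeg v = cdeg f + cdeg (bub t e)" by (rule be; assumption)+
 moreover have "AE z in circ. Im z \<ge> 0 \<longrightarrow> v z = g z"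
 proof -
  have "AE z in circ. Im z \<ge> 0 \<longrightarrow> f z = g z" using f by (simp add: adm_def)
  thus ?thesis using AE_space
  proof eventually_elim
   case (elim z)
   have "v z = g z" if "Im z \<ge> 0"
   proof -
    have z: "cmod z = 1" using elim by simp
    have "bub t e z * cnj (bub t e z) = 1"
     using cmod_bub[OF assms(2) z t] complex_norm_square[of "bub t e z"] by simp
    thus ?thesis using ep(4)[OF s1 z that] elim that by (simp add: v_def mult.assoc)
   qed
   thus ?case by simp
  qed
 qed
 ultimately have "adm g (d + 1) v" using f cdeg_bub[OF assms(2) t] by (simp add: adm_def)
 thus ?thesis
 proof (rule that)
  show "cenergy v \<le> cenergy f + 1 + 4 * s^2 + 4 * s^2 * (LINT p|circ2. cmod (dquot f p)) + 4 * s * (LINT p|circ2. cmod (dquot (bub t e) p))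
   - 2 * (LINT p|circ2. interact f (bub t e) p) - 2 * (LINT p|circ2. Im (cross f p) * (etab \<delta> t e (fst p) - etab \<delta> t e (snd p)) / (cdist p)^2)"
   using cenergy_bub_le[OF assms(2) t] by (intro order_trans[OF be(3)]; assumption?) auto
 qed
qed

text \<open>A bubble at \<open>- \<i>\<close>, the middle of the free arc. As \<open>t\<close> tends
  to 1 it tends to 1 off its centre, so its interaction with \<open>f\<close> vanishes; the
  correction is \<open>O(1 - t)\<close>, and only the energy of the bubble itself, at most 1,
  remains.\<close>

lemma adm_up_approx:
 assumes f: "adm g d f" and eps: "\<epsilon> > 0"
 shows "\<exists>v. adm g (d + 1) v \<and> cenergy v \<le> cenergy f + 1 + \<epsilon>"
proof -
 have cf: "circ_map f" using f by (simp add: adm_def)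
 note [measurable] = circ_map_measurable[OF cf]
 have e: "cmod (- \<i>) = 1" "Im (- \<i>) \<le> - 1" by auto
 define b where "b k = bub (tseq k) (- \<i>)" for k
 have t: "0 \<le> tseq k" "tseq k < 1" "1/4 \<le> tseq k" for k using tseq[of k] by auto
 have bm: "circ_map (b k)" for k unfolding b_def by (rule circ_map_bub[OF e(1) t(1,2)])
 note [measurable] = circ_map_measurable[OF bm]
 have bE: "cenergy (b k) \<le> 1" for k unfolding b_def by (rule cenergy_bub_le[OF e(1) t(1,2)])
 define s A where "s k = 56 / 1^2 * (1 - tseq k)" and "A = (LINT p|circ2. cmod (dquot f p))" for k
 define E where "E k = 4 * (s k)^2 + 4 * (s k)^2 * A + 4 * s k * 1 + 2 * (s k * A) - 2 * integral\<^sup>L circ2 (interact f (b k))" for k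
 have b1: "(\<lambda>k. 1 - b k z) \<leadsto> 0" if "z \<noteq> - \<i>" "cmod z = 1" for z
 proof (rule Lim_null_comparison)
  show "eventually (\<lambda>k. norm (1 - b k z) \<le> sqrt (4 * (1 - tseq k) * pk (tseq k) (- \<i>, z))) sequentially"
   using one_minus_bub[OF e(1) that(2) t(1,2)] unfolding b_def by (intro always_eventually allI real_le_rsqrt)
  have "(\<lambda>k. sqrt (4 * (1 - tseq k) * pk (tseq k) (- \<i>, z))) \<leadsto> sqrt (4 * (1 - 1) * 0)"
   by (intro tendsto_intros tseq_lim kernel_limits(1)) (use that in \<open>auto simp: cdist_def\<close>)
  thus "(\<lambda>k. sqrt (4 * (1 - tseq k) * pk (tseq k) (- \<i>, z))) \<leadsto> 0" by simp
 qed
 have "(\<lambda>k. integral\<^sup>L circ2 (interact f (b k))) \<leadsto> 0"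
 proof (rule integral_interact_tendsto_0[OF cf bm bE])
  show "AE p in circ2. (\<lambda>k. b k (fst p) - b k (snd p)) \<leadsto> 0"
   using AE_circ2[OF AE_circ_neq[OF e(1)]] AE_space
  proof eventually_elim
   case (elim p)
   from tendsto_diff[OF b1[of "snd p"] b1[of "fst p"]] elim show ?case by auto
  qed
 qed
 hence "E \<leadsto> 4 * (56 / 1^2 * (1 - 1))^2 + 4 * (56 / 1^2 * (1 - 1))^2 * A + 4 * (56 / 1^2 * (1 - 1)) * 1 + 2 * (56 / 1^2 * (1 - 1) * A) - 2 * 0"
  unfolding E_def s_def by (intro tendsto_intros tseq_lim)
 hence "E \<leadsto> 0" by simp
 from order_tendstoD(2)[OF this eps] have "eventually (\<lambda>k. E k < \<epsilon>) sequentially" .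
 \<comment> \<open>\<open>56 / 168 = 1/3\<close>, the size up to which the correction may be
   lifted.\<close>
 moreover have "eventually (\<lambda>k. tseq k > 1 - 1/168) sequentially"
  by (rule order_tendstoD(1)[OF tseq_lim]) simp
 ultimately have "eventually (\<lambda>k. E k < \<epsilon> \<and> tseq k > 1 - 1/168) sequentially" by (rule eventually_conj)
 then obtain k where k: "E k < \<epsilon>" "tseq k > 1 - 1/168" by (auto simp: eventually_sequentially)
 have s: "s k \<le> 1/3" "0 \<le> s k" using k(2) t(2)[of k] by (auto simp: s_def)
 obtain v where v: "adm g (d + 1) v" "cenergy v \<le> cenergy f + 1 + 4 * (s k)^2 + 4 * (s k)^2 * A + 4 * s k * (LINT p|circ2. cmod (dquot (b k) p))
   - 2 * (LINT p|circ2. interact f (b k) p) - 2 * (LINT p|circ2. Im (cross f p) * (etab 1 (tseq k) (- \<i>) (fst p) - etab 1 (tseq k) (- \<i>) (snd p)) / (cdist p)^2)"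
  unfolding s_def b_def A_def by (rule bubble_adm[OF f e _ _ t(3,2) s(1)[unfolded s_def]]) (auto intro: that)
 have "\<bar>\<integral>p. Im (cross f p) * (etab 1 (tseq k) (- \<i>) (fst p) - etab 1 (tseq k) (- \<i>) (snd p)) / (cdist p)^2 \<partial>circ2\<bar> \<le> s k * A"
  unfolding A_def by (rule integrable_Im_cross_lip(2)[OF cf]) (use etab_props[OF e _ _ t(3,2)[of k], folded s_def] in auto)
 moreover have "4 * s k * (LINT p|circ2. cmod (dquot (b k) p)) \<le> 4 * s k * 1"
  using integral_abs_dquot_le_1[OF circ_map_fin_energy[OF bm] bE, of k] s(2) by (intro mult_left_mono) auto
 ultimately have "cenergy v \<le> cenergy f + 1 + \<epsilon>" using v(2) k(1) unfolding E_def by linarith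
 thus ?thesis using v(1) by blast
qed

lemma adm_down_approx:
 assumes f: "adm g d f" and eps: "\<epsilon> > 0"
 shows "\<exists>v. adm g (d - 1) v \<and> cenergy v \<le> cenergy f + 1 + \<epsilon>"
proof -
 have "adm (\<lambda>z. cnj (g z)) (- d) (\<lambda>z. cnj (f z))" using f by (simp add: adm_cnj)
 from adm_up_approx[OF this eps] obtain v where v: "adm (\<lambda>z. cnj (g z)) (- d + 1) v" "cenergy v \<le> cenergy f + 1 + \<epsilon>"
  by (auto simp: fin_energy_cnj(2))
 have "adm g (d - 1) (\<lambda>z. cnj (v z))" using v(1) adm_cnj[of g "d - 1" "\<lambda>z. cnj (v z)"] by simp
 thus ?thesis using v(2) by (auto simp: fin_energy_cnj(2))
qed

lemma adm_approx:
 assumes f: "adm g d f" and eps: "\<epsilon> > 0"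
 shows "\<exists>v. adm g d' v \<and> cenergy v \<le> cenergy f + \<bar>real_of_int (d' - d)\<bar> + \<epsilon>"
 using eps
proof (induction "nat \<bar>d' - d\<bar>" arbitrary: d' \<epsilon>)
 case 0
 thus ?case using f by (intro exI[of _ f]) auto
next
 case (Suc n)
 have step: "\<exists>v. adm g d' v \<and> cenergy v \<le> cenergy f + \<bar>real_of_int (d' - d)\<bar> + \<epsilon>"
  if "d'' = d' - 1 \<and> d' > d \<or> d'' = d' + 1 \<and> d' < d" for d''
 proof -
  have "n = nat \<bar>d'' - d\<bar>" using Suc(2) that by linarith
  from Suc(1)[OF this, of "\<epsilon> / 2"] Suc(3) obtain u where u: "adm g d'' u" "cenergy u \<le> cenergy f + \<bar>real_of_int (d'' - d)\<bar> + \<epsilon> / 2"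
   by auto
  have "\<exists>v. adm g d' v \<and> cenergy v \<le> cenergy u + 1 + \<epsilon> / 2"
   using that adm_up_approx[OF u(1), of "\<epsilon> / 2"] adm_down_approx[OF u(1), of "\<epsilon> / 2"] Suc(3) by auto
  then obtain v where v: "adm g d' v" "cenergy v \<le> cenergy u + 1 + \<epsilon> / 2" by blast
  moreover have "\<bar>real_of_int (d'' - d)\<bar> + 1 = \<bar>real_of_int (d' - d)\<bar>" using that by auto
  ultimately show ?thesis using u(2) by (intro exI[of _ v]) auto
 qed
 consider "d' > d" | "d' < d" using Suc(2) by linarith
 thus ?case using step[of "d' - 1"] step[of "d' + 1"] by cases auto
qed

subsection \<open>Energy gain of a bubble\<close>

text \<open>The Euler-Lagrange equation. Turning the phase of \<open>f\<close> by a small multiple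
  \<open>a\<close> of \<open>\<psi>\<close> changes neither the degree nor the values on the fixed
  arc, and lowers the energy by \<open>2 a I\<close> up to \<open>O(a^2)\<close>. The estimate for
  corrected bubbles supplies this, with the constant map 1 as the bubble.\<close>

lemma adm_critical:
 fixes \<psi> :: "complex => real"
 assumes f: "adm g d f" and min: "\<And>v. adm g d v ==> cenergy f \<le> cenergy v"
  and [measurable]: "\<psi> \<in> borel_measurable circ" and C: "0 \<le> C"
  and b: "\<And>z. cmod z = 1 ==> \<bar>\<psi> z\<bar> \<le> C"
  and l: "\<And>z w. cmod z = 1 ==> cmod w = 1 ==> \<bar>\<psi> z - \<psi> w\<bar> \<le> C * cmod (z - w)"
  and 0: "\<And>z. cmod z = 1 ==> Im z \<ge> 0 ==> \<psi> z = 0"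
 shows "(LINT p|circ2. Im (cross f p) * (\<psi> (fst p) - \<psi> (snd p)) / (cdist p)^2) = 0"
proof (rule ccontr)
 let ?L = "\<lambda>a. LINT p|circ2. Im (cross f p) * (a * \<psi> (fst p) - a * \<psi> (snd p)) / (cdist p)^2"
 let ?I = "LINT p|circ2. cmod (dquot f p)"
 define I where "I = (LINT p|circ2. Im (cross f p) * (\<psi> (fst p) - \<psi> (snd p)) / (cdist p)^2)"
 assume "\<not> ?thesis"
 hence I0: "I \<noteq> 0" by (simp add: I_def)
 define A where "A = ?I"
 have A0: "A \<ge> 0" by (simp add: A_def)
 have cf: "circ_map f" using f by (simp add: adm_def)
 have one: "circ_map (\<lambda>_. 1)" by (rule circ_C1_circ_map[OF circ_C1_const]) simp
 have one': "cenergy (\<lambda>_. 1) = 0" "cdeg (\<lambda>_. 1) = 0" "dquot (\<lambda>_. 1) p = 0" "interact f (\<lambda>_. 1) p = 0" for p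
  using abs_cdeg_le[OF circ_map_fin_energy[OF one]] by (simp_all add: cenergy_def dquot_def interact_def cross_def)
 have key: "2 * a * I \<le> 4 * C^2 * (1 + A) * a^2" if a: "\<bar>a\<bar> * C \<le> 1/3" for a
 proof -
  define v where "v z = f z * 1 * cnj (lift (\<lambda>z. a * \<psi> z) z)" for z
  have m: "(\<lambda>z. a * \<psi> z) \<in> borel_measurable circ" by measurable
  have s0: "0 \<le> \<bar>a\<bar> * C" using C by simp
  have b': "\<bar>a * \<psi> z\<bar> \<le> \<bar>a\<bar> * C" if "cmod z = 1" for z
   using b[OF that] by (simp add: abs_mult mult_left_mono)
  have l': "\<bar>a * \<psi> z - a * \<psi> w\<bar> \<le> \<bar>a\<bar> * C * cmod (z - w)" if "cmod z = 1" "cmod w = 1" for z w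
   using mult_left_mono[OF l[OF that], of "\<bar>a\<bar>"]
   by (simp add: abs_mult mult.assoc flip: right_diff_distrib)
  note L = circ_map_mult_lift[OF cf one m s0 a b' l', folded v_def]
  have "circ_map v" "cdeg v = cdeg f + cdeg (\<lambda>_. 1)" by (rule L; assumption)+
  moreover have "AE z in circ. Im z \<ge> 0 \<longrightarrow> v z = g z"
  proof -
   have "AE z in circ. Im z \<ge> 0 \<longrightarrow> f z = g z" using f by (simp add: adm_def)
   thus ?thesis using AE_space
    by eventually_elim (auto simp: v_def lift_def 0 complex_eq_iff)
  qed
  ultimately have "adm g d v" using f by (simp add: adm_def one')
  hence "cenergy f \<le> cenergy v" by (rule min)
  also have "\<dots> \<le> cenergy f + cenergy (\<lambda>_. 1) + 4 * (\<bar>a\<bar> * C)^2 + 4 * (\<bar>a\<bar> * C)^2 * ?I + 4 * (\<bar>a\<bar> * C) * (LINT p|circ2. cmod (dquot (\<lambda>_. 1) p))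
   - 2 * (LINT p|circ2. interact f (\<lambda>_. 1) p) - 2 * (?L a)"
   by (rule L; assumption)
  finally have "2 * (?L a) \<le> 4 * C^2 * (1 + A) * a^2"
   by (simp add: one' A_def[symmetric] power_mult_distrib algebra_simps del: mult_minus_left mult_minus_right)
  also have "(\<lambda>p. Im (cross f p) * (a * \<psi> (fst p) - a * \<psi> (snd p)) / (cdist p)^2) = (\<lambda>p. a * (Im (cross f p) * (\<psi> (fst p) - \<psi> (snd p)) / (cdist p)^2))"
   by (simp add: fun_eq_iff right_diff_distrib diff_divide_distrib mult_ac)
  finally have "2 * (a * I) \<le> 4 * C^2 * (1 + A) * a^2"
   by (simp only: I_def integral_mult_right_zero)
  thus ?thesis by (simp only: mult.assoc)
 qed
 define K where "K = 4 * C^2 * (1 + A)"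
 \<comment> \<open>The test value will be \<open>a = r I\<close>. The summand \<open>K\<close> gives
   \<open>r K \<le> 1\<close>, which yields the contradiction; the summand
   \<open>3 C \<bar>I\<bar>\<close> gives \<open>\<bar>a\<bar> C \<le> 1/3\<close>, which the lift
   requires.\<close>
 define r where "r = 1 / (K + 3 * C * \<bar>I\<bar> + 1)"
 have K: "K \<ge> 0" using A0 by (simp add: K_def)
 have D: "K + 3 * C * \<bar>I\<bar> + 1 > 0" using K C by (intro add_nonneg_pos add_nonneg_nonneg) auto
 hence r: "r > 0" "r * (K + 3 * C * \<bar>I\<bar> + 1) = 1" by (auto simp: r_def)
 have rK: "r * K \<ge> 0" "r * (3 * C * \<bar>I\<bar>) \<ge> 0" using r K C by auto
 hence rr: "r * K \<le> 1" "r * (3 * C * \<bar>I\<bar>) \<le> 1" using r unfolding distrib_left by linarith+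
 have "\<bar>r * I\<bar> * C \<le> 1/3" using rr(2) r(1) by (simp add: abs_mult mult_ac)
 from key[OF this] have "2 * (r * I^2) \<le> (r * K) * (r * I^2)"
  by (simp add: K_def power2_eq_square mult_ac)
 also have "\<dots> \<le> 1 * (r * I^2)" using rr r(1) by (intro mult_right_mono) auto
 finally show False using r(1) I0 by simp
qed

section \<open>The difference quotient of a bubble in L1\<close>

text \<open>Far from \<open>e\<close> the kernel itself is small. Near \<open>e\<close>,
  \<open>sqrt P \<le> \<epsilon> P + 1 / (4 \<epsilon>)\<close>, and the constant is bounded by
  \<open>\<epsilon>\<close> times a second Poisson kernel, with parameter
  \<open>1 - \<epsilon>^2\<close>: a majorant for the short arc whose integral is known without
  measuring the arc.\<close>

lemma integral_sqrt_pk_le: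
 assumes e: "cmod e = 1" and t: "1/4 \<le> t" "t < 1" and \<epsilon>: "0 < \<epsilon>" "\<epsilon> < 1"
 shows "integrable circ (\<lambda>z. sqrt (pk t (e, z)))"
  "(LINT z|circ. sqrt (pk t (e, z))) \<le> 2 * \<epsilon> + sqrt ((1 - t^2) / t) / \<epsilon>^2"
proof -
 let ?L = "LINT z|circ. sqrt (pk t (e, z))"
 have t0: "0 \<le> t" using t by simp
 define \<gamma> where "\<gamma> = 1 - \<epsilon>^2"
 have \<gamma>: "0 \<le> \<gamma>" "\<gamma> < 1" using \<epsilon> by (auto simp: \<gamma>_def power_le_one)
 note i = integrable_pk(1)
 have pt: "sqrt (pk t (e, z)) \<le> \<epsilon> * pk t (e, z) + \<epsilon> * pk \<gamma> (e, z) + sqrt ((1 - t^2) / t) / \<epsilon>^2" for z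
 proof (cases "cdist (e, z) < \<epsilon>^2")
  case True
  have "(1 - \<gamma>^2) = \<epsilon>^2 * (2 - \<epsilon>^2)" by (simp add: \<gamma>_def power2_eq_square algebra_simps)
  moreover have "\<epsilon>^2 * (2 - \<epsilon>^2) \<ge> \<epsilon>^2 * 1" using \<epsilon> by (intro mult_left_mono) (auto simp: power_le_one)
  ultimately have n: "1 - \<gamma>^2 \<ge> \<epsilon>^2" by simp
  have "(cdist (e, z))^2 \<le> (\<epsilon>^2)^2" using True by (intro power_mono) auto
  hence "\<gamma> * (cdist (e, z))^2 \<le> 1 * (\<epsilon>^2)^2" using \<gamma> by (intro mult_mono) auto
  hence d: "(1 - \<gamma>)^2 + \<gamma> * (cdist (e, z))^2 \<le> 2 * (\<epsilon>^2)^2" by (simp add: \<gamma>_def)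
  have "0 \<le> 1 - \<gamma>^2" using n zero_le_power2[of \<epsilon>] by linarith
  hence "\<epsilon>^2 / (2 * (\<epsilon>^2)^2) \<le> pk \<gamma> (e, z)" unfolding pk_def
   by (rule frac_le[OF _ n poisson_denom_pos[OF \<gamma>] d])
  hence "1 \<le> 2 * \<epsilon>^2 * pk \<gamma> (e, z)" using \<epsilon> by (simp add: field_simps power2_eq_square)
  hence p: "1 / (2 * \<epsilon>) \<le> \<epsilon> * pk \<gamma> (e, z)" using \<epsilon> by (simp add: field_simps power2_eq_square)
  have "0 \<le> (sqrt \<epsilon> * sqrt (pk t (e, z)) - 1 / (2 * sqrt \<epsilon>))^2" by simp
  also have "\<dots> = \<epsilon> * pk t (e, z) - sqrt (pk t (e, z)) + 1 / (4 * \<epsilon>)"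
   using \<epsilon> pk_nonneg[OF t0 t(2)] by (simp add: power2_diff power_mult_distrib power_divide)
  also have "\<dots> \<le> \<epsilon> * pk t (e, z) - sqrt (pk t (e, z)) + 1 / (2 * \<epsilon>)" using \<epsilon> by (simp add: frac_le)
  finally have "sqrt (pk t (e, z)) \<le> \<epsilon> * pk t (e, z) + \<epsilon> * pk \<gamma> (e, z)" using p by linarith
  moreover have "sqrt ((1 - t^2) / t) / \<epsilon>^2 \<ge> 0" using t by (simp add: power_le_one)
  ultimately show ?thesis by linarith
 next
  case False
  have "(sqrt (pk t (e, z)) * cdist (e, z))^2 = pk t (e, z) * (cdist (e, z))^2"
   using pk_nonneg[OF t0 t(2)] by (simp add: power_mult_distrib)
  also have "\<dots> \<le> (1 - t^2) / t" by (rule pk_cdist2) (use t in auto)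
  finally have "sqrt (pk t (e, z)) * cdist (e, z) \<le> sqrt ((1 - t^2) / t)" by (rule real_le_rsqrt)
  moreover have "sqrt (pk t (e, z)) * \<epsilon>^2 \<le> sqrt (pk t (e, z)) * cdist (e, z)"
   using False pk_nonneg[OF t0 t(2)] by (intro mult_left_mono) auto
  ultimately have "sqrt (pk t (e, z)) \<le> sqrt ((1 - t^2) / t) / \<epsilon>^2" using \<epsilon> by (simp add: field_simps)
  moreover have "0 \<le> \<epsilon> * pk t (e, z)" "0 \<le> \<epsilon> * pk \<gamma> (e, z)"
   using \<epsilon> pk_nonneg[OF t0 t(2)] pk_nonneg[OF \<gamma>] by auto
  ultimately show ?thesis by linarith
 qed
 have ib: "integrable circ (\<lambda>z. \<epsilon> * pk t (e, z) + \<epsilon> * pk \<gamma> (e, z) + sqrt ((1 - t^2) / t) / \<epsilon>^2)"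
  using i[OF t0 t(2)] i[OF \<gamma>] by auto
 show si: "integrable circ (\<lambda>z. sqrt (pk t (e, z)))"
  by (rule B_integrable_bound[OF ib]) (use pt pk_nonneg[OF t0 t(2)] in \<open>auto intro!: AE_I2 order_trans[OF pt]\<close>)
 have "?L \<le> (LINT z|circ. \<epsilon> * pk t (e, z) + \<epsilon> * pk \<gamma> (e, z) + sqrt ((1 - t^2) / t) / \<epsilon>^2)"
  by (rule integral_mono[OF si ib pt])
 also have "\<dots> = 2 * \<epsilon> + sqrt ((1 - t^2) / t) / \<epsilon>^2"
  using i[OF t0 t(2)] i[OF \<gamma>] integral_pk(1)[OF e t0 t(2)] integral_pk(1)[OF e \<gamma>] by simp
 finally show "?L \<le> 2 * \<epsilon> + sqrt ((1 - t^2) / t) / \<epsilon>^2" .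
qed

text \<open>By conformal invariance the difference quotient is at most the product of the square
  roots of two Poisson kernels, so the double integral is at most the square of a single
  one.\<close>

lemma integral_dquot_bub_le:
 assumes e: "cmod e = 1" and t: "1/4 \<le> t" "t < 1" and \<epsilon>: "0 < \<epsilon>" "\<epsilon> < 1"
 shows "(LINT p|circ2. cmod (dquot (bub t e) p)) \<le> (2 * \<epsilon> + sqrt ((1 - t^2) / t) / \<epsilon>^2)^2"
proof -
 have t0: "0 \<le> t" using t by simp
 let ?s = "\<lambda>z. sqrt (pk t (e, z))"
 note i = integral_sqrt_pk_le[OF e t \<epsilon>]
 have pn: "pk t p \<ge> 0" for p by (rule pk_nonneg[OF t0 t(2)])
 have i2: "integrable circ2 (\<lambda>p. ?s (fst p) * ?s (snd p))"
 proof (rule circ2_integrable_bounded[where B = "(1 + t) / (1 - t)"])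
  fix z w
  have "?s z * ?s w = sqrt (pk t (e, z) * pk t (e, w))" by (simp add: real_sqrt_mult)
  also have "\<dots> \<le> sqrt ((1 + t) / (1 - t) * ((1 + t) / (1 - t)))"
   using pn t0 t by (intro real_sqrt_le_mono mult_mono pk_le) auto
  also have "\<dots> = (1 + t) / (1 - t)" using t0 t by (simp only: real_sqrt_mult_self real_sqrt_mult[symmetric] real_sqrt_abs2) simp
  finally show "norm (?s (fst (z, w)) * ?s (snd (z, w))) \<le> (1 + t) / (1 - t)" using pn by simp
 qed measurable
 have le: "cmod (dquot (bub t e) (z, w)) \<le> ?s z * ?s w" if zw: "cmod z = 1" "cmod w = 1" for z w
 proof (cases "cdist (z, w) = 0")
  case False
  have "cmod (bub t e z - bub t e w) = sqrt (pk t (e, z) * pk t (e, w) * (cdist (z, w))^2)"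
   using cmod_bub_diff[OF e zw t0 t(2)] by (metis norm_ge_zero real_sqrt_unique)
  thus ?thesis using False by (simp add: cmod_dquot real_sqrt_mult)
 qed (simp add: cmod_dquot pn)
 have "(LINT p|circ2. cmod (dquot (bub t e) p)) \<le> (LINT p|circ2. ?s (fst p) * ?s (snd p))"
  by (rule integral_mono[OF integrable_dquot[OF circ_map_fin_energy[OF circ_map_bub[OF e t0 t(2)]]] i2]) (use le in force)
 also have "\<dots> = (LINT z|circ. (LINT w|circ. ?s z * ?s w))" using circ2_fubini(1)[OF i2] by simp
 also have "\<dots> = (LINT z|circ. ?s z)^2" by (simp add: power2_eq_square)
 also have "\<dots> \<le> (2 * \<epsilon> + sqrt ((1 - t^2) / t) / \<epsilon>^2)^2"
  using i(2) by (intro power_mono) (auto simp: pn)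
 finally show ?thesis .
qed

lemma integral_dquot_bub_small:
 assumes "\<epsilon> > 0"
 shows "\<forall>\<^sub>F t in at_left 1. \<forall>e. cmod e = 1 \<longrightarrow> (LINT p|circ2. cmod (dquot (bub t e) p)) \<le> \<epsilon>"
proof -
 define \<eta> where "\<eta> = min (1/2) (sqrt \<epsilon> / 4)"
 have \<eta>: "0 < \<eta>" "\<eta> < 1" "2 * \<eta> < sqrt \<epsilon>" unfolding \<eta>_def using real_sqrt_gt_zero[OF assms] by linarith+
 have "((\<lambda>t::real. 2 * \<eta> + sqrt ((1 - t^2) / t) / \<eta>^2) \<longlongrightarrow> 2 * \<eta> + sqrt ((1 - 1^2) / 1) / \<eta>^2) (at_left 1)"
  using \<eta> by (intro tendsto_intros) auto
 hence "((\<lambda>t::real. 2 * \<eta> + sqrt ((1 - t^2) / t) / \<eta>^2) \<longlongrightarrow> 2 * \<eta>) (at_left 1)" by simp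
 from order_tendstoD(2)[OF this \<eta>(3)]
 have "\<forall>\<^sub>F t in at_left 1. 2 * \<eta> + sqrt ((1 - t^2) / t) / \<eta>^2 < sqrt \<epsilon>" .
 moreover have "\<forall>\<^sub>F t in at_left 1. 1/4 \<le> t \<and> t < (1::real)"
  by (rule eventually_at_leftI[of "1/4"]) auto
 ultimately show ?thesis
 proof eventually_elim
  case (elim t)
  show ?case
  proof (intro allI impI)
   fix e :: complex assume e: "cmod e = 1"
   have "(LINT p|circ2. cmod (dquot (bub t e) p)) \<le> (2 * \<eta> + sqrt ((1 - t^2) / t) / \<eta>^2)^2"
    by (rule integral_dquot_bub_le) (use e elim \<eta> in auto)
   also have "\<dots> \<le> (sqrt \<epsilon>)^2" using elim \<eta> by (intro power_mono) (auto simp: power_le_one)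
   finally show "(LINT p|circ2. cmod (dquot (bub t e) p)) \<le> \<epsilon>" using assms by simp
  qed
 qed
qed

lemma integrable_bk_cross:
 assumes f: "circ_map f" and t: "0 \<le> t" "t < 1"
 shows "integrable circ2 (\<lambda>p. bk t e p * (1 - Re (cross f p)))"
  "integrable circ2 (\<lambda>p. bk t e p * (ck p * Im (cross f p)))"
proof -
 let ?C = "\<lambda>p. ck p * Im (cross f p)"
 note [measurable] = circ_map_measurable[OF f]
 have b: "\<And>z. cmod z = 1 ==> cmod (f z) \<le> 1" using f by (simp add: circ_map_norm)
 show "integrable circ2 (\<lambda>p. bk t e p * (1 - Re (cross f p)))"
 proof (rule integrable_bk_bounded[OF _ t])
  fix z w :: complex assume "cmod z = 1" "cmod w = 1"
  thus "\<bar>1 - Re (cross f (z, w))\<bar> \<le> 2" using Re_cross_bound(1)[of f 1 z w, OF b] by auto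
 qed measurable
 have i: "integrable circ2 (\<lambda>p. ((1 + t) / (1 - t))^2 * (?C p))"
  using integrable_ck_cross[OF circ_map_fin_energy[OF f]] by simp
 show "integrable circ2 (\<lambda>p. bk t e p * (?C p))"
 proof (rule B_integrable_bound[OF i])
  show "AE p in circ2. norm (bk t e p * (?C p)) \<le> norm (((1 + t) / (1 - t))^2 * (?C p))"
   using bk_le[OF t] bk_nonneg[OF t] by (intro AE_I2) (auto simp: abs_mult intro!: mult_right_mono)
 qed measurable
qed

text \<open>Compares \<open>f\<close> with \<open>f\<close> times a corrected bubble. The correction
  enters through the first variation in the direction \<open>etab\<close>. Since
  \<open>Im (bub t e) - etab\<close> vanishes on the fixed arc, the Euler-Lagrange equation allows
  \<open>Im (bub t e)\<close> in its place, and \<open>bub_interact_identity\<close> evaluates the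
  result. For fixed \<open>\<delta>\<close> all terms on the right are
  \<open>o(1 - t)\<close>.\<close>

lemma no_gain_bound:
 assumes f: "adm g d f" and min: "\<And>v. adm g d v ==> cenergy f \<le> cenergy v"
  and ng: "\<And>v. adm g (d + 1) v ==> cenergy f + 1 \<le> cenergy v"
  and e: "cmod e = 1" "Im e \<le> -\<delta>" and d: "0 < \<delta>" "\<delta> \<le> 1" and t: "1/4 \<le> t" "t < 1"
  and s: "56 / \<delta>^2 * (1 - t) \<le> 1/3"
 defines "s \<equiv> 56 / \<delta>^2 * (1 - t)" and "A \<equiv> \<integral>p. cmod (dquot f p) \<partial>circ2"
 shows "(LINT p|circ2. bk t e p * (1 - Re (cross f p))) - (1 - t^2) / (1 + t^2) * (LINT p|circ2. bk t e p * (ck p * Im (cross f p)))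
  \<le> 4 * s^2 * (1 + A) + 4 * s * (LINT p|circ2. cmod (dquot (bub t e) p)) + 2 * (1 - t)^2 * s * A"
proof -
 let ?E = "etab \<delta> t e"
 let ?I = "interact f (bub t e)"
 let ?L = "LINT p|circ2. cmod (dquot (bub t e) p)"
 have t0: "0 \<le> t" using t by simp
 have cf: "circ_map f" using f by (simp add: adm_def)
 note [measurable] = circ_map_measurable[OF cf]
 obtain v where v: "adm g (d + 1) v" "cenergy v \<le> cenergy f + 1 + 4 * s^2 + 4 * s^2 * (LINT p|circ2. cmod (dquot f p)) + 4 * s * ?L
   - 2 * (LINT p|circ2. interact f (bub t e) p) - 2 * (LINT p|circ2. Im (cross f p) * (etab \<delta> t e (fst p) - etab \<delta> t e (snd p)) / (cdist p)^2)"
  unfolding s_def by (rule bubble_adm[OF f e d t s]) (auto intro: that)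
 note ep = etab_props[OF e d t, folded s_def]
 let ?b = "\<lambda>z. Im (bub t e z)"
 let ?D = "\<lambda>\<psi> p. Im (cross f p) * (\<psi> (fst p) - \<psi> (snd p)) / (cdist p)^2"
 note bm = circ_map_bub[OF e(1) t0 t(2)]
 have [measurable]: "?b \<in> borel_measurable circ" using circ_map_measurable[OF bm] by measurable
 note ep(1)[measurable]
 obtain L where L: "L \<ge> 0" "\<And>z w. cmod z = 1 ==> cmod w = 1 ==> cmod (bub t e z - bub t e w) \<le> L * cmod (z - w)"
  by (rule circ_C1_lipschitz[OF bub_C1[OF e(1) t0 t(2)]]) (rule that)
 have bl: "\<bar>?b z - ?b w\<bar> \<le> L * cmod (z - w)" if "cmod z = 1" "cmod w = 1" for z w
  using order_trans[OF abs_Im_le_cmod L(2)[OF that]] by simp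
 have i1: "integrable circ2 (?D ?b)" by (rule integrable_Im_cross_lip(1)[OF cf _ bl]) auto
 have s0: "0 \<le> s" using t by (simp add: s_def)
 have i2: "integrable circ2 (?D ?E)" "\<bar>integral\<^sup>L circ2 (?D ?E)\<bar> \<le> s * A"
  unfolding A_def by (rule integrable_Im_cross_lip[OF cf ep(1), where s = s], rule ep(3); assumption)+
 have "integral\<^sup>L circ2 (?D (\<lambda>z. ?b z - etab \<delta> t e z)) = 0"
 proof (rule adm_critical[OF f min])
  show "0 \<le> 1 + s + L" using s0 L(1) by simp
  fix z :: complex assume z: "cmod z = 1"
  have "\<bar>?b z\<bar> \<le> 1" using abs_Im_le_cmod[of "bub t e z"] cmod_bub[OF e(1) z t0 t(2)] by simp
  thus "\<bar>?b z - etab \<delta> t e z\<bar> \<le> 1 + s + L" using ep(2)[OF z] L(1) by linarith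
  show "?b z - etab \<delta> t e z = 0" if "Im z \<ge> 0" using chi_props(3)[OF d(1) that] by (simp add: etab_def)
  fix w :: complex assume w: "cmod w = 1"
  have "\<bar>?b z - etab \<delta> t e z - (?b w - etab \<delta> t e w)\<bar> \<le> L * cmod (z - w) + s * cmod (z - w) + cmod (z - w)"
   using bl[OF z w] ep(3)[OF z w] norm_ge_zero[of "z - w"] by linarith
  thus "\<bar>?b z - etab \<delta> t e z - (?b w - etab \<delta> t e w)\<bar> \<le> (1 + s + L) * cmod (z - w)" by (simp add: algebra_simps)
 qed measurable
 also have "?D (\<lambda>z. ?b z - etab \<delta> t e z) = (\<lambda>p. ?D ?b p - ?D ?E p)"
  by (rule ext) (simp add: diff_divide_distrib[symmetric] right_diff_distrib)
 finally have crit: "integral\<^sup>L circ2 (?D ?b) = integral\<^sup>L circ2 (?D ?E)"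
  using i1 i2(1) by simp
 let ?J1 = "\<lambda>p. bk t e p * (1 - Re (cross f p))" and ?J2 = "\<lambda>p. bk t e p * (ck p * Im (cross f p))"
 define c where "c = (1 - t^2) / (1 + t^2)"
 define k where "k = 2 * t / (1 + t^2)"
 note iJ = integrable_bk_cross[OF cf t0 t(2), of e]
 have "integral\<^sup>L circ2 ?I + k * integral\<^sup>L circ2 (?D ?b) = (LINT p|circ2. interact f (bub t e) p + k * ?D ?b p)"
  by (simp only: B_integral_add[OF integrable_interact[OF cf bm] integrable_mult_right[OF i1]] integral_mult_right_zero)
 also have "\<dots> = (LINT p|circ2. ?J1 p / 2 - c * ?J2 p / 2)"
 proof (rule B_integral_cong[OF refl])
  fix p assume "p \<in> space circ2"
  then obtain z w where p: "p = (z, w)" "cmod z = 1" "cmod w = 1" by auto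
  show "interact f (bub t e) p + k * ?D ?b p = ?J1 p / 2 - c * ?J2 p / 2"
   using bub_interact_identity[OF cf e(1) p(2,3) t0 t(2)] by (simp only: p(1) fst_conv snd_conv k_def c_def)
 qed
 also have "\<dots> = integral\<^sup>L circ2 ?J1 / 2 - c * integral\<^sup>L circ2 ?J2 / 2" using iJ by simp
 finally have id: "integral\<^sup>L circ2 ?I + k * integral\<^sup>L circ2 (?D ?b) = integral\<^sup>L circ2 ?J1 / 2 - c * integral\<^sup>L circ2 ?J2 / 2" .
 \<comment> \<open>The identity has the factor \<open>k = 2 t / (1 + t^2)\<close> before the first
   variation, the energy has 1. The discrepancy is quadratic in \<open>1 - t\<close>, and it
   multiplies an integral which, thanks to criticality, is bounded by \<open>s * A\<close>.\<close>
 have "1 - k = (1 - t)^2 / (1 + t^2)" proof -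
  have p: "1 + t^2 \<noteq> 0" using zero_le_power2[of t] by linarith
  hence "1 - k = ((1 + t^2) - 2 * t) / (1 + t^2)" by (simp add: k_def diff_divide_distrib)
  also have "(1 + t^2) - 2 * t = (1 - t)^2" by (simp add: power2_eq_square algebra_simps)
  finally show ?thesis .
 qed
 also have "\<dots> \<le> (1 - t)^2 / 1" by (rule divide_left_mono) (auto simp: add_pos_nonneg)
 finally have "\<bar>1 - k\<bar> \<le> (1 - t)^2" using \<open>1 - k = (1 - t)^2 / (1 + t^2)\<close> by simp
 hence "\<bar>1 - k\<bar> * \<bar>integral\<^sup>L circ2 (?D ?b)\<bar> \<le> (1 - t)^2 * (s * A)"
  unfolding crit by (intro mult_mono i2) auto
 hence "\<bar>(1 - k) * integral\<^sup>L circ2 (?D ?b)\<bar> \<le> (1 - t)^2 * (s * A)" by (simp only: abs_mult)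
 moreover have "(1 - k) * integral\<^sup>L circ2 (?D ?b) = integral\<^sup>L circ2 (?D ?b) - k * integral\<^sup>L circ2 (?D ?b)"
  by (simp add: left_diff_distrib)
 ultimately have "integral\<^sup>L circ2 ?I + integral\<^sup>L circ2 (?D ?b) \<ge> integral\<^sup>L circ2 ?J1 / 2 - c * integral\<^sup>L circ2 ?J2 / 2 - (1 - t)^2 * (s * A)"
  using id by linarith
 hence "integral\<^sup>L circ2 ?J1 - c * integral\<^sup>L circ2 ?J2 \<le> 4 * s^2 + 4 * s^2 * A + 4 * s * ?L + 2 * ((1 - t)^2 * (s * A))"
  using v(2) ng[OF v(1)] crit unfolding A_def[symmetric] by linarith
 thus ?thesis unfolding c_def by (simp add: algebra_simps)
qed

subsection \<open>Averaging over the bubble centre\<close>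

text \<open>The semigroup law of the Poisson kernel, under which radii multiply: as a function of
  \<open>e\<close>, \<open>pk t (e, w)\<close> has coefficients of size \<open>t^n\<close>, and
  Poisson extension multiplies them by \<open>t^n\<close> once more.\<close>

lemma integral_bk_section:
 assumes z: "cmod z = 1" and w: "cmod w = 1" and t: "0 \<le> t" "t < 1"
 shows "(LINT e|circ. bk t e (z, w)) = pk (t^2) (z, w)"
proof -
 let ?P = "\<lambda>e. complex_of_real (pk t (e, w))" let ?x = "of_real (t^2) * (z * cnj w)"
 have t2: "0 \<le> t^2" "t^2 < 1" using t by (auto simp: power_less_one_iff)
 have n: "norm ?x < 1" "norm (cnj ?x) < 1" using t2 z w by (simp_all add: norm_mult del: of_real_power)
 have m: "fm ?P n = (of_real t * w) ^ n" for n
  using pint_power[OF w t, of n] by (simp add: pint_def fm_def pk_commute[of t w])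
 have p: "fp ?P n = cnj (of_real t * w) ^ n" for n
  using arg_cong[OF fm_cnj[of ?P n], of cnj] m[of n] by simp
 have "(\<lambda>n. of_real t ^ n * (fp ?P n * z ^ n + fm ?P n * cnj z ^ n)) sums (pint t ?P z + fm ?P 0)"
  by (rule poisson_expansion[where B = "(1 + t) / (1 - t)"]) (use pk_le[OF t] pk_nonneg[OF t] z t in auto)
 moreover have "of_real t ^ n * (fp ?P n * z ^ n + fm ?P n * cnj z ^ n) = ?x ^ n + cnj ?x ^ n" for n
  unfolding m p distrib_left power_mult_distrib[symmetric] by (simp add: power2_eq_square mult_ac)
 ultimately have "pint t ?P z + fm ?P 0 = 1 / (1 - ?x) + 1 / (1 - cnj ?x)"
  using sums_unique2[OF sums_add[OF geometric_sums[OF n(1)] geometric_sums[OF n(2)]]] by simp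
 hence "pint t ?P z = of_real (pk (t^2) (z, w))"
  unfolding pk_geometric[OF z w t2] using m[of 0] by (simp add: eq_diff_eq)
 moreover have "pint t ?P z = of_real (LINT e|circ. bk t e (z, w))"
  unfolding pint_def bk_def integral_complex_of_real[symmetric] by (simp add: pk_commute[of t z])
 ultimately show ?thesis by (simp only: of_real_eq_iff)
qed

lemma cdist_measurable_section [measurable]: "(\<lambda>e. cdist (e, z)) \<in> borel_measurable circ"
 unfolding cdist_def fst_conv snd_conv by measurable

lemma bk_measurable_section [measurable]: "(\<lambda>e. bk t e p) \<in> borel_measurable circ"
 unfolding bk_def by (intro borel_measurable_times measurable_pk_section)

lemma pk_measurable2 [measurable]:
 "(\<lambda>x. bk t (fst x) (snd x)) \<in> borel_measurable (circ \<Otimes>\<^sub>M circ2)"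
 "(\<lambda>x. bk t (snd x) (fst x)) \<in> borel_measurable (circ2 \<Otimes>\<^sub>M circ)"
proof -
 let ?C = "circ \<Otimes>\<^sub>M circ2"
 let ?I = "circ2 \<Otimes>\<^sub>M circ"
 have 1: "(\<lambda>x. (fst x, g (snd x))) \<in> measurable ?C circ2"
  "(\<lambda>x. (snd x, g (fst x))) \<in> measurable ?I circ2"
  if [measurable]: "g \<in> measurable circ2 circ" for g
 proof -
  have "(\<lambda>x. (fst x, g (snd x))) \<in> measurable ?C (circ \<Otimes>\<^sub>M circ)" by measurable
  thus "(\<lambda>x. (fst x, g (snd x))) \<in> measurable ?C circ2" by (simp only: circ2_def[symmetric])
  have "(\<lambda>x. (snd x, g (fst x))) \<in> measurable ?I (circ \<Otimes>\<^sub>M circ)" by measurable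
  thus "(\<lambda>x. (snd x, g (fst x))) \<in> measurable ?I circ2" by (simp only: circ2_def[symmetric])
 qed
 show "(\<lambda>x. bk t (fst x) (snd x)) \<in> borel_measurable ?C"
  "(\<lambda>x. bk t (snd x) (fst x)) \<in> borel_measurable ?I"
  unfolding bk_def
  by (intro borel_measurable_times measurable_compose[OF 1(1) measurable_kernels(1)] measurable_compose[OF 1(2) measurable_kernels(1)] fst_circ2 snd_circ2)+
qed

interpretation cc2: pair_sigma_finite circ circ2 ..

text \<open>The weight with which a pair of points enters after averaging the bubble centre \<open>e\<close> against \<open>\<omega>^2\<close>.\<close>

definition wk :: "(complex => real) => real => complex \<times> complex => real" where
 "wk \<omega> t p = (LINT e|circ. (\<omega> e)^2 * bk t e p)"

lemma wk_fubini:
 assumes [measurable]: "\<omega> \<in> borel_measurable circ" and \<omega>: "\<And>z. cmod z = 1 ==> \<bar>\<omega> z\<bar> \<le> 1"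
  and h: "integrable circ2 h" and t: "0 \<le> t" "t < 1"
 shows "integrable circ (\<lambda>e. (\<omega> e)^2 * (LINT p|circ2. bk t e p * h p))"
  "(LINT e|circ. (\<omega> e)^2 * (LINT p|circ2. bk t e p * h p)) = (LINT p|circ2. wk \<omega> t p * h p)"
  "integrable circ2 (\<lambda>p. wk \<omega> t p * h p)"
proof -
 note [measurable] = borel_measurable_integrable[OF h]
 define B where "B = ((1 + t) / (1 - t))^2"
 have b: "\<bar>(\<omega> e)^2 * bk t e p * x\<bar> \<le> B * \<bar>x\<bar>" if "cmod e = 1" for e p and x :: real
 proof -
  have "(\<omega> e)^2 \<le> 1" using \<omega>[OF that] by (simp add: abs_square_le_1)
  hence "(\<omega> e)^2 * bk t e p * \<bar>x\<bar> \<le> 1 * B * \<bar>x\<bar>"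
   using bk_le[OF t] bk_nonneg[OF t] by (intro mult_right_mono mult_mono) (auto simp: B_def)
  thus ?thesis using bk_nonneg[OF t] by (simp add: abs_mult)
 qed
 let ?F = "\<lambda>x. (\<omega> (fst x))^2 * bk t (fst x) (snd x) * h (snd x)"
 have hB: "integrable circ2 (\<lambda>p. B * \<bar>h p\<bar>)" using h by simp
 have [measurable]: "bk t e \<in> borel_measurable circ2" for e by measurable
 have ie: "integrable circ2 (\<lambda>p. (\<omega> e)^2 * bk t e p * h p)" if "cmod e = 1" for e
  by (rule B_integrable_bound[OF hB]) (use b[OF that] in \<open>auto simp: B_def intro!: AE_I2\<close>)
 have i: "integrable (circ \<Otimes>\<^sub>M circ2) ?F"
 proof (rule cc2.Fubini_integrable)
  show "integrable circ (\<lambda>x. \<integral>y. norm (?F (x, y)) \<partial>circ2)"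
  proof (rule circ_integrable_bounded[where B = "\<integral>p. B * \<bar>h p\<bar> \<partial>circ2"])
   fix e :: complex assume e: "cmod e = 1"
   have "(LINT y|circ2. norm (?F (e, y))) \<le> (LINT p|circ2. B * \<bar>h p\<bar>)"
    using ie[OF e] b[OF e] by (intro integral_mono hB) auto
   thus "norm (LINT y|circ2. norm (?F (e, y))) \<le> (LINT p|circ2. B * \<bar>h p\<bar>)" by simp
  qed measurable
  show "AE x in circ. integrable circ2 (\<lambda>y. ?F (x, y))" using ie by (intro AE_I2) auto
 qed measurable
 have eq1: "(LINT p|circ2. ?F (e, p)) = (\<omega> e)^2 * (LINT p|circ2. bk t e p * h p)" for e
  by (simp add: mult.assoc)
 have eq2: "(LINT e|circ. ?F (e, p)) = wk \<omega> t p * h p" for p by (simp add: wk_def)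
 show "integrable circ (\<lambda>e. (\<omega> e)^2 * (LINT p|circ2. bk t e p * h p))"
  using cc2.integrable_fst'[OF i] unfolding eq1 .
 have i2: "integrable (circ \<Otimes>\<^sub>M circ2) (\<lambda>(x, y). ?F (x, y))" using i by (simp add: split_def)
 show "integrable circ2 (\<lambda>p. wk \<omega> t p * h p)" using cc2.integrable_snd[OF i2] unfolding eq2 .
 show "(LINT e|circ. (\<omega> e)^2 * (LINT p|circ2. bk t e p * h p)) = (LINT p|circ2. wk \<omega> t p * h p)"
  using cc2.Fubini_integral[OF i2] unfolding eq1 eq2 by simp
qed

lemma wk_measurable [measurable]:
 assumes [measurable]: "\<omega> \<in> borel_measurable circ"
 shows "wk \<omega> t \<in> borel_measurable circ2"
 unfolding wk_def[abs_def] by measurable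

section \<open>Lipschitz weights and the limit of the averaged kernel\<close>

context
 fixes \<omega> :: "complex => real" and L :: real
 assumes \<omega>m [measurable]: "\<omega> \<in> borel_measurable circ" and \<omega>1: "\<And>z. cmod z = 1 ==> \<bar>\<omega> z\<bar> \<le> 1"
  and L: "0 \<le> L" and \<omega>L: "\<And>z w. cmod z = 1 ==> cmod w = 1 ==> \<bar>\<omega> z - \<omega> w\<bar> \<le> L * cmod (z - w)"
begin

text \<open>As a function of \<open>e\<close>, \<open>bk\<close> concentrates at \<open>z\<close>
  and \<open>w\<close>, so \<open>\<omega> e\<close> may be replaced by values there. The product
  \<open>\<omega> z * \<omega> w\<close> is chosen because it turns \<open>cross f\<close> into the
  cross term of \<open>\<omega> f\<close>. The first bound serves for domination, the second for the
  limit off the diagonal.\<close>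

lemma wk_loc:
 assumes z: "cmod z = 1" and w: "cmod w = 1" and t: "1/4 \<le> t" "t < 1"
 shows "\<bar>wk \<omega> t (z, w) - \<omega> z * \<omega> w * pk (t^2) (z, w)\<bar> \<le> 4 * L"
  "z \<noteq> w ==> \<bar>wk \<omega> t (z, w) - \<omega> z * \<omega> w * pk (t^2) (z, w)\<bar> \<le> L * (32 * (1 - t^2) / (t * (cdist (z, w))^2))"
proof -
 have t0: "0 \<le> t" "t < 1" "0 < t" using t by auto
 note pn = pk_nonneg[OF t0(1,2)]
 have ib: "integrable circ (\<lambda>e. \<phi> e * bk t e (z, w))"
  if [measurable]: "\<phi> \<in> borel_measurable circ" and "\<And>e. cmod e = 1 ==> \<bar>\<phi> e\<bar> \<le> C" for \<phi> :: "complex => real" and C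
 proof (rule circ_integrable_bounded[where B = "C * ((1 + t) / (1 - t))^2"])
  fix e :: complex assume "cmod e = 1"
  thus "norm (\<phi> e * bk t e (z, w)) \<le> C * ((1 + t) / (1 - t))^2"
   unfolding norm_mult using that(2)[of e] bk_le[OF t0(1,2)] bk_nonneg[OF t0(1,2)] by (intro mult_mono) auto
 qed measurable
 have i1: "integrable circ (\<lambda>e. (\<omega> e)^2 * bk t e (z, w))"
  by (rule ib[where C = 1]) (use \<omega>1 in \<open>auto simp: abs_square_le_1\<close>)
 have i2: "integrable circ (\<lambda>e. \<omega> z * \<omega> w * bk t e (z, w))" by (rule ib[where C = "\<bar>\<omega> z * \<omega> w\<bar>"]) auto
 let ?K = "\<lambda>e. (cdist (e, z) + cdist (e, w)) * bk t e (z, w)"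
 have i3: "integrable circ ?K"
  by (rule ib[where C = 4]) (use z w cdist_le_2 in \<open>force intro: order_trans[OF add_mono[OF cdist_le_2 cdist_le_2]]\<close>)+
 note ip = integrable_pk(2)[OF t0(1,2)]
 have "wk \<omega> t (z, w) - \<omega> z * \<omega> w * pk (t^2) (z, w) = (LINT e|circ. (\<omega> e)^2 * bk t e (z, w) - \<omega> z * \<omega> w * bk t e (z, w))"
  unfolding wk_def integral_bk_section[OF z w t0(1,2), symmetric] using i1 i2 by simp
 also have "\<bar>\<dots>\<bar> \<le> (LINT e|circ. \<bar>(\<omega> e)^2 * bk t e (z, w) - \<omega> z * \<omega> w * bk t e (z, w)\<bar>)" by (rule integral_abs_bound)
 also have "\<dots> \<le> (LINT e|circ. L * ?K e)"
 proof (rule integral_mono)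
  show "integrable circ (\<lambda>e. \<bar>(\<omega> e)^2 * bk t e (z, w) - \<omega> z * \<omega> w * bk t e (z, w)\<bar>)" using i1 i2 by auto
  show "integrable circ (\<lambda>e. L * ?K e)" using i3 by simp
  fix e assume "e \<in> space circ"
  hence e: "cmod e = 1" by simp
  \<comment> \<open>Symmetrised so that each summand contains one difference between
    \<open>\<omega> e\<close> and a value at \<open>z\<close> or \<open>w\<close>.\<close>
  have "2 * ((\<omega> e)^2 - \<omega> z * \<omega> w) = (\<omega> e - \<omega> z) * (\<omega> e + \<omega> w) + (\<omega> e - \<omega> w) * (\<omega> e + \<omega> z)"
   by (simp add: power2_eq_square algebra_simps)
  hence "2 * \<bar>(\<omega> e)^2 - \<omega> z * \<omega> w\<bar> = \<bar>(\<omega> e - \<omega> z) * (\<omega> e + \<omega> w) + (\<omega> e - \<omega> w) * (\<omega> e + \<omega> z)\<bar>"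
   by (metis abs_mult abs_numeral)
  also have "\<dots> \<le> \<bar>\<omega> e - \<omega> z\<bar> * \<bar>\<omega> e + \<omega> w\<bar> + \<bar>\<omega> e - \<omega> w\<bar> * \<bar>\<omega> e + \<omega> z\<bar>"
   by (simp only: abs_mult[symmetric] abs_triangle_ineq)
  also have "\<dots> \<le> (L * cdist (e, z)) * 2 + (L * cdist (e, w)) * 2"
   using \<omega>L[OF e z] \<omega>L[OF e w] \<omega>1[OF e] \<omega>1[OF z] \<omega>1[OF w] by (intro add_mono mult_mono) (auto simp: cdist_def)
  finally have "\<bar>(\<omega> e)^2 - \<omega> z * \<omega> w\<bar> \<le> L * (cdist (e, z) + cdist (e, w))" by (simp add: algebra_simps)
  from mult_right_mono[OF this bk_nonneg[OF t0(1,2)]]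
  have "\<bar>(\<omega> e)^2 - \<omega> z * \<omega> w\<bar> * bk t e (z, w) \<le> L * ?K e" by (simp only: mult.assoc)
  thus "\<bar>(\<omega> e)^2 * bk t e (z, w) - \<omega> z * \<omega> w * bk t e (z, w)\<bar> \<le> L * ?K e"
   using bk_nonneg[OF t0(1,2)] by (simp add: abs_mult flip: left_diff_distrib)
 qed
 also have "\<dots> = L * integral\<^sup>L circ ?K" by simp
 finally have main: "\<bar>wk \<omega> t (z, w) - \<omega> z * \<omega> w * pk (t^2) (z, w)\<bar> \<le> L * integral\<^sup>L circ ?K" .
 have c2: "pk t p * cdist p \<le> 2" for p by (rule pk_cdist[OF t])
 have "integral\<^sup>L circ ?K \<le> (LINT e|circ. 2 * pk t (e, w) + 2 * pk t (e, z))"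
 proof (rule integral_mono[OF i3])
  fix e
  have "?K e = (pk t (e, z) * cdist (e, z)) * pk t (e, w) + (pk t (e, w) * cdist (e, w)) * pk t (e, z)"
   by (simp add: bk_def algebra_simps)
  also have "\<dots> \<le> 2 * pk t (e, w) + 2 * pk t (e, z)" by (intro add_mono mult_right_mono c2 pn)
  finally show "?K e \<le> 2 * pk t (e, w) + 2 * pk t (e, z)" .
 qed (use ip in simp)
 also have "\<dots> = 4" using ip integral_pk(2)[OF z t0(1,2)] integral_pk(2)[OF w t0(1,2)] by simp
 finally show "\<bar>wk \<omega> t (z, w) - \<omega> z * \<omega> w * pk (t^2) (z, w)\<bar> \<le> 4 * L"
  using main mult_left_mono[OF _ L, of "integral\<^sup>L circ ?K" 4] by simp
 assume "z \<noteq> w"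
 hence D: "cdist (z, w) > 0" by (simp add: cdist_def)
 \<comment> \<open>Of \<open>z\<close> and \<open>w\<close>, the one farther from \<open>e\<close>
   is at distance at least half of \<open>cdist (z, w)\<close>, so its kernel is at most
   \<open>M\<close>; the other kernel has integral 1.\<close>
 define M where "M = (1 - t^2) / t * (4 / (cdist (z, w))^2)"
 have M: "M \<ge> 0" using t0 by (simp add: M_def power_le_one)
 have far: "pk t (e, x) \<le> M" if "cdist (z, w) \<le> 2 * cdist (e, x)" for e x
 proof -
  have "(cdist (z, w))^2 \<le> (2 * cdist (e, x))^2" using that by (intro power_mono) auto
  hence "pk t (e, x) * (cdist (z, w))^2 \<le> pk t (e, x) * (4 * (cdist (e, x))^2)"
   by (intro mult_left_mono pn) (simp add: power_mult_distrib)
  also have "\<dots> = 4 * (pk t (e, x) * (cdist (e, x))^2)" by simp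
  also have "\<dots> \<le> 4 * ((1 - t^2) / t)" by (intro mult_left_mono pk_cdist2 t0) auto
  finally have "pk t (e, x) \<le> 4 * ((1 - t^2) / t) / (cdist (z, w))^2" using D by (simp only: pos_le_divide_eq zero_less_power)
  thus ?thesis by (simp add: M_def mult.commute)
 qed
 have "integral\<^sup>L circ ?K \<le> (LINT e|circ. M * (4 + 2 * pk t (e, w) + 2 * pk t (e, z)))"
 proof (rule integral_mono[OF i3])
  fix e assume "e \<in> space circ"
  hence e: "cmod e = 1" by simp
  have tri: "cdist (z, w) \<le> cdist (e, z) + cdist (e, w)"
   unfolding cdist_def fst_conv snd_conv using norm_triangle_ineq4[of "e - w" "e - z"] by (simp add: norm_minus_commute)
  have *: "(cdist (e, x) + cdist (e, y)) * (pk t (e, x) * pk t (e, y)) \<le> M * (4 + 2 * pk t (e, x) + 2 * pk t (e, y))"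
   if "cdist (z, w) \<le> 2 * cdist (e, y)" "cmod y = 1" for x y
  proof -
   have "(cdist (e, x) + cdist (e, y)) * (pk t (e, x) * pk t (e, y)) = pk t (e, y) * (pk t (e, x) * cdist (e, x) + cdist (e, y) * pk t (e, x))"
    by (simp add: algebra_simps)
   also have "\<dots> \<le> M * (2 + 2 * pk t (e, x))"
    using far[OF that(1)] pn cdist_le_2[OF e that(2)] by (intro mult_mono add_mono c2 mult_right_mono far[OF that(1)] M) auto
   also have "\<dots> \<le> M * (4 + 2 * pk t (e, x) + 2 * pk t (e, y))" using M pn[of "(e, y)"] by (intro mult_left_mono) auto
   finally show ?thesis .
  qed
  show "?K e \<le> M * (4 + 2 * pk t (e, w) + 2 * pk t (e, z))"
  proof (cases "cdist (z, w) \<le> 2 * cdist (e, w)")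
   case True
   from *[OF True w, of z] show ?thesis by (simp add: bk_def algebra_simps)
  next
   case False
   hence "cdist (z, w) \<le> 2 * cdist (e, z)" using tri by simp
   from *[OF this z, of w] show ?thesis by (simp add: bk_def algebra_simps)
  qed
 qed (use ip in simp)
 also have "\<dots> = M * 8" using ip integral_pk(2)[OF z t0(1,2)] integral_pk(2)[OF w t0(1,2)] by simp
 finally have "L * integral\<^sup>L circ ?K \<le> L * (M * 8)" by (rule mult_left_mono[OF _ L])
 also have "M * 8 = 32 * (1 - t^2) / (t * (cdist (z, w))^2)" by (simp add: M_def)
 finally show "\<bar>wk \<omega> t (z, w) - \<omega> z * \<omega> w * pk (t^2) (z, w)\<bar> \<le> L * (32 * (1 - t^2) / (t * (cdist (z, w))^2))"
  using main by linarith
qed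

text \<open>The kernel at \<open>w\<close> is at least \<open>(1 - t) / (1 + t)\<close> wherever its
  points lie, while the kernel at \<open>z\<close> concentrates and reproduces
  \<open>\<omega> z\<close> squared. The bound is of order \<open>1 - t\<close>, on which the whole
  comparison takes place.\<close>

lemma wk_ge:
 assumes z: "cmod z = 1" and w: "cmod w = 1" and t: "1/4 \<le> t" "t < 1"
 shows "wk \<omega> t (z, w) \<ge> (1 - t) / 2 * ((\<omega> z)^2 - 2 * L * sqrt ((1 - t^2) / t))"
proof -
 let ?L = "LINT e|circ. pk t (e, z) * (cdist (e, z))^2"
 have t0: "0 \<le> t" "t < 1" "0 < t" using t by auto
 note pn = pk_nonneg[OF t0(1,2)]
 \<comment> \<open>Balances \<open>2 d \<le> a + d^2 / a\<close>: the mean of \<open>d^2\<close>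
   under the Poisson kernel is at most \<open>a^2\<close>.\<close>
 define a where "a = sqrt ((1 - t^2) / t)"
 have a: "a > 0" "a^2 = (1 - t^2) / t" using t0 by (auto simp: a_def power_less_one_iff power_le_one abs_square_less_1)
 let ?c = "\<lambda>e. pk t (e, z) * (cdist (e, z))^2 / a - a * pk t (e, z)"
 note ip = integrable_pk(2)[OF t0(1,2)]
 have ic: "integrable circ (\<lambda>e. pk t (e, z) * (cdist (e, z))^2)"
  by (rule circ_integrable_bounded[where B = "(1 - t^2) / t"]) (use pk_cdist2[OF t0(3,2)] pn in auto)
 have i1: "integrable circ (\<lambda>e. (\<omega> e)^2 * bk t e (z, w))"
 proof (rule circ_integrable_bounded[where B = "1 * ((1 + t) / (1 - t))^2"])
  fix e :: complex assume "cmod e = 1"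
  thus "norm ((\<omega> e)^2 * bk t e (z, w)) \<le> 1 * ((1 + t) / (1 - t))^2"
   unfolding norm_mult using \<omega>1[of e] bk_le[OF t0(1,2)] bk_nonneg[OF t0(1,2)] by (intro mult_mono) (auto simp: abs_square_le_1)
 qed measurable
 have icc: "integrable circ ?c" using ip ic by simp
 have "(1 - t) / 2 * ((\<omega> z)^2 - 2 * L * a) = (LINT e|circ. (1 - t) / 2 * (((\<omega> z)^2 - 2 * L * a) * pk t (e, z)))"
  using integral_pk(2)[OF z t0(1,2)] by simp
 also have "\<dots> \<le> (LINT e|circ. (\<omega> e)^2 * bk t e (z, w) + (1 - t) / 2 * L * (?c e))"
  proof (rule integral_mono)
  fix e assume "e \<in> space circ"
  hence e: "cmod e = 1" by simp
  let ?d = "cdist (e, z)" and ?P = "pk t (e, z)"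
  have "(\<omega> z)^2 - (\<omega> e)^2 = (\<omega> z - \<omega> e) * (\<omega> z + \<omega> e)" by (simp add: power2_eq_square algebra_simps)
  also have "\<dots> \<le> \<bar>\<omega> z - \<omega> e\<bar> * \<bar>\<omega> z + \<omega> e\<bar>" unfolding abs_mult[symmetric] by simp
  also have "\<dots> \<le> (L * ?d) * 2"
   using \<omega>L[OF z e] \<omega>1[OF e] \<omega>1[OF z] by (intro mult_mono) (auto simp: cdist_def norm_minus_commute)
  also have "\<dots> = L * (2 * ?d)" by simp
  also have "\<dots> \<le> L * (a + ?d^2 / a)"
  proof (rule mult_left_mono[OF _ L])
   have "0 \<le> (a - ?d)^2 / a" using a by simp
   also have "\<dots> = a + ?d^2 / a - 2 * ?d" using a(1) by (simp add: power2_eq_square field_simps)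
   finally show "2 * ?d \<le> a + ?d^2 / a" by simp
  qed
  finally have "(\<omega> z)^2 - 2 * L * a \<le> (\<omega> e)^2 + L * (?d^2 / a - a)" by (simp add: algebra_simps)
  from mult_right_mono[OF this pn] have "((\<omega> z)^2 - 2 * L * a) * ?P \<le> (\<omega> e)^2 * ?P + L * ?c e"
   by (simp add: algebra_simps)
  from mult_left_mono[OF this, of "(1 - t) / 2"] t0
  have 1: "(1 - t) / 2 * (((\<omega> z)^2 - 2 * L * a) * ?P) \<le> (\<omega> e)^2 * (?P * ((1 - t) / 2)) + (1 - t) / 2 * L * ?c e"
   by (simp add: algebra_simps)
  have "(1 - t) / 2 \<le> (1 - t) / (1 + t)" using t0 by (intro divide_left_mono) auto
  also have "\<dots> \<le> pk t (e, w)" by (rule pk_ge[OF t0(1,2) cdist_le_2[OF e w]])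
  finally have "(\<omega> e)^2 * (?P * ((1 - t) / 2)) \<le> (\<omega> e)^2 * bk t e (z, w)"
   unfolding bk_def fst_conv snd_conv by (intro mult_left_mono pn) auto
  with 1 show "(1 - t) / 2 * (((\<omega> z)^2 - 2 * L * a) * ?P) \<le> (\<omega> e)^2 * bk t e (z, w) + (1 - t) / 2 * L * ?c e" by linarith
 qed (use ip i1 icc in auto)
 also have "\<dots> = wk \<omega> t (z, w) + (1 - t) / 2 * L * integral\<^sup>L circ ?c"
  unfolding wk_def by (simp only: B_integral_add[OF i1 integrable_mult_right[OF icc]] integral_mult_right_zero)
 also have "\<dots> \<le> wk \<omega> t (z, w) + (1 - t) / 2 * L * 0"
 proof (intro add_left_mono mult_left_mono)
  have "?L \<le> (LINT e|circ. (1 - t^2) / t)"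
   by (rule integral_mono[OF ic]) (use pk_cdist2[OF t0(3,2)] in auto)
  hence "?L \<le> a^2" by (simp add: a(2))
  hence "?L / a \<le> a" using a(1) by (simp add: field_simps power2_eq_square)
  thus "integral\<^sup>L circ ?c \<le> 0" using ip ic integral_pk(2)[OF z t0(1,2)] by simp
 qed (use t0 L in auto)

 finally show ?thesis unfolding a_def by simp
qed

lemma fin_energy_weight: "fin_energy (\<lambda>z. of_real (\<omega> z))"
 by (rule fin_energy_lipschitz(1)[where L = L]) (use \<omega>L L in \<open>auto simp flip: of_real_diff\<close>)

text \<open>The weight is replaced by \<open>\<omega> z * \<omega> w * pk (t^2)\<close>, and
  \<open>pk (t^2) * ck = (1 + t^2) * nk (t^2)\<close> brings in the degree of
  \<open>\<omega> f\<close>; the factor 2 is the limit of \<open>1 + t^2\<close>.\<close>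

lemma wk_limit:
 assumes f: "circ_map f"
 shows "(\<lambda>k. \<integral>p. wk \<omega> (tseq k) p * (ck p * Im (cross f p)) \<partial>circ2) \<leadsto> 2 * cdeg (\<lambda>z. of_real (\<omega> z) * f z)"
proof -
 let ?L = "\<lambda>z w. \<lambda>k. L * (32 * (1 - (tseq k)^2) / (tseq k * (cdist (z, w))^2))"
 define h where "h p = ck p * Im (cross f p)" for p
 define F where "F z = of_real (\<omega> z) * f z" for z
 note [measurable] = circ_map_measurable[OF f]
 have ih: "integrable circ2 h" unfolding h_def[abs_def] by (rule integrable_ck_cross[OF circ_map_fin_energy[OF f]])
 have [measurable]: "h \<in> borel_measurable circ2" unfolding h_def[abs_def] by measurable
 have fF: "fin_energy F" unfolding F_def[abs_def] by (rule fin_energy_mult[OF fin_energy_weight circ_map_fin_energy[OF f]])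
 have t: "0 \<le> tseq k" "1/4 \<le> tseq k" "tseq k < 1" "0 < tseq k" for k using tseq[of k] by auto
 have t2: "0 < (tseq k)^2" "(tseq k)^2 < 1" "1/4 \<le> (tseq k)^2" for k
  using t[of k] power_mono[OF tseq(1)[of k], of 2] by (auto simp: power_less_one_iff abs_square_less_1 power_divide)
 have lim2: "(\<lambda>k. (tseq k)^2) \<leadsto> 1" using tendsto_power[OF tseq_lim, of 2] by simp
 let ?S = "\<lambda>k p. \<omega> (fst p) * \<omega> (snd p) * pk ((tseq k)^2) p * h p"
 have S: "?S k p = (1 + (tseq k)^2) * (nk ((tseq k)^2) p * Im (cross F p))" for k p
 proof -
  have "1 + (tseq k)^2 \<noteq> 0" using t2[of k] by auto
  moreover have "Im (cross F p) = \<omega> (fst p) * \<omega> (snd p) * Im (cross f p)" by (simp add: F_def cross_def algebra_simps)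
  ultimately show ?thesis by (simp add: nk_def h_def)
 qed
 have iS: "integrable circ2 (?S k)" for k
  unfolding S using integrable_nk_cross[OF fF t2(3,2)] by simp
 have iW: "integrable circ2 (\<lambda>p. wk \<omega> (tseq k) p * h p)" for k
  by (rule wk_fubini(3)[OF \<omega>m \<omega>1 ih t(1,3)])
 have "(\<lambda>k. \<integral>p. ?S k p \<partial>circ2) \<leadsto> (1 + 1) * cdeg F"
  unfolding S integral_mult_right_zero by (intro tendsto_mult tendsto_add tendsto_const lim2 nk_tendsto_cdeg[OF fF t2(1,2) lim2])
 moreover have "(\<lambda>k. \<integral>p. wk \<omega> (tseq k) p * h p - ?S k p \<partial>circ2) \<leadsto> (LINT p|circ2. 0)"
 proof (rule integral_dominated_convergence[where w = "\<lambda>p. 4 * L * \<bar>h p\<bar>"])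
  have eq: "wk \<omega> (tseq k) (z, w) * h (z, w) - ?S k (z, w) = (wk \<omega> (tseq k) (z, w) - \<omega> z * \<omega> w * pk ((tseq k)^2) (z, w)) * h (z, w)" for k z w
   by (simp add: algebra_simps)
  show "AE p in circ2. norm (wk \<omega> (tseq k) p * h p - ?S k p) \<le> 4 * L * \<bar>h p\<bar>" for k
  proof (rule AE_I2)
   fix p assume "p \<in> space circ2"
   then obtain z w where p: "p = (z, w)" "cmod z = 1" "cmod w = 1" by auto
   show "norm (wk \<omega> (tseq k) p * h p - ?S k p) \<le> 4 * L * \<bar>h p\<bar>"
    unfolding p(1) eq real_norm_def abs_mult by (intro mult_right_mono wk_loc(1) p t) auto
  qed
  show "AE p in circ2. (\<lambda>k. wk \<omega> (tseq k) p * h p - ?S k p) \<leadsto> 0"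
  proof (rule AE_I2)
   fix p assume "p \<in> space circ2"
   then obtain z w where p: "p = (z, w)" "cmod z = 1" "cmod w = 1" by auto
   show "(\<lambda>k. wk \<omega> (tseq k) p * h p - ?S k p) \<leadsto> 0"
   proof (cases "z = w")
    case True
    thus ?thesis by (simp add: p h_def ck_def cdist_def)
   next
    case False
    hence c: "(cdist (z, w))^2 > 0" by (simp add: cdist_def)
    have "(?L z w) \<leadsto> L * (32 * (1 - 1) / (1 * (cdist (z, w))^2))"
     using c by (intro tendsto_intros lim2 tseq_lim) auto
    hence "(?L z w) \<leadsto> 0" by simp
    hence "(\<lambda>k. wk \<omega> (tseq k) (z, w) - \<omega> z * \<omega> w * pk ((tseq k)^2) (z, w)) \<leadsto> 0"
     by (rule Lim_null_comparison[rotated]) (use wk_loc(2)[OF p(2,3) t(2,3) False] in auto)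
    thus ?thesis unfolding p(1) eq by (rule tendsto_mult_left_zero)
   qed
  qed
 qed (use ih in auto)
 ultimately have "(\<lambda>k. (LINT p|circ2. wk \<omega> (tseq k) p * h p - ?S k p) + (LINT p|circ2. ?S k p)) \<leadsto> (LINT p|circ2. 0) + (1 + 1) * cdeg F"
  by (intro tendsto_add)
 moreover have "(LINT p|circ2. wk \<omega> (tseq k) p * h p - ?S k p) + (LINT p|circ2. ?S k p) = (LINT p|circ2. wk \<omega> (tseq k) p * h p)" for k
  using B_integral_diff[OF iW iS] by simp
 ultimately show ?thesis unfolding h_def F_def[abs_def] by simp
qed

text \<open>Averages the bubble inequality over centres in the support of \<open>\<omega>\<close>
  and divides by \<open>1 - t\<close>. On the left \<open>wk_ge\<close> leaves half of the weighted
  integral; on the right \<open>(1 - t^2) / ((1 + t^2) (1 - t))\<close> tends to 1 and the double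
  integral to twice the degree.\<close>

lemma no_gain_weighted:
 assumes f: "adm g d f" and min: "\<And>v. adm g d v ==> cenergy f \<le> cenergy v"
  and ng: "\<And>v. adm g (d + 1) v ==> cenergy f + 1 \<le> cenergy v"
  and \<delta>: "0 < \<delta>" "\<delta> \<le> 1" and supp: "\<And>e. cmod e = 1 ==> Im e > - \<delta> ==> \<omega> e = 0"
 shows "(LINT p|circ2. (\<omega> (fst p))^2 * (1 - Re (cross f p))) \<le> 4 * cdeg (\<lambda>z. of_real (\<omega> z) * f z)"
proof -
 let ?L = "\<lambda>z. of_real (\<omega> z) * f z"
 let ?O = "\<lambda>p. \<omega> (fst p)"
 have cf: "circ_map f" using f by (simp add: adm_def)
 note [measurable] = circ_map_measurable[OF cf]
 define h where "h p = ck p * Im (cross f p)" for p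
 define \<phi> where "\<phi> p = 1 - Re (cross f p)" for p
 have [measurable]: "\<phi> \<in> borel_measurable circ2" unfolding \<phi>_def[abs_def] by measurable
 have ih: "integrable circ2 h" unfolding h_def[abs_def] by (rule integrable_ck_cross[OF circ_map_fin_energy[OF cf]])
 have \<phi>: "0 \<le> \<phi> (z, w)" "\<phi> (z, w) \<le> 2" if "cmod z = 1" "cmod w = 1" for z w
  using Re_cross_bound(1)[of f 1 z w] circ_map_norm[OF cf] that by (auto simp: \<phi>_def)
 have i\<phi>: "integrable circ2 \<phi>" by (rule circ2_integrable_bounded[where B = 2]) (use \<phi> in auto)
 have i\<omega>: "integrable circ2 (\<lambda>p. (?O p)^2 * \<phi> p)"
 proof (rule circ2_integrable_bounded[where B = "1 * 2"])
  fix z w :: complex assume "cmod z = 1" "cmod w = 1"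
  thus "norm ((\<omega> (fst (z, w)))^2 * \<phi> (z, w)) \<le> 1 * 2"
   unfolding norm_mult using \<omega>1[of z] \<phi>[of z w] by (intro mult_mono) (auto simp: abs_square_le_1)
 qed measurable
 define A where "A = (LINT p|circ2. cmod (dquot f p))"
 define C where "C = 56 / \<delta>^2"
 have C: "C > 0" using \<delta> by (simp add: C_def)
 have A: "A \<ge> 0" by (simp add: A_def)
 define W where "W = (LINT p|circ2. (?O p)^2 * \<phi> p)"
 define a where "a t = sqrt ((1 - t^2) / t)" for t :: real
 define T where "T k = (LINT p|circ2. wk \<omega> (tseq k) p * h p)" for k
 have fl: "filterlim tseq (at_left 1) sequentially"
  unfolding filterlim_at using tseq_lim tseq(3) less_imp_neq[OF tseq(3)] by (auto intro!: always_eventually)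
 have al: "(\<lambda>k. a (tseq k)) \<leadsto> 0"
 proof -
  have "(\<lambda>k. a (tseq k)) \<leadsto> sqrt ((1 - 1^2) / 1)" unfolding a_def by (intro tendsto_intros tseq_lim) auto
  thus ?thesis by simp
 qed
 have main: "W / 2 \<le> \<epsilon> + 2 * cdeg ?L" if \<epsilon>: "\<epsilon> > 0" for \<epsilon>
 proof -
  \<comment> \<open>The mixed error term \<open>4 C \<epsilon>'\<close> persists as \<open>t\<close>
    tends to 1 and is given half of \<open>\<epsilon>\<close>.\<close>
  define \<epsilon>' where "\<epsilon>' = \<epsilon> / (8 * C)"
  have e': "\<epsilon>' > 0" "4 * C * \<epsilon>' < \<epsilon>" using \<epsilon> C by (auto simp: \<epsilon>'_def)
  have "((\<lambda>t. 4 * C^2 * (1 - t) * (1 + A) + 4 * C * \<epsilon>' + 2 * (1 - t)^2 * C * A) \<longlongrightarrow> 4 * C^2 * (1 - 1) * (1 + A) + 4 * C * \<epsilon>' + 2 * (1 - 1)^2 * C * A) (at_left 1)"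
   by (intro tendsto_intros)
  hence "((\<lambda>t. 4 * C^2 * (1 - t) * (1 + A) + 4 * C * \<epsilon>' + 2 * (1 - t)^2 * C * A) \<longlongrightarrow> 4 * C * \<epsilon>') (at_left 1)" by simp
  from order_tendstoD(2)[OF this e'(2)]
  have ev1: "\<forall>\<^sub>F t in at_left 1. 4 * C^2 * (1 - t) * (1 + A) + 4 * C * \<epsilon>' + 2 * (1 - t)^2 * C * A < \<epsilon>" .
  have "((\<lambda>t. C * (1 - t)) \<longlongrightarrow> C * (1 - 1)) (at_left 1)" by (intro tendsto_intros)
  hence ev2: "\<forall>\<^sub>F t in at_left 1. C * (1 - t) < 1/3" by (rule order_tendstoD) simp
  have "\<forall>\<^sub>F k in sequentially. (W - 2 * L * a (tseq k) * integral\<^sup>L circ2 \<phi>) / 2 \<le> \<epsilon> + (1 + tseq k) / (1 + (tseq k)^2) * T k"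
   using filterlim_iff[THEN iffD1, OF fl, rule_format, OF ev1] filterlim_iff[THEN iffD1, OF fl, rule_format, OF ev2]
    filterlim_iff[THEN iffD1, OF fl, rule_format, OF integral_dquot_bub_small[OF e'(1)]]
  proof eventually_elim
   case (elim k)
   define t where "t = tseq k"
   have t: "1/4 \<le> t" "t < 1" "0 \<le> t" using tseq[of k] by (auto simp: t_def)
   define c where "c = (1 - t^2) / (1 + t^2)"
   let ?J1 = "\<lambda>e. (\<omega> e)^2 * (LINT p|circ2. bk t e p * \<phi> p)" and ?J2 = "\<lambda>e. (\<omega> e)^2 * (LINT p|circ2. bk t e p * h p)"
   note w1 = wk_fubini[OF \<omega>m \<omega>1 i\<phi> t(3,2)] and w2 = wk_fubini[OF \<omega>m \<omega>1 ih t(3,2)]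
   have pt: "?J1 e - c * ?J2 e \<le> (1 - t) * \<epsilon>" if e: "cmod e = 1" for e
   proof (cases "\<omega> e = 0")
    case True
    thus ?thesis using t \<epsilon> by simp
   next
    case False
    hence "Im e \<le> - \<delta>" using supp[OF e] by force
    have sb: "56 / \<delta>^2 * (1 - t) \<le> 1/3" using elim(2) by (simp add: C_def t_def)
    define s where "s = C * (1 - t)"
    have "(LINT p|circ2. bk t e p * \<phi> p) - c * (LINT p|circ2. bk t e p * h p)
     \<le> 4 * s^2 * (1 + A) + 4 * s * (LINT p|circ2. cmod (dquot (bub t e) p)) + 2 * (1 - t)^2 * s * A"
     using no_gain_bound[OF f min ng e \<open>Im e \<le> - \<delta>\<close> \<delta> t(1,2) sb]
     unfolding \<phi>_def h_def c_def A_def s_def C_def .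
    also have "\<dots> \<le> 4 * s^2 * (1 + A) + 4 * s * \<epsilon>' + 2 * (1 - t)^2 * s * A"
     using elim(3) e C t by (intro add_mono mult_left_mono) (auto simp: t_def s_def)
    also have "\<dots> = (1 - t) * (4 * C^2 * (1 - t) * (1 + A) + 4 * C * \<epsilon>' + 2 * (1 - t)^2 * C * A)"
     by (simp add: s_def power2_eq_square algebra_simps)
    also have "\<dots> \<le> (1 - t) * \<epsilon>" using elim(1) t by (intro mult_left_mono) (auto simp: t_def)
    finally have "(\<omega> e)^2 * ((LINT p|circ2. bk t e p * \<phi> p) - c * (LINT p|circ2. bk t e p * h p)) \<le> (\<omega> e)^2 * ((1 - t) * \<epsilon>)"
     by (rule mult_left_mono) simp
    also have "\<dots> \<le> 1 * ((1 - t) * \<epsilon>)" using \<omega>1[OF e] t \<epsilon> by (intro mult_right_mono) (auto simp: abs_square_le_1)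
    finally show ?thesis by (simp add: algebra_simps)
   qed
   have "(LINT p|circ2. wk \<omega> t p * \<phi> p) - c * (LINT p|circ2. wk \<omega> t p * h p) = (LINT e|circ. ?J1 e - c * ?J2 e)"
    by (simp only: B_integral_diff[OF w1(1) integrable_mult_right[OF w2(1)]] integral_mult_right_zero w1(2) w2(2))
   also have "\<dots> \<le> (LINT e|circ. (1 - t) * \<epsilon>)"
    by (rule integral_mono) (use pt in \<open>auto intro!: B_integrable_diff w1(1) integrable_mult_right w2(1)\<close>)
   finally have up: "(LINT p|circ2. wk \<omega> t p * \<phi> p) \<le> (1 - t) * \<epsilon> + c * T k" by (simp add: T_def t_def)
   have "(1 - t) / 2 * (W - 2 * L * a t * integral\<^sup>L circ2 \<phi>) = (LINT p|circ2. (1 - t) / 2 * ((?O p)^2 * \<phi> p - 2 * L * a t * \<phi> p))"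
    unfolding W_def by (simp only: B_integral_diff[OF i\<omega> integrable_mult_right[OF i\<phi>]] integral_mult_right_zero)
   also have "\<dots> \<le> (LINT p|circ2. wk \<omega> t p * \<phi> p)"
   proof (rule integral_mono[OF _ w1(3)])
    fix p assume "p \<in> space circ2"
    then obtain z w where p: "p = (z, w)" "cmod z = 1" "cmod w = 1" by auto
    have "(1 - t) / 2 * ((?O p)^2 * \<phi> p - 2 * L * a t * \<phi> p) = (1 - t) / 2 * ((\<omega> z)^2 - 2 * L * a t) * \<phi> p"
     by (simp add: p algebra_simps)
    also have "\<dots> \<le> wk \<omega> t p * \<phi> p"
     unfolding a_def p(1) by (intro mult_right_mono wk_ge p t \<phi>)
    finally show "(1 - t) / 2 * ((?O p)^2 * \<phi> p - 2 * L * a t * \<phi> p) \<le> wk \<omega> t p * \<phi> p" .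
   qed (intro integrable_mult_right B_integrable_diff i\<omega> i\<phi>)
   finally have "(1 - t) * ((W - 2 * L * a t * integral\<^sup>L circ2 \<phi>) / 2) \<le> (1 - t) * \<epsilon> + c * T k" using up by simp
   also have "\<dots> = (1 - t) * (\<epsilon> + (1 + t) / (1 + t^2) * T k)"
    by (simp add: c_def distrib_left power2_eq_square algebra_simps)
   finally show ?case using t by (simp add: t_def)
  qed
  moreover have "(\<lambda>k. (W - 2 * L * a (tseq k) * integral\<^sup>L circ2 \<phi>) / 2) \<leadsto> (W - 2 * L * 0 * integral\<^sup>L circ2 \<phi>) / 2"
   by (intro tendsto_intros al) auto
  moreover have "(\<lambda>k. \<epsilon> + (1 + tseq k) / (1 + (tseq k)^2) * T k) \<leadsto> \<epsilon> + (1 + 1) / (1 + 1^2) * (2 * cdeg ?L)"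
   unfolding T_def h_def by (intro tendsto_intros tseq_lim wk_limit[OF cf]) auto
  ultimately have "(W - 2 * L * 0 * integral\<^sup>L circ2 \<phi>) / 2 \<le> \<epsilon> + (1 + 1) / (1 + 1^2) * (2 * cdeg ?L)"
   by (intro tendsto_le[OF sequentially_bot])
  thus ?thesis by simp
 qed
 have "W / 2 \<le> 2 * cdeg ?L"
  by (rule field_le_epsilon) (use main in \<open>simp add: add.commute\<close>)
 thus ?thesis unfolding W_def \<phi>_def by simp
qed

end

subsection \<open>Cut-offs of small energy\<close>

lemma cenergy_eq_cdeg:
 assumes f: "fin_energy f" and 0: "\<And>n. n > 0 ==> fm f n = 0"
 shows "cenergy f = cdeg f"
proof -
 have "(\<lambda>n. real n * ac f n) = (\<lambda>n. real n * dc f n)" using 0 by (auto simp: fun_eq_iff ac_def dc_def)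
 thus ?thesis using sums_unique[OF energy_sums[OF f]] unfolding cdeg_def by (simp only:)
qed

text \<open>The mean of \<open>\<omega>^2\<close> at the two points exceeds the product of the
  values of \<open>\<omega>\<close> by half of a squared difference. Against \<open>nk\<close> this
  excess is dominated by the energy density of \<open>\<omega>\<close> and tends to 0 off the
  diagonal, so it disappears. The degree of \<open>\<omega> f\<close> is thus linear in
  \<open>\<omega>^2\<close>, whence the next lemma.\<close>

lemma weighted_cdeg:
 fixes \<omega> :: "complex => real"
 assumes f: "circ_map f" and \<omega>: "fin_energy (\<lambda>z. of_real (\<omega> z))"
 shows "(\<lambda>k. \<integral>p. ((\<omega> (fst p))^2 + (\<omega> (snd p))^2) / 2 * (nk (tseq k) p * Im (cross f p)) \<partial>circ2) \<leadsto> cdeg (\<lambda>z. of_real (\<omega> z) * f z)"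
  "integrable circ2 (\<lambda>p. ((\<omega> (fst p))^2 + (\<omega> (snd p))^2) / 2 * (nk (tseq k) p * Im (cross f p)))"
proof -
 let ?L = "\<lambda>z. of_real (\<omega> z)"
 let ?O = "\<lambda>p. (\<omega> (fst p))^2 + (\<omega> (snd p))^2"
 let ?K = "\<lambda>k p. nk (tseq k) p * Im (cross f p)"
 let ?A = "\<lambda>z. of_real (\<omega> z) * f z"
 have t: "1/4 \<le> tseq k" "tseq k < 1" "0 < tseq k" for k using tseq[of k] by auto
 note [measurable] = circ_map_measurable[OF f]
 have "(\<lambda>z. Re (of_real (\<omega> z))) \<in> borel_measurable circ" using fin_energy_measurable[OF \<omega>] by measurable
 hence [measurable]: "\<omega> \<in> borel_measurable circ" by simp
 define F where "F z = of_real (\<omega> z) * f z" for z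
 have fF: "fin_energy F" unfolding F_def[abs_def] by (rule fin_energy_mult[OF \<omega> circ_map_fin_energy[OF f]])
 let ?N = "\<lambda>k p. nk (tseq k) p * Im (cross F p)"
 let ?R = "\<lambda>k p. (\<omega> (fst p) - \<omega> (snd p))^2 / 2 * (?K k p)"
 have eq: "(?O p) / 2 * (?K k p) = ?N k p + ?R k p" for k p
 proof -
  have gen: "(x^2 + y^2) / 2 * (n * i) = n * (x * y * i) + (x - y)^2 / 2 * (n * i)" for x y n i :: real
   by (simp add: power2_eq_square field_simps)
  have "Im (cross F p) = \<omega> (fst p) * \<omega> (snd p) * Im (cross f p)" by (simp add: F_def cross_def algebra_simps)
  thus ?thesis using gen by simp
 qed
 have iN: "integrable circ2 (?N k)" for k by (rule integrable_nk_cross[OF fF t(1,2)])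
 have w: "integrable circ2 (\<lambda>p. 2 * (cmod (dquot ?L p))^2)" using fin_energyD[OF \<omega>] by simp
 have b: "\<bar>?R k (z, w)\<bar> \<le> 2 * (cmod (dquot ?L (z, w)))^2" if zw: "cmod z = 1" "cmod w = 1" for k z w
 proof (cases "z = w")
  case False
  hence c: "cdist (z, w) \<noteq> 0" by (simp add: cdist_def)
  have i: "\<bar>Im (cross f (z, w))\<bar> \<le> 1" using Re_cross_bound(2)[of f 1 z w] circ_map_norm[OF f] zw by simp
  have "\<bar>?R k (z, w)\<bar> = (cmod (dquot ?L (z, w)))^2 / 2 * (\<bar>nk (tseq k) (z, w)\<bar> * (cdist (z, w))^2 * \<bar>Im (cross f (z, w))\<bar>)"
   using c by (simp add: cmod_dquot abs_mult power_divide flip: of_real_diff)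
  also have "\<dots> \<le> (cmod (dquot ?L (z, w)))^2 / 2 * (4 * 1)"
   by (intro mult_left_mono mult_mono nk_cdist2 t zw i) auto
  finally show ?thesis by simp
 qed simp
 have AEb: "AE p in circ2. norm (?R k p) \<le> 2 * (cmod (dquot ?L p))^2" for k
  by (rule AE_I2) (use b in auto)
 have iR: "integrable circ2 (?R k)" for k
  by (rule B_integrable_bound[OF w]) (use AEb in auto)
 show "integrable circ2 (\<lambda>p. (?O p) / 2 * (?K k p))"
  unfolding eq by (rule B_integrable_add[OF iN iR])
 have "(\<lambda>k. integral\<^sup>L circ2 (?R k)) \<leadsto> (LINT p|circ2. 0)"
 proof (rule integral_dominated_convergence[OF _ _ w _ AEb])
  show "AE p in circ2. (\<lambda>k. ?R k p) \<leadsto> 0"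
  proof (rule AE_I2)
   fix p
   show "(\<lambda>k. ?R k p) \<leadsto> 0"
   proof (cases "cdist p = 0")
    case False
    show ?thesis by (intro tendsto_mult_right_zero tendsto_mult_left_zero nk_tendsto_0[OF tseq_lim False])
   qed (simp add: cdist_def)
  qed
 qed measurable
 hence lim: "(\<lambda>k. integral\<^sup>L circ2 (?N k) + integral\<^sup>L circ2 (?R k)) \<leadsto> cdeg F + 0"
  by (intro tendsto_add nk_tendsto_cdeg[OF fF t(3,2) tseq_lim]) (simp only: B_integral_zero)
 have FF: "?A = F" by (simp add: F_def[abs_def])
 show "(\<lambda>k. \<integral>p. (?O p) / 2 * (?K k p) \<partial>circ2) \<leadsto> cdeg ?A"
  using lim unfolding eq FF B_integral_add[OF iN iR] by (simp only: add_0_right)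
qed

lemma cdeg_partition:
 fixes a b c :: "complex => real"
 assumes f: "circ_map f" and fe: "fin_energy (\<lambda>z. of_real (a z))" "fin_energy (\<lambda>z. of_real (b z))" "fin_energy (\<lambda>z. of_real (c z))"
  and 1: "\<And>z. cmod z = 1 ==> (a z)^2 + (b z)^2 + (c z)^2 = 1"
 shows "cdeg f = cdeg (\<lambda>z. of_real (a z) * f z) + cdeg (\<lambda>z. of_real (b z) * f z) + cdeg (\<lambda>z. of_real (c z) * f z)"
proof (rule LIMSEQ_unique)
 let ?L = "\<lambda>k. \<integral>p. nk (tseq k) p * Im (cross f p) \<partial>circ2"
 show "?L \<leadsto> cdeg f"
  by (rule nk_tendsto_cdeg[OF circ_map_fin_energy[OF f] tseq(2,3) tseq_lim])
 let ?W = "\<lambda>\<omega> k p. ((\<omega> (fst p))^2 + (\<omega> (snd p))^2) / 2 * (nk (tseq k) p * Im (cross f p))"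
 have "(LINT p|circ2. nk (tseq k) p * Im (cross f p)) = integral\<^sup>L circ2 (?W a k) + integral\<^sup>L circ2 (?W b k) + integral\<^sup>L circ2 (?W c k)" for k
 proof -
  have "(LINT p|circ2. nk (tseq k) p * Im (cross f p)) = (LINT p|circ2. ?W a k p + ?W b k p + ?W c k p)"
  proof (rule B_integral_cong[OF refl])
   fix p assume "p \<in> space circ2"
   then obtain z w where p: "p = (z, w)" "cmod z = 1" "cmod w = 1" by auto
   have "?W a k p + ?W b k p + ?W c k p = (((a z)^2 + (b z)^2 + (c z)^2) + ((a w)^2 + (b w)^2 + (c w)^2)) / 2 * (nk (tseq k) p * Im (cross f p))"
    by (simp add: p(1) field_simps)
   thus "nk (tseq k) p * Im (cross f p) = ?W a k p + ?W b k p + ?W c k p" by (simp add: 1 p)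
  qed
  thus ?thesis
   by (simp only: B_integral_add weighted_cdeg(2)[OF f fe(1)] weighted_cdeg(2)[OF f fe(2)] weighted_cdeg(2)[OF f fe(3)] B_integrable_add)
 qed
 thus "?L \<leadsto> cdeg (\<lambda>z. of_real (a z) * f z) + cdeg (\<lambda>z. of_real (b z) * f z) + cdeg (\<lambda>z. of_real (c z) * f z)"
  by (simp only:) (intro tendsto_add weighted_cdeg(1) f fe)
qed

lemma circ_C1_sum:
 assumes "\<And>i. i \<in> A ==> circ_C1 (F i) (F' i)"
 shows "circ_C1 (\<lambda>z. \<Sum>i\<in>A. F i z) (\<lambda>z. \<Sum>i\<in>A. F' i z)"
proof (cases "finite A")
 case True
 thus ?thesis using assms by (induction) (auto intro: circ_C1_add circ_C1_const)
qed (auto intro: circ_C1_const)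

lemma circ_C1_compose_Re:
 assumes F: "circ_C1 F F'" and \<phi>: "\<And>x. (\<phi> has_real_derivative \<phi>' x) (at x)" "continuous_on UNIV \<phi>'"
 shows "circ_C1 (\<lambda>z. of_real (\<phi> (Re (F z)))) (\<lambda>z. of_real (\<phi>' (Re (F z)) * Re (F' z)))"
 unfolding circ_C1_def
proof (intro conjI allI)
 let ?L = "\<lambda>\<theta>. Re (F (cis \<theta>))"
 note c = circ_C1_continuous[OF F]
 show "continuous_on UNIV (\<lambda>\<theta>. complex_of_real (\<phi>' (Re (F (cis \<theta>))) * Re (F' (cis \<theta>))))"
  by (intro continuous_intros continuous_on_compose2[OF \<phi>(2)] c) auto
 fix \<theta>
 have "((\<lambda>\<theta>. F (cis \<theta>)) has_vector_derivative F' (cis \<theta>)) (at \<theta>)" using F by (simp add: circ_C1_def)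
 hence "(?L has_vector_derivative Re (F' (cis \<theta>))) (at \<theta>)"
  by (rule bounded_linear.has_vector_derivative[OF bounded_linear_Re])
 hence "(?L has_real_derivative Re (F' (cis \<theta>))) (at \<theta>)"
  by (simp add: has_real_derivative_iff_has_vector_derivative)
 from DERIV_chain2[OF \<phi>(1) this]
 have "((\<lambda>\<theta>. \<phi> (Re (F (cis \<theta>)))) has_vector_derivative \<phi>' (Re (F (cis \<theta>))) * Re (F' (cis \<theta>))) (at \<theta>)"
  by (simp add: has_real_derivative_iff_has_vector_derivative)
 from bounded_linear.has_vector_derivative[OF bounded_linear_of_real this]
 show "((\<lambda>\<theta>. complex_of_real (\<phi> (Re (F (cis \<theta>))))) has_vector_derivative of_real (\<phi>' (Re (F (cis \<theta>))) * Re (F' (cis \<theta>)))) (at \<theta>)" .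
qed

text \<open>The cut is made at \<open>1\<close> and \<open>-1\<close>, near which \<open>F\<close>
  vanishes identically. The open sets \<open>S0\<close>, where the result is 0, and
  \<open>S1\<close>, where it is \<open>F\<close>, cover the line of angles.\<close>

lemma circ_C1_cut:
 fixes s :: "complex => real"
 assumes F: "circ_C1 F F'" and s: "continuous_on UNIV (\<lambda>\<theta>. s (cis \<theta>))" "s 1 > 1" "s (-1) > 1"
  and 0: "\<And>z. cmod z = 1 ==> s z > 1 ==> F z = 0"
 shows "circ_C1 (\<lambda>z. if (Im z \<ge> 0) = b then F z else 0) (\<lambda>z. if (Im z \<ge> 0) = b then F' z else 0)"
proof -
 let ?L = "\<lambda>\<theta>. if (Im (cis \<theta>) \<ge> 0) = b then F' (cis \<theta>) else 0"
 let ?A = "\<lambda>\<theta>. F (cis \<theta>)"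
 define S0 S1 where "S0 = {\<theta>. s (cis \<theta>) > 1} \<union> (if b then {\<theta>. Im (cis \<theta>) < 0} else {\<theta>. Im (cis \<theta>) > 0})"
  and "S1 = (if b then {\<theta>. Im (cis \<theta>) > 0} else {\<theta>. Im (cis \<theta>) < 0})"
 have o1: "open {\<theta>. Im (cis \<theta>) < 0}" "open {\<theta>. Im (cis \<theta>) > 0}"
  by (auto intro!: open_Collect_less continuous_intros)
 have o2: "open {\<theta>. s (cis \<theta>) > 1}" by (intro open_Collect_less s continuous_intros)
 have o: "open S0" "open S1" using o1 o2 by (auto simp: S0_def S1_def)
 have cov: "\<theta> \<in> S0 \<or> \<theta> \<in> S1" for \<theta>
 proof (cases "Im (cis \<theta>) = 0")
  case True
  hence "cis \<theta> = 1 \<or> cis \<theta> = -1"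
   using sin_cos_squared_add[of \<theta>] by (auto simp: complex_eq_iff power2_eq_1_iff)
  thus ?thesis using s by (auto simp: S0_def)
 next
  case False
  thus ?thesis by (cases "Im (cis \<theta>) > 0") (auto simp: S0_def S1_def)
 qed
 have D: "(?A has_vector_derivative F' (cis \<theta>)) (at \<theta>)" for \<theta> using F by (simp add: circ_C1_def)
 have F'0: "F' (cis \<theta>) = 0" if "s (cis \<theta>) > 1" for \<theta>
 proof -
  have "(?A has_vector_derivative 0) (at \<theta>)"
   by (rule has_vector_derivative_transform_within_open[OF has_vector_derivative_const o2, of _ 0]) (use that 0 in auto)
  thus ?thesis using vector_derivative_unique_at[OF D] by blast
 qed
 have e0: "(if (Im (cis \<theta>) \<ge> 0) = b then F (cis \<theta>) else 0) = 0" "(if (Im (cis \<theta>) \<ge> 0) = b then F' (cis \<theta>) else 0) = 0"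
  if "\<theta> \<in> S0" for \<theta>
  using that 0[of "cis \<theta>"] F'0[of \<theta>] by (auto simp: S0_def split: if_splits)
 have e1: "(if (Im (cis \<theta>) \<ge> 0) = b then F (cis \<theta>) else 0) = F (cis \<theta>)" "(if (Im (cis \<theta>) \<ge> 0) = b then F' (cis \<theta>) else 0) = F' (cis \<theta>)"
  if "\<theta> \<in> S1" for \<theta>
  using that by (auto simp: S1_def split: if_splits)
 show ?thesis unfolding circ_C1_def
 proof (intro conjI allI)
  fix \<theta>
  show "((\<lambda>\<theta>. if (Im (cis \<theta>) \<ge> 0) = b then F (cis \<theta>) else 0) has_vector_derivative (if (Im (cis \<theta>) \<ge> 0) = b then F' (cis \<theta>) else 0)) (at \<theta>)"
  proof (cases "\<theta> \<in> S0")
   case True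
   show ?thesis unfolding e0(2)[OF True]
    by (rule has_vector_derivative_transform_within_open[OF has_vector_derivative_const o(1) True, of 0]) (use e0 in auto)
  next
   case False
   hence 1: "\<theta> \<in> S1" using cov by blast
   show ?thesis unfolding e1(2)[OF 1]
    by (rule has_vector_derivative_transform_within_open[OF D o(2) 1]) (use e1 in auto)
  qed
 next
  have "continuous_on S0 ?L"
   by (rule continuous_on_eq[OF continuous_on_const]) (use e0 in auto)
  moreover have "continuous_on S1 ?L"
   by (rule continuous_on_eq[OF continuous_on_subset[OF circ_C1_continuous(2)[OF F]]]) (use e1 in auto)
  ultimately have "continuous_on (S0 \<union> S1) ?L"
   by (intro continuous_on_open_Un o)
  thus "continuous_on UNIV ?L"
   using cov by (metis UNIV_eq_I UnI1 UnI2)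
 qed
qed

section \<open>Logarithmic cut-offs\<close>

text \<open>A continuously differentiable step from 0 to 1 over the unit interval, made of two
  parabolic arcs; its derivative \<open>xi'\<close> is a tent of height 2.\<close>

definition xi :: "real => real" where
 "xi s = 2 * (max 0 s)^2 - 4 * (max 0 (s - 1/2))^2 + 2 * (max 0 (s - 1))^2"

definition xi' :: "real => real" where
 "xi' s = 4 * max 0 s - 8 * max 0 (s - 1/2) + 4 * max 0 (s - 1)"

lemma xi_values: "s \<le> 0 ==> xi s = 0" "s \<ge> 1 ==> xi s = 1"
 by (auto simp: xi_def power2_eq_square algebra_simps)

lemma has_derivative_pos_part_square: "((\<lambda>s::real. (max 0 s)^2) has_real_derivative 2 * max 0 x) (at x)"
proof -
 consider "x > 0" | "x < 0" | "x = 0" by linarith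
 thus ?thesis
 proof cases
  case 1
  have "((\<lambda>s::real. s^2) has_real_derivative 2 * x) (at x)" by (auto intro!: derivative_eq_intros)
  thus ?thesis using 1 by (subst DERIV_cong_ev[OF refl _ refl, of _ "\<lambda>s. s^2"])
   (auto intro!: eventually_mono[OF eventually_gt_at_top] simp: eventually_nhds intro!: exI[of _ "{0<..}"])
 next
  case 2
  have "((\<lambda>s::real. 0) has_real_derivative 0) (at x)" by simp
  thus ?thesis using 2 by (subst DERIV_cong_ev[OF refl _ refl, of _ "\<lambda>s. 0"])
   (auto simp: eventually_nhds max_def intro!: exI[of _ "{..<0}"])
 next
  case 3
  have "(\<lambda>h::real. (max 0 h)^2 / h) \<midarrow>0\<rightarrow> 0"
  proof (rule Lim_null_comparison[where g = "\<lambda>h. \<bar>h\<bar>"])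
   show "\<forall>\<^sub>F h in at 0. norm ((max 0 h)^2 / h) \<le> \<bar>h\<bar>" for h :: real
    by (rule always_eventually) (auto simp: max_def power2_eq_square)
   show "(\<lambda>h::real. \<bar>h\<bar>) \<midarrow>0\<rightarrow> 0" by (intro tendsto_eq_intros) auto
  qed
  thus ?thesis using 3 by (simp add: has_field_derivative_def DERIV_def flip: has_field_derivative_def)
 qed
qed

lemma xi_deriv: "(xi has_real_derivative xi' x) (at x)"
proof -
 have p: "((\<lambda>s. (max 0 (s - c))^2) has_real_derivative 2 * max 0 (x - c)) (at x)" for c
 proof -
  have "((\<lambda>s. s - c) has_real_derivative 1) (at x)" by (auto intro!: derivative_eq_intros)
  from DERIV_chain2[OF has_derivative_pos_part_square this] show ?thesis by simp
 qed
 show ?thesis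
  using DERIV_add[OF DERIV_diff[OF DERIV_cmult[OF p[of 0], of 2] DERIV_cmult[OF p[of "1/2"], of 4]] DERIV_cmult[OF p[of 1], of 2]]
  by (simp add: xi_def[abs_def] xi'_def)
qed

lemma xi'_bound: "0 \<le> xi' s" "xi' s \<le> 2"
 by (auto simp: xi'_def max_def)

lemma xi_lipschitz: "\<bar>xi x - xi y\<bar> \<le> 2 * \<bar>x - y\<bar>"
proof -
 have "norm (xi x - xi y) \<le> 2 * norm (x - y)"
  by (rule field_differentiable_bound[OF convex_UNIV, where f' = xi']) (use xi_deriv xi'_bound in auto)
 thus ?thesis by simp
qed

text \<open>Up to the factor a partial sum of \<open>- log (1 - z^2)\<close>, the classical witness
  that the points \<open>1\<close> and \<open>-1\<close> have capacity zero: with the value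
  normalised to 2 at both points, the energy is 8 over a harmonic number.\<close>

definition lcut :: "nat => complex => complex" where
 "lcut N z = of_real (2 / harm N) * (\<Sum>n\<in>{1..N}. of_real (1 / real n) * z ^ (2 * n))"

lemma lcut_C1:
 "circ_C1 (lcut N) (\<lambda>z. of_real (2 / harm N) * (\<Sum>n\<in>{1..N}. of_real (1 / real n) * (\<i> * of_nat (2 * n) * z ^ (2 * n))))"
 unfolding lcut_def[abs_def] by (intro circ_C1_cmult circ_C1_sum circ_C1_power)

lemma harm_pos_Suc: "harm (Suc N) > (0::real)"
 by (rule harm_pos) simp

lemma lcut_ends: "Re (lcut (Suc N) 1) = 2" "Re (lcut (Suc N) (-1)) = 2"
proof -
 have "(\<Sum>n\<in>{1..Suc N}. complex_of_real (1 / real n)) = of_real (harm (Suc N))"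
  by (simp add: harm_def inverse_eq_divide)
 thus "Re (lcut (Suc N) 1) = 2" "Re (lcut (Suc N) (-1)) = 2"
  using less_imp_neq[OF harm_pos_Suc[of N]] by (simp_all add: lcut_def power_mult del: sum.cl_ivl_Suc flip: of_real_mult)
qed

lemma lcut_energy: "cenergy (lcut (Suc N)) = 8 / harm (Suc N)"
proof -
 let ?H = "2 / harm (Suc N)"
 define F where "F z = (\<Sum>n\<in>{1..Suc N}. of_real (1 / real n) * z ^ (2 * n))" for z :: complex
 define F' where "F' z = (\<Sum>n\<in>{1..Suc N}. of_real (1 / real n) * (\<i> * of_nat (2 * n) * z ^ (2 * n)))" for z :: complex
 have C: "circ_C1 F F'" unfolding F_def[abs_def] F'_def[abs_def] by (intro circ_C1_cmult circ_C1_sum circ_C1_power)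
 have ib: "integrable circ (\<lambda>z. k * z ^ m * cnj z ^ n)" for k :: complex and m n
  by (rule circ_integrable_bounded[where B = "cmod k"]) (auto simp: norm_mult norm_power)
 have "fm F m = 0" if "m > 0" for m
 proof -
  have "fm F m = (LINT z|circ. (\<Sum>n\<in>{1..Suc N}. of_real (1 / real n) * z ^ (2 * n + m) * cnj z ^ 0))"
   unfolding fm_def F_def by (simp add: sum_distrib_right power_add mult.assoc del: sum.cl_ivl_Suc)
  also have "\<dots> = (\<Sum>n\<in>{1..Suc N}. \<integral>z. of_real (1 / real n) * z ^ (2 * n + m) * cnj z ^ 0 \<partial>circ)"
   by (rule B_integral_sum) (rule ib)
  also have "\<dots> = 0" using that by (intro sum.neutral) (simp add: integral_circ_power)
  finally show ?thesis .
 qed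
 hence "cenergy F = cdeg F" by (intro cenergy_eq_cdeg circ_C1_fin_energy[OF C])
 moreover have "cdeg F = 2 * harm (Suc N)"
 proof -
  have "(LINT z|circ. F' z * cnj (F z)) = (LINT z|circ. (\<Sum>n\<in>{1..Suc N}. \<Sum>m\<in>{1..Suc N}. 2 * \<i> / of_nat m * z ^ (2 * n) * cnj z ^ (2 * m)))"
   unfolding F_def F'_def cnj_sum sum_product
   by (intro B_integral_cong refl sum.cong) (auto simp: field_simps)
  also have "\<dots> = (\<Sum>n\<in>{1..Suc N}. \<Sum>m\<in>{1..Suc N}. \<integral>z. 2 * \<i> / of_nat m * z ^ (2 * n) * cnj z ^ (2 * m) \<partial>circ)"
   by (subst B_integral_sum, intro B_integrable_sum ib, intro sum.cong refl)
     (rule B_integral_sum, rule ib)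
  also have "\<dots> = (\<Sum>n\<in>{1..Suc N}. \<Sum>m\<in>{1..Suc N}. if n = m then 2 * \<i> / of_nat m else 0)"
  proof (intro sum.cong refl)
   fix n m
   have "(LINT z|circ. 2 * \<i> / of_nat m * z ^ (2 * n) * cnj z ^ (2 * m)) = 2 * \<i> / of_nat m * (LINT z|circ. z ^ (2 * n) * cnj z ^ (2 * m))"
    by (subst integral_mult_right_zero[symmetric]) (simp only: mult.assoc)
   also have "\<dots> = (if n = m then 2 * \<i> / of_nat m else 0)" unfolding circ_monomials(1) by simp
   finally show "(LINT z|circ. 2 * \<i> / of_nat m * z ^ (2 * n) * cnj z ^ (2 * m)) = (if n = m then 2 * \<i> / of_nat m else 0)" .
  qed
  also have "\<dots> = (\<Sum>n\<in>{1..Suc N}. 2 * \<i> / of_nat n)" by (intro sum.cong refl) (simp del: sum.cl_ivl_Suc)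
  also have "\<dots> = \<i> * of_real (2 * harm (Suc N))"
   by (simp add: harm_def sum_distrib_left divide_inverse mult_ac del: sum.cl_ivl_Suc)
  finally show ?thesis using circ_C1_cdeg[OF C] by (metis complex_i_not_zero mult_cancel_left of_real_eq_iff)
 qed
 moreover have "lcut (Suc N) = (\<lambda>z. of_real ?H * F z)" by (simp add: fun_eq_iff lcut_def F_def)
 ultimately have "cenergy (lcut (Suc N)) = ?H^2 * (2 * harm (Suc N))"
  using fin_energy_cmult(2)[OF circ_C1_fin_energy[OF C], of "of_real ?H"] harm_pos_Suc[of N]
  by (simp add: norm_divide)
 thus ?thesis using harm_pos_Suc[of N] by (simp add: power2_eq_square)
qed

text \<open>Away from \<open>1\<close> and \<open>-1\<close> the partial sums of
  \<open>x^n / n\<close> with \<open>x = z^2\<close> stay bounded, while the harmonic number by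
  which they are divided diverges.\<close>

lemma lcut_tendsto:
 assumes z: "cmod z = 1" "z^2 \<noteq> 1"
 shows "(\<lambda>N. Re (lcut (Suc N) z)) \<leadsto> 0"
proof -
 define x where "x = z^2"
 have x: "cmod x = 1" "x \<noteq> 1" using z by (auto simp: x_def norm_power)
 \<comment> \<open>Summation by parts: multiplication by \<open>1 - x\<close> leaves only
   differences of consecutive coefficients. The added last term and the bound
   \<open>2 - 1 / (N + 1)\<close> make the induction telescope.\<close>
 have S: "cmod ((1 - x) * (\<Sum>n\<in>{1..Suc N}. of_real (1 / real n) * x ^ n) + of_real (1 / real (Suc N)) * x ^ (Suc (Suc N))) \<le> 2 - 1 / real (Suc N)" for N
 proof (induction N)
  case 0
  show ?case using x by (simp add: algebra_simps power2_eq_square)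
 next
  case (Suc N)
  let ?S = "\<Sum>n\<in>{1..Suc N}. complex_of_real (1 / real n) * x ^ n"
  let ?a = "complex_of_real (1 / real (Suc N))" and ?b = "complex_of_real (1 / real (Suc (Suc N)))"
  have "(1 - x) * (\<Sum>n\<in>{1..Suc (Suc N)}. of_real (1 / real n) * x ^ n) + ?b * x ^ (Suc (Suc (Suc N)))
   = ((1 - x) * ?S + ?a * x ^ Suc (Suc N)) + (?b - ?a) * x ^ Suc (Suc N)"
   by (subst sum.nat_ivl_Suc') (simp_all add: algebra_simps diff_divide_distrib del: sum.cl_ivl_Suc)
  also have "cmod \<dots> \<le> (2 - 1 / real (Suc N)) + cmod (?b - ?a)"
   using norm_triangle_mono[OF Suc order_refl[of "cmod ((?b - ?a) * x ^ Suc (Suc N))"]] x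
   by (simp only: norm_mult norm_power power_one mult_1_right)
  also have "cmod (?b - ?a) = 1 / real (Suc N) - 1 / real (Suc (Suc N))"
   unfolding of_real_diff[symmetric] norm_of_real by (subst abs_minus_commute, rule abs_of_nonneg) (simp add: frac_le)
  finally show ?case by simp
 qed
 have bd: "cmod (lcut (Suc N) z) \<le> 6 / cmod (1 - x) * inverse (harm (Suc N))" for N
 proof -
  let ?S = "\<Sum>n\<in>{1..Suc N}. complex_of_real (1 / real n) * x ^ n"
  let ?e = "of_real (1 / real (Suc N)) * x ^ (Suc (Suc N))"
  have "cmod ((1 - x) * ?S) \<le> cmod ((1 - x) * ?S + ?e) + cmod ?e"
   using norm_triangle_ineq4[of "(1 - x) * ?S + ?e" ?e] by (simp only: add_diff_cancel_right')
  also have "\<dots> \<le> 2 + 1"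
  proof (rule add_mono)
   show "cmod ((1 - x) * ?S + ?e) \<le> 2" by (rule order_trans[OF S]) simp
   show "cmod ?e \<le> 1" unfolding norm_mult norm_power x norm_of_real by simp
  qed
  finally have "cmod (1 - x) * cmod ?S \<le> 3" by (simp only: norm_mult)
  hence "cmod ?S \<le> 3 / cmod (1 - x)" using x by (simp only: pos_le_divide_eq zero_less_norm_iff right_minus_eq) (simp add: mult.commute)
  hence "2 / harm (Suc N) * cmod ?S \<le> 2 / harm (Suc N) * (3 / cmod (1 - x))"
   using less_imp_le[OF harm_pos_Suc[of N]] by (intro mult_left_mono divide_nonneg_nonneg) simp_all
  moreover have "cmod (lcut (Suc N) z) = 2 / harm (Suc N) * cmod ?S"
   using harm_pos_Suc[of N] by (simp only: lcut_def norm_mult norm_of_real x_def power_mult) simp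
  ultimately show ?thesis by (simp add: divide_inverse mult_ac)
 qed
 have "(\<lambda>N. inverse (harm (Suc N) :: real)) \<leadsto> 0"
  using filterlim_compose[OF tendsto_inverse_0_at_top[OF harm_at_top] filterlim_Suc] .
 hence "(\<lambda>N. 6 / cmod (1 - x) * inverse (harm (Suc N))) \<leadsto> 0" by (rule tendsto_mult_right_zero)
 thus ?thesis
  by (rule Lim_null_comparison[rotated]) (use order_trans[OF abs_Re_le_cmod bd] in auto)
qed

text \<open>Sine and cosine of one angle make the squares sum to 1. The cosine vanishes where
  \<open>s \<ge> 1\<close>, in particular near \<open>1\<close> and \<open>-1\<close>, so it splits
  smoothly into a lower part \<open>a\<close> and an upper part \<open>c\<close>. Only
  \<open>b\<close> is nonzero at the ends of the arcs, and its energy tends to 0.\<close>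

lemma cutoffs:
 obtains a b c :: "nat => complex => real" where
  "\<And>N z. (a N z)^2 + (b N z)^2 + (c N z)^2 = 1"
  "\<And>N. \<exists>a'. circ_C1 (\<lambda>z. of_real (a N z)) a'" "\<And>N. \<exists>c'. circ_C1 (\<lambda>z. of_real (c N z)) c'"
  "\<And>N. \<exists>\<delta>>0. \<delta> \<le> 1 \<and> (\<forall>z. cmod z = 1 \<longrightarrow> Im z > - \<delta> \<longrightarrow> a N z = 0)"
  "\<And>N z. Im z < 0 ==> c N z = 0"
  "\<And>N. fin_energy (\<lambda>z. of_real (b N z))" "(\<lambda>N. cenergy (\<lambda>z. of_real (b N z))) \<leadsto> 0"
  "AE z in circ. (\<lambda>N. a N z) \<leadsto> (if Im z < 0 then 1 else 0)"
  "AE z in circ. (\<lambda>N. b N z) \<leadsto> 0"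
  "AE z in circ. (\<lambda>N. c N z) \<leadsto> (if Im z < 0 then 0 else 1)"
proof -
 let ?L = "\<lambda>N. LINT p|circ2. 16 * (cmod (dquot (lcut (Suc N)) p))^2"
 define s where "s N z = Re (lcut (Suc N) z)" for N z
 define k where "k N z = cos (pi / 2 * xi (s N z))" for N z
 define a where "a N z = (if (Im z \<ge> 0) = False then k N z else 0)" for N z
 define b where "b N z = sin (pi / 2 * xi (s N z))" for N z
 define c where "c N z = (if (Im z \<ge> 0) = True then k N z else 0)" for N z
 let ?phi = "\<lambda>s. cos (pi / 2 * xi s)"
 have cont: "continuous_on UNIV xi" by (rule DERIV_continuous_on[OF xi_deriv])
 define k' :: "nat => complex => complex" where "k' N = (\<lambda>z. of_real ((- sin (pi / 2 * xi (Re (lcut (Suc N) z))) * (pi / 2 * xi' (Re (lcut (Suc N) z)))) * Re (of_real (2 / harm (Suc N)) * (\<Sum>n\<in>{1..Suc N}. of_real (1 / real n) * (\<i> * of_nat (2 * n) * z ^ (2 * n))))))" for N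
 have k': "circ_C1 (\<lambda>z. of_real (k N z)) (k' N)" for N
  unfolding k_def s_def k'_def
 proof (rule circ_C1_compose_Re[OF lcut_C1])
  show "(?phi has_real_derivative - sin (pi / 2 * xi x) * (pi / 2 * xi' x)) (at x)" for x
   by (rule DERIV_fun_cos[THEN DERIV_cong]) (auto intro!: derivative_eq_intros xi_deriv)
  show "continuous_on UNIV (\<lambda>x. - sin (pi / 2 * xi x) * (pi / 2 * xi' x))"
   unfolding xi'_def by (intro continuous_intros cont)
 qed
 have s1: "k N z = 0" if "s N z \<ge> 1" for N z using xi_values(2)[OF that] by (simp add: k_def)
 have scont: "continuous_on UNIV (\<lambda>\<theta>. s N (cis \<theta>))" for N
  unfolding s_def by (intro continuous_intros circ_C1_continuous(1)[OF lcut_C1])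
 have cut: "circ_C1 (\<lambda>z. if (Im z \<ge> 0) = B then of_real (k N z) else 0) (\<lambda>z. if (Im z \<ge> 0) = B then k' N z else 0)" for N B
  by (rule circ_C1_cut[OF k'[of N] scont[of N]]) (use lcut_ends s1 in \<open>auto simp: s_def\<close>)
 have lim: "AE z in circ. (\<lambda>N. xi (s N z)) \<leadsto> 0"
  using AE_circ_neq[of 1, simplified] AE_circ_neq[of "-1", simplified] AE_space
 proof eventually_elim
  case (elim z)
  hence "z^2 \<noteq> 1" by (simp add: power2_eq_1_iff)
  hence "(\<lambda>N. s N z) \<leadsto> 0" unfolding s_def by (intro lcut_tendsto) (use elim in auto)
  from continuous_on_tendsto_compose[OF cont this] show ?case using xi_values(1)[of 0] by simp
 qed
 have klim: "AE z in circ. (\<lambda>N. k N z) \<leadsto> 1"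
  using lim by eventually_elim (auto simp: k_def intro!: tendsto_eq_intros)
 show ?thesis
 proof (rule that[of a b c])
  show "(a N z)^2 + (b N z)^2 + (c N z)^2 = 1" for N z by (simp add: a_def b_def c_def k_def)
  show "\<exists>a'. circ_C1 (\<lambda>z. of_real (a N z)) a'" for N
   using cut[of False N] by (auto simp: a_def if_distrib[of complex_of_real] cong: if_cong)
  show "\<exists>c'. circ_C1 (\<lambda>z. of_real (c N z)) c'" for N
   using cut[of True N] by (auto simp: c_def if_distrib[of complex_of_real] cong: if_cong)
  show "\<exists>\<delta>>0. \<delta> \<le> 1 \<and> (\<forall>z. cmod z = 1 \<longrightarrow> Im z > - \<delta> \<longrightarrow> a N z = 0)" for N
  proof -
   obtain L where L: "L \<ge> 0" "\<And>z w. cmod z = 1 ==> cmod w = 1 ==> cmod (lcut (Suc N) z - lcut (Suc N) w) \<le> L * cmod (z - w)"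
    by (rule circ_C1_lipschitz[OF lcut_C1]) (rule that)
   \<comment> \<open>A point of the lower arc with \<open>Im z > - \<delta>\<close> lies within
     \<open>2 \<delta>\<close> of an end, so \<open>s\<close> differs there by at most
     \<open>2 L \<delta> \<le> 1\<close> from its value 2.\<close>
   define \<delta> where "\<delta> = 1 / (2 * L + 1)"
   have \<delta>: "\<delta> > 0" "\<delta> \<le> 1" "2 * (L * \<delta>) \<le> 1" using L(1) by (auto simp: \<delta>_def field_simps)
   have "a N z = 0" if z: "cmod z = 1" "Im z > - \<delta>" for z
   proof (cases "Im z \<ge> 0")
    case False
    define \<sigma> :: real where "\<sigma> = (if Re z \<ge> 0 then 1 else -1)"
    have r: "(Re z)^2 + (Im z)^2 = 1" using z(1) by (metis cmod_power2 one_power2)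
    have "\<bar>Re z\<bar> \<le> 1" using abs_Re_le_cmod[of z] z by simp
    hence "(Re z)^2 \<le> \<bar>Re z\<bar>" using mult_left_mono[of "\<bar>Re z\<bar>" 1 "\<bar>Re z\<bar>"] by (simp add: power2_eq_square flip: abs_mult)
    moreover have "(cmod (z - of_real \<sigma>))^2 = 2 - 2 * \<bar>Re z\<bar>"
     using r unfolding cmod_power2 by (auto simp: \<sigma>_def power2_eq_square algebra_simps)
    ultimately have "(cmod (z - of_real \<sigma>))^2 \<le> 2 * (Im z)^2" using r by linarith
    also have "\<dots> \<le> (2 * \<bar>Im z\<bar>)^2" by (simp add: power_mult_distrib)
    finally have "cmod (z - of_real \<sigma>) \<le> 2 * \<bar>Im z\<bar>" by (rule power2_le_imp_le) simp
    hence "cmod (z - of_real \<sigma>) \<le> 2 * \<delta>" using False z(2) by linarith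
    hence "cmod (lcut (Suc N) z - lcut (Suc N) (of_real \<sigma>)) \<le> L * (2 * \<delta>)"
     using L(2)[of z "of_real \<sigma>"] z(1) mult_left_mono[OF _ L(1), of "cmod (z - of_real \<sigma>)" "2 * \<delta>"] by (force simp: \<sigma>_def)
    hence "\<bar>s N z - s N (of_real \<sigma>)\<bar> \<le> 1"
     using abs_Re_le_cmod[of "lcut (Suc N) z - lcut (Suc N) (of_real \<sigma>)"] \<delta>(3) by (simp add: s_def)
    moreover have "s N (of_real \<sigma>) = 2" using lcut_ends[of N] by (auto simp: s_def \<sigma>_def)
    ultimately show ?thesis using s1[of N z] by (simp add: a_def)
   qed (simp add: a_def)
   thus ?thesis using \<delta>(1,2) by blast
  qed
  show "c N z = 0" if "Im z < 0" for N z using that by (simp add: c_def)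
  \<comment> \<open>The factor 4 is 2, a bound for \<open>pi / 2\<close>, times the Lipschitz
    constant 2 of \<open>xi\<close>.\<close>
  have bl: "\<bar>b N z - b N w\<bar> \<le> 4 * cmod (lcut (Suc N) z - lcut (Suc N) w)" for N z w
  proof -
   have "norm (sin x - sin y) \<le> 1 * norm (x - y)" for x y :: real
    by (rule field_differentiable_bound[OF convex_UNIV, where f' = cos]) (auto intro!: derivative_eq_intros)
   hence "\<bar>b N z - b N w\<bar> \<le> \<bar>pi / 2 * xi (s N z) - pi / 2 * xi (s N w)\<bar>" by (simp add: b_def)
   also have "\<dots> = pi / 2 * \<bar>xi (s N z) - xi (s N w)\<bar>" by (simp only: right_diff_distrib[symmetric] abs_mult) simp
   also have "\<dots> \<le> 2 * (2 * \<bar>s N z - s N w\<bar>)" using pi_less_4 by (intro mult_mono xi_lipschitz) auto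
   finally show ?thesis using abs_Re_le_cmod[of "lcut (Suc N) z - lcut (Suc N) w"] by (simp add: s_def)
  qed
  have bE: "fin_energy (\<lambda>z. of_real (b N z))" "cenergy (\<lambda>z. of_real (b N z)) \<le> (?L N)" for N
  proof -
   have m: "(\<lambda>z. complex_of_real (b N z)) \<in> borel_measurable circ"
    using circ_C1_fin_energy[OF lcut_C1[of "Suc N"], THEN fin_energy_measurable] unfolding b_def s_def xi_def by measurable
   have i: "integrable circ2 (\<lambda>p. 16 * (cmod (dquot (lcut (Suc N)) p))^2)"
    using fin_energyD[OF circ_C1_fin_energy[OF lcut_C1[of "Suc N"]]] by simp
   have d: "(cmod (dquot (\<lambda>z. complex_of_real (b N z)) (z, w)))^2 \<le> 16 * (cmod (dquot (lcut (Suc N)) (z, w)))^2" for z w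
   proof -
    have "cmod (dquot (\<lambda>z. complex_of_real (b N z)) (z, w)) \<le> 4 * cmod (dquot (lcut (Suc N)) (z, w))"
     using divide_right_mono[OF bl[of N z w] cdist_nonneg[of "(z, w)"]] by (simp add: cmod_dquot flip: of_real_diff)
    from power_mono[OF this, of 2] show ?thesis by (simp add: power_mult_distrib)
   qed
   show "fin_energy (\<lambda>z. of_real (b N z))" "cenergy (\<lambda>z. of_real (b N z)) \<le> (?L N)"
    by (rule fin_energyI[OF m _ i, where B = 1]; use d in \<open>simp add: b_def\<close>)+
  qed
  show "fin_energy (\<lambda>z. of_real (b N z))" for N by (rule bE(1))
  have "cenergy (\<lambda>z. of_real (b N z)) \<le> 128 * inverse (harm (Suc N))" for N
   using bE(2)[of N] lcut_energy[of N] by (simp add: cenergy_def divide_inverse)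
  moreover have "(\<lambda>N. 128 * inverse (harm (Suc N) :: real)) \<leadsto> 0"
   by (rule tendsto_mult_right_zero, rule filterlim_compose[OF tendsto_inverse_0_at_top[OF harm_at_top] filterlim_Suc])
  ultimately show "(\<lambda>N. cenergy (\<lambda>z. of_real (b N z))) \<leadsto> 0"
   by (rule real_tendsto_sandwich[OF always_eventually always_eventually tendsto_const, OF allI allI, rotated]) (rule cenergy_nonneg)
  show "AE z in circ. (\<lambda>N. b N z) \<leadsto> 0"
   using lim by eventually_elim (auto simp: b_def intro!: tendsto_eq_intros)
  show "AE z in circ. (\<lambda>N. a N z) \<leadsto> (if Im z < 0 then 1 else 0)"
   using klim by eventually_elim (auto simp: a_def)
  show "AE z in circ. (\<lambda>N. c N z) \<leadsto> (if Im z < 0 then 0 else 1)"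
   using klim by eventually_elim (auto simp: c_def)
 qed
qed

subsection \<open>Strict inequality and existence of minimisers\<close>

definition upper :: "complex => real" where "upper z = (if Im z < 0 then 0 else 1)"

lemma measurable_upper [measurable]: "upper \<in> borel_measurable borel"
 unfolding upper_def[abs_def] by measurable

text \<open>The Cayley transform turns this into the number \<open>q\<close> of the theorem.\<close>

definition qarc :: "(complex => complex) => (complex => complex) => real" where
 "qarc g g' = (LINT z|circ. upper z * Im (g' z * cnj (g z)))"

lemma cdeg_real:
 assumes "fin_energy (\<lambda>z. of_real (c z))"
 shows "cdeg (\<lambda>z. of_real (c z)) = 0"
 using cdeg_cnj[OF assms] by simp

text \<open>In the derivative of \<open>c g\<close> times the conjugate of \<open>c g\<close>, the
  term \<open>c' c\<close> integrates to the degree of a real function, which is 0 by conjugation.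
  What remains is \<open>c^2\<close> times the degree density of \<open>g\<close>.\<close>

lemma cdeg_cutoff:
 fixes c :: "complex => real"
 assumes c: "circ_C1 (\<lambda>z. of_real (c z)) c'" and g: "circ_C1 g g'" and u: "\<And>z. cmod z = 1 ==> cmod (g z) = 1"
 shows "cdeg (\<lambda>z. of_real (c z) * g z) = (LINT z|circ. (c z)^2 * Im (g' z * cnj (g z)))"
proof -
 let ?L = "LINT z|circ. of_real (c z) * of_real (c z) * (g' z * cnj (g z))"
 let ?A = "\<lambda>z. of_real (c z) * g z"
 let ?G = "\<lambda>z. g' z * cnj (g z)"
 obtain Bc where Bc: "Bc \<ge> 0" "\<And>z. cmod z = 1 ==> cmod (of_real (c z)) \<le> Bc" "\<And>z. cmod z = 1 ==> cmod (c' z) \<le> Bc"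
  by (rule circ_C1_bounded[OF c]) (rule that)
 obtain B where B: "B \<ge> 0" "\<And>z. cmod z = 1 ==> cmod (g z) \<le> B" "\<And>z. cmod z = 1 ==> cmod (g' z) \<le> B"
  by (rule circ_C1_bounded[OF g]) (rule that)
 note [measurable] = circ_measurable_of_cis[OF circ_C1_continuous(1)[OF c]] circ_measurable_of_cis[OF circ_C1_continuous(2)[OF c]]
  circ_measurable_of_cis[OF circ_C1_continuous(1)[OF g]] circ_measurable_of_cis[OF circ_C1_continuous(2)[OF g]]
 have i1: "integrable circ (\<lambda>z. of_real (c z) * of_real (c z) * (?G z))"
  by (rule circ_integrable_bounded[where B = "Bc * Bc * (B * B)"])
   (measurable, unfold norm_mult complex_mod_cnj, intro mult_mono Bc B, auto intro: Bc B)
 have i2: "integrable circ (\<lambda>z. c' z * cnj (of_real (c z)))"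
  by (rule circ_integrable_bounded[where B = "Bc * Bc"])
   (measurable, unfold norm_mult complex_mod_cnj, intro mult_mono Bc, auto intro: Bc)
 have "\<i> * of_real (cdeg ?A) = (LINT z|circ. (of_real (c z) * g' z + c' z * g z) * cnj (of_real (c z) * g z))"
  by (rule circ_C1_cdeg[OF circ_C1_mult[OF c g], symmetric])
 also have "\<dots> = (LINT z|circ. of_real (c z) * of_real (c z) * (?G z) + c' z * cnj (of_real (c z)))"
 proof (rule B_integral_cong[OF refl])
  fix z assume "z \<in> space circ"
  hence "g z * cnj (g z) = 1" using complex_norm_square[of "g z"] u[of z] by simp
  hence "c' z * g z * cnj (of_real (c z) * g z) = c' z * cnj (of_real (c z))" by (simp add: mult_ac)
  thus "(of_real (c z) * g' z + c' z * g z) * cnj (of_real (c z) * g z) = of_real (c z) * of_real (c z) * (?G z) + c' z * cnj (of_real (c z))"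
   by (simp add: algebra_simps)
 qed
 also have "\<dots> = ?L + \<i> * of_real (cdeg (\<lambda>z. of_real (c z)))"
  using B_integral_add[OF i1 i2] circ_C1_cdeg[OF c] by simp
 finally have "\<i> * of_real (cdeg ?A) = ?L"
  by (simp add: cdeg_real[OF circ_C1_fin_energy[OF c]])
 from arg_cong[OF this, of Im] have "cdeg ?A = Im ?L" by simp
 also have "\<dots> = (LINT z|circ. Im (of_real (c z) * of_real (c z) * (?G z)))" by (rule integral_Im[OF i1, symmetric])
 also have "\<dots> = (LINT z|circ. (c z)^2 * Im (?G z))"
 proof -
  have "Im (of_real x * of_real x * w) = x^2 * Im w" for x w by (simp add: power2_eq_square)
  thus ?thesis by (simp only:)
 qed
 finally show ?thesis .
qed

text \<open>\<open>Im z\<close> has mean 0; were it nonnegative almost everywhere, it would vanish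
  almost everywhere, leaving only the points \<open>1\<close> and \<open>-1\<close>.\<close>

lemma not_AE_upper: "\<not> (AE z in circ. Im z \<ge> 0)"
proof
 assume *: "AE z in circ. Im z \<ge> 0"
 have i: "integrable circ (\<lambda>z. z)" by (rule circ_integrable_bounded[where B = 1]) auto
 have "(LINT z|circ. Im z) = 0" using integral_Im[OF i] integral_circ_power[of 1] by simp
 moreover have "integrable circ Im" using integrable_Im[OF i] by simp
 ultimately have "AE z in circ. Im z = 0" using integral_nonneg_eq_0_iff_AE[OF _ *] by simp
 hence "AE z in circ. False"
  using AE_circ_neq[of 1, simplified] AE_circ_neq[of "-1", simplified] AE_space
 proof eventually_elim
  case (elim z)
  hence "(Re z)^2 = 1" using cmod_power2[of z] by simp
  thus ?case using elim by (auto simp: power2_eq_1_iff complex_eq_iff)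
 qed
 thus False using emeasure_circ_space by (simp add: eventually_False ae_filter_eq_bot_iff del: space_circ)
qed

text \<open>The three cut-offs split the degree of \<open>f\<close>. The lower part obeys the
  averaged bubble inequality, the upper part coincides with that of \<open>g\<close> and tends to
  \<open>qarc\<close>, and the middle part is bounded by its energy, which tends to 0. For the
  second claim, a constant times a real cut-off has degree 0.\<close>

lemma no_gain_degree:
 assumes f: "adm g d f" and min: "\<And>v. adm g d v ==> cenergy f \<le> cenergy v"
  and ng: "\<And>v. adm g (d + 1) v ==> cenergy f + 1 \<le> cenergy v"
  and g: "circ_C1 g g'" and u: "\<And>z. cmod z = 1 ==> cmod (g z) = 1"
 shows "(LINT p|circ2. (1 - upper (fst p)) * (1 - Re (cross f p))) \<le> 4 * (of_int d - qarc g g')"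
  "(AE z in circ. f z = \<kappa>) ==> qarc g g' = 0"
proof -
 let ?E = "\<lambda>p. 1 - Re (cross f p)"
 let ?G = "\<lambda>z. g' z * cnj (g z)"
 have cf: "circ_map f" using f by (simp add: adm_def)
 have fg: "AE z in circ. Im z \<ge> 0 \<longrightarrow> f z = g z" using f by (simp add: adm_def)
 note [measurable] = circ_map_measurable[OF cf] circ_measurable_of_cis[OF circ_C1_continuous(1)[OF g]] circ_measurable_of_cis[OF circ_C1_continuous(2)[OF g]]
 obtain a b c :: "nat => complex => real" where
  one: "\<And>N z. (a N z)^2 + (b N z)^2 + (c N z)^2 = 1"
  and a: "\<And>N. \<exists>a'. circ_C1 (\<lambda>z. of_real (a N z)) a'" and c: "\<And>N. \<exists>c'. circ_C1 (\<lambda>z. of_real (c N z)) c'"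
  and supp: "\<And>N. \<exists>\<delta>>0. \<delta> \<le> 1 \<and> (\<forall>z. cmod z = 1 \<longrightarrow> Im z > - \<delta> \<longrightarrow> a N z = 0)"
  and c0: "\<And>N z. Im z < 0 ==> c N z = 0"
  and b: "\<And>N. fin_energy (\<lambda>z. of_real (b N z))" and bE: "(\<lambda>N. cenergy (\<lambda>z. of_real (b N z))) \<leadsto> 0"
  and la: "AE z in circ. (\<lambda>N. a N z) \<leadsto> (if Im z < 0 then 1 else 0)"
  and lb: "AE z in circ. (\<lambda>N. b N z) \<leadsto> 0"
  and lc: "AE z in circ. (\<lambda>N. c N z) \<leadsto> (if Im z < 0 then 0 else 1)"
  by (rule cutoffs) (rule that)
 have fa: "fin_energy (\<lambda>z. of_real (a N z))" and fc: "fin_energy (\<lambda>z. of_real (c N z))" for N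
  using a[of N] c[of N] circ_C1_fin_energy by blast+
 have m: "(\<lambda>z. w z) \<in> borel_measurable circ" if "fin_energy (\<lambda>z. complex_of_real (w z))" for w
 proof -
  have "(\<lambda>z. Re (of_real (w z))) \<in> borel_measurable circ" using fin_energy_measurable[OF that] by measurable
  thus ?thesis by simp
 qed
 note [measurable] = m[OF fa] m[OF b] m[OF fc]
 have abs1: "\<bar>a N z\<bar> \<le> 1" "\<bar>b N z\<bar> \<le> 1" "\<bar>c N z\<bar> \<le> 1" for N z
  using one[of N z] zero_le_power2[of "a N z"] zero_le_power2[of "b N z"] zero_le_power2[of "c N z"]
  unfolding abs_square_le_1[symmetric] by linarith+
 have cq: "(\<lambda>N. cdeg (\<lambda>z. of_real (c N z) * f z)) \<leadsto> qarc g g'"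
 proof -
  obtain B where B: "B \<ge> 0" "\<And>z. cmod z = 1 ==> cmod (g z) \<le> B" "\<And>z. cmod z = 1 ==> cmod (g' z) \<le> B"
   by (rule circ_C1_bounded[OF g]) (rule that)
  have "cdeg (\<lambda>z. of_real (c N z) * f z) = (LINT z|circ. (c N z)^2 * Im (?G z))" for N
  proof -
   obtain c' where c': "circ_C1 (\<lambda>z. of_real (c N z)) c'" using c by blast
   have "cdeg (\<lambda>z. of_real (c N z) * f z) = cdeg (\<lambda>z. of_real (c N z) * g z)"
   proof (rule cdeg_cong_AE)
    show "AE z in circ. of_real (c N z) * f z = of_real (c N z) * g z"
     using fg by eventually_elim (use c0 in force)
   qed measurable
   thus ?thesis using cdeg_cutoff[OF c' g u] by simp
  qed
  moreover have "(\<lambda>N. \<integral>z. (c N z)^2 * Im (?G z) \<partial>circ) \<leadsto> qarc g g'"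
   unfolding qarc_def
  proof (rule integral_dominated_convergence[where w = "\<lambda>_. B * B"])
   show "AE z in circ. (\<lambda>N. (c N z)^2 * Im (?G z)) \<leadsto> upper z * Im (?G z)"
    using lc by eventually_elim (auto simp: upper_def split: if_splits intro!: tendsto_eq_intros)
   show "AE z in circ. norm ((c N z)^2 * Im (?G z)) \<le> B * B" for N
   proof (rule AE_I2)
    fix z assume "z \<in> space circ"
    hence z: "cmod z = 1" by simp
    have "\<bar>Im (?G z)\<bar> \<le> B * B"
     by (rule order_trans[OF abs_Im_le_cmod]) (unfold norm_mult complex_mod_cnj, intro mult_mono B z, auto simp: B)
    hence "\<bar>(c N z)^2\<bar> * \<bar>Im (?G z)\<bar> \<le> 1 * (B * B)"
     using abs1[of N z] by (intro mult_mono) (auto simp: abs_square_le_1)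
    thus "norm ((c N z)^2 * Im (?G z)) \<le> B * B" by (simp only: real_norm_def abs_mult mult_1_left)
   qed
  qed auto
  ultimately show ?thesis by simp
 qed
 show "qarc g g' = 0" if \<kappa>: "AE z in circ. f z = \<kappa>"
 proof -
  have "cdeg (\<lambda>z. of_real (c N z) * f z) = 0" for N
  proof -
   have "cdeg (\<lambda>z. of_real (c N z) * f z) = cdeg (\<lambda>z. \<kappa> * of_real (c N z))"
    by (rule cdeg_cong_AE) (use \<kappa> in \<open>auto elim!: eventually_mono\<close>)
   also have "\<dots> = (cmod \<kappa>)^2 * cdeg (\<lambda>z. of_real (c N z))"
   proof -
    have "(\<lambda>n. real n * dc (\<lambda>z. \<kappa> * of_real (c N z)) n) = (\<lambda>n. (cmod \<kappa>)^2 * (real n * dc (\<lambda>z. of_real (c N z)) n))"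
     by (simp add: fun_eq_iff dc_def fp_cmult norm_mult power_mult_distrib algebra_simps)
    thus ?thesis unfolding cdeg_def using suminf_mult[OF cdeg_summable[OF fc]] by simp
   qed
   finally show ?thesis by (simp add: cdeg_real[OF fc])
  qed
  thus ?thesis using LIMSEQ_unique[OF cq] by simp
 qed
 have bq: "(\<lambda>N. cdeg (\<lambda>z. of_real (b N z) * f z)) \<leadsto> 0"
 proof (rule Lim_null_comparison)
  let ?R = "\<lambda>N p. (b N (snd p))^2 * (cmod (dquot f p))^2"
  note fE = fin_energyD[OF circ_map_fin_energy[OF cf]]
  have le1: "?R N p \<le> (cmod (dquot f p))^2" for N p
   using abs1(2)[of N "snd p"] by (intro mult_left_le_one_le) (auto simp: abs_square_le_1)
  have iR: "integrable circ2 (?R N)" for N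
   by (rule B_integrable_bound[OF fE]) (use le1 in auto)
  have "cenergy (\<lambda>z. of_real (b N z) * f z) \<le> (LINT p|circ2. 2 * (cmod (dquot (\<lambda>z. of_real (b N z)) p))^2 + 2 * ?R N p)" for N
  proof (rule fin_energyI(2)[where B = 1])
   fix z w :: complex assume zw: "cmod z = 1" "cmod w = 1"
   show "cmod (of_real (b N z) * f z) \<le> 1" using abs1 zw circ_map_norm[OF cf] by (simp add: norm_mult)
   show "(cmod (dquot (\<lambda>z. of_real (b N z) * f z) (z, w)))^2 \<le> 2 * (cmod (dquot (\<lambda>z. of_real (b N z)) (z, w)))^2 + 2 * ?R N (z, w)"
    unfolding dquot_mult using cmod_add_sq[of "dquot (\<lambda>z. of_real (b N z)) (z, w) * f z" "of_real (b N w) * dquot f (z, w)"] zw circ_map_norm[OF cf]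
    by (simp add: norm_mult power_mult_distrib)
  qed (use iR fin_energyD[OF b] in auto)
  also have "(LINT p|circ2. 2 * (cmod (dquot (\<lambda>z. of_real (b N z)) p))^2 + 2 * ?R N p) = 2 * cenergy (\<lambda>z. of_real (b N z)) + 2 * integral\<^sup>L circ2 (?R N)" for N
   using iR[of N] fin_energyD[OF b, of N] by (simp add: cenergy_def)
  finally have "\<bar>cdeg (\<lambda>z. of_real (b N z) * f z)\<bar> \<le> 2 * cenergy (\<lambda>z. of_real (b N z)) + 2 * integral\<^sup>L circ2 (?R N)" for N
   using abs_cdeg_le[OF fin_energy_mult[OF b circ_map_fin_energy[OF cf]], of N] by (rule order_trans[rotated])
  thus "\<forall>\<^sub>F N in sequentially. norm (cdeg (\<lambda>z. of_real (b N z) * f z)) \<le> 2 * cenergy (\<lambda>z. of_real (b N z)) + 2 * integral\<^sup>L circ2 (?R N)"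
   by auto
  have "(\<lambda>N. integral\<^sup>L circ2 (?R N)) \<leadsto> (LINT p|circ2. 0)"
  proof (rule integral_dominated_convergence[OF _ _ fE])
   show "AE p in circ2. (\<lambda>N. ?R N p) \<leadsto> 0"
    using AE_circ2[OF lb] by eventually_elim (auto intro!: tendsto_eq_intros)
   show "AE p in circ2. norm (?R N p) \<le> (cmod (dquot f p))^2" for N using le1 by (intro AE_I2) auto
  qed measurable
  thus "(\<lambda>N. 2 * cenergy (\<lambda>z. of_real (b N z)) + 2 * integral\<^sup>L circ2 (?R N)) \<leadsto> 0"
   by (auto intro!: tendsto_eq_intros bE)
 qed
 have al: "(\<lambda>N. \<integral>p. (a N (fst p))^2 * (?E p) \<partial>circ2) \<leadsto> (LINT p|circ2. (1 - upper (fst p)) * (?E p))"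
 proof (rule integral_dominated_convergence[where w = "\<lambda>_. 2"])
  show "AE p in circ2. (\<lambda>N. (a N (fst p))^2 * (?E p)) \<leadsto> (1 - upper (fst p)) * (?E p)"
   using AE_circ2[OF la] by eventually_elim (auto simp: upper_def split: if_splits intro!: tendsto_eq_intros)
  show "AE p in circ2. norm ((a N (fst p))^2 * (?E p)) \<le> 2" for N
  proof (rule AE_I2)
   fix p assume "p \<in> space circ2"
   then obtain z w where p: "p = (z, w)" "cmod z = 1" "cmod w = 1" by auto
   have "\<bar>Re (cross f (z, w))\<bar> \<le> 1" using Re_cross_bound(1)[of f 1 z w] circ_map_norm[OF cf] p by simp
   hence "\<bar>(a N z)^2\<bar> * \<bar>1 - Re (cross f (z, w))\<bar> \<le> 1 * 2"
    using abs1[of N z] by (intro mult_mono) (auto simp: abs_square_le_1)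
   thus "norm ((a N (fst p))^2 * (?E p)) \<le> 2" by (simp only: p(1) real_norm_def abs_mult fst_conv)
  qed
 qed simp_all
 have main: "(LINT p|circ2. (a N (fst p))^2 * (?E p)) \<le> 4 * (of_int d - cdeg (\<lambda>z. of_real (b N z) * f z) - cdeg (\<lambda>z. of_real (c N z) * f z))" for N
 proof -
  obtain a' where a': "circ_C1 (\<lambda>z. of_real (a N z)) a'" using a by blast
  obtain L where L: "L \<ge> 0" "\<And>z w. cmod z = 1 ==> cmod w = 1 ==> cmod (complex_of_real (a N z) - of_real (a N w)) \<le> L * cmod (z - w)"
   by (rule circ_C1_lipschitz[OF a']) (rule that)
  obtain \<delta> where \<delta>: "\<delta> > 0" "\<delta> \<le> 1" "\<And>z. cmod z = 1 ==> Im z > - \<delta> ==> a N z = 0" using supp by blast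
  have "(LINT p|circ2. (a N (fst p))^2 * (?E p)) \<le> 4 * cdeg (\<lambda>z. of_real (a N z) * f z)"
  proof (rule no_gain_weighted[OF _ _ L(1) _ f min ng \<delta>])
   show "\<bar>a N z - a N w\<bar> \<le> L * cmod (z - w)" if "cmod z = 1" "cmod w = 1" for z w
    using L(2)[OF that] by (simp flip: of_real_diff)
  qed (use abs1 in auto)
  moreover have "cdeg f = cdeg (\<lambda>z. of_real (a N z) * f z) + cdeg (\<lambda>z. of_real (b N z) * f z) + cdeg (\<lambda>z. of_real (c N z) * f z)"
   by (rule cdeg_partition[OF cf fa b fc one])
  moreover have "cdeg f = of_int d" using f by (simp add: adm_def)
  moreover have "x \<le> 4 * (k - B - C)" if "x \<le> 4 * A" "e = A + B + C" "e = k" for x A B C e k :: real using that by simp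
  ultimately show ?thesis by blast
 qed
 have "(\<lambda>N. 4 * (of_int d - cdeg (\<lambda>z. of_real (b N z) * f z) - cdeg (\<lambda>z. of_real (c N z) * f z))) \<leadsto> 4 * (of_int d - 0 - qarc g g')"
  by (intro tendsto_intros bq cq)
 from tendsto_le[OF sequentially_bot this al] main
 show "(LINT p|circ2. (1 - upper (fst p)) * (?E p)) \<le> 4 * (of_int d - qarc g g')" by simp
qed

text \<open>For \<open>d\<close> at most \<open>qarc\<close> the nonnegative integrand of
  \<open>no_gain_degree\<close> vanishes almost everywhere. As the free arc is not a null set, it
  contains a point \<open>z\<close> with \<open>cross f (z, w) = 1\<close> for almost all
  \<open>w\<close>, which makes \<open>f\<close> constant.\<close>

lemma strict_gain_up:
 assumes f: "adm g d f" and min: "\<And>v. adm g d v ==> cenergy f \<le> cenergy v"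
  and g: "circ_C1 g g'" and u: "\<And>z. cmod z = 1 ==> cmod (g z) = 1"
  and q: "of_int d \<le> qarc g g'" "qarc g g' \<noteq> 0"
 shows "\<exists>v. adm g (d + 1) v \<and> cenergy v < cenergy f + 1"
proof (rule ccontr)
 assume "\<not> ?thesis"
 hence ng: "cenergy f + 1 \<le> cenergy v" if "adm g (d + 1) v" for v using that by force
 have N: "(LINT p|circ2. (1 - upper (fst p)) * (1 - Re (cross f p))) \<le> 4 * (of_int d - qarc g g')"
  "(AE z in circ. f z = \<kappa>) ==> qarc g g' = 0" for \<kappa>
  by (rule no_gain_degree[OF f min ng g u]; assumption)+
 have cf: "circ_map f" using f by (simp add: adm_def)
 note [measurable] = circ_map_measurable[OF cf]
 let ?F = "\<lambda>p. (1 - upper (fst p)) * (1 - Re (cross f p))"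
 have r: "\<bar>Re (cross f (z, w))\<bar> \<le> 1" if "cmod z = 1" "cmod w = 1" for z w
  using Re_cross_bound(1)[of f 1 z w] circ_map_norm[OF cf] that by simp
 have nn: "0 \<le> ?F (z, w)" "?F (z, w) \<le> 2" if "cmod z = 1" "cmod w = 1" for z w
  using r[OF that] by (auto simp: upper_def)
 have iF: "integrable circ2 ?F" by (rule circ2_integrable_bounded[where B = 2]) (use nn in auto)
 have "integral\<^sup>L circ2 ?F \<le> 0"
  by (rule order_trans[OF N(1)]) (use q(1) in simp)
 moreover have nnAE: "AE p in circ2. 0 \<le> ?F p" using nn by (intro AE_I2) auto
 ultimately have "integral\<^sup>L circ2 ?F = 0" using integral_nonneg_AE[OF nnAE] by linarith
 hence "AE p in circ2. ?F p = 0" using integral_nonneg_eq_0_iff_AE[OF iF nnAE] by simp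
 hence "AE z in circ. AE w in circ. ?F (z, w) = 0" unfolding circ2_def by (rule circ2.AE_pair)
 hence "AE z in circ. Im z \<ge> 0" if "AE z in circ. \<not> (Im z < 0 \<and> cmod z = 1 \<and> (AE w in circ. ?F (z, w) = 0))"
  using that AE_space by eventually_elim auto
 hence "\<not> (AE z in circ. \<not> (Im z < 0 \<and> cmod z = 1 \<and> (AE w in circ. ?F (z, w) = 0)))"
  using not_AE_upper by blast
 then obtain z where z: "Im z < 0" "cmod z = 1" "AE w in circ. ?F (z, w) = 0"
  using always_eventually[of "\<lambda>z. \<not> (Im z < 0 \<and> cmod z = 1 \<and> (AE w in circ. ?F (z, w) = 0))"] by blast
 have "AE w in circ. f w = f z"
  using z(3) AE_space
 proof eventually_elim
  case (elim w)
  hence R: "Re (cross f (z, w)) = 1" and w: "cmod w = 1" using z(1) by (auto simp: upper_def)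
  have "cmod (cross f (z, w)) = 1" using circ_map_norm[OF cf] z(2) w by (simp add: cross_def norm_mult)
  hence "cross f (z, w) = 1" using R cmod_power2[of "cross f (z, w)"] by (simp add: complex_eq_iff)
  hence "f z * cnj (f w) * f w = f w" by (simp add: cross_def)
  moreover have "cnj (f w) * f w = 1" using complex_norm_square[of "f w"] circ_map_norm[OF cf w] by (simp add: mult.commute)
  ultimately show ?case by (simp only: mult.assoc mult_1_right)
 qed
 thus False using N(2) q by blast
qed

lemma strict_gain_down:
 assumes f: "adm g d f" and min: "\<And>v. adm g d v ==> cenergy f \<le> cenergy v"
  and g: "circ_C1 g g'" and u: "\<And>z. cmod z = 1 ==> cmod (g z) = 1"
  and q: "of_int d \<ge> qarc g g'" "qarc g g' \<noteq> 0"
 shows "\<exists>v. adm g (d - 1) v \<and> cenergy v < cenergy f + 1"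
proof -
 let ?L = "\<lambda>z. cnj (g z)"
 let ?A = "\<lambda>z. cnj (f z)"
 have qq: "qarc ?L (\<lambda>z. cnj (g' z)) = - qarc g g'"
  unfolding qarc_def B_integral_minus[symmetric] by (rule B_integral_cong) (auto simp: algebra_simps)
 have "\<exists>v. adm ?L (- d + 1) v \<and> cenergy v < cenergy ?A + 1"
 proof (rule strict_gain_up)
  show "adm ?L (- d) ?A" using f by (simp add: adm_cnj)
  show "cenergy ?A \<le> cenergy v" if "adm ?L (- d) v" for v
   using min[of "\<lambda>z. cnj (v z)"] adm_cnj[of g d "\<lambda>z. cnj (v z)"] that by (simp add: fin_energy_cnj(2))
  show "circ_C1 ?L (\<lambda>z. cnj (g' z))" by (rule circ_C1_cnj[OF g])
 qed (use u q in \<open>auto simp: qq\<close>)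
 then obtain v where v: "adm ?L (- d + 1) v" "cenergy v < cenergy f + 1" by (auto simp: fin_energy_cnj(2))
 have "adm g (d - 1) (\<lambda>z. cnj (v z))" using v(1) adm_cnj[of g "d - 1" "\<lambda>z. cnj (v z)"] by simp
 thus ?thesis using v(2) by (auto simp: fin_energy_cnj(2))
qed

lemma adm_self:
 assumes "circ_map g" shows "\<exists>k. adm g k g"
 using cdeg_int[OF assms] assms by (auto simp: adm_def)

lemma minimizer_exists:
 assumes g: "circ_C1 g g'" and u: "\<And>z. cmod z = 1 ==> cmod (g z) = 1" and q0: "qarc g g' \<noteq> 0"
  and d: "of_int d - 1 \<le> qarc g g'" "qarc g g' \<le> of_int d + 1"
 shows "\<exists>f. adm g d f \<and> (\<forall>v. adm g d v \<longrightarrow> cenergy f \<le> cenergy v)"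
proof -
 have cg: "circ_map g" by (rule circ_C1_circ_map[OF g u])
 obtain k where "adm g k g" using adm_self[OF cg] by blast
 from adm_approx[OF this, of 1 d] have ne: "\<exists>v. adm g d v" by auto
 define S where "S = cenergy ` {v. adm g d v}"
 define m where "m = Inf S"
 have S: "S \<noteq> {}" "bdd_below S" using ne by (auto simp: S_def intro!: bdd_belowI2[where m = 0])
 have m_le: "m \<le> cenergy v" if "adm g d v" for v
  unfolding m_def by (rule cInf_lower[OF _ S(2)]) (use that in \<open>simp add: S_def\<close>)
 have "\<exists>v. adm g d v \<and> cenergy v < m + 1 / real (Suc n)" for n
 proof -
  have "Inf S < m + 1 / real (Suc n)" by (simp add: m_def)
  from cInf_lessD[OF S(1) this] show ?thesis by (auto simp: S_def)
 qed
 then obtain F where F: "\<And>n. adm g d (F n)" "\<And>n. cenergy (F n) < m + 1 / real (Suc n)" by metis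
 have lim: "(\<lambda>n. cenergy (F n)) \<leadsto> m"
 proof (rule real_tendsto_sandwich)
  show "\<forall>\<^sub>F n in sequentially. m \<le> cenergy (F n)" using m_le[OF F(1)] by simp
  show "\<forall>\<^sub>F n in sequentially. cenergy (F n) \<le> m + 1 / real (Suc n)" using less_imp_le[OF F(2)] by (intro always_eventually) blast
  have "(\<lambda>n. m + inverse (real (Suc n))) \<leadsto> m + 0" by (intro tendsto_add tendsto_const LIMSEQ_inverse_real_of_nat)
  thus "(\<lambda>n. m + 1 / real (Suc n)) \<leadsto> m" by (simp add: inverse_eq_divide)
 qed simp
 have Fc: "circ_map (F n)" "cdeg (F n) = of_int d" "AE z in circ. Im z \<ge> 0 \<longrightarrow> F n z = g z" for n
  using F(1)[of n] by (auto simp: adm_def)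
 have "cenergy (F n) \<le> m + 1" for n
  using F(2)[of n] order_trans[OF less_imp_le[OF F(2)[of n]], of "m + 1"] by (simp add: divide_le_eq)
 then obtain r h where r: "strict_mono r" and h: "circ_map h" "AE z in circ. (\<lambda>n. F (r n) z) \<leadsto> h z"
  by (rule circ_map_compact[OF Fc(1)]) (rule that)
 have con: "cenergy h + \<bar>of_int d - cdeg h\<bar> \<le> m"
  by (rule energy_concentration[OF Fc(1,2) _ h]) (use LIMSEQ_subseq_LIMSEQ[OF lim r] in \<open>simp add: o_def\<close>)
 obtain d' where d': "cdeg h = of_int d'" using cdeg_int[OF h(1)] by blast
 have "AE z in circ. \<forall>n. Im z \<ge> 0 \<longrightarrow> F n z = g z" unfolding AE_all_countable using Fc(3) by blast
 hence "AE z in circ. Im z \<ge> 0 \<longrightarrow> h z = g z"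
  using h(2) by eventually_elim (auto intro: LIMSEQ_unique)
 hence hd: "adm g d' h" using h(1) d' by (simp add: adm_def)
 \<comment> \<open>Bubbles added to a competitor of any degree bound the infimum. Together with
   \<open>con'\<close> this shows that \<open>h\<close> minimises within its own degree
   \<open>d'\<close>; and if \<open>d'\<close> differed from \<open>d\<close>, a competitor one step
   closer, obtained at a cost below 1, would undercut \<open>m\<close>.\<close>
 have m_le2: "m \<le> cenergy v + \<bar>real_of_int (d - e)\<bar>" if v: "adm g e v" for e v
 proof (rule field_le_epsilon)
  fix \<epsilon> :: real assume "\<epsilon> > 0"
  from adm_approx[OF v this, of d] obtain v' where "adm g d v'" "cenergy v' \<le> cenergy v + \<bar>real_of_int (d - e)\<bar> + \<epsilon>" by blast
  thus "m \<le> cenergy v + \<bar>real_of_int (d - e)\<bar> + \<epsilon>" using m_le by force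
 qed
 have con': "cenergy h + \<bar>real_of_int (d - d')\<bar> \<le> m" using con d' by simp
 have hmin: "cenergy h \<le> cenergy v" if "adm g d' v" for v using m_le2[OF that] con' by linarith
 have "d' = d"
 proof (rule ccontr)
  assume "d' \<noteq> d"
  then consider "d' < d" | "d' > d" by linarith
  thus False
  proof cases
   case 1
   hence "real_of_int d' \<le> of_int d - 1" by linarith
   hence "of_int d' \<le> qarc g g'" using d by linarith
   from strict_gain_up[OF hd hmin g u this q0] obtain v where v: "adm g (d' + 1) v" "cenergy v < cenergy h + 1" by blast
   show False using m_le2[OF v(1)] v(2) con' 1 by linarith
  next
   case 2
   hence "real_of_int d' \<ge> of_int d + 1" by linarith
   hence "of_int d' \<ge> qarc g g'" using d by linarith
   from strict_gain_down[OF hd hmin g u this q0] obtain v where v: "adm g (d' - 1) v" "cenergy v < cenergy h + 1" by blast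
   show False using m_le2[OF v(1)] v(2) con' 2 by linarith
  qed
 qed
 thus ?thesis using hd con' m_le by force
qed

subsection \<open>The degree on the circle\<close>

lemma nn_integral_cis:
 assumes "K \<in> borel_measurable circ"
 shows "(\<integral>\<^sup>+\<theta>\<in>{0..2*pi}. K (cis \<theta>) \<partial>lborel) = ennreal (2*pi) * (\<integral>\<^sup>+z. K z \<partial>circ)"
proof -
 let ?I = "\<integral>\<^sup>+\<theta>\<in>{0..2*pi}. K (cis \<theta>) \<partial>lborel"
 have "ennreal (2*pi) * (?I / ennreal (2*pi)) = ?I"
  by (subst ennreal_times_divide, subst mult.commute, rule ennreal_mult_divide_eq) auto
 thus ?thesis by (simp only: nn_integral_circ[OF assms])
qed

text \<open>A Borel function agreeing with \<open>f\<close> almost everywhere: it bridges the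
  Lebesgue measurable functions of the problem and the measure \<open>circ\<close>, whose measurable
  sets are Borel.\<close>

definition crep :: "(complex => complex) => (complex => complex) => bool" where
 "crep f F \<longleftrightarrow> F \<in> borel_measurable circ \<and> (AE \<theta> in lborel. \<theta> \<in> {0..2*pi} \<longrightarrow> f (cis \<theta>) = F (cis \<theta>))"

lemma crep_refl: "F \<in> borel_measurable circ ==> crep F F" by (simp add: crep_def)

lemma crep_diff: "crep f F ==> crep g G ==> crep (\<lambda>z. f z - g z) (\<lambda>z. F z - G z)"
 unfolding crep_def by (auto elim: eventually_elim2)

lemma crep_unique:
 assumes "crep f F" "crep f G" shows "AE z in circ. F z = G z"
proof (rule AE_circ_cis)
 have [measurable]: "F \<in> borel_measurable circ" "G \<in> borel_measurable circ" using assms by (auto simp: crep_def)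
 show "{z \<in> space circ. F z = G z} \<in> sets circ" by measurable
 show "AE \<theta> in lborel. \<theta> \<in> {0..2*pi} \<longrightarrow> F (cis \<theta>) = G (cis \<theta>)"
  using assms unfolding crep_def by (auto elim: eventually_elim2)
qed

lemma H12_norm_crep:
 assumes "crep f F"
 shows "H12_circle_norm_sq f = ennreal (2*pi) * (\<integral>\<^sup>+z. ennreal ((cmod (F z))^2) \<partial>circ) +
  ennreal (2*pi) * (ennreal (2*pi) * (\<integral>\<^sup>+p. ennreal ((cmod (dquot F p))^2) \<partial>circ2))"
proof -
 let ?C = "\<lambda>s t. (cmod (f (cis s) - f (cis t)))^2 / (cmod (cis s - cis t))^2"
 let ?N = "\<integral>\<^sup>+p. ennreal ((cmod (dquot F p))^2) \<partial>circ2"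
 have [measurable]: "F \<in> borel_measurable circ" and ae: "AE \<theta> in lborel. \<theta> \<in> {0..2*pi} \<longrightarrow> f (cis \<theta>) = F (cis \<theta>)"
  using assms by (auto simp: crep_def)
 let ?I = "{0..2*pi}"
 have 1: "(\<integral>\<^sup>+s\<in>?I. ennreal ((cmod (f (cis s)))^2) \<partial>lborel) = (\<integral>\<^sup>+s\<in>?I. ennreal ((cmod (F (cis s)))^2) \<partial>lborel)"
  by (rule nn_integral_cong_AE, use ae in eventually_elim) (auto simp: indicator_def)
 define J where "J z = (\<integral>\<^sup>+w. ennreal ((cmod (dquot F (z, w)))^2) \<partial>circ)" for z
 have [measurable]: "(\<lambda>p. ennreal ((cmod (dquot F p))^2)) \<in> borel_measurable (circ \<Otimes>\<^sub>M circ)"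
  unfolding circ2_def[symmetric] by measurable
 have Jm [measurable]: "J \<in> borel_measurable circ" unfolding J_def[abs_def] by measurable
 have 2: "(\<integral>\<^sup>+t\<in>?I. ennreal (?C s t) \<partial>lborel) = ennreal (2*pi) * J (cis s)"
  if "f (cis s) = F (cis s)" for s
 proof -
  have "(\<integral>\<^sup>+t\<in>?I. ennreal (?C s t) \<partial>lborel)
   = (\<integral>\<^sup>+t\<in>?I. ennreal ((cmod (dquot F (cis s, cis t)))^2) \<partial>lborel)"
   by (rule nn_integral_cong_AE, use ae in eventually_elim) (auto simp: indicator_def that dquot_def norm_divide power_divide)
  also have "\<dots> = ennreal (2*pi) * J (cis s)"
   unfolding J_def by (rule nn_integral_cis) measurable
  finally show ?thesis .
 qed
 have "(\<integral>\<^sup>+s\<in>?I. (\<integral>\<^sup>+t\<in>?I. ennreal (?C s t) \<partial>lborel) \<partial>lborel)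
  = (\<integral>\<^sup>+s\<in>?I. ennreal (2*pi) * J (cis s) \<partial>lborel)"
 proof (rule nn_integral_cong_AE, use ae in eventually_elim)
  case (elim s)
  show ?case
  proof (cases "s \<in> ?I")
   case True
   hence "f (cis s) = F (cis s)" using elim by blast
   from 2[OF this] show ?thesis by (simp only:)
  qed simp
 qed
 also have "\<dots> = ennreal (2*pi) * (\<integral>\<^sup>+z. ennreal (2*pi) * J z \<partial>circ)" by (rule nn_integral_cis) measurable
 also have "(\<integral>\<^sup>+z. ennreal (2*pi) * J z \<partial>circ) = ennreal (2*pi) * ?N"
 proof -
  have "(\<integral>\<^sup>+z. J z \<partial>circ) = ?N"
   unfolding J_def circ2_def by (rule circ.nn_integral_fst[where f = "\<lambda>p. ennreal ((cmod (dquot F p))^2)"]) measurable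
  thus ?thesis by (simp add: nn_integral_cmult)
 qed
 finally have 3: "(\<integral>\<^sup>+s\<in>?I. (\<integral>\<^sup>+t\<in>?I. ennreal (?C s t) \<partial>lborel) \<partial>lborel)
  = ennreal (2*pi) * (ennreal (2*pi) * ?N)" .
 show ?thesis unfolding H12_circle_norm_sq_def nn_integral_completion 1 3
  by (subst nn_integral_cis) auto
qed

lemma crep_exists:
 assumes f: "f \<in> H12_circle"
 obtains F where "crep f F" "circ_map F"
proof -
 have m: "(\<lambda>\<theta>. f (cis \<theta>)) \<in> borel_measurable lebesgue" and n: "AE \<theta> in lborel. cmod (f (cis \<theta>)) = 1"
  and fin: "H12_circle_norm_sq f < \<infinity>"
  using f by (auto simp: H12_circle_def AE_completion_iff)
 have "(\<lambda>\<theta>. Re (f (cis \<theta>))) \<in> borel_measurable (completion lborel)" "(\<lambda>\<theta>. Im (f (cis \<theta>))) \<in> borel_measurable (completion lborel)"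
  using m by measurable
 from this[THEN completion_ex_borel_measurable_real] obtain a b where
  ab: "a \<in> borel_measurable lborel" "b \<in> borel_measurable lborel" "AE \<theta> in lborel. Re (f (cis \<theta>)) = a \<theta>" "AE \<theta> in lborel. Im (f (cis \<theta>)) = b \<theta>" by blast
 define u where "u \<theta> = (if (a \<theta>)^2 + (b \<theta>)^2 = 1 then Complex (a \<theta>) (b \<theta>) else 1)" for \<theta>
 have [measurable]: "a \<in> borel_measurable borel" "b \<in> borel_measurable borel" using ab by simp_all
 have [measurable]: "u \<in> borel_measurable borel" unfolding u_def[abs_def] Complex_eq by measurable
 have u1: "cmod (u \<theta>) = 1" for \<theta> by (simp add: u_def cmod_def)
 have ue: "AE \<theta> in lborel. f (cis \<theta>) = u \<theta>"
  using n ab(3,4)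
 proof eventually_elim
  case (elim \<theta>)
  thus ?case using cmod_power2[of "f (cis \<theta>)"] by (simp add: u_def complex_eq_iff)
 qed
 \<comment> \<open>The angle in \<open>[0, 2 pi)\<close>, matching the interval of integration,
   whereas the imaginary part of \<open>Ln\<close> jumps at the negative axis.\<close>
 define ar where "ar z = (if Im (Ln z) < 0 then Im (Ln z) + 2*pi else Im (Ln z))" for z
 have [measurable]: "ar \<in> borel_measurable borel" unfolding ar_def[abs_def] by measurable
 define F where "F z = u (ar z)" for z
 have Fm [measurable]: "F \<in> borel_measurable circ" unfolding F_def[abs_def] by measurable
 have ar: "ar (cis \<theta>) = \<theta>" if "\<theta> \<in> {0..<2*pi}" for \<theta>
 proof (cases "\<theta> \<le> pi")
  case True
  thus ?thesis using Arg_cis[of \<theta>] that by (simp add: ar_def Arg_eq_Im_Ln)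
 next
  case False
  have "cis \<theta> = cis (\<theta> - 2*pi)" by (simp add: complex_eq_iff cos_diff sin_diff)
  thus ?thesis using Arg_cis[of "\<theta> - 2*pi"] False that by (simp add: ar_def Arg_eq_Im_Ln)
 qed
 have "AE \<theta> in lborel. \<theta> \<noteq> 2*pi" by (rule AE_lborel_singleton)
 with ue have "AE \<theta> in lborel. \<theta> \<in> {0..2*pi} \<longrightarrow> f (cis \<theta>) = F (cis \<theta>)"
  by eventually_elim (auto simp: F_def ar)
 hence c: "crep f F" by (simp add: crep_def)
 have "(\<integral>\<^sup>+p. ennreal ((cmod (dquot F p))^2) \<partial>circ2) < \<infinity>"
 proof -
  have "ennreal (2*pi) * (ennreal (2*pi) * (\<integral>\<^sup>+p. ennreal ((cmod (dquot F p))^2) \<partial>circ2)) < \<infinity>"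
   using fin unfolding H12_norm_crep[OF c] by (simp add: less_top[symmetric])
  thus ?thesis by (auto simp: ennreal_mult_less_top)
 qed
 hence "integrable circ2 (\<lambda>p. (cmod (dquot F p))^2)"
  by (intro integrableI_bounded) auto
 hence "circ_map F" unfolding circ_map_def fin_energy_def using u1 by (auto simp: F_def intro!: exI[of _ 1])
 with c show ?thesis by (rule that)
qed

lemma circ_C1_of_C1_circle:
 assumes f: "f \<in> C1_circle"
 obtains f' where "circ_C1 f f'" "circ_map f" "C1_degree f = of_real (cdeg f)"
proof -
 obtain D where D: "\<And>x. ((\<lambda>\<theta>. f (cis \<theta>)) has_vector_derivative D x) (at x)" "continuous_on UNIV D"
  using f by (auto simp: C1_circle_def C1_differentiable_on_def)
 define f' where "f' z = D (Im (Ln z))" for z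
 have f'D: "f' (cis \<theta>) = D \<theta>" for \<theta>
 proof -
  \<comment> \<open>The derivative inherits the period of the map, so it depends only on the point
    of the circle; \<open>c\<close> is a multiple of the full turn.\<close>
  define c where "c = Im (Ln (cis \<theta>)) - \<theta>"
  have "cis (\<theta> + c) = cis \<theta>" using cis_Im_Ln[of "cis \<theta>"] by (simp add: c_def)
  hence "cis \<theta> * cis c = cis \<theta> * 1" by (simp add: cis_mult)
  hence "cis c = 1" by simp
  hence "f (cis (t + c)) = f (cis t)" for t by (simp add: cis_mult[symmetric])
  moreover have "((\<lambda>t. t + c) has_vector_derivative 1) (at \<theta>)" by (auto intro!: derivative_eq_intros)
  from vector_diff_chain_at[OF this D(1)] have "((\<lambda>t. f (cis (t + c))) has_vector_derivative D (\<theta> + c)) (at \<theta>)"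
   by (simp add: o_def)
  ultimately have "((\<lambda>t. f (cis t)) has_vector_derivative D (\<theta> + c)) (at \<theta>)" by simp
  from vector_derivative_unique_at[OF this D(1)] show ?thesis by (simp add: f'_def c_def)
 qed
 have C: "circ_C1 f f'" unfolding circ_C1_def f'D using D by simp
 have u: "cmod (f z) = 1" if "cmod z = 1" for z
 proof -
  have "cmod (f (cis (Im (Ln z)))) = 1" using f by (simp only: C1_circle_def mem_Collect_eq)
  thus ?thesis using cis_Im_Ln[OF that] by simp
 qed
 have "C1_degree f = 1 / (2 * of_real pi * \<i>) * integral {0..2*pi} (\<lambda>\<theta>. f' (cis \<theta>) * cnj (f (cis \<theta>)))"
  unfolding C1_degree_def f'D vector_derivative_at[OF D(1)] by (simp add: mult.commute)
 also have "integral {0..2*pi} (\<lambda>\<theta>. f' (cis \<theta>) * cnj (f (cis \<theta>))) = 2 * of_real pi * (LINT z|circ. f' z * cnj (f z))"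
  by (subst integral_circ_continuous) (auto intro!: continuous_intros circ_C1_continuous[OF C])
 also have "1 / (2 * of_real pi * \<i>) * \<dots> = of_real (cdeg f)" unfolding circ_C1_cdeg[OF C] by simp
 finally show ?thesis using that[OF C circ_C1_circ_map[OF C u]] by simp
qed

lemma C1_circle_of_circ_C1:
 assumes C: "circ_C1 F F'" and u: "circ_map F"
 shows "F \<in> C1_circle"
 using C circ_map_norm[OF u] unfolding C1_circle_def C1_differentiable_on_def circ_C1_def by auto

lemma H12_circle_of_circ_map:
 assumes F: "circ_map F" and c: "crep f F" and m: "(\<lambda>\<theta>. f (cis \<theta>)) \<in> borel_measurable lebesgue"
  and n: "AE \<theta> in lebesgue. cmod (f (cis \<theta>)) = 1"
 shows "f \<in> H12_circle"
proof -
 note [measurable] = circ_map_measurable[OF F]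
 have "(\<integral>\<^sup>+p. ennreal ((cmod (dquot F p))^2) \<partial>circ2) < \<infinity>"
  using fin_energyD[OF circ_map_fin_energy[OF F]] by (simp add: nn_integral_eq_integral)
 moreover have "(\<integral>\<^sup>+z. ennreal ((cmod (F z))^2) \<partial>circ) < \<infinity>"
 proof -
  have "integrable circ (\<lambda>z. (cmod (F z))^2)"
   by (rule circ_integrable_bounded[where B = 1]) (auto simp: circ_map_norm[OF F])
  thus ?thesis by (simp add: nn_integral_eq_integral)
 qed
 ultimately have "H12_circle_norm_sq f < \<infinity>"
  unfolding H12_norm_crep[OF c] by (simp add: ennreal_mult_less_top)
 thus ?thesis using m n by (simp add: H12_circle_def)
qed

lemma H12_circle_circ_map: "circ_map F ==> F \<in> H12_circle"
proof (rule H12_circle_of_circ_map)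
 let ?L = "\<lambda>\<theta>. F (cis \<theta>)"
 assume F: "circ_map F"
 note [measurable] = circ_map_measurable[OF F]
 show "crep F F" by (rule crep_refl) measurable
 have "?L \<in> borel_measurable lborel" by measurable
 thus "?L \<in> borel_measurable lebesgue" by (rule measurable_completion)
 show "AE \<theta> in lebesgue. cmod (F (cis \<theta>)) = 1" by (simp add: circ_map_norm[OF F])
qed

lemma tendsto_int_iff_real: "(a \<leadsto> b) \<longleftrightarrow> (\<lambda>n. real_of_int (a n)) \<leadsto> real_of_int b" for a :: "nat => int"
proof
 assume "a \<leadsto> b"
 hence "eventually (\<lambda>n. a n \<in> {b}) sequentially" by (rule topological_tendstoD) (auto simp: open_discrete)
 thus "(\<lambda>n. real_of_int (a n)) \<leadsto> real_of_int b" by (intro tendsto_eventually) (auto elim: eventually_mono)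
next
 assume "(\<lambda>n. real_of_int (a n)) \<leadsto> real_of_int b"
 hence "eventually (\<lambda>n. dist (real_of_int (a n)) (real_of_int b) < 1) sequentially" by (rule tendstoD) simp
 thus "a \<leadsto> b"
  by (intro tendsto_eventually) (auto elim!: eventually_mono simp: dist_real_def)
qed

lemma H12_norm_tendsto_iff:
 assumes F: "\<And>n. crep (f n) (F n)" "\<And>n. circ_map (F n)" and G: "crep g G" "circ_map G"
 shows "(\<lambda>n. H12_circle_norm_sq (\<lambda>z. f n z - g z)) \<leadsto> 0 \<longleftrightarrow>
  (\<lambda>n. \<integral>z. (cmod (F n z - G z))^2 \<partial>circ) \<leadsto> 0 \<and> (\<lambda>n. cenergy (\<lambda>z. F n z - G z)) \<leadsto> 0"
proof -
 note [measurable] = circ_map_measurable[OF F(2)] circ_map_measurable[OF G(2)]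
 let ?a = "\<lambda>n. \<integral>z. (cmod (F n z - G z))^2 \<partial>circ" and ?b = "\<lambda>n. cenergy (\<lambda>z. F n z - G z)"
 have i1: "integrable circ (\<lambda>z. (cmod (F n z - G z))^2)" for n
 proof (rule circ_integrable_bounded[where B = "2^2"])
  fix z :: complex assume z: "cmod z = 1"
  have "cmod (F n z - G z) \<le> 2" using norm_triangle_ineq4[of "F n z" "G z"] circ_map_norm[OF F(2) z] circ_map_norm[OF G(2) z] by simp
  from power_mono[OF this, of 2] show "norm ((cmod (F n z - G z))^2) \<le> 2^2" by simp
 qed measurable
 have i2: "integrable circ2 (\<lambda>p. (cmod (dquot (\<lambda>z. F n z - G z) p))^2)" for n
  by (rule fin_energyD[OF fin_energy_diff(1)[OF circ_map_fin_energy[OF F(2)] circ_map_fin_energy[OF G(2)]]])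
 have eq: "H12_circle_norm_sq (\<lambda>z. f n z - g z) = ennreal (2*pi * ?a n + 2*pi * (2*pi * ?b n))" for n
  unfolding H12_norm_crep[OF crep_diff[OF F(1) G(1)]] cenergy_def
  by (simp add: nn_integral_eq_integral[OF i1] nn_integral_eq_integral[OF i2] ennreal_mult[symmetric] ennreal_plus[symmetric] del: ennreal_plus)
 have "(\<lambda>n. ennreal (2*pi * ?a n + 2*pi * (2*pi * ?b n))) \<leadsto> ennreal 0 \<longleftrightarrow> (\<lambda>n. 2*pi * ?a n + 2*pi * (2*pi * ?b n)) \<leadsto> 0"
  by (rule tendsto_ennreal_iff) (auto intro!: always_eventually)
 also have "\<dots> \<longleftrightarrow> ?a \<leadsto> 0 \<and> ?b \<leadsto> 0"
 proof
  assume *: "(\<lambda>n. 2*pi * ?a n + 2*pi * (2*pi * ?b n)) \<leadsto> 0"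
  have p: "?a n \<le> 2*pi * ?a n" "?b n \<le> 2*pi * (2*pi * ?b n)" for n
  proof -
   have 1: "1 \<le> 2*pi" using pi_gt3 by simp
   have m: "x \<le> 2*pi * x" if "x \<ge> 0" for x using mult_right_mono[OF 1 that] by simp
   show "?a n \<le> 2*pi * ?a n" by (rule m) simp
   have "?b n \<le> 2*pi * ?b n" by (rule m) simp
   also have "\<dots> \<le> 2*pi * (2*pi * ?b n)" by (rule m) simp
   finally show "?b n \<le> 2*pi * (2*pi * ?b n)" .
  qed
  have sw: "x \<leadsto> 0" if "\<And>n. 0 \<le> x n" "\<And>n. x n \<le> y n" "y \<leadsto> 0" for x y :: "nat => real"
   by (rule real_tendsto_sandwich[OF _ _ tendsto_const that(3)]) (use that in auto)
  have nn: "0 \<le> 2*pi * ?a n" "0 \<le> 2*pi * (2*pi * ?b n)" for n by auto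
  have "?a \<leadsto> 0" by (rule sw[OF _ add_increasing2[OF nn(2) p(1)] *]) simp
  moreover have "?b \<leadsto> 0" by (rule sw[OF _ add_increasing[OF nn(1) p(2)] *]) simp
  ultimately show "?a \<leadsto> 0 \<and> ?b \<leadsto> 0" by simp
 qed (auto intro!: tendsto_eq_intros)
 finally show ?thesis unfolding eq by simp
qed

text \<open>Existence: \<open>cdeg\<close> of a representative is an integer, does not depend on the
  representative, and is continuous. Uniqueness: smooth maps are dense in the norm. So the definite
  description denotes \<open>Dg\<close>.\<close>

lemma degree_circle_eq:
 assumes f: "f \<in> H12_circle" and c: "crep f F"
 shows "of_int (degree_circle f) = cdeg F"
proof -
 define Dg where "Dg = restrict (\<lambda>f. \<lfloor>cdeg (SOME F. crep f F \<and> circ_map F)\<rfloor>) H12_circle"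
 have Dg: "of_int (Dg f) = cdeg F" if f: "f \<in> H12_circle" and c: "crep f F" for f F
 proof -
  define G where "G = (SOME F. crep f F \<and> circ_map F)"
  have G: "crep f G" "circ_map G" using someI_ex[of "\<lambda>F. crep f F \<and> circ_map F"] crep_exists[OF f] unfolding G_def by blast+
  have m: "F \<in> borel_measurable circ" using c by (simp add: crep_def)
  have "cdeg F = cdeg G" by (rule cdeg_cong_AE[OF crep_unique[OF c G(1)] m circ_map_measurable[OF G(2)]])
  moreover obtain k where "cdeg G = of_int k" using cdeg_int[OF G(2)] by blast
  ultimately show ?thesis using f by (simp add: Dg_def G_def[symmetric])
 qed
 have Dg_ext: "is_continuous_degree_extension Dg"
  unfolding is_continuous_degree_extension_def
 proof (intro conjI ballI allI impI)
  show "Dg \<in> extensional H12_circle" by (simp add: Dg_def)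
  fix f assume "f \<in> C1_circle"
  then obtain f' where f: "circ_map f" "C1_degree f = of_real (cdeg f)" by (rule circ_C1_of_C1_circle)
  have "of_int (Dg f) = cdeg f" by (rule Dg[OF H12_circle_circ_map[OF f(1)] crep_refl[OF circ_map_measurable[OF f(1)]]])
  thus "of_int (Dg f) = C1_degree f" unfolding f(2) by (metis of_real_of_int_eq)
 next
  fix F f assume F: "\<forall>n::nat. F n \<in> H12_circle" and f: "f \<in> H12_circle"
   and lim: "(\<lambda>n. H12_circle_norm_sq (\<lambda>z. F n z - f z)) \<leadsto> 0"
  have "\<exists>G. crep (F n) G \<and> circ_map G" for n using crep_exists F by blast
  then obtain G where G: "\<And>n. crep (F n) (G n)" "\<And>n. circ_map (G n)" by metis
  obtain H where H: "crep f H" "circ_map H" by (rule crep_exists[OF f])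
  have "(\<lambda>n. cenergy (\<lambda>z. G n z - H z)) \<leadsto> 0" using lim H12_norm_tendsto_iff[where F = G and f = F, OF G H] by blast
  hence "(\<lambda>n. cdeg (G n)) \<leadsto> cdeg H"
   by (rule cdeg_tendsto[OF circ_map_fin_energy[OF G(2)] circ_map_fin_energy[OF H(2)]])
  moreover have "of_int (Dg (F n)) = cdeg (G n)" for n using Dg F G by blast
  moreover have "of_int (Dg f) = cdeg H" using Dg f H by blast
  ultimately show "(\<lambda>n. Dg (F n)) \<leadsto> Dg f" by (simp add: tendsto_int_iff_real)
 qed
 have unique: "D = Dg" if D: "is_continuous_degree_extension D" for D
 proof
  fix f show "D f = Dg f"
  proof (cases "f \<in> H12_circle")
   case True
   then obtain H where H: "crep f H" "circ_map H" by (rule crep_exists)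
   obtain \<phi> where \<phi>: "\<And>j::nat. \<exists>\<phi>'. circ_C1 (\<phi> j) \<phi>'" "\<And>j. circ_map (\<phi> j)"
    "(\<lambda>j. \<integral>z. (cmod (\<phi> j z - H z))^2 \<partial>circ) \<leadsto> 0" "(\<lambda>j. cenergy (\<lambda>z. \<phi> j z - H z)) \<leadsto> 0"
    by (rule circ_map_dense[OF H(2)]) (rule that)
   have C1: "\<phi> j \<in> C1_circle" for j using C1_circle_of_circ_C1 \<phi>(1,2) by blast
   have r: "crep (\<phi> j) (\<phi> j)" for j by (rule crep_refl[OF circ_map_measurable[OF \<phi>(2)]])
   have "(\<lambda>j. H12_circle_norm_sq (\<lambda>z. \<phi> j z - f z)) \<leadsto> 0"
    using \<phi>(3,4) H12_norm_tendsto_iff[where f = \<phi> and F = \<phi>, OF r \<phi>(2) H] by blast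
   hence lim: "(\<lambda>j. D' (\<phi> j)) \<leadsto> D' f" if "is_continuous_degree_extension D'" for D'
    using that True H12_circle_circ_map[OF \<phi>(2)] unfolding is_continuous_degree_extension_def by blast
   have "of_int (D (\<phi> j)) = (of_int (Dg (\<phi> j)) :: complex)" for j
    using D Dg_ext C1 unfolding is_continuous_degree_extension_def by metis
   hence "D (\<phi> j) = Dg (\<phi> j)" for j by simp
   thus ?thesis using LIMSEQ_unique[OF lim[OF D]] lim[OF Dg_ext] by simp
  next
   case False
   thus ?thesis using D by (simp add: is_continuous_degree_extension_def Dg_def extensional_def)
  qed
 qed
 have "degree_circle = Dg" unfolding degree_circle_def using Dg_ext unique by (rule the_equality)
 thus ?thesis using Dg[OF f c] by simp
qed

subsection \<open>Transfer to the line\<close>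

text \<open>The inverse of the stereographic projection. Its angle
  \<open>2 * arctan x - pi / 2\<close> runs through the open interval from \<open>- 3 pi / 2\<close>
  to \<open>pi / 2\<close>, so only the pole \<open>\<i>\<close> is missed.\<close>

definition cay :: "real => complex" where
 "cay x = Complex (2 * x / (1 + x^2)) ((x^2 - 1) / (1 + x^2))"

lemma one_plus_square_pos [simp]: "1 + x^2 > 0" "1 + x^2 \<noteq> 0" for x :: real
 using zero_le_power2[of x] by linarith+

lemma cay_arctan: "cay x = cis (2 * arctan x - pi / 2)"
proof -
 have s: "sqrt (1 + x^2) * sqrt (1 + x^2) = 1 + x^2" using one_plus_square_pos(1)[of x] by simp
 have "cos (2 * arctan x - pi / 2) = 2 * x / (1 + x^2)"
  using s by (simp add: cos_diff sin_double sin_arctan cos_arctan)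
 moreover have "sin (2 * arctan x - pi / 2) = (x^2 - 1) / (1 + x^2)"
  using one_plus_square_pos(1)[of x]
  by (simp add: sin_diff cos_double sin_arctan cos_arctan power_divide diff_divide_distrib)
 ultimately show ?thesis by (simp add: cay_def complex_eq_iff)
qed

lemma cmod_cay [simp]: "cmod (cay x) = 1" by (simp add: cay_arctan)

lemma cay_measurable [measurable]: "cay \<in> measurable borel circ"
proof -
 have "(\<lambda>x. cis (2 * arctan x - pi / 2)) \<in> measurable borel circ" by measurable
 thus ?thesis by (simp add: cay_arctan[abs_def])
qed

lemma stereographic_cay [simp]: "stereographic (cay x) = x"
proof -
 have "1 - (x^2 - 1) / (1 + x^2) = 2 / (1 + x^2)" by (simp add: field_simps)
 thus ?thesis by (simp add: stereographic_def cay_def)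
qed

lemma stereographic_measurable [measurable]: "stereographic \<in> borel_measurable borel"
 unfolding stereographic_def[abs_def] by measurable

lemma Im_cay_nonneg: "Im (cay x) \<ge> 0 \<longleftrightarrow> x \<notin> {-1<..<1}"
proof -
 have "Im (cay x) \<ge> 0 \<longleftrightarrow> 1 \<le> x^2" using one_plus_square_pos(1)[of x] by (auto simp: cay_def zero_le_divide_iff simp del: one_plus_square_pos)
 also have "\<dots> \<longleftrightarrow> 1 \<le> \<bar>x\<bar>" using abs_le_square_iff[of 1 x] by simp
 finally show ?thesis by auto
qed

text \<open>The factors \<open>2 / (1 + x^2)\<close> at the two points are also the densities of arc
  length, so they cancel in the energy integral, which is therefore conformally invariant.\<close>

lemma cmod_cay_diff: "(cmod (cay x - cay y))^2 = 4 * (x - y)^2 / ((1 + x^2) * (1 + y^2))"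
proof -
 define A B where AB: "A = 1 + x^2" "B = 1 + y^2"
 have nz: "A \<noteq> 0" "B \<noteq> 0" by (auto simp: AB)
 have "(2 * x / A - 2 * y / B)^2 + ((x^2 - 1) / A - (y^2 - 1) / B)^2
  = ((2 * x * B - 2 * y * A)^2 + ((x^2 - 1) * B - (y^2 - 1) * A)^2) / (A * B)^2"
  using nz by (simp add: diff_frac_eq power_divide add_divide_distrib)
 also have "(2 * x * B - 2 * y * A)^2 + ((x^2 - 1) * B - (y^2 - 1) * A)^2 = 4 * (x - y)^2 * (A * B)"
  unfolding AB by (simp add: power2_eq_square algebra_simps)
 also have "\<dots> / (A * B)^2 = 4 * (x - y)^2 / (A * B)" using nz by (simp add: power2_eq_square)
 finally show ?thesis by (simp add: cmod_power2 cay_def AB)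
qed

text \<open>Substitution on the compact intervals \<open>B n\<close>, whose images
  \<open>A n\<close> exhaust the open interval of angles, followed by continuity from below.\<close>

lemma nn_integral_cay_interval:
 fixes K :: "real => ennreal"
 assumes [measurable]: "K \<in> borel_measurable borel"
 shows "(\<integral>\<^sup>+\<theta>\<in>{- (3 * pi / 2)<..<pi / 2}. K \<theta> \<partial>lborel) = (\<integral>\<^sup>+x. K (2 * arctan x - pi / 2) * ennreal (2 / (1 + x^2)) \<partial>lborel)"
proof -
 define g where "g x = 2 * arctan x - pi / 2" for x :: real
 define A where "A n = {g (- real (Suc n))..g (real (Suc n))}" for n
 define B where "B n = {- real (Suc n)..real (Suc n)}" for n
 have [measurable]: "g \<in> borel_measurable borel" unfolding g_def[abs_def] by measurable
 have gm: "g x \<le> g y \<longleftrightarrow> x \<le> y" for x y by (simp add: g_def arctan_le_iff)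
 have UA: "(\<Union>n. A n) = {- (3 * pi / 2)<..<pi / 2}"
 proof (intro equalityI subsetI)
  fix \<theta> assume "\<theta> \<in> (\<Union>n. A n)"
  then obtain n where "\<theta> \<in> A n" by blast
  thus "\<theta> \<in> {- (3 * pi / 2)<..<pi / 2}"
   using arctan_lbound[of "- real (Suc n)"] arctan_ubound[of "real (Suc n)"] by (simp add: A_def g_def)
 next
  fix \<theta> assume th: "\<theta> \<in> {- (3 * pi / 2)<..<pi / 2}"
  define x where "x = tan ((\<theta> + pi / 2) / 2)"
  have gx: "g x = \<theta>" using th by (simp add: g_def x_def arctan_tan add_divide_distrib)
  obtain n where "\<bar>x\<bar> \<le> real n" using real_arch_simple by blast
  hence "\<theta> \<in> A n" unfolding A_def gx[symmetric] atLeastAtMost_iff gm by auto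
  thus "\<theta> \<in> (\<Union>n. A n)" by blast
 qed
 have UB: "(\<Union>n. B n) = UNIV"
 proof -
  have "\<exists>n. x \<in> B n" for x
  proof -
   obtain n where "\<bar>x\<bar> \<le> real n" using real_arch_simple by blast
   thus ?thesis by (intro exI[of _ n]) (auto simp: B_def)
  qed
  thus ?thesis by blast
 qed
 have "A n \<subseteq> A (Suc n)" for n
  unfolding A_def atLeastatMost_subset_iff gm by auto
 hence inc: "incseq A" "incseq B" by (auto intro!: incseq_SucI simp: B_def)
 have dg: "(g has_real_derivative 2 / (1 + x^2)) (at x)" for x
  unfolding g_def[abs_def] divide_inverse[of 2]
  by (rule DERIV_cong[OF DERIV_diff[OF DERIV_cmult[OF DERIV_arctan] DERIV_const]]) simp
 have eq: "(\<integral>\<^sup>+\<theta>. K \<theta> * indicator (A n) \<theta> \<partial>lborel) = (\<integral>\<^sup>+x. K (g x) * ennreal (2 / (1 + x^2)) * indicator (B n) x \<partial>lborel)" for n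
  unfolding A_def B_def
  by (rule nn_integral_substitution_aux) (auto intro!: dg continuous_intros)
 have "(\<integral>\<^sup>+\<theta>\<in>{- (3 * pi / 2)<..<pi / 2}. K \<theta> \<partial>lborel) = emeasure (density lborel K) (\<Union>n. A n)"
  unfolding UA by (subst emeasure_density) auto
 also have "\<dots> = (SUP n. emeasure (density lborel K) (A n))"
  by (rule SUP_emeasure_incseq[symmetric, OF _ inc(1)]) (auto simp: A_def)
 also have "\<dots> = (SUP n. emeasure (density lborel (\<lambda>x. K (g x) * ennreal (2 / (1 + x^2)))) (B n))"
  by (subst (1 2) emeasure_density) (auto simp: eq A_def[symmetric] B_def[symmetric], auto simp: A_def B_def)
 also have "\<dots> = emeasure (density lborel (\<lambda>x. K (g x) * ennreal (2 / (1 + x^2)))) (\<Union>n. B n)"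
  by (rule SUP_emeasure_incseq[OF _ inc(2)]) (auto simp: B_def)
 also have "\<dots> = (\<integral>\<^sup>+x. K (g x) * ennreal (2 / (1 + x^2)) \<partial>lborel)"
  unfolding UB by (subst emeasure_density) auto
 finally show ?thesis unfolding g_def .
qed

lemma nn_integral_period_shift:
 fixes K :: "real => ennreal"
 assumes [measurable]: "K \<in> borel_measurable borel" and per: "\<And>\<theta>. K (\<theta> - 2 * pi) = K \<theta>"
 shows "(\<integral>\<^sup>+\<theta>\<in>{- (3 * pi / 2)<..<pi / 2}. K \<theta> \<partial>lborel) = (\<integral>\<^sup>+\<theta>\<in>{0..2*pi}. K \<theta> \<partial>lborel)"
proof -
 have sh: "(\<integral>\<^sup>+\<theta>\<in>{- (3 * pi / 2)<..<0}. K \<theta> \<partial>lborel) = (\<integral>\<^sup>+\<theta>\<in>{pi / 2<..<2 * pi}. K \<theta> \<partial>lborel)"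
 proof -
  have "(\<integral>\<^sup>+\<theta>\<in>{- (3 * pi / 2)<..<0}. K \<theta> \<partial>lborel) = (\<integral>\<^sup>+\<theta>. K (- (2 * pi) + 1 * \<theta>) * indicator {- (3 * pi / 2)<..<0} (- (2 * pi) + 1 * \<theta>) \<partial>lborel)"
   by (subst nn_integral_real_affine[where c = 1 and t = "- (2 * pi)"]) auto
  also have "\<dots> = (\<integral>\<^sup>+\<theta>\<in>{pi / 2<..<2 * pi}. K \<theta> \<partial>lborel)"
   by (rule nn_integral_cong) (use per in \<open>auto simp: indicator_def field_simps\<close>)
  finally show ?thesis .
 qed
 have "(\<integral>\<^sup>+\<theta>\<in>{- (3 * pi / 2)<..<pi / 2}. K \<theta> \<partial>lborel) = (\<integral>\<^sup>+\<theta>. K \<theta> * indicator {- (3 * pi / 2)<..<0} \<theta> + K \<theta> * indicator {0..<pi / 2} \<theta> \<partial>lborel)"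
  by (rule nn_integral_cong) (auto simp: indicator_def)
 also have "\<dots> = (\<integral>\<^sup>+\<theta>\<in>{- (3 * pi / 2)<..<0}. K \<theta> \<partial>lborel) + (\<integral>\<^sup>+\<theta>\<in>{0..<pi / 2}. K \<theta> \<partial>lborel)"
  by (rule nn_integral_add) auto
 also have "\<dots> = (\<integral>\<^sup>+\<theta>. K \<theta> * indicator {pi / 2<..<2 * pi} \<theta> + K \<theta> * indicator {0..<pi / 2} \<theta> \<partial>lborel)"
  unfolding sh by (rule nn_integral_add[symmetric]) auto
 also have "\<dots> = (\<integral>\<^sup>+\<theta>\<in>{0..2*pi}. K \<theta> \<partial>lborel)"
 proof (rule nn_integral_cong_AE)
  show "AE \<theta> in lborel. K \<theta> * indicator {pi / 2<..<2 * pi} \<theta> + K \<theta> * indicator {0..<pi / 2} \<theta> = K \<theta> * indicator {0..2*pi} \<theta>"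
   using AE_lborel_singleton[of "pi / 2"] AE_lborel_singleton[of "2 * pi"]
   by eventually_elim (auto simp: indicator_def)
 qed
 finally show ?thesis .
qed

lemma nn_integral_cay:
 assumes [measurable]: "K \<in> borel_measurable circ"
 shows "(\<integral>\<^sup>+x. K (cay x) * ennreal (2 / (1 + x^2)) \<partial>lborel) = ennreal (2 * pi) * (\<integral>\<^sup>+z. K z \<partial>circ)"
proof -
 have m: "(\<lambda>\<theta>. K (cis \<theta>)) \<in> borel_measurable borel" by measurable
 have per: "K (cis (\<theta> - 2 * pi)) = K (cis \<theta>)" for \<theta> by (simp add: cis_divide[symmetric])
 have "(\<integral>\<^sup>+x. K (cay x) * ennreal (2 / (1 + x^2)) \<partial>lborel) = (\<integral>\<^sup>+\<theta>\<in>{- (3 * pi / 2)<..<pi / 2}. K (cis \<theta>) \<partial>lborel)"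
  unfolding cay_arctan by (rule nn_integral_cay_interval[OF m, symmetric])
 also have "\<dots> = (\<integral>\<^sup>+\<theta>\<in>{0..2*pi}. K (cis \<theta>) \<partial>lborel)" by (rule nn_integral_period_shift[OF m per])
 also have "\<dots> = ennreal (2 * pi) * (\<integral>\<^sup>+z. K z \<partial>circ)" by (rule nn_integral_cis) measurable
 finally show ?thesis .
qed

lemma AE_cay:
 assumes [measurable]: "{z \<in> space circ. P z} \<in> sets circ"
 shows "(AE z in circ. P z) \<longleftrightarrow> (AE x in lborel. P (cay x))"
proof -
 define N where "N = {z \<in> space circ. \<not> P z}"
 have N [measurable]: "N \<in> sets circ"
 proof -
  have "N = space circ - {z \<in> space circ. P z}" by (auto simp: N_def)
  thus ?thesis using assms by simp
 qed
 have [measurable]: "(\<lambda>x. indicator N (cay x) :: ennreal) \<in> borel_measurable borel"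
  by (rule measurable_compose[OF cay_measurable]) measurable
 have "(AE z in circ. P z) \<longleftrightarrow> (\<integral>\<^sup>+z. indicator N z \<partial>circ) = 0"
  using N AE_iff_null_sets[OF N] by (simp add: AE_iff_measurable[OF N] N_def)
 also have "\<dots> \<longleftrightarrow> (\<integral>\<^sup>+x. indicator N (cay x) * ennreal (2 / (1 + x^2)) \<partial>lborel) = 0"
  by (subst nn_integral_cay) auto
 also have "\<dots> \<longleftrightarrow> (AE x in lborel. indicator N (cay x) * ennreal (2 / (1 + x^2)) = 0)"
  by (rule nn_integral_0_iff_AE) measurable
 also have "\<dots> \<longleftrightarrow> (AE x in lborel. P (cay x))"
  by (intro AE_cong) (auto simp: indicator_def N_def)
 finally show ?thesis .
qed

section \<open>Maps on the line and their representatives on the circle\<close>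

definition lrep :: "(real => complex) => (complex => complex) => bool" where
 "lrep u F \<longleftrightarrow> F \<in> borel_measurable circ \<and> (AE x in lborel. u x = F (cay x))"

lemma gagliardo_lrep:
 assumes "lrep u F"
 shows "gagliardo_line u = ennreal (2 * pi) * (ennreal (2 * pi) * (\<integral>\<^sup>+p. ennreal ((cmod (dquot F p))^2) \<partial>circ2))"
proof -
 let ?C = "\<lambda>x y. cmod (dquot F (cay x, cay y))"
 have [measurable]: "F \<in> borel_measurable circ" and ae: "AE x in lborel. u x = F (cay x)"
  using assms by (auto simp: lrep_def)
 have [measurable]: "(\<lambda>p. ennreal ((cmod (dquot F p))^2)) \<in> borel_measurable (circ \<Otimes>\<^sub>M circ)"
  unfolding circ2_def[symmetric] by measurable
 define J where "J z = (\<integral>\<^sup>+w. ennreal ((cmod (dquot F (z, w)))^2) \<partial>circ)" for z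
 have Jm [measurable]: "J \<in> borel_measurable circ" unfolding J_def[abs_def] by measurable
 have pt: "ennreal ((cmod (F (cay x) - F (cay y)))^2 / \<bar>x - y\<bar>^2)
  = ennreal (2 / (1 + x^2)) * (ennreal ((?C x y)^2) * ennreal (2 / (1 + y^2)))" for x y
 proof -
  define A B where AB: "A = 1 + x^2" "B = 1 + y^2"
  have "(?C x y)^2 = (cmod (F (cay x) - F (cay y)))^2 / (4 * (x - y)^2 / (A * B))"
   by (simp add: cmod_dquot cdist_def power_divide cmod_cay_diff AB)
  hence "(cmod (F (cay x) - F (cay y)))^2 / \<bar>x - y\<bar>^2 = 2 / A * ((?C x y)^2 * (2 / B))"
   by (simp add: AB)
  thus ?thesis by (simp only: AB[symmetric]) (subst ennreal_mult'[symmetric], simp, subst ennreal_mult'[symmetric], simp add: AB, simp)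
 qed
 have in1: "(\<integral>\<^sup>+y. ennreal ((cmod (u x - u y))^2 / \<bar>x - y\<bar>^2) \<partial>lborel) = ennreal (2 * pi) * (J (cay x) * ennreal (2 / (1 + x^2)))"
  if "u x = F (cay x)" for x
 proof -
  have m1: "(\<lambda>z. ennreal ((cmod (dquot F (cay x, z)))^2)) \<in> borel_measurable circ" by measurable
  have "(\<integral>\<^sup>+y. ennreal ((cmod (u x - u y))^2 / \<bar>x - y\<bar>^2) \<partial>lborel)
   = (\<integral>\<^sup>+y. ennreal (2 / (1 + x^2)) * (ennreal ((?C x y)^2) * ennreal (2 / (1 + y^2))) \<partial>lborel)"
   by (rule nn_integral_cong_AE, use ae in eventually_elim) (simp only: that pt)
  also have "\<dots> = ennreal (2 / (1 + x^2)) * (\<integral>\<^sup>+y. ennreal ((?C x y)^2) * ennreal (2 / (1 + y^2)) \<partial>lborel)"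
   by (rule nn_integral_cmult) (use measurable_compose[OF cay_measurable m1] in measurable)
  also have "\<dots> = ennreal (2 / (1 + x^2)) * (ennreal (2 * pi) * J (cay x))"
   unfolding J_def by (subst nn_integral_cay[OF m1]) simp
  finally show ?thesis by (simp add: mult_ac)
 qed
 have "gagliardo_line u = (\<integral>\<^sup>+x. ennreal (2 * pi) * (J (cay x) * ennreal (2 / (1 + x^2))) \<partial>lborel)"
  unfolding gagliardo_line_def nn_integral_completion
  by (rule nn_integral_cong_AE, use ae in eventually_elim) (erule in1)
 also have "\<dots> = ennreal (2 * pi) * (\<integral>\<^sup>+x. J (cay x) * ennreal (2 / (1 + x^2)) \<partial>lborel)"
  by (rule nn_integral_cmult) measurable
 also have "\<dots> = ennreal (2 * pi) * (ennreal (2 * pi) * (\<integral>\<^sup>+z. J z \<partial>circ))" by (simp only: nn_integral_cay[OF Jm])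
 also have "(\<integral>\<^sup>+z. J z \<partial>circ) = (\<integral>\<^sup>+p. ennreal ((cmod (dquot F p))^2) \<partial>circ2)"
  unfolding J_def circ2_def by (rule circ.nn_integral_fst[where f = "\<lambda>p. ennreal ((cmod (dquot F p))^2)"]) measurable
 finally show ?thesis .
qed

text \<open>Two factors \<open>2 pi\<close> from the normalisation of \<open>circ\<close>, against
  the \<open>1 / (2 pi)\<close> of the energy on the line.\<close>

lemma energy_lrep:
 assumes u: "lrep u F" and F: "circ_map F"
 shows "energy u = ennreal (2 * pi * cenergy F)" "gagliardo_line u < \<infinity>"
proof -
 have g: "gagliardo_line u = ennreal (2 * pi * (2 * pi * cenergy F))"
  unfolding gagliardo_lrep[OF u] cenergy_def
  using nn_integral_eq_integral[OF fin_energyD[OF circ_map_fin_energy[OF F]]]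
  by (simp only: ennreal_mult'[symmetric] zero_le_power2 AE_I2 simp_thms pi_ge_zero mult_nonneg_nonneg zero_le_numeral)
 thus "gagliardo_line u < \<infinity>" by simp
 show "energy u = ennreal (2 * pi * cenergy F)" unfolding energy_def g
  by (subst ennreal_mult'[symmetric]) auto
qed

lemma lebesgue_measurable_AE:
 fixes f g :: "real => complex"
 assumes g: "g \<in> borel_measurable borel" and ae: "AE x in lborel. f x = g x"
 shows "f \<in> borel_measurable lebesgue"
proof (rule measurableI)
 fix A :: "complex set" assume A [measurable]: "A \<in> sets borel"
 have [measurable]: "g \<in> borel_measurable lebesgue" using g by (simp add: measurable_completion)
 have [measurable]: "Measurable.pred lebesgue (\<lambda>x. f x \<noteq> g x)" "Measurable.pred lebesgue (\<lambda>x. f x \<noteq> g x \<and> f x \<in> A)"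
  by (rule sets_completion_AE, use ae in eventually_elim, simp)+
 have "f -` A \<inter> space lebesgue = {x \<in> space lebesgue. \<not> f x \<noteq> g x \<and> g x \<in> A \<or> f x \<noteq> g x \<and> f x \<in> A}" by auto
 also have "\<dots> \<in> sets lebesgue" by measurable
 finally show "f -` A \<inter> space lebesgue \<in> sets lebesgue" .
qed simp

lemma AE_cis_periodic:
 assumes "AE \<theta> in lborel. \<theta> \<in> {0..2*pi} \<longrightarrow> P (cis \<theta>)"
 shows "AE \<theta> in lborel. P (cis \<theta>)"
proof -
 have "AE \<theta> in lborel. \<theta> + 2 * pi * of_int n \<in> {0..2*pi} \<longrightarrow> P (cis (\<theta> + 2 * pi * of_int n))" for n :: int
 proof -
  have "AE \<theta> in distr lborel borel ((+) (2 * pi * of_int n)). \<theta> \<in> {0..2*pi} \<longrightarrow> P (cis \<theta>)"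
   using assms unfolding lborel_distr_plus .
  from AE_distrD[OF _ this] show ?thesis by (simp add: add.commute)
 qed
 hence "AE \<theta> in lborel. \<forall>n::int. \<theta> + 2 * pi * of_int n \<in> {0..2*pi} \<longrightarrow> P (cis (\<theta> + 2 * pi * of_int n))"
  unfolding AE_all_countable by blast
 thus ?thesis
 proof eventually_elim
  case (elim \<theta>)
  define n where "n = - \<lfloor>\<theta> / (2 * pi)\<rfloor>"
  have "of_int \<lfloor>\<theta> / (2 * pi)\<rfloor> \<le> \<theta> / (2 * pi)" "\<theta> / (2 * pi) \<le> of_int \<lfloor>\<theta> / (2 * pi)\<rfloor> + 1"
   by linarith+
  hence "of_int \<lfloor>\<theta> / (2 * pi)\<rfloor> * (2 * pi) \<le> \<theta>" "\<theta> \<le> (of_int \<lfloor>\<theta> / (2 * pi)\<rfloor> + 1) * (2 * pi)"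
   by (simp_all only: pos_le_divide_eq pos_divide_le_eq zero_less_mult_iff pi_gt_zero zero_less_numeral simp_thms)
  hence "\<theta> + 2 * pi * of_int n \<in> {0..2*pi}" by (simp add: n_def algebra_simps)
  hence "P (cis (\<theta> + 2 * pi * of_int n))" using elim by blast
  moreover have "cis (\<theta> + 2 * pi * of_int n) = cis \<theta>" by (simp add: cis_mult[symmetric] cis_multiple_2pi)
  ultimately show ?case by simp
 qed
qed

text \<open>The exceptional null set on the line is transported to the circle by
  \<open>AE_cay\<close>. Off it and off the pole, \<open>cay\<close> inverts
  \<open>stereographic\<close>, so \<open>F\<close> represents the map whose degree is to be
  computed.\<close>

lemma degree_line_lrep:
 assumes u: "lrep u F" and F: "circ_map F"
 shows "of_int (degree_line u) = cdeg F"
proof -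
 let ?U = "u \<circ> stereographic"
 note [measurable] = circ_map_measurable[OF F]
 have "AE x in lborel. u x = F (cay x)" using u by (simp add: lrep_def)
 \<comment> \<open>The exceptional set itself need not be Borel, so it is enlarged to a Borel null
   set before it is transported.\<close>
 then obtain N where N: "N \<in> null_sets lborel" "{x. u x \<noteq> F (cay x)} \<subseteq> N" by (rule AE_E3) auto
 have [measurable]: "N \<in> sets borel" using N(1) by auto
 have "AE z in circ. stereographic z \<notin> N"
 proof (subst AE_cay)
  show "{z \<in> space circ. stereographic z \<notin> N} \<in> sets circ" by measurable
  show "AE x in lborel. stereographic (cay x) \<notin> N" using AE_not_in[OF N(1)] by simp
 qed
 hence "AE z in circ. (stereographic z \<notin> N \<and> z \<noteq> \<i>)" using AE_circ_neq[of \<i>] by simp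
 hence "AE \<theta> in uniform_measure lborel {0..2*pi}. (stereographic (cis \<theta>) \<notin> N \<and> cis \<theta> \<noteq> \<i>)"
  unfolding circ_def by (rule AE_distrD[OF cis_measurable_uniform])
 hence "AE \<theta> in lborel. \<theta> \<in> {0..2*pi} \<longrightarrow> (stereographic (cis \<theta>) \<notin> N \<and> cis \<theta> \<noteq> \<i>)"
  by (subst (asm) AE_uniform_measure) auto
 hence ae: "AE \<theta> in lborel. stereographic (cis \<theta>) \<notin> N \<and> cis \<theta> \<noteq> \<i>" by (rule AE_cis_periodic)
 have inv: "cay (stereographic z) = z" if z: "cmod z = 1" "z \<noteq> \<i>" for z
 proof -
  have r: "(Re z)^2 + (Im z)^2 = 1" using z(1) by (metis cmod_power2 one_power2)
  have n: "1 - Im z \<noteq> 0" using r z(2) by (auto simp: complex_eq_iff)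
  define s where "s = stereographic z"
  have s: "s * (1 - Im z) = Re z" using n by (simp add: s_def stereographic_def)
  have "(1 + s^2) * (1 - Im z)^2 = 2 * (1 - Im z)" using r s by algebra
  hence "((1 + s^2) * (1 - Im z)) * (1 - Im z) = 2 * (1 - Im z)" by (simp only: power2_eq_square mult.assoc)
  hence q: "(1 + s^2) * (1 - Im z) = 2" using n by (simp only: mult_cancel_right) simp
  have "Re z * (1 + s^2) = s * ((1 + s^2) * (1 - Im z))" by (simp only: s[symmetric] mult_ac)
  hence "2 * s / (1 + s^2) = Re z" unfolding q by (simp add: divide_eq_eq)
  moreover have "Im z * (1 + s^2) = (1 + s^2) - (1 + s^2) * (1 - Im z)" by (simp add: algebra_simps)
  hence "(s^2 - 1) / (1 + s^2) = Im z" unfolding q by (simp add: divide_eq_eq)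
  ultimately show ?thesis by (simp add: cay_def complex_eq_iff s_def)
 qed
 have eq: "AE \<theta> in lborel. ?U (cis \<theta>) = F (cis \<theta>)"
  using ae
 proof eventually_elim
  case (elim \<theta>)
  hence "u (stereographic (cis \<theta>)) = F (cay (stereographic (cis \<theta>)))" using N(2) by blast
  thus ?case using inv[of "cis \<theta>"] elim by simp
 qed
 have c: "crep ?U F" using eq by (auto simp: crep_def)
 have "u \<circ> stereographic \<in> H12_circle"
 proof (rule H12_circle_of_circ_map[OF F c])
  show "(\<lambda>\<theta>. ?U (cis \<theta>)) \<in> borel_measurable lebesgue"
   by (rule lebesgue_measurable_AE[OF _ eq]) measurable
  show "AE \<theta> in lebesgue. cmod (?U (cis \<theta>)) = 1"
   unfolding AE_completion_iff using eq by eventually_elim (simp add: circ_map_norm[OF F])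
 qed
 thus ?thesis unfolding degree_line_def by (rule degree_circle_eq[OF _ c])
qed

lemma lrep_exists:
 assumes u: "u \<in> H12_line"
 obtains F where "lrep u F" "circ_map F"
proof -
 have m: "u \<in> borel_measurable lebesgue" and n: "AE x in lborel. cmod (u x) = 1" and fin: "gagliardo_line u < \<infinity>"
  using u by (auto simp: H12_line_def AE_completion_iff)
 have "(\<lambda>x. Re (u x)) \<in> borel_measurable (completion lborel)" "(\<lambda>x. Im (u x)) \<in> borel_measurable (completion lborel)"
  using m by measurable
 from this[THEN completion_ex_borel_measurable_real] obtain a b where
  ab: "a \<in> borel_measurable lborel" "b \<in> borel_measurable lborel" "AE x in lborel. Re (u x) = a x" "AE x in lborel. Im (u x) = b x" by blast
 define v where "v x = (if (a x)^2 + (b x)^2 = 1 then Complex (a x) (b x) else 1)" for x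
 have [measurable]: "a \<in> borel_measurable borel" "b \<in> borel_measurable borel" using ab by simp_all
 have [measurable]: "v \<in> borel_measurable borel" unfolding v_def[abs_def] Complex_eq by measurable
 have v1: "cmod (v x) = 1" for x by (simp add: v_def cmod_def)
 have ve: "AE x in lborel. u x = v x"
  using n ab(3,4)
 proof eventually_elim
  case (elim x)
  thus ?case using cmod_power2[of "u x"] by (simp add: v_def complex_eq_iff)
 qed
 define F where "F z = v (stereographic z)" for z
 have Fm [measurable]: "F \<in> borel_measurable circ" unfolding F_def[abs_def] by measurable
 have l: "lrep u F" unfolding lrep_def using ve by (auto simp: F_def)
 have "(\<integral>\<^sup>+p. ennreal ((cmod (dquot F p))^2) \<partial>circ2) < \<infinity>"
  using fin unfolding gagliardo_lrep[OF l] by (auto simp: ennreal_mult_less_top)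
 hence "integrable circ2 (\<lambda>p. (cmod (dquot F p))^2)" by (intro integrableI_bounded) auto
 hence "circ_map F" unfolding circ_map_def fin_energy_def using v1 by (auto simp: F_def intro!: exI[of _ 1])
 with l show ?thesis by (rule that)
qed

lemma upper_AE_cay:
 fixes F G :: "complex => complex"
 assumes [measurable]: "F \<in> borel_measurable circ" "G \<in> borel_measurable circ"
 shows "(AE z in circ. Im z \<ge> 0 \<longrightarrow> F z = G z) \<longleftrightarrow> (AE x in lborel. x \<notin> {-1<..<1} \<longrightarrow> F (cay x) = G (cay x))"
 unfolding Im_cay_nonneg[symmetric]
proof (rule AE_cay)
 have "{z \<in> space circ. Im z \<ge> 0 \<longrightarrow> F z - G z = 0} \<in> sets circ" by measurable
 thus "{z \<in> space circ. Im z \<ge> 0 \<longrightarrow> F z = G z} \<in> sets circ" by simp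
qed

text \<open>Every competitor on the line has a representative on the circle with the same degree,
  the same fixed values and the energy divided by \<open>2 pi\<close>, so minimality carries
  over.\<close>

lemma min_energy_achievedI:
 assumes G [measurable]: "G \<in> borel_measurable circ" and g: "\<And>x. g x = G (cay x)"
  and ex: "\<exists>F. adm G d F \<and> (\<forall>v. adm G d v \<longrightarrow> cenergy F \<le> cenergy v)"
 shows "min_energy_achieved g d"
proof -
 obtain F where F: "adm G d F" "\<And>v. adm G d v ==> cenergy F \<le> cenergy v" using ex by blast
 have cF: "circ_map F" using F(1) by (simp add: adm_def)
 note [measurable] = circ_map_measurable[OF cF]
 define u where "u x = F (cay x)" for x
 have l: "lrep u F" by (simp add: lrep_def u_def)
 have "(\<lambda>x. F (cay x)) \<in> borel_measurable lborel" by measurable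
 hence "u \<in> borel_measurable lebesgue" unfolding u_def[abs_def] by (rule measurable_completion)
 hence "u \<in> H12_line" using energy_lrep(2)[OF l cF] by (simp add: H12_line_def u_def circ_map_norm[OF cF])
 moreover have "degree_line u = d" using degree_line_lrep[OF l cF] F(1) by (simp add: adm_def)
 moreover have "AE x in lebesgue. x \<notin> {-1<..<1} \<longrightarrow> u x = g x"
  unfolding AE_completion_iff u_def g by (subst upper_AE_cay[symmetric]) (use F(1) in \<open>auto simp: adm_def\<close>)
 ultimately have u: "u \<in> admissible g d" by (simp add: admissible_def)
 have "energy u \<le> energy v" if v: "v \<in> admissible g d" for v
 proof -
  have v': "v \<in> H12_line" "AE x in lborel. x \<notin> {-1<..<1} \<longrightarrow> v x = g x" "degree_line v = d"
   using v unfolding admissible_def AE_completion_iff by auto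
  obtain H where H: "lrep v H" "circ_map H" by (rule lrep_exists[OF v'(1)])
  note [measurable] = circ_map_measurable[OF H(2)]
  have "AE x in lborel. v x = H (cay x)" using H(1) by (simp add: lrep_def)
  hence "AE x in lborel. x \<notin> {-1<..<1} \<longrightarrow> H (cay x) = G (cay x)"
   using v'(2) by eventually_elim (auto simp: g)
  hence "AE z in circ. Im z \<ge> 0 \<longrightarrow> H z = G z" by (subst upper_AE_cay) measurable
  hence "adm G d H" using degree_line_lrep[OF H] v'(3) H(2) by (simp add: adm_def)
  hence "cenergy F \<le> cenergy H" by (rule F(2))
  thus ?thesis unfolding energy_lrep(1)[OF l cF] energy_lrep(1)[OF H] by (intro ennreal_leI) auto
 qed
 hence "energy u = min_energy g d"
  unfolding min_energy_def using u by (intro antisym INF_greatest INF_lower) auto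
 thus ?thesis using u by (auto simp: min_energy_achieved_def)
qed

subsection \<open>Blaschke products\<close>

text \<open>Bubbles act on the Hardy class: \<open>1 / (1 - t h)\<close> is a power series in
  \<open>z\<close>, each term of which only raises frequencies.\<close>

lemma fm_bub_mult:
 assumes [measurable]: "G \<in> borel_measurable circ" and B: "\<And>z. cmod z = 1 ==> cmod (G z) \<le> B"
  and 0: "\<And>n. n > 0 ==> fm G n = 0" and e: "cmod e = 1" and t: "0 \<le> t" "t < 1" and n: "n > 0"
 shows "fm (\<lambda>z. bub t e z * G z) n = 0"
proof -
 define h where "h z = z * cnj e" for z
 have [measurable]: "h \<in> borel_measurable circ" unfolding h_def[abs_def] by measurable
 define F where "F z = (of_real t - h z) * G z * z ^ n" for z
 have [measurable]: "F \<in> borel_measurable circ" unfolding F_def[abs_def] by measurable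
 have B0: "B \<ge> 0" using B[of 1] norm_ge_zero[of "G 1"] by (simp del: norm_ge_zero)
 have h1: "cmod (h z) = 1" if "cmod z = 1" for z using that e by (simp add: h_def norm_mult)
 have Fb: "cmod (F z) \<le> 2 * B" if z: "cmod z = 1" for z
 proof -
  have "cmod (of_real t - h z) \<le> 2"
   using norm_triangle_ineq4[of "of_real t" "h z"] h1[OF z] t by simp
  hence "cmod (of_real t - h z) * cmod (G z) \<le> 2 * B" by (intro mult_mono B z) auto
  thus ?thesis using z by (simp add: F_def norm_mult norm_power)
 qed
 have i: "integrable circ (\<lambda>z. G z * z ^ m)" for m
  by (rule circ_integrable_bounded[where B = B]) (use B in \<open>auto simp: norm_mult norm_power\<close>)
 have "(LINT z|circ. h z ^ m * F z) = 0" for m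
 proof -
  have "(LINT z|circ. h z ^ m * F z) = (LINT z|circ. of_real t * cnj e ^ m * (G z * z ^ (n + m)) - cnj e ^ (m + 1) * (G z * z ^ (n + m + 1)))"
   by (rule B_integral_cong) (auto simp: F_def h_def power_mult_distrib power_add algebra_simps)
  also have "\<dots> = of_real t * cnj e ^ m * fm G (n + m) - cnj e ^ (m + 1) * fm G (n + m + 1)"
   unfolding fm_def by (simp only: B_integral_diff[OF integrable_mult_right[OF i] integrable_mult_right[OF i]] integral_mult_right_zero)
  also have "\<dots> = 0" using n by (simp add: 0)
  finally show ?thesis .
 qed
 moreover have "(\<lambda>m. of_real t ^ m * (LINT x|circ. h x ^ m * F x)) sums (LINT x|circ. F x / (1 - of_real t * h x))"
  by (rule geometric_sums_integral[OF circ.finite_measure_axioms _ _ _ _ t, where B = "2 * B"]) (use h1 Fb in auto)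
 ultimately have "(LINT x|circ. F x / (1 - of_real t * h x)) = 0" by (simp add: sums_iff)
 also have "(LINT x|circ. F x / (1 - of_real t * h x)) = fm (\<lambda>z. bub t e z * G z) n"
  unfolding fm_def
 proof (rule B_integral_cong[OF refl])
  fix z
  have ee: "cnj e * e = 1" "e \<noteq> 0" using complex_norm_square[of e] e by (auto simp: mult.commute)
  have "bub t e z = (cnj e * (of_real t * e - z)) / (cnj e * (e - of_real t * z))" using ee by (simp add: bub_def)
  also have "cnj e * (of_real t * e - z) = of_real t * (cnj e * e) - h z" by (simp add: h_def algebra_simps)
  also have "cnj e * (e - of_real t * z) = cnj e * e - of_real t * h z" by (simp add: h_def algebra_simps)
  finally show "F z / (1 - of_real t * h z) = bub t e z * G z * z ^ n" by (simp add: ee F_def)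
 qed
 finally show ?thesis .
qed

section \<open>Finite products of bubbles\<close>

definition bubs :: "nat => complex => (nat => real) => (nat => complex) => complex => complex" where
 "bubs k c t e z = c * (\<Prod>j=1..k. bub (t j) (e j) z)"

text \<open>The derivative of the argument of the product along the circle, so that its integral is
  the degree.\<close>

definition pks :: "nat => (nat => real) => (nat => complex) => complex => real" where
 "pks k t e z = (\<Sum>j=1..k. pk (t j) (e j, z))"

context
 fixes k :: nat and c :: complex and t :: "nat => real" and e :: "nat => complex"
 assumes c: "cmod c = 1" and e: "\<And>j. cmod (e j) = 1" and t: "\<And>j. 0 \<le> t j" "\<And>j. t j < 1"
begin

lemma cmod_bubs: "cmod z = 1 ==> cmod (bubs k c t e z) = 1"
 by (simp add: bubs_def norm_mult c prod_norm[symmetric] cmod_bub[OF e _ t])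

lemma bubs_cnj: "cmod z = 1 ==> bubs k c t e z * cnj (bubs k c t e z) = 1"
 using complex_norm_square[of "bubs k c t e z"] cmod_bubs[of z] by simp

lemma bubs_C1: "circ_C1 (bubs k c t e) (\<lambda>z. \<i> * of_real (pks k t e z) * bubs k c t e z)"
proof (induction k)
 case 0
 show ?case using circ_C1_const[of c] by (simp add: bubs_def[abs_def] pks_def)
next
 case (Suc k)
 have "circ_C1 (\<lambda>z. bubs k c t e z * bub (t (Suc k)) (e (Suc k)) z)
  (\<lambda>z. bubs k c t e z * (\<i> * of_real (pk (t (Suc k)) (e (Suc k), z)) * bub (t (Suc k)) (e (Suc k)) z)
   + (\<i> * of_real (pks k t e z) * bubs k c t e z) * bub (t (Suc k)) (e (Suc k)) z)"
  by (rule circ_C1_mult[OF Suc bub_C1[OF e t]])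
 moreover have "bubs k c t e z * (\<i> * of_real (pk (t (Suc k)) (e (Suc k), z)) * bub (t (Suc k)) (e (Suc k)) z)
   + (\<i> * of_real (pks k t e z) * bubs k c t e z) * bub (t (Suc k)) (e (Suc k)) z
  = \<i> * of_real (pks (Suc k) t e z) * bubs (Suc k) c t e z" for z
  by (simp add: pks_def bubs_def algebra_simps)
 ultimately show ?case by (simp add: bubs_def[abs_def] mult.assoc)
qed

lemma bubs_deriv:
 "cmod z = 1 ==> Im (\<i> * of_real (pks k t e z) * bubs k c t e z * cnj (bubs k c t e z)) = pks k t e z"
 by (simp only: mult.assoc bubs_cnj) simp

lemma pks_measurable [measurable]: "pks k t e \<in> borel_measurable circ"
 unfolding pks_def[abs_def] by measurable

lemma pks_nonneg: "pks k t e z \<ge> 0"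
 unfolding pks_def by (intro sum_nonneg pk_nonneg t)

lemma pks_pos: "k > 0 ==> cmod z = 1 ==> pks k t e z > 0"
 unfolding pks_def
proof (rule sum_pos)
 fix j assume z: "cmod z = 1"
 have "0 < (1 - t j) / (1 + t j)" using t[of j] by simp
 also have "\<dots> \<le> pk (t j) (e j, z)" by (rule pk_ge[OF t cdist_le_2[OF e z]])
 finally show "0 < pk (t j) (e j, z)" .
qed auto

lemma integrable_pks: "integrable circ (pks k t e)" and integral_pks: "(LINT z|circ. pks k t e z) = real k"
proof -
 note i = integrable_pk(1)[OF t]
 show "integrable circ (pks k t e)" unfolding pks_def[abs_def] using i by auto
 show "(LINT z|circ. pks k t e z) = real k"
  unfolding pks_def by (subst B_integral_sum[OF i]) (simp add: integral_pk(1)[OF e t])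
qed

lemma circ_map_bubs: "circ_map (bubs k c t e)"
 by (rule circ_C1_circ_map[OF bubs_C1 cmod_bubs])

lemma cdeg_bubs: "cdeg (bubs k c t e) = real k"
proof -
 have "\<i> * of_real (cdeg (bubs k c t e)) = (LINT z|circ. \<i> * of_real (pks k t e z) * bubs k c t e z * cnj (bubs k c t e z))"
  by (rule circ_C1_cdeg[OF bubs_C1, symmetric])
 also have "\<dots> = (LINT z|circ. \<i> * of_real (pks k t e z))"
  by (rule B_integral_cong[OF refl])
    (simp only: mult.assoc bubs_cnj space_circ mem_sphere_0 mult_1_right)
 also have "\<dots> = \<i> * of_real (real k)" using integral_pks by simp
 finally show ?thesis by (simp only: mult_cancel_left of_real_eq_iff) simp
qed

text \<open>Factor by factor the product stays in the Hardy class, where negative frequencies are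
  absent and energy and degree are the same sum.\<close>

lemma cenergy_bubs: "cenergy (bubs k c t e) = real k"
proof -
 have "fm (bubs j c t e) n = 0" if "n > 0" for j n
  using that
 proof (induction j arbitrary: n)
  case 0
  thus ?case by (simp add: fm_def bubs_def integral_circ_power)
 next
  case (Suc j)
  have m: "bubs j c t e \<in> borel_measurable circ"
   unfolding bubs_def[abs_def] using circ_map_measurable[OF circ_map_bub[OF e t]] by measurable
  have b: "cmod (bubs j c t e z) \<le> 1" if "cmod z = 1" for z
   using that by (simp add: bubs_def norm_mult c prod_norm[symmetric] cmod_bub[OF e _ t])
  have "fm (\<lambda>z. bub (t (Suc j)) (e (Suc j)) z * bubs j c t e z) n = 0"
   by (rule fm_bub_mult[OF m b Suc.IH e t Suc.prems])
  thus ?case by (simp add: bubs_def[abs_def] mult_ac)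
 qed
 from cenergy_eq_cdeg[OF circ_map_fin_energy[OF circ_map_bubs] this] show ?thesis by (simp add: cdeg_bubs)
qed

lemma qarc_bubs: "qarc (bubs k c t e) (\<lambda>z. \<i> * of_real (pks k t e z) * bubs k c t e z) = (LINT z|circ. upper z * pks k t e z)"
 unfolding qarc_def by (rule B_integral_cong[OF refl]) (use bubs_deriv in auto)

text \<open>Both inequalities are strict because \<open>pks\<close> is positive at every point of
  the circle and neither arc is a null set.\<close>

lemma qarc_bubs_bounds:
 assumes "k > 0"
 shows "0 < (LINT z|circ. upper z * pks k t e z)" "(LINT z|circ. upper z * pks k t e z) < real k"
proof -
 let ?L = "\<lambda>z. (1 - upper z) * pks k t e z"
 have i: "integrable circ (\<lambda>z. upper z * pks k t e z)"
  by (rule B_integrable_bound[OF integrable_pks]) (auto simp: upper_def pks_nonneg)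
 have i': "integrable circ ?L"
  using B_integrable_diff[OF integrable_pks i] by (simp add: algebra_simps)
 have pos: "0 < (LINT z|circ. w z * pks k t e z)"
  if w: "\<And>z. w z \<ge> 0" "integrable circ (\<lambda>z. w z * pks k t e z)" "\<not> (AE z in circ. w z = 0)" for w
 proof (rule ccontr)
  assume "\<not> ?thesis"
  moreover have nn: "AE z in circ. 0 \<le> w z * pks k t e z" using w(1) pks_nonneg by auto
  ultimately have "(LINT z|circ. w z * pks k t e z) = 0" using integral_nonneg_AE[OF nn] by linarith
  hence "AE z in circ. w z * pks k t e z = 0" using integral_nonneg_eq_0_iff_AE[OF w(2) nn] by simp
  hence "AE z in circ. w z = 0" using AE_space
  proof eventually_elim
   case (elim z)
   thus ?case using pks_pos[OF assms, of z] by simp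
  qed
  thus False using w(3) by blast
 qed
 show "0 < (LINT z|circ. upper z * pks k t e z)"
 proof (rule pos[OF _ i])
  show "\<not> (AE z in circ. upper z = 0)"
  proof
   assume "AE z in circ. upper z = 0"
   moreover have "{z \<in> space circ. upper z = 0} \<in> sets circ" by measurable
   ultimately have "AE x in lborel. upper (cay x) = 0" using AE_cay[of "\<lambda>z. upper z = 0"] by blast
   hence "AE x in lborel. x \<notin> {1..2::real}"
   proof eventually_elim
    case (elim x)
    thus ?case using Im_cay_nonneg[of x] by (auto simp: upper_def split: if_splits)
   qed
   hence "{1..2::real} \<in> null_sets lborel" by (subst AE_iff_null_sets) auto
   thus False by (auto simp: null_sets_def)
  qed
 qed (simp add: upper_def)
 have "0 < (LINT z|circ. (1 - upper z) * pks k t e z)"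
 proof (rule pos[OF _ i'])
  show "\<not> (AE z in circ. 1 - upper z = 0)"
  proof
   assume "AE z in circ. 1 - upper z = 0"
   hence "AE z in circ. Im z \<ge> 0" by eventually_elim (auto simp: upper_def split: if_splits)
   thus False using not_AE_upper by blast
  qed
 qed (simp add: upper_def)
 also have "?L = (\<lambda>z. pks k t e z - upper z * pks k t e z)" by (simp add: algebra_simps)
 also have "integral\<^sup>L circ \<dots> = real k - (LINT z|circ. upper z * pks k t e z)"
  using B_integral_diff[OF integrable_pks i] by (simp add: integral_pks)
 finally show "(LINT z|circ. upper z * pks k t e z) < real k" by simp
qed

text \<open>The wedge of a unit map with its derivative is the derivative of its phase, here
  \<open>pks\<close> times the Jacobian \<open>2 / (1 + x^2)\<close> of \<open>cay\<close>. The
  integrand is nonnegative, so the change of variables for nonnegative integrals applies.\<close>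

lemma wedge_integral_bubs:
 assumes g: "\<And>x. g x = bubs k c t e (cay x)"
 shows "1 / (2 * pi) * (LINT x:(- {-1<..<1})|lebesgue. wedge (g x) (vector_derivative g (at x))) = (LINT z|circ. upper z * pks k t e z)"
proof -
 let ?I = "\<integral>\<^sup>+x. ennreal (upper (cay x) * pks k t e (cay x) * (2 / (1 + x^2))) \<partial>lborel"
 let ?N = "\<integral>\<^sup>+z. ennreal (upper z * pks k t e z) \<partial>circ"
 let ?L = "\<lambda>x. 2 * arctan x - pi / 2"
 let ?A = "\<lambda>z. upper z * pks k t e z"
 let ?G = "bubs k c t e"
 have d: "(g has_vector_derivative (2 / (1 + x^2)) *\<^sub>R (\<i> * of_real (pks k t e (cay x)) * ?G (cay x))) (at x)" for x
 proof -
  have "(?L has_real_derivative 2 * inverse (1 + x^2) - 0) (at x)"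
   by (rule DERIV_diff[OF DERIV_cmult[OF DERIV_arctan] DERIV_const])
  hence 1: "(?L has_vector_derivative 2 / (1 + x^2)) (at x)"
   by (simp only: has_real_derivative_iff_has_vector_derivative divide_inverse diff_zero)
  have "((\<lambda>\<theta>. ?G (cis \<theta>)) has_vector_derivative \<i> * of_real (pks k t e (cis \<theta>)) * ?G (cis \<theta>)) (at \<theta>)" for \<theta>
   using bubs_C1 by (simp add: circ_C1_def)
  from vector_diff_chain_at[OF 1 this] have "((\<lambda>x. ?G (cay x)) has_vector_derivative (2 / (1 + x^2)) *\<^sub>R (\<i> * of_real (pks k t e (cay x)) * ?G (cay x))) (at x)"
   by (simp only: o_def cay_arctan)
  thus ?thesis by (simp only: g[abs_def])
 qed
 have w: "indicator (- {-1<..<1}) x *\<^sub>R wedge (g x) (vector_derivative g (at x)) = upper (cay x) * pks k t e (cay x) * (2 / (1 + x^2))" for x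
 proof -
  have wg: "wedge v (a *\<^sub>R u) = a * Im (u * cnj v)" for v u a by (simp add: wedge_def algebra_simps)
  have "wedge (g x) (vector_derivative g (at x)) = 2 / (1 + x^2) * pks k t e (cay x)"
   unfolding vector_derivative_at[OF d] wg g bubs_deriv[OF cmod_cay] ..
  moreover have "indicator (- {-1<..<1}) x = upper (cay x)"
   using Im_cay_nonneg[of x] by (auto simp: upper_def indicator_def not_less)
  ultimately show ?thesis by simp
 qed
 have um: "?A \<in> borel_measurable circ" by measurable
 have i: "integrable circ ?A"
  by (rule B_integrable_bound[OF integrable_pks]) (auto simp: upper_def pks_nonneg)
 have u0: "upper z * pks k t e z \<ge> 0" for z by (simp add: upper_def pks_nonneg)
 have mm: "(\<lambda>x. upper (cay x) * pks k t e (cay x) * (2 / (1 + x^2))) \<in> borel_measurable lborel"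
  using measurable_compose[OF cay_measurable um] by measurable
 have "(LINT x:(- {-1<..<1})|lebesgue. wedge (g x) (vector_derivative g (at x))) = (LINT x|lborel. upper (cay x) * pks k t e (cay x) * (2 / (1 + x^2)))"
  unfolding set_lebesgue_integral_def w by (rule integral_completion[OF mm])
 also have "\<dots> = enn2real ?I"
  by (rule integral_eq_nn_integral[OF mm]) (use u0 in auto)
 also have "?I = ennreal (2 * pi) * ?N"
 proof -
  have "?I
   = (\<integral>\<^sup>+x. ennreal (upper (cay x) * pks k t e (cay x)) * ennreal (2 / (1 + x^2)) \<partial>lborel)"
   by (rule nn_integral_cong, rule ennreal_mult'') simp
  also have "\<dots> = ennreal (2 * pi) * ?N"
   by (rule nn_integral_cay) measurable
  finally show ?thesis .
 qed
 also have "?N = ennreal (LINT z|circ. upper z * pks k t e z)"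
  by (rule nn_integral_eq_integral[OF i]) (use u0 in auto)
 finally show ?thesis
  by (simp add: enn2real_mult integral_nonneg_AE u0)
qed

end

section \<open>Blaschke factors as bubbles\<close>

lemma cay_complex: "cay x = \<i> * (of_real x - \<i>) / (of_real x + \<i>)"
proof -
 have "cay x * (of_real x + \<i>) = \<i> * (of_real x - \<i>)"
 proof -
  have "2 * x / (1 + x^2) * x - (x^2 - 1) / (1 + x^2) = 1"
   using one_plus_square_pos(2)[of x] by (simp add: divide_simps) (simp add: power2_eq_square algebra_simps)
  moreover have "2 * x / (1 + x^2) + (x^2 - 1) / (1 + x^2) * x = x"
   using one_plus_square_pos(2)[of x] by (simp add: divide_simps) (simp add: power2_eq_square algebra_simps)
  ultimately show ?thesis by (simp add: cay_def complex_eq_iff)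
 qed
 moreover have "of_real x + \<i> \<noteq> 0" by (simp add: complex_eq_iff)
 ultimately show ?thesis by (simp add: divide_eq_eq eq_divide_eq)
qed

text \<open>The Cayley transform sends the zero \<open>\<beta>\<close> to the point
  \<open>\<alpha>\<close> of the disc; up to a constant of modulus 1 the factor becomes the disc
  automorphism vanishing at \<open>\<alpha> = t e\<close>.\<close>

lemma blaschke_factor_bub:
 assumes b: "Im \<beta> > 0"
 obtains t e c where "0 \<le> t" "t < 1" "cmod e = 1" "cmod c = 1"
  "\<And>x::real. (of_real x - \<beta>) / (of_real x - cnj \<beta>) = c * bub t e (cay x)"
proof -
 let ?C = "cnj \<beta> - \<i>"
 let ?B = "\<beta> + \<i>"
 let ?N = "cnj \<beta> + \<i>"
 define \<alpha> where "\<alpha> = \<i> * (\<beta> - \<i>) / ?B"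
 have n1: "\<beta> + \<i> \<noteq> 0" "cnj \<beta> - \<i> \<noteq> 0" using b by (auto simp: complex_eq_iff)
 define t where "t = cmod \<alpha>"
 \<comment> \<open>For \<open>\<alpha> = 0\<close> the direction \<open>e\<close> is
   arbitrary.\<close>
 define e where "e = (if \<alpha> = 0 then 1 else \<alpha> / of_real t)"
 have te: "of_real t * e = \<alpha>" by (auto simp: t_def e_def)
 have e1: "cmod e = 1" by (auto simp: t_def e_def norm_divide)
 have "(cmod (\<beta> - \<i>))^2 < (cmod ?B)^2" using b unfolding cmod_power2 by (simp add: power2_eq_square algebra_simps)
 hence "cmod (\<beta> - \<i>) < cmod ?B" by (rule power_less_imp_less_base) simp
 hence t1: "0 \<le> t" "t < 1" using n1 by (auto simp: t_def \<alpha>_def norm_divide norm_mult)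
 define c' where "c' = - \<i> * ?B / ?C"
 have "cmod ?C = cmod ?B" by (metis complex_cnj_add complex_cnj_i complex_mod_cnj diff_conv_add_uminus)
 hence c1: "cmod c' = 1" using n1 by (simp add: c'_def norm_divide norm_mult)
 have main: "(of_real x - \<beta>) / (of_real x - cnj \<beta>) = c' * e * bub t e (cay x)" for x :: real
 proof -
  define X where "X = complex_of_real x"
  define z where "z = cay x"
  have nx: "X + \<i> \<noteq> 0" "X - cnj \<beta> \<noteq> 0" using b by (auto simp: X_def complex_eq_iff)
  have z: "z = \<i> * (X - \<i>) / (X + \<i>)" by (simp add: z_def X_def cay_complex)
  have ca: "cnj \<alpha> = - \<i> * ?N / ?C" by (simp add: \<alpha>_def)
  have 1: "\<alpha> - z = 2 * (X - \<beta>) / (?B * (X + \<i>))"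
   using n1(1) nx(1) unfolding \<alpha>_def z by (simp add: diff_frac_eq) (simp add: algebra_simps)
  have "cnj \<alpha> * z = ?N * (X - \<i>) / (?C * (X + \<i>))" unfolding ca z by (simp add: mult_ac)
  hence "1 - cnj \<alpha> * z = (?C * (X + \<i>) - ?N * (X - \<i>)) / (?C * (X + \<i>))"
   using n1(2) nx(1) by (simp add: diff_divide_distrib)
  also have "?C * (X + \<i>) - ?N * (X - \<i>) = - 2 * \<i> * (X - cnj \<beta>)" by (simp add: algebra_simps)
  finally have 2: "1 - cnj \<alpha> * z = - 2 * \<i> * (X - cnj \<beta>) / (?C * (X + \<i>))" .
  have ee: "e * cnj e = 1" "e \<noteq> 0" using complex_norm_square[of e] e1 by auto
  have "e - of_real t * z = e * (1 - cnj \<alpha> * z)"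
  proof -
   have "e * (1 - cnj \<alpha> * z) = e - of_real t * (e * cnj e) * z" unfolding te[symmetric] by (simp add: algebra_simps)
   thus ?thesis by (simp add: ee)
  qed
  hence "e * bub t e z = (\<alpha> - z) / (1 - cnj \<alpha> * z)" using ee by (simp add: bub_def te)
  hence "c' * e * bub t e z = c' * ((\<alpha> - z) / (1 - cnj \<alpha> * z))" by (simp add: mult.assoc)
  also have "\<dots> = (X - \<beta>) / (X - cnj \<beta>)"
  proof -
   define p q r a b where "p = \<beta> + \<i>" "q = cnj \<beta> - \<i>" "r = X + \<i>" "a = X - \<beta>" "b = X - cnj \<beta>"
   have "p \<noteq> 0" "q \<noteq> 0" "r \<noteq> 0" "b \<noteq> 0" using n1 nx by (auto simp: p_q_r_a_b_def)
   hence "- \<i> * p / q * (2 * a / (p * r) / (- 2 * \<i> * b / (q * r))) = a / b" by (simp add: field_simps)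
   thus ?thesis unfolding 1 2 c'_def p_q_r_a_b_def .
  qed
  finally show ?thesis by (simp add: X_def z_def)
 qed
 show ?thesis by (rule that[OF t1 e1 _ main]) (simp add: norm_mult c1 e1)
qed

lemma blaschke_bubs:
 assumes "h \<in> blaschke k"
 obtains c t e where "cmod c = 1" "\<And>j. cmod (e j) = 1" "\<And>j. 0 \<le> t j" "\<And>j. t j < 1"
  "\<And>x::real. h (of_real x) = bubs k c t e (cay x)"
proof -
 obtain \<theta> \<beta> where b: "\<And>j. j \<in> {1..k} ==> 0 < Im (\<beta> j)"
  and h: "\<And>z. 0 \<le> Im z ==> h z = cis \<theta> * (\<Prod>j=1..k. (z - \<beta> j) / (z - cnj (\<beta> j)))"
  using assms unfolding blaschke_def mem_Collect_eq by blast
 \<comment> \<open>Indices outside \<open>1..k\<close> receive the zero \<open>\<i>\<close>, so that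
   the conditions on \<open>t\<close> and \<open>e\<close> hold for every \<open>j\<close>.\<close>
 define B where "B j = (if j \<in> {1..k} then \<beta> j else \<i>)" for j
 have "\<exists>t e c. 0 \<le> t \<and> t < 1 \<and> cmod e = 1 \<and> cmod c = 1 \<and> (\<forall>x::real. (of_real x - B j) / (of_real x - cnj (B j)) = c * bub t e (cay x))" for j
  by (rule blaschke_factor_bub[of "B j"]) (use b in \<open>auto simp: B_def\<close>)
 then obtain t e c where tec: "\<And>j. 0 \<le> t j" "\<And>j. t j < (1::real)" "\<And>j. cmod (e j) = 1" "\<And>j. cmod (c j) = 1"
  "\<And>j (x::real). (of_real x - B j) / (of_real x - cnj (B j)) = c j * bub (t j) (e j) (cay x)" by metis
 have "h (of_real x) = bubs k (cis \<theta> * (\<Prod>j=1..k. c j)) t e (cay x)" for x :: real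
 proof -
  have "h (of_real x) = cis \<theta> * (\<Prod>j=1..k. (of_real x - B j) / (of_real x - cnj (B j)))"
   by (subst h) (auto simp: B_def intro!: prod.cong)
  thus ?thesis unfolding tec(5) by (simp add: bubs_def prod.distrib mult.assoc)
 qed
 moreover have "cmod (cis \<theta> * (\<Prod>j=1..k. c j)) = 1" by (simp add: norm_mult prod_norm[symmetric] tec)
 ultimately show ?thesis using that tec(1-3) by blast
qed

theorem theorem1p5:
  fixes k :: nat and h :: "complex \<Rightarrow> complex" and g :: "real \<Rightarrow> complex" and q :: real
  assumes "k \<ge> 1"
    and "h \<in> blaschke k"
    and g_def: "g = (\<lambda>x. h (complex_of_real x))"
    and q_def: "q = 1 / (2 * pi) *
          (LINT x:(- {-1<..<1})|lebesgue. wedge (g x) (vector_derivative g (at x)))"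
  shows "0 < q \<and> q < real k \<and>
    (real k - 1 < q \<and> q < real k \<longrightarrow>
       (\<forall>d\<in>{int k - 1, int k}. min_energy_achieved g d)) \<and>
    (real k - 2 < q \<and> q \<le> real k - 1 \<longrightarrow>
       (\<forall>d\<in>{int k - 2, int k - 1, int k}. min_energy_achieved g d)) \<and>
    (\<forall>l::int. 1 \<le> l \<and> l \<le> int k - 2 \<and> q = of_int l \<longrightarrow>
       (\<forall>d\<in>{l - 1, l, l + 1, int k}. min_energy_achieved g d)) \<and>
    (\<forall>l::int. 0 \<le> l \<and> l \<le> int k - 2 \<and> of_int l < q \<and> q < of_int l + 1 \<longrightarrow>
       (\<forall>d\<in>{l, l + 1, int k}. min_energy_achieved g d))"
proof -
 obtain c t e where cte: "cmod c = 1" "\<And>j. cmod (e j) = 1" "\<And>j. 0 \<le> t j" "\<And>j. t j < 1"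
  and hG: "\<And>x::real. h (of_real x) = bubs k c t e (cay x)"
  by (rule blaschke_bubs[OF assms(2)]) (rule that)
 define G where "G = bubs k c t e"
 define G' where "G' z = \<i> * of_real (pks k t e z) * bubs k c t e z" for z
 have gG: "g x = G (cay x)" for x by (simp add: g_def hG G_def)
 have q: "q = (LINT z|circ. upper z * pks k t e z)"
  unfolding q_def by (rule wedge_integral_bubs[OF cte]) (simp add: gG G_def)
 have bounds: "0 < q" "q < real k"
  unfolding q using qarc_bubs_bounds[OF cte] assms(1) by auto
 have C1: "circ_C1 G G'" unfolding G_def G'_def[abs_def] by (rule bubs_C1[OF cte])
 have u: "cmod (G z) = 1" if "cmod z = 1" for z unfolding G_def by (rule cmod_bubs[OF cte that])
 have cG: "circ_map G" unfolding G_def by (rule circ_map_bubs[OF cte])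
 have qa: "qarc G G' = q" unfolding q G_def G'_def[abs_def] by (rule qarc_bubs[OF cte])
 \<comment> \<open>Every degree listed is \<open>k\<close> or differs from \<open>q\<close> by at
   most 1. The degree \<open>k\<close> is treated apart, since \<open>q\<close> may be far below it;
   there \<open>G\<close> itself attains the lower bound of the energy by the degree.\<close>
 have ach: "min_energy_achieved g d" if d: "d = int k \<or> of_int d - 1 \<le> q \<and> q \<le> of_int d + 1" for d
 proof (rule min_energy_achievedI[OF circ_map_measurable[OF cG] gG])
  show "\<exists>F. adm G d F \<and> (\<forall>v. adm G d v \<longrightarrow> cenergy F \<le> cenergy v)"
  proof (cases "d = int k")
   case True
   have "cdeg G = real k" "cenergy G = real k"
    unfolding G_def by (rule cdeg_bubs[OF cte] cenergy_bubs[OF cte])+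
   moreover have "real k \<le> cenergy v" if "adm G d v" for v
    using that abs_cdeg_le[of v] True by (auto simp: adm_def)
   ultimately show ?thesis using cG True by (intro exI[of _ G]) (auto simp: adm_def)
  next
   case False
   show ?thesis by (rule minimizer_exists[OF C1 u]) (use False d bounds qa in auto)
  qed
 qed
 show ?thesis using bounds by (auto intro!: ach)
qed

end
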